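(* Let $\nu>0$, $\gamma>0$, $y_\Omega\in L^2(\Omega)$, $b\in C(\bar\omega)$, and $\mu^*\in L^q(\omega)$ for some $q>2$. Let $(u^\gamma,y^\gamma,\varphi^\gamma)$ be the unique solution of the optimality system $$-\Delta y^\gamma=0\text{ in }\Omega,\quad y^\gamma=u^\gamma\text{ on }\Gamma,$$ $$-\Delta\varphi^\gamma=y^\gamma-y_\Omega+\chi_{\bar\omega}\max\{0,\mu^*+\gamma(y^\gamma-b)\}\text{ in }\Omega,\quad\varphi^\gamma=0\text{ on }\Gamma,$$ $$\nu u^\gamma=\partial_n\varphi^\gamma\text{ on }\Gamma,$$ which is equivalent to $G(u^\gamma)=0$ with $G:L^2(\Gamma)\to L^2(\Gamma)$, $$G(u)=\nu u+S^*Su-S^*y_\Omega+S^*\big(\chi_{\bar\omega}\max\{0,\mu^*+\gamma(Su-b)\}\big).$$ Then the semismooth Newton method for this system, $M(u^k)(u^{k+1}-u^k)=-G(u^k)$, $k=0,1,2,\dots$, where $$M(u)v=\nu v+S^*Sv+\gamma S^*\chi_{\omega_A(u)}Sv,\qquad\omega_A(u)=\{x\in\bar\omega:\ \mu^*(x)+\gamma(Su(x)-b(x))>0\},$$ converges locally q-superlinearly: if $u^0$ is close enough to $u^\gamma$ in $L^2(\Gamma)$, then $u^k\to u^\gamma$ q-superlinearly in $L^2(\Gamma)$.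
   Context: $\Omega\subset\mathbb{R}^2$ is a bounded convex domain with polygonal boundary $\Gamma$, and $\omega$ is a domain with $\bar\omega\subset\Omega$. $(\cdot,\cdot)_X$ is the inner product of $L^2(X)$, and $\chi_B$ is the characteristic function of $B$. Let $\Phi=\{\phi\in H^1_0(\Omega):\Delta\phi\in L^2(\Omega)\}$; functions in $\Phi$ have normal derivative $\partial_n\phi\in L^2(\Gamma)$. The continuous linear operator $S:L^2(\Gamma)\to L^2(\Omega)$ is defined by $y=Su$ iff $(y,-\Delta\phi)_\Omega=-(u,\partial_n\phi)_\Gamma$ for all $\phi\in\Phi$ (transposition solution of $-\Delta y=0$ in $\Omega$, $y=u$ on $\Gamma$). Its adjoint $S^*:L^2(\Omega)\to L^2(\Gamma)$ is $S^*z=-\partial_n\phi$, where $\phi\in H^1_0(\Omega)$ is the weak solution of $-\Delta\phi=z$. The system is the first order optimality system of the Moreau–Yosida penalized problem $\min_{u\in L^2(\Gamma)}\frac12\|Su-y_\Omega\|^2_{L^2(\Omega)}+\frac\nu2\|u\|^2_{L^2(\Gamma)}+\frac1{2\gamma}\int_{\bar\omega}\max\{0,\mu^*+\gamma(Su-b)\}^2dx$, which has a unique solution $u^\gamma$. *)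

theory Defs
  imports "HOL-Analysis.Analysis" "HOL-Library.Landau_Symbols"
begin

text \<open>Elements of Lebesgue spaces are represented by functions. Operators on them pick some
  representative of their value, so equality in a Lebesgue space is equality almost everywhere.\<close>

definition l2 :: "'a measure \<Rightarrow> ('a \<Rightarrow> real) set" where
  "l2 M = {f \<in> borel_measurable M. integrable M (\<lambda>x. (f x)\<^sup>2)}"

definition l2_inner :: "'a measure \<Rightarrow> ('a \<Rightarrow> real) \<Rightarrow> ('a \<Rightarrow> real) \<Rightarrow> real" where
  "l2_inner M f g = (\<integral>x. f x * g x \<partial>M)"

definition l2_norm :: "'a measure \<Rightarrow> ('a \<Rightarrow> real) \<Rightarrow> real" where
  "l2_norm M f = sqrt (l2_inner M f f)"

definition lp :: "real \<Rightarrow> 'a measure \<Rightarrow> ('a \<Rightarrow> real) set" where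
  "lp p M = {f \<in> borel_measurable M. integrable M (\<lambda>x. \<bar>f x\<bar> powr p)}"

text \<open>Arc length measure on the boundary of a convex polygonal domain. Every edge occurs with both
  orientations among the pairs of end points, hence the factor 1/2.\<close>

definition edge_ends :: "(real^2) set \<Rightarrow> ((real^2) \<times> (real^2)) set" where
  "edge_ends \<Omega> = {(p, q). closed_segment p q edge_of closure \<Omega>}"

definition bdry :: "(real^2) set \<Rightarrow> (real^2) measure" where
  "bdry \<Omega> =
     distr (density (count_space (edge_ends \<Omega>) \<Otimes>\<^sub>M restrict_space lborel {0..1})
              (\<lambda>((p, q), t). ennreal (dist p q / 2)))
       (restrict_space borel (frontier \<Omega>)) (\<lambda>((p, q), t). linepath p q t)"

definition grad :: "(real^2 \<Rightarrow> real) \<Rightarrow> real^2 \<Rightarrow> real^2" where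
  "grad f x = (\<chi> i. frechet_derivative f (at x) (axis i 1))"

definition laplace :: "(real^2 \<Rightarrow> real) \<Rightarrow> real^2 \<Rightarrow> real" where
  "laplace f x = (\<Sum>i\<in>UNIV. grad (\<lambda>y. grad f y $ i) x $ i)"

primrec Ck :: "nat \<Rightarrow> (real^2 \<Rightarrow> real) \<Rightarrow> bool" where
  "Ck 0 f \<longleftrightarrow> continuous_on UNIV f"
| "Ck (Suc k) f \<longleftrightarrow> (\<forall>x. f differentiable at x) \<and> (\<forall>i. Ck k (\<lambda>x. grad f x $ i))"

definition smooth :: "(real^2 \<Rightarrow> real) \<Rightarrow> bool" where
  "smooth f \<longleftrightarrow> (\<forall>k. Ck k f)"

definition test_functions :: "(real^2) set \<Rightarrow> (real^2 \<Rightarrow> real) set" where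
  "test_functions \<Omega> =
     {\<theta>. smooth \<theta> \<and> compact (closure {x. \<theta> x \<noteq> 0}) \<and> closure {x. \<theta> x \<noteq> 0} \<subseteq> \<Omega>}"

definition is_weak_grad :: "(real^2) set \<Rightarrow> (real^2 \<Rightarrow> real) \<Rightarrow> (real^2 \<Rightarrow> real^2) \<Rightarrow> bool" where
  "is_weak_grad \<Omega> f g \<longleftrightarrow>
     f \<in> l2 (lebesgue_on \<Omega>) \<and> (\<forall>i. (\<lambda>x. g x $ i) \<in> l2 (lebesgue_on \<Omega>)) \<and>
     (\<forall>\<theta>\<in>test_functions \<Omega>. \<forall>i.
        l2_inner (lebesgue_on \<Omega>) f (\<lambda>x. grad \<theta> x $ i)
          = - l2_inner (lebesgue_on \<Omega>) (\<lambda>x. g x $ i) \<theta>)"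

definition weak_grad :: "(real^2) set \<Rightarrow> (real^2 \<Rightarrow> real) \<Rightarrow> real^2 \<Rightarrow> real^2" where
  "weak_grad \<Omega> f = (SOME g. is_weak_grad \<Omega> f g)"

text \<open>The closure of the test functions in the \<open>H\<^sup>1\<close>-norm.\<close>

definition H10 :: "(real^2) set \<Rightarrow> (real^2 \<Rightarrow> real) set" where
  "H10 \<Omega> = {f. \<exists>g. is_weak_grad \<Omega> f g \<and>
     (\<exists>\<theta>. (\<forall>n::nat. \<theta> n \<in> test_functions \<Omega>) \<and>
        (\<lambda>n. l2_norm (lebesgue_on \<Omega>) (\<lambda>x. \<theta> n x - f x)) \<longlonglongrightarrow> 0 \<and>
        (\<forall>i. (\<lambda>n. l2_norm (lebesgue_on \<Omega>) (\<lambda>x. grad (\<theta> n) x $ i - g x $ i)) \<longlonglongrightarrow> 0))}"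

definition is_weak_laplace :: "(real^2) set \<Rightarrow> (real^2 \<Rightarrow> real) \<Rightarrow> (real^2 \<Rightarrow> real) \<Rightarrow> bool" where
  "is_weak_laplace \<Omega> f z \<longleftrightarrow> z \<in> l2 (lebesgue_on \<Omega>) \<and>
     (\<forall>\<theta>\<in>test_functions \<Omega>.
        l2_inner (lebesgue_on \<Omega>) f (laplace \<theta>) = l2_inner (lebesgue_on \<Omega>) z \<theta>)"

definition weak_laplace :: "(real^2) set \<Rightarrow> (real^2 \<Rightarrow> real) \<Rightarrow> real^2 \<Rightarrow> real" where
  "weak_laplace \<Omega> f = (SOME z. is_weak_laplace \<Omega> f z)"

definition Phi :: "(real^2) set \<Rightarrow> (real^2 \<Rightarrow> real) set" where
  "Phi \<Omega> = {\<phi> \<in> H10 \<Omega>. \<exists>z. is_weak_laplace \<Omega> \<phi> z}"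

text \<open>As usual for functions whose weak gradient and Laplacian are square integrable, the normal
  derivative is defined by Green's formula
  \<open>\<integral>\<^bsub>\<Gamma>\<^esub> (\<partial>\<^sub>n \<phi>) v = \<integral>\<^bsub>\<Omega>\<^esub> (\<nabla>\<phi> \<bullet> \<nabla>v + \<Delta>\<phi> v)\<close> for all smooth \<open>v\<close> on the plane, whose restrictions
  are dense in \<open>H\<^sup>1(\<Omega>)\<close>; here \<open>n\<close> is the outward unit normal.\<close>

definition is_normal_deriv :: "(real^2) set \<Rightarrow> (real^2 \<Rightarrow> real) \<Rightarrow> (real^2 \<Rightarrow> real) \<Rightarrow> bool" where
  "is_normal_deriv \<Omega> \<phi> g \<longleftrightarrow> g \<in> l2 (bdry \<Omega>) \<and>
     (\<forall>v. smooth v \<longrightarrow>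
        l2_inner (bdry \<Omega>) g v
          = (\<integral>x. weak_grad \<Omega> \<phi> x \<bullet> grad v x + weak_laplace \<Omega> \<phi> x * v x \<partial>lebesgue_on \<Omega>))"

definition normal_deriv :: "(real^2) set \<Rightarrow> (real^2 \<Rightarrow> real) \<Rightarrow> real^2 \<Rightarrow> real" where
  "normal_deriv \<Omega> \<phi> = (SOME g. is_normal_deriv \<Omega> \<phi> g)"

text \<open>Transposition solution of \<open>-\<Delta>y = 0\<close> in \<open>\<Omega>\<close>, \<open>y = u\<close> on the boundary.\<close>

definition transposition_sol ::
    "(real^2) set \<Rightarrow> (real^2 \<Rightarrow> real) \<Rightarrow> (real^2 \<Rightarrow> real) \<Rightarrow> bool" where
  "transposition_sol \<Omega> u y \<longleftrightarrow> y \<in> l2 (lebesgue_on \<Omega>) \<and>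
     (\<forall>\<phi>\<in>Phi \<Omega>.
        l2_inner (lebesgue_on \<Omega>) y (\<lambda>x. - weak_laplace \<Omega> \<phi> x)
          = - l2_inner (bdry \<Omega>) u (normal_deriv \<Omega> \<phi>))"

definition S_op :: "(real^2) set \<Rightarrow> (real^2 \<Rightarrow> real) \<Rightarrow> real^2 \<Rightarrow> real" where
  "S_op \<Omega> u = (SOME y. transposition_sol \<Omega> u y)"

text \<open>Weak solution of \<open>-\<Delta>\<phi> = z\<close> in \<open>\<Omega>\<close>, \<open>\<phi> = 0\<close> on the boundary.\<close>

definition weak_sol :: "(real^2) set \<Rightarrow> (real^2 \<Rightarrow> real) \<Rightarrow> (real^2 \<Rightarrow> real) \<Rightarrow> bool" where
  "weak_sol \<Omega> z \<phi> \<longleftrightarrow> \<phi> \<in> H10 \<Omega> \<and>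
     (\<forall>v\<in>H10 \<Omega>.
        (\<integral>x. weak_grad \<Omega> \<phi> x \<bullet> weak_grad \<Omega> v x \<partial>lebesgue_on \<Omega>) = l2_inner (lebesgue_on \<Omega>) z v)"

text \<open>The Hilbert space adjoint of the solution operator, by its formula \<open>-\<partial>\<^sub>n \<phi>\<close>.\<close>

definition S_adj :: "(real^2) set \<Rightarrow> (real^2 \<Rightarrow> real) \<Rightarrow> real^2 \<Rightarrow> real" where
  "S_adj \<Omega> z = (\<lambda>x. - normal_deriv \<Omega> (SOME \<phi>. weak_sol \<Omega> z \<phi>) x)"

text \<open>The values of \<open>\<mu>\<close> on all of \<open>closure \<omega>\<close> matter here, so \<open>\<mu>\<close> is meant to be an element of
  \<open>L\<^sup>q(closure \<omega>)\<close>; this is the same as \<open>L\<^sup>q(\<omega>)\<close> when the boundary of \<open>\<omega>\<close> is a null set.\<close>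

definition penalty :: "(real^2) set \<Rightarrow> real \<Rightarrow> (real^2 \<Rightarrow> real) \<Rightarrow> (real^2 \<Rightarrow> real) \<Rightarrow>
    (real^2 \<Rightarrow> real) \<Rightarrow> real^2 \<Rightarrow> real" where
  "penalty \<omega> \<gamma> \<mu> b y = (\<lambda>x. indicator (closure \<omega>) x * max 0 (\<mu> x + \<gamma> * (y x - b x)))"

definition optimality_system where
  "optimality_system \<Omega> \<omega> \<nu> \<gamma> y\<Omega> b \<mu> u y \<phi> \<longleftrightarrow>
     u \<in> l2 (bdry \<Omega>) \<and>
     transposition_sol \<Omega> u y \<and>
     weak_sol \<Omega> (\<lambda>x. y x - y\<Omega> x + penalty \<omega> \<gamma> \<mu> b y x) \<phi> \<and>
     (AE x in bdry \<Omega>. \<nu> * u x = normal_deriv \<Omega> \<phi> x)"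

definition G_op :: "(real^2) set \<Rightarrow> (real^2) set \<Rightarrow> real \<Rightarrow> real \<Rightarrow> (real^2 \<Rightarrow> real) \<Rightarrow> (real^2 \<Rightarrow> real) \<Rightarrow>
    (real^2 \<Rightarrow> real) \<Rightarrow> (real^2 \<Rightarrow> real) \<Rightarrow> real^2 \<Rightarrow> real" where
  "G_op \<Omega> \<omega> \<nu> \<gamma> y\<Omega> b \<mu> u =
     (\<lambda>x. \<nu> * u x + S_adj \<Omega> (S_op \<Omega> u) x - S_adj \<Omega> y\<Omega> x + S_adj \<Omega> (penalty \<omega> \<gamma> \<mu> b (S_op \<Omega> u)) x)"

definition active_set :: "(real^2) set \<Rightarrow> (real^2) set \<Rightarrow> real \<Rightarrow> (real^2 \<Rightarrow> real) \<Rightarrow>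
    (real^2 \<Rightarrow> real) \<Rightarrow> (real^2 \<Rightarrow> real) \<Rightarrow> (real^2) set" where
  "active_set \<Omega> \<omega> \<gamma> b \<mu> u = {x \<in> closure \<omega>. \<mu> x + \<gamma> * (S_op \<Omega> u x - b x) > 0}"

definition M_op :: "(real^2) set \<Rightarrow> (real^2) set \<Rightarrow> real \<Rightarrow> real \<Rightarrow> (real^2 \<Rightarrow> real) \<Rightarrow>
    (real^2 \<Rightarrow> real) \<Rightarrow> (real^2 \<Rightarrow> real) \<Rightarrow> (real^2 \<Rightarrow> real) \<Rightarrow> real^2 \<Rightarrow> real" where
  "M_op \<Omega> \<omega> \<nu> \<gamma> b \<mu> u v =
     (\<lambda>x. \<nu> * v x + S_adj \<Omega> (S_op \<Omega> v) x
        + \<gamma> * S_adj \<Omega> (\<lambda>x. indicator (active_set \<Omega> \<omega> \<gamma> b \<mu> u) x * S_op \<Omega> v x) x)"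

definition newton_step where
  "newton_step \<Omega> \<omega> \<nu> \<gamma> y\<Omega> b \<mu> u u' \<longleftrightarrow>
     u \<in> l2 (bdry \<Omega>) \<and> u' \<in> l2 (bdry \<Omega>) \<and>
     (AE x in bdry \<Omega>. M_op \<Omega> \<omega> \<nu> \<gamma> b \<mu> u (\<lambda>x. u' x - u x) x = - G_op \<Omega> \<omega> \<nu> \<gamma> y\<Omega> b \<mu> u x)"

definition q_superlinear :: "'a measure \<Rightarrow> (nat \<Rightarrow> 'a \<Rightarrow> real) \<Rightarrow> ('a \<Rightarrow> real) \<Rightarrow> bool" where
  "q_superlinear N us u \<longleftrightarrow>
     (\<lambda>k. l2_norm N (\<lambda>x. us k x - u x)) \<longlonglongrightarrow> 0 \<and>
     (\<lambda>k. l2_norm N (\<lambda>x. us (Suc k) x - u x)) \<in> o(\<lambda>k. l2_norm N (\<lambda>x. us k x - u x))"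

end

theory Submission
  imports Defs
begin

text \<open>
  The difference \<open>e'\<close> between the next iterate and the solution satisfies
  \<open>M(u) e' = - S\<^sup>* R\<close>, where \<open>R\<close> is the error of the linearization of the maximum. Since
  \<open>M(u) \<ge> \<nu>\<close>, it suffices that \<open>S\<^sup>* R\<close> is of smaller order than the previous difference \<open>e\<close>.
  Now \<open>\<bar>R\<bar> \<le> \<gamma> \<bar>S e\<bar>\<close>, and \<open>R\<close> vanishes except where the argument \<open>w\<close> of the maximum at the
  solution satisfies \<open>0 < \<bar>w\<bar> \<le> \<gamma> \<bar>S e\<bar>\<close>; the measure of this set tends to zero with \<open>e\<close>.
  The required norm gap is \<open>\<parallel>S\<^sup>* z\<parallel> \<le> K \<bar>A\<bar>\<^sup>1\<^sup>/\<^sup>4 \<parallel>z\<parallel>\<close> for \<open>z\<close> supported in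
  \<open>A \<subseteq> closure \<omega>\<close>: a cut-off moves the right hand side away from the boundary at the cost of the
  \<open>H\<^sup>1\<close>-norm of the solution, and Ladyzhenskaya's inequality bounds the latter.

  That normal derivatives exist in \<open>L\<^sup>2\<close> of the boundary follows by duality from
  \<open>\<parallel>V\<parallel>\<^sup>2 \<le> H \<parallel>v\<parallel>\<^sup>2\<close> for the harmonic extension \<open>V\<close> of a smooth \<open>v\<close>. With the distance \<open>m\<close> to the
  boundary and \<open>d = H m - m\<^sup>2/2\<close>, testing the equation of \<open>V\<close> with \<open>d V\<close> gives
  \<open>\<integral> \<nabla>(V\<^sup>2) \<bullet> \<nabla>d \<le> 0\<close>. On the set of points that are closest to a given edge, \<open>\<nabla>d\<close> is the multiple
  \<open>H - m\<close> of the normal of that edge, and by convexity this set consists of segments starting at the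
  edge. Integrating along them yields \<open>\<integral> \<nabla>(V\<^sup>2) \<bullet> \<nabla>d \<ge> \<integral> V\<^sup>2 - H \<integral>\<^bsub>\<Gamma>\<^esub> v\<^sup>2\<close>.
\<close>

section \<open>Square integrable functions\<close>

text \<open>All operators are choices of representatives, so nothing can be said about them before
  existence and almost everywhere uniqueness of the chosen objects are proved, and identities
  between them hold only up to null sets. The critical object is the normal derivative: for a
  solution with square integrable right hand side it is a priori only the functional in Green's
  formula, whose continuity in the boundary norm has to be earned. The weight is found from Green's
  formula: the distance \<open>m\<close> is concave with unit gradient, so
  \<open>d = H m - m^2/2\<close> satisfies \<open>\<Delta>d = (H - m) \<Delta>m - 1 \<le> -1\<close>
  as soon as \<open>H\<close> bounds \<open>m\<close>; it vanishes on the boundary and has inward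
  slope \<open>H\<close> there. As \<open>m\<close> is not smooth, the equation is tested with
  smooth compactly supported approximations of \<open>d\<close>. The obstacle in the Newton part is
  that the maximum is not Newton differentiable from L2 to L2: the pointwise bound on
  \<open>R\<close> alone gives an error of the order of \<open>e\<close>, and only the small support
  of \<open>R\<close> can improve it. Points with \<open>w = 0\<close> are harmless: the slope is
  taken at the perturbed argument, so the linearization is exact there.\<close>

lemma quadratic_nonneg_imp:
  fixes a b c :: real
  assumes "\<And>t. 0 \<le> a + 2 * t * b + t\<^sup>2 * c" "0 \<le> c"
  shows "b\<^sup>2 \<le> a * c"
proof (cases "c = 0")
  case True
  have "b = 0"
  proof (rule ccontr)
    assume "b \<noteq> 0"
    \<comment> \<open>For \<open>c = 0\<close> the quadratic is linear in \<open>t\<close>; this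
      \<open>t\<close> gives it the value -1.\<close>
    with assms(1)[of "- (a + 1) / (2 * b)"] True have "0 \<le> a - (a + 1)" by (simp add: field_simps)
    then show False by simp
  qed
  then show ?thesis using True by simp
next
  case False
  then have c: "c > 0" using assms by simp
  have "0 \<le> a - b\<^sup>2 / c"
    using assms(1)[of "- b / c"] c by (simp add: field_simps power2_eq_square)
  then show ?thesis using c by (simp add: field_simps)
qed

text \<open>The form lives on a set of functions and is only semidefinite: functions that agree
  almost everywhere stay distinct, so even the L2 product is not definite. The instances are the L2
  product, the Dirichlet form on test functions, the boundary product on smooth functions and the
  form of the Newton operator.\<close>

locale psd_form =
  fixes X :: "('a \<Rightarrow> real) set" and B :: "('a \<Rightarrow> real) \<Rightarrow> ('a \<Rightarrow> real) \<Rightarrow> real"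
  assumes add: "\<And>f g. f \<in> X \<Longrightarrow> g \<in> X \<Longrightarrow> (\<lambda>x. f x + g x) \<in> X"
    and scale: "\<And>f c. f \<in> X \<Longrightarrow> (\<lambda>x. c * f x) \<in> X"
    and nonempty: "X \<noteq> {}"
    and sym: "\<And>f g. f \<in> X \<Longrightarrow> g \<in> X \<Longrightarrow> B f g = B g f"
    and add_left: "\<And>f g h. f \<in> X \<Longrightarrow> g \<in> X \<Longrightarrow> h \<in> X \<Longrightarrow> B (\<lambda>x. f x + g x) h = B f h + B g h"
    and scale_left: "\<And>f g c. f \<in> X \<Longrightarrow> g \<in> X \<Longrightarrow> B (\<lambda>x. c * f x) g = c * B f g"
    and nonneg: "\<And>f. f \<in> X \<Longrightarrow> 0 \<le> B f f"
begin

lemma expand: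
  assumes "f \<in> X" "g \<in> X"
  shows "B (\<lambda>x. f x + t * g x) (\<lambda>x. f x + t * g x) = B f f + 2 * t * B f g + t\<^sup>2 * B g g"
proof -
  have tg: "(\<lambda>x. t * g x) \<in> X" using scale assms by blast
  have s: "(\<lambda>x. f x + t * g x) \<in> X" using add[OF assms(1) tg] .
  have "B (\<lambda>x. f x + t * g x) (\<lambda>x. f x + t * g x)
      = B f (\<lambda>x. f x + t * g x) + t * B g (\<lambda>x. f x + t * g x)"
    using add_left[OF assms(1) tg s] scale_left[OF assms(2) s, of t] by simp
  also have "B f (\<lambda>x. f x + t * g x) = B f f + t * B f g"
    using sym[OF assms(1) s] add_left[OF assms(1) tg assms(1)] scale_left[OF assms(2) assms(1), of t]
      sym[OF assms] by simp
  also have "B g (\<lambda>x. f x + t * g x) = B f g + t * B g g"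
    using sym[OF assms(2) s] add_left[OF assms(1) tg assms(2)] scale_left[OF assms(2) assms(2), of t]
      sym[OF assms] by simp
  finally show ?thesis by (simp add: power2_eq_square algebra_simps)
qed

lemma Cauchy_Schwarz:
  assumes "f \<in> X" "g \<in> X"
  shows "(B f g)\<^sup>2 \<le> B f f * B g g"
proof (rule quadratic_nonneg_imp)
  fix t :: real
  have "(\<lambda>x. f x + t * g x) \<in> X" using add[OF assms(1) scale[OF assms(2)]] .
  from nonneg[OF this] show "0 \<le> B f f + 2 * t * B f g + t\<^sup>2 * B g g"
    using expand[OF assms] by simp
qed (use nonneg assms in auto)

text \<open>A minimizing sequence of \<open>B f f - 2 F f\<close> is Cauchy by the parallelogram law. Its
  members represent \<open>F\<close> in the limit, without any completeness of \<open>X\<close>.\<close>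

lemma Riesz_sequence:
  fixes F :: "('a \<Rightarrow> real) \<Rightarrow> real"
  assumes F_add: "\<And>f g. f \<in> X \<Longrightarrow> g \<in> X \<Longrightarrow> F (\<lambda>x. f x + g x) = F f + F g"
    and F_scale: "\<And>f c. f \<in> X \<Longrightarrow> F (\<lambda>x. c * f x) = c * F f"
    and F_bd: "\<And>f. f \<in> X \<Longrightarrow> \<bar>F f\<bar> \<le> C * sqrt (B f f)"
  obtains \<theta> :: "nat \<Rightarrow> 'a \<Rightarrow> real" where "\<And>n. \<theta> n \<in> X"
    "\<And>e. 0 < e \<Longrightarrow> \<exists>N. \<forall>m\<ge>N. \<forall>n\<ge>N. B (\<lambda>x. \<theta> m x - \<theta> n x) (\<lambda>x. \<theta> m x - \<theta> n x) < e"
    "\<And>f. f \<in> X \<Longrightarrow> (\<lambda>n. B (\<theta> n) f) \<longlonglongrightarrow> F f"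
proof -
  define J where "J f = B f f - 2 * F f" for f
  define d where "d = Inf (J ` X)"
  have low: "- C\<^sup>2 \<le> J f" if "f \<in> X" for f
  proof -
    have "0 \<le> (sqrt (B f f) - C)\<^sup>2" by simp
    then have "2 * (C * sqrt (B f f)) \<le> B f f + C\<^sup>2"
      using nonneg[OF that] by (simp add: power2_eq_square algebra_simps)
    then show ?thesis using F_bd[OF that] unfolding J_def by linarith
  qed
  have bdd: "bdd_below (J ` X)" using low by (auto intro!: bdd_belowI)
  have dle: "d \<le> J f" if "f \<in> X" for f
    unfolding d_def by (rule cInf_lower) (use that bdd in auto)
  have "\<exists>f\<in>X. J f < d + inverse (real (Suc n))" for n
  proof -
    have "\<exists>a\<in>J ` X. a < d + inverse (real (Suc n))"
      unfolding d_def by (rule cInf_lessD) (use nonempty in auto)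
    then show ?thesis by auto
  qed
  then obtain \<theta> where \<theta>: "\<And>n. \<theta> n \<in> X" "\<And>n. J (\<theta> n) < d + inverse (real (Suc n))" by metis
  have Jexp: "J (\<lambda>x. f x + t * g x) = J f + 2 * t * (B f g - F g) + t\<^sup>2 * B g g"
    if "f \<in> X" "g \<in> X" for f g t
    using expand[OF that, of t] F_add[OF that(1) scale[OF that(2), of t]] F_scale[OF that(2), of t]
    unfolding J_def by (simp add: algebra_simps)
  show ?thesis
  proof
    show "\<theta> n \<in> X" for n by (rule \<theta>)
  next
    fix e :: real assume "0 < e"
    then obtain N where N: "inverse (real (Suc N)) < e / 4" using reals_Archimedean[of "e/4"] by auto
    have "B (\<lambda>x. \<theta> m x - \<theta> n x) (\<lambda>x. \<theta> m x - \<theta> n x) < e" if "m \<ge> N" "n \<ge> N" for m n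
    proof -
      let ?g = "\<lambda>x. \<theta> m x + (-1) * \<theta> n x"
      have g: "?g \<in> X" using add[OF \<theta>(1)[of m] scale[OF \<theta>(1)[of n], of "-1"]] .
      \<comment> \<open>The values of \<open>J\<close> on the segment from \<open>\<theta> n\<close>
        to \<open>\<theta> m\<close>, at its end and at its midpoint. Eliminating the linear term
        leaves the parallelogram estimate, because the midpoint value is at least
        \<open>d\<close>.\<close>
      have e1: "J (\<lambda>x. \<theta> n x + 1 * ?g x) = J (\<theta> n) + 2 * (B (\<theta> n) ?g - F ?g) + B ?g ?g"
        using Jexp[OF \<theta>(1)[of n] g, of 1] by simp
      have e2: "J (\<lambda>x. \<theta> n x + (1/2) * ?g x) = J (\<theta> n) + (B (\<theta> n) ?g - F ?g) + B ?g ?g / 4"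
        using Jexp[OF \<theta>(1)[of n] g, of "1/2"] by (simp add: power2_eq_square)
      have "d \<le> J (\<lambda>x. \<theta> n x + (1/2) * ?g x)" by (rule dle) (rule add[OF \<theta>(1) scale[OF g]])
      moreover have "(\<lambda>x. \<theta> n x + 1 * ?g x) = \<theta> m" by auto
      ultimately have "d \<le> J (\<theta> n) + (B (\<theta> n) ?g - F ?g) + B ?g ?g / 4"
        and "J (\<theta> m) = J (\<theta> n) + 2 * (B (\<theta> n) ?g - F ?g) + B ?g ?g"
        using e1 e2 by (simp_all only:)
      then have "B ?g ?g \<le> 2 * (J (\<theta> m) - d) + 2 * (J (\<theta> n) - d)" by argo
      also have "\<dots> < e"
      proof -
        have "inverse (real (Suc m)) \<le> inverse (real (Suc N))" "inverse (real (Suc n)) \<le> inverse (real (Suc N))"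
          using that by (auto intro!: le_imp_inverse_le)
        moreover have "2 * (a - d) + 2 * (b - d) < e"
          if "a < d + p" "b < d + q" "p \<le> r" "q \<le> r" "r < e / 4" for a b p q r :: real
        proof -
          have "a - d < e / 4" "b - d < e / 4" using that by linarith+
          then show ?thesis by simp
        qed
        ultimately show ?thesis using \<theta>(2)[of m] \<theta>(2)[of n] N by blast
      qed
      finally show ?thesis by simp
    qed
    then show "\<exists>N. \<forall>m\<ge>N. \<forall>n\<ge>N. B (\<lambda>x. \<theta> m x - \<theta> n x) (\<lambda>x. \<theta> m x - \<theta> n x) < e" by blast
  next
    fix f assume f: "f \<in> X"
    \<comment> \<open>A near minimizer nearly solves the Euler equation: \<open>J\<close> stays
      above \<open>d\<close> in every direction \<open>f\<close>, so the discriminant of the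
      quadratic in \<open>t\<close> is controlled by the defect 1/(n+1).\<close>
    have bd: "(B (\<theta> n) f - F f)\<^sup>2 \<le> inverse (real (Suc n)) * B f f" for n
    proof (rule quadratic_nonneg_imp)
      fix t :: real
      have "d \<le> J (\<lambda>x. \<theta> n x + t * f x)" by (rule dle) (rule add[OF \<theta>(1) scale[OF f]])
      then show "0 \<le> inverse (real (Suc n)) + 2 * t * (B (\<theta> n) f - F f) + t\<^sup>2 * B f f"
        using Jexp[OF \<theta>(1)[of n] f, of t] \<theta>(2)[of n] by linarith
    qed (use nonneg f in auto)
    have "(\<lambda>n. (B (\<theta> n) f - F f)\<^sup>2) \<longlonglongrightarrow> 0"
    proof (rule tendsto_sandwich[of "\<lambda>_. 0"])
      show "(\<lambda>n. inverse (real (Suc n)) * B f f) \<longlonglongrightarrow> 0"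
        by (intro tendsto_mult_left_zero LIMSEQ_inverse_real_of_nat)
    qed (use bd in auto)
    then have "(\<lambda>n. sqrt ((B (\<theta> n) f - F f)\<^sup>2)) \<longlonglongrightarrow> sqrt 0" by (rule tendsto_real_sqrt)
    then have "(\<lambda>n. B (\<theta> n) f - F f) \<longlonglongrightarrow> 0" by (simp add: tendsto_rabs_zero_iff)
    then show "(\<lambda>n. B (\<theta> n) f) \<longlonglongrightarrow> F f" by (simp add: LIM_zero_iff)
  qed
qed

end

lemma l2_measurable: "f \<in> l2 M \<Longrightarrow> f \<in> borel_measurable M"
  and l2_square_integrable: "f \<in> l2 M \<Longrightarrow> integrable M (\<lambda>x. (f x)\<^sup>2)"
  by (auto simp: l2_def)

lemma l2_mult_integrable:
  assumes "f \<in> l2 M" "g \<in> l2 M"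
  shows "integrable M (\<lambda>x. f x * g x)"
proof (rule Bochner_Integration.integrable_bound)
  show "integrable M (\<lambda>x. (f x)\<^sup>2 + (g x)\<^sup>2)" using assms by (auto simp: l2_def)
  show "(\<lambda>x. f x * g x) \<in> borel_measurable M" using assms by (auto simp: l2_def)
  show "AE x in M. norm (f x * g x) \<le> norm ((f x)\<^sup>2 + (g x)\<^sup>2)"
  proof (rule AE_I2)
    fix x
    have "2 * (\<bar>f x\<bar> * \<bar>g x\<bar>) \<le> (f x)\<^sup>2 + (g x)\<^sup>2"
      using sum_squares_bound[of "\<bar>f x\<bar>" "\<bar>g x\<bar>"] by simp
    moreover have "0 \<le> \<bar>f x\<bar> * \<bar>g x\<bar>" by simp
    ultimately have "\<bar>f x\<bar> * \<bar>g x\<bar> \<le> (f x)\<^sup>2 + (g x)\<^sup>2" by linarith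
    then show "norm (f x * g x) \<le> norm ((f x)\<^sup>2 + (g x)\<^sup>2)" by (simp add: abs_mult)
  qed
qed

lemma l2_zero [simp]: "(\<lambda>x. 0) \<in> l2 M"
  by (simp add: l2_def)

lemma l2_scale: "f \<in> l2 M \<Longrightarrow> (\<lambda>x. c * f x) \<in> l2 M"
  by (auto simp: l2_def power_mult_distrib)

lemma l2_uminus: "f \<in> l2 M \<Longrightarrow> (\<lambda>x. - f x) \<in> l2 M"
  by (auto simp: l2_def)

lemma l2_add: "f \<in> l2 M \<Longrightarrow> g \<in> l2 M \<Longrightarrow> (\<lambda>x. f x + g x) \<in> l2 M"
  using l2_mult_integrable[of f M g] by (auto simp: l2_def power2_sum mult.assoc)

lemma l2_diff: "f \<in> l2 M \<Longrightarrow> g \<in> l2 M \<Longrightarrow> (\<lambda>x. f x - g x) \<in> l2 M"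
  using l2_add[OF _ l2_uminus, of f M g] by simp

lemma l2_bound:
  assumes "f \<in> l2 M" "g \<in> borel_measurable M" "AE x in M. \<bar>g x\<bar> \<le> C * \<bar>f x\<bar>"
  shows "g \<in> l2 M"
proof -
  have "integrable M (\<lambda>x. (g x)\<^sup>2)"
  proof (rule Bochner_Integration.integrable_bound)
    show "integrable M (\<lambda>x. C\<^sup>2 * (f x)\<^sup>2)" using assms by (auto simp: l2_def)
    show "AE x in M. norm ((g x)\<^sup>2) \<le> norm (C\<^sup>2 * (f x)\<^sup>2)"
      using assms(3)
    proof eventually_elim
      case (elim x)
      then have "\<bar>g x\<bar>\<^sup>2 \<le> (C * \<bar>f x\<bar>)\<^sup>2" by (intro power_mono) auto
      then show ?case by (simp add: power_mult_distrib)
    qed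
  qed (use assms in auto)
  then show ?thesis using assms by (simp add: l2_def)
qed

lemma l2_mult_bounded:
  assumes "f \<in> l2 M" "h \<in> borel_measurable M" "AE x in M. \<bar>h x\<bar> \<le> C"
  shows "(\<lambda>x. h x * f x) \<in> l2 M"
proof (rule l2_bound[OF assms(1), of _ C])
  show "AE x in M. \<bar>h x * f x\<bar> \<le> C * \<bar>f x\<bar>"
    using assms(3) by eventually_elim (auto simp: abs_mult intro: mult_right_mono)
qed (use assms in \<open>auto dest: l2_measurable\<close>)

lemma l2_bounded:
  assumes "finite_measure M" "h \<in> borel_measurable M" "AE x in M. \<bar>h x\<bar> \<le> C"
  shows "h \<in> l2 M"
proof -
  interpret finite_measure M by fact
  have "(\<lambda>x. 1) \<in> l2 M" by (simp add: l2_def)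
  from l2_mult_bounded[OF this assms(2,3)] show ?thesis by simp
qed

lemma l2_inner_commute: "l2_inner M f g = l2_inner M g f"
  by (simp add: l2_inner_def mult.commute)

lemma l2_inner_add_left: "f \<in> l2 M \<Longrightarrow> g \<in> l2 M \<Longrightarrow> h \<in> l2 M \<Longrightarrow>
    l2_inner M (\<lambda>x. f x + g x) h = l2_inner M f h + l2_inner M g h"
  unfolding l2_inner_def by (simp add: distrib_right l2_mult_integrable)

lemma l2_inner_diff_left: "f \<in> l2 M \<Longrightarrow> g \<in> l2 M \<Longrightarrow> h \<in> l2 M \<Longrightarrow>
    l2_inner M (\<lambda>x. f x - g x) h = l2_inner M f h - l2_inner M g h"
  unfolding l2_inner_def by (simp add: left_diff_distrib l2_mult_integrable)

lemma l2_inner_add_right: "f \<in> l2 M \<Longrightarrow> g \<in> l2 M \<Longrightarrow> h \<in> l2 M \<Longrightarrow>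
    l2_inner M h (\<lambda>x. f x + g x) = l2_inner M h f + l2_inner M h g"
  using l2_inner_add_left[of f M g h] by (simp add: l2_inner_commute)

lemma l2_inner_diff_right: "f \<in> l2 M \<Longrightarrow> g \<in> l2 M \<Longrightarrow> h \<in> l2 M \<Longrightarrow>
    l2_inner M h (\<lambda>x. f x - g x) = l2_inner M h f - l2_inner M h g"
  using l2_inner_diff_left[of f M g h] by (simp add: l2_inner_commute)

lemma l2_inner_scale_left: "l2_inner M (\<lambda>x. c * f x) g = c * l2_inner M f g"
  unfolding l2_inner_def by (simp add: mult.assoc)

lemma l2_inner_scale_right: "l2_inner M g (\<lambda>x. c * f x) = c * l2_inner M g f"
  by (simp add: l2_inner_commute[of M g] l2_inner_scale_left)

lemma l2_inner_uminus_left: "l2_inner M (\<lambda>x. - f x) g = - l2_inner M f g"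
  using l2_inner_scale_left[of M "-1" f g] by simp

lemma l2_inner_uminus_right: "l2_inner M g (\<lambda>x. - f x) = - l2_inner M g f"
  using l2_inner_scale_right[of M g "-1" f] by simp

lemma l2_inner_cong_AE:
  assumes "AE x in M. f x = f' x" "AE x in M. g x = g' x"
    and "f \<in> borel_measurable M" "f' \<in> borel_measurable M"
      "g \<in> borel_measurable M" "g' \<in> borel_measurable M"
  shows "l2_inner M f g = l2_inner M f' g'"
  unfolding l2_inner_def by (rule integral_cong_AE) (use assms in auto)

lemma l2_inner_self_nonneg: "0 \<le> l2_inner M f f"
  by (simp add: l2_inner_def)

lemma l2_norm_nonneg [simp]: "0 \<le> l2_norm M f"
  by (simp add: l2_norm_def l2_inner_self_nonneg)

lemma l2_norm_power2: "(l2_norm M f)\<^sup>2 = l2_inner M f f"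
  by (simp add: l2_norm_def l2_inner_self_nonneg)

interpretation l2: psd_form "l2 M" "l2_inner M" for M :: "'a measure"
  by unfold_locales (auto intro: l2_add l2_scale l2_zero l2_inner_commute l2_inner_add_left
      l2_inner_scale_left l2_inner_self_nonneg)

lemma l2_Cauchy_Schwarz:
  assumes "f \<in> l2 M" "g \<in> l2 M"
  shows "\<bar>l2_inner M f g\<bar> \<le> l2_norm M f * l2_norm M g"
proof (rule power2_le_imp_le)
  show "\<bar>l2_inner M f g\<bar>\<^sup>2 \<le> (l2_norm M f * l2_norm M g)\<^sup>2"
    using l2.Cauchy_Schwarz[OF assms] by (simp add: power_mult_distrib l2_norm_power2)
qed auto

lemma l2_norm_scale: "l2_norm M (\<lambda>x. c * f x) = \<bar>c\<bar> * l2_norm M f"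
  by (simp add: l2_norm_def l2_inner_scale_left l2_inner_scale_right real_sqrt_mult flip: power2_eq_square mult.assoc)

lemma l2_norm_uminus: "l2_norm M (\<lambda>x. - f x) = l2_norm M f"
  using l2_norm_scale[of M "-1" f] by simp

lemma l2_norm_cong_AE:
  assumes "AE x in M. f x = g x" "f \<in> borel_measurable M" "g \<in> borel_measurable M"
  shows "l2_norm M f = l2_norm M g"
  unfolding l2_norm_def using assms by (auto intro!: arg_cong[where f = sqrt] l2_inner_cong_AE)

lemma l2_norm_triangle:
  assumes "f \<in> l2 M" "g \<in> l2 M"
  shows "l2_norm M (\<lambda>x. f x + g x) \<le> l2_norm M f + l2_norm M g"
proof (rule power2_le_imp_le)
  have "(l2_norm M (\<lambda>x. f x + g x))\<^sup>2 = l2_inner M f f + 2 * l2_inner M f g + l2_inner M g g"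
    using l2.expand[OF assms, of 1] by (simp add: l2_norm_power2)
  also have "\<dots> \<le> (l2_norm M f + l2_norm M g)\<^sup>2"
    using l2_Cauchy_Schwarz[OF assms] by (simp add: power2_sum l2_norm_power2)
  finally show "(l2_norm M (\<lambda>x. f x + g x))\<^sup>2 \<le> (l2_norm M f + l2_norm M g)\<^sup>2" .
qed auto

lemma l2_norm_zero_iff:
  assumes "f \<in> l2 M"
  shows "l2_norm M f = 0 \<longleftrightarrow> (AE x in M. f x = 0)"
proof -
  have "l2_norm M f = 0 \<longleftrightarrow> (\<integral>x. (f x)\<^sup>2 \<partial>M) = 0"
    by (simp add: l2_norm_def l2_inner_def power2_eq_square)
  also have "\<dots> \<longleftrightarrow> (AE x in M. (f x)\<^sup>2 = 0)"
    by (rule integral_nonneg_eq_0_iff_AE) (use assms in \<open>auto simp: l2_def\<close>)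
  finally show ?thesis by simp
qed

lemma l2_norm_mono:
  assumes "f \<in> l2 M" "g \<in> borel_measurable M" "AE x in M. \<bar>g x\<bar> \<le> C * \<bar>f x\<bar>" "0 \<le> C"
  shows "l2_norm M g \<le> C * l2_norm M f"
proof (rule power2_le_imp_le)
  have "(l2_norm M g)\<^sup>2 \<le> l2_inner M (\<lambda>x. C * f x) (\<lambda>x. C * f x)"
    unfolding l2_norm_power2 l2_inner_def
  proof (rule integral_mono_AE)
    show "AE x in M. g x * g x \<le> C * f x * (C * f x)"
      using assms(3)
    proof eventually_elim
      case (elim x)
      then have "\<bar>g x\<bar>\<^sup>2 \<le> (C * \<bar>f x\<bar>)\<^sup>2" by (intro power_mono) auto
      then show ?case by (simp add: power_mult_distrib power2_eq_square ac_simps)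
    qed
    show "integrable M (\<lambda>x. g x * g x)"
      by (intro l2_mult_integrable l2_bound[OF assms(1-3)])
    show "integrable M (\<lambda>x. C * f x * (C * f x))"
      by (intro l2_mult_integrable l2_scale assms)
  qed
  then show "(l2_norm M g)\<^sup>2 \<le> (C * l2_norm M f)\<^sup>2"
    by (simp add: l2_inner_scale_left l2_inner_scale_right power_mult_distrib l2_norm_power2 power2_eq_square[of C]
        mult.assoc)
qed (use assms in auto)

lemma l2_inner_tendsto:
  assumes "\<And>n. f n \<in> l2 M" "f0 \<in> l2 M" "\<And>n. g n \<in> l2 M" "g0 \<in> l2 M"
    and "(\<lambda>n. l2_norm M (\<lambda>x. f n x - f0 x)) \<longlonglongrightarrow> 0" "(\<lambda>n. l2_norm M (\<lambda>x. g n x - g0 x)) \<longlonglongrightarrow> 0"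
  shows "(\<lambda>n. l2_inner M (f n) (g n)) \<longlonglongrightarrow> l2_inner M f0 g0"
proof -
  have "(\<lambda>n. l2_inner M (f n) (g n) - l2_inner M f0 g0) \<longlonglongrightarrow> 0"
  proof (rule tendsto_rabs_zero_cancel, rule tendsto_sandwich[of "\<lambda>_. 0"])
    have "\<bar>l2_inner M (f n) (g n) - l2_inner M f0 g0\<bar>
       \<le> l2_norm M (\<lambda>x. f n x - f0 x) * (l2_norm M (\<lambda>x. g n x - g0 x) + l2_norm M g0)
         + l2_norm M f0 * l2_norm M (\<lambda>x. g n x - g0 x)" for n
    proof -
      have d: "(\<lambda>x. f n x - f0 x) \<in> l2 M" "(\<lambda>x. g n x - g0 x) \<in> l2 M"
        using assms by (auto intro: l2_diff)
      have "l2_inner M (f n) (g n) - l2_inner M f0 g0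
          = l2_inner M (\<lambda>x. f n x - f0 x) (g n) + l2_inner M f0 (\<lambda>x. g n x - g0 x)"
        using assms by (simp add: l2_inner_diff_left l2_inner_diff_right)
      moreover have "l2_norm M (g n) \<le> l2_norm M (\<lambda>x. g n x - g0 x) + l2_norm M g0"
        using l2_norm_triangle[OF d(2) assms(4)] by simp
      then have "\<bar>l2_inner M (\<lambda>x. f n x - f0 x) (g n)\<bar>
          \<le> l2_norm M (\<lambda>x. f n x - f0 x) * (l2_norm M (\<lambda>x. g n x - g0 x) + l2_norm M g0)"
        using l2_Cauchy_Schwarz[OF d(1) assms(3)[of n]]
        by (meson l2_norm_nonneg mult_left_mono order_trans)
      ultimately show ?thesis using l2_Cauchy_Schwarz[OF assms(2) d(2)] by linarith
    qed
    then show "\<forall>\<^sub>F n in sequentially. \<bar>l2_inner M (f n) (g n) - l2_inner M f0 g0\<bar>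
       \<le> l2_norm M (\<lambda>x. f n x - f0 x) * (l2_norm M (\<lambda>x. g n x - g0 x) + l2_norm M g0)
         + l2_norm M f0 * l2_norm M (\<lambda>x. g n x - g0 x)" by simp
    have "(\<lambda>n. l2_norm M (\<lambda>x. f n x - f0 x) * (l2_norm M (\<lambda>x. g n x - g0 x) + l2_norm M g0)
         + l2_norm M f0 * l2_norm M (\<lambda>x. g n x - g0 x)) \<longlonglongrightarrow> 0 * (0 + l2_norm M g0) + l2_norm M f0 * 0"
      by (intro tendsto_intros assms)
    then show "(\<lambda>n. l2_norm M (\<lambda>x. f n x - f0 x) * (l2_norm M (\<lambda>x. g n x - g0 x) + l2_norm M g0)
         + l2_norm M f0 * l2_norm M (\<lambda>x. g n x - g0 x)) \<longlonglongrightarrow> 0" by simp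
  qed auto
  then show ?thesis by (simp add: LIM_zero_iff)
qed

lemma l2_norm_tendsto_const:
  "f \<in> l2 M \<Longrightarrow> (\<lambda>n. l2_norm M (\<lambda>x. f x - f x)) \<longlonglongrightarrow> 0"
  by (simp add: l2_norm_def l2_inner_def)

lemma l2_norm_tendsto:
  assumes "\<And>n. f n \<in> l2 M" "f0 \<in> l2 M" "(\<lambda>n. l2_norm M (\<lambda>x. f n x - f0 x)) \<longlonglongrightarrow> 0"
  shows "(\<lambda>n. l2_norm M (f n)) \<longlonglongrightarrow> l2_norm M f0"
  unfolding l2_norm_def by (intro tendsto_intros l2_inner_tendsto assms)

text \<open>Riesz-Fischer for sequences of functions. A rapidly converging subsequence has summable
  increments and converges almost everywhere; Fatou's lemma then gives norm convergence of the whole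
  sequence. Finiteness of the measure turns L2 bounds of the increments into L1 bounds.\<close>

lemma l2_complete:
  assumes fin: "finite_measure M" and f: "\<And>n::nat. f n \<in> l2 M"
    and cau: "\<And>e. 0 < e \<Longrightarrow> \<exists>N. \<forall>m\<ge>N. \<forall>n\<ge>N. l2_norm M (\<lambda>x. f m x - f n x) < e"
  obtains g where "g \<in> l2 M" "(\<lambda>n. l2_norm M (\<lambda>x. f n x - g x)) \<longlonglongrightarrow> 0"
proof -
  interpret finite_measure M by fact
  have one: "(\<lambda>x. 1) \<in> l2 M" by (simp add: l2_def)
  have "\<exists>N. \<forall>m\<ge>N. \<forall>n\<ge>N. l2_norm M (\<lambda>x. f m x - f n x) < (1/2)^k" for k
    by (rule cau) simp
  then obtain N0 where N0: "\<And>k m n. m \<ge> N0 k \<Longrightarrow> n \<ge> N0 k \<Longrightarrow> l2_norm M (\<lambda>x. f m x - f n x) < (1/2)^k"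
    by metis
  \<comment> \<open>Summing the thresholds makes the indices monotone while \<open>r k\<close> stays
    at least \<open>N0 k\<close>.\<close>
  define r where "r k = (\<Sum>i\<le>k. N0 i)" for k
  have rN: "N0 k \<le> r k" for k unfolding r_def by (rule member_le_sum) auto
  have rr: "r k \<le> r (Suc k)" for k unfolding r_def by simp
  have rk: "N0 k \<le> r (Suc k)" for k using rN[of k] rr[of k] by simp
  define u where "u k = f (r k)" for k
  have um[measurable]: "u k \<in> borel_measurable M" for k
    unfolding u_def using f l2_measurable by blast
  have fm[measurable]: "f n \<in> borel_measurable M" for n using f l2_measurable by blast
  have udiff: "(\<integral>\<^sup>+x. ennreal \<bar>u (Suc k) x - u k x\<bar> \<partial>M) \<le> ennreal (l2_norm M (\<lambda>x. 1) * (1/2)^k)" for k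
  proof -
    have d: "(\<lambda>x. \<bar>u (Suc k) x - u k x\<bar>) \<in> l2 M"
      by (rule l2_bound[of "\<lambda>x. u (Suc k) x - u k x" _ _ 1]) (auto simp: u_def intro!: l2_diff f)
    have "(\<integral>\<^sup>+x. ennreal \<bar>u (Suc k) x - u k x\<bar> \<partial>M) = ennreal (l2_inner M (\<lambda>x. 1) (\<lambda>x. \<bar>u (Suc k) x - u k x\<bar>))"
      unfolding l2_inner_def using l2_mult_integrable[OF one d]
      by (subst nn_integral_eq_integral) auto
    also have "l2_inner M (\<lambda>x. 1) (\<lambda>x. \<bar>u (Suc k) x - u k x\<bar>) \<le> l2_norm M (\<lambda>x. 1) * l2_norm M (\<lambda>x. \<bar>u (Suc k) x - u k x\<bar>)"
      using l2_Cauchy_Schwarz[OF one d] by simp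
    also have "l2_norm M (\<lambda>x. \<bar>u (Suc k) x - u k x\<bar>) = l2_norm M (\<lambda>x. u (Suc k) x - u k x)"
      by (simp add: l2_norm_def l2_inner_def)
    also have "\<dots> \<le> (1/2)^k" unfolding u_def using N0[OF rk[of k] rN[of k]] by simp
    finally show ?thesis by (simp add: mult_left_mono ennreal_leI)
  qed
  have "(\<integral>\<^sup>+x. (\<Sum>k. ennreal \<bar>u (Suc k) x - u k x\<bar>) \<partial>M) = (\<Sum>k. \<integral>\<^sup>+x. ennreal \<bar>u (Suc k) x - u k x\<bar> \<partial>M)"
    by (rule nn_integral_suminf) auto
  also have "\<dots> \<le> (\<Sum>k. ennreal (l2_norm M (\<lambda>x. 1) * (1/2)^k))"
    by (rule suminf_le) (use udiff in auto)
  also have "\<dots> = ennreal (\<Sum>k. l2_norm M (\<lambda>x. 1) * (1/2)^k)"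
    by (rule suminf_ennreal2) (auto intro!: summable_mult summable_geometric)
  finally have "(\<integral>\<^sup>+x. (\<Sum>k. ennreal \<bar>u (Suc k) x - u k x\<bar>) \<partial>M) < top"
    by (rule le_less_trans[OF _ ennreal_less_top])
  then have "(\<integral>\<^sup>+x. (\<Sum>k. ennreal \<bar>u (Suc k) x - u k x\<bar>) \<partial>M) \<noteq> \<infinity>" by simp
  then have AEfin: "AE x in M. (\<Sum>k. ennreal \<bar>u (Suc k) x - u k x\<bar>) \<noteq> \<infinity>"
    by (intro nn_integral_PInf_AE) auto
  define g where "g x = lim (\<lambda>k. u k x)" for x
  have conv: "AE x in M. (\<lambda>k. u k x) \<longlonglongrightarrow> g x"
    using AEfin
  proof eventually_elim
    case (elim x)
    have "summable (\<lambda>k. \<bar>u (Suc k) x - u k x\<bar>)"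
      by (rule summable_suminf_not_top) (use elim in auto)
    then have "summable (\<lambda>k. u (Suc k) x - u k x)" by (rule summable_rabs_cancel)
    then have "convergent (\<lambda>n. \<Sum>k<n. u (Suc k) x - u k x)" by (simp add: summable_iff_convergent)
    then have "convergent (\<lambda>n. u n x - u 0 x)"
      unfolding sum_lessThan_telescope[of "\<lambda>k. u k x"] .
    then have "convergent (\<lambda>n. (u n x - u 0 x) + u 0 x)" by (intro convergent_add convergent_const)
    then show ?case unfolding g_def by (simp add: convergent_LIMSEQ_iff)
  qed
  have gm[measurable]: "g \<in> borel_measurable M"
    unfolding g_def by (rule borel_measurable_lim_metric) measurable
  have fg: "(\<integral>\<^sup>+x. ennreal ((f m x - g x)\<^sup>2) \<partial>M) \<le> ennreal (((1/2)^j)\<^sup>2)" if m: "m \<ge> N0 j" for m j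
  proof -
    have "(\<integral>\<^sup>+x. ennreal ((f m x - g x)\<^sup>2) \<partial>M) = (\<integral>\<^sup>+x. liminf (\<lambda>k. ennreal ((f m x - u k x)\<^sup>2)) \<partial>M)"
    proof (rule nn_integral_cong_AE)
      show "AE x in M. ennreal ((f m x - g x)\<^sup>2) = liminf (\<lambda>k. ennreal ((f m x - u k x)\<^sup>2))"
        using conv
      proof eventually_elim
        case (elim x)
        have "(\<lambda>k. ennreal ((f m x - u k x)\<^sup>2)) \<longlonglongrightarrow> ennreal ((f m x - g x)\<^sup>2)"
          by (intro tendsto_ennrealI tendsto_intros elim)
        from lim_imp_Liminf[OF _ this] show ?case by simp
      qed
    qed
    also have "\<dots> \<le> liminf (\<lambda>k. \<integral>\<^sup>+x. ennreal ((f m x - u k x)\<^sup>2) \<partial>M)"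
      by (rule nn_integral_liminf) auto
    also have "\<dots> \<le> ennreal (((1/2)^j)\<^sup>2)"
    proof (rule Liminf_le)
      show "\<forall>\<^sub>F k in sequentially. (\<integral>\<^sup>+x. ennreal ((f m x - u k x)\<^sup>2) \<partial>M) \<le> ennreal (((1/2)^j)\<^sup>2)"
      proof (rule eventually_sequentiallyI[of j])
        fix k assume "j \<le> k"
        have mono: "r j \<le> r k" using \<open>j \<le> k\<close> rr by (rule lift_Suc_mono_le[rotated])
        have d: "(\<lambda>x. f m x - u k x) \<in> l2 M" unfolding u_def by (intro l2_diff f)
        have "(\<integral>\<^sup>+x. ennreal ((f m x - u k x)\<^sup>2) \<partial>M) = ennreal ((l2_norm M (\<lambda>x. f m x - u k x))\<^sup>2)"
          unfolding l2_norm_power2 l2_inner_def using l2_square_integrable[OF d]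
          by (subst nn_integral_eq_integral) (auto simp: power2_eq_square)
        also have "\<dots> \<le> ennreal (((1/2)^j)\<^sup>2)"
          unfolding u_def using N0[OF m, of "r k"] rN[of j] mono
          by (intro ennreal_leI power_mono) (auto intro: less_imp_le)
        finally show "(\<integral>\<^sup>+x. ennreal ((f m x - u k x)\<^sup>2) \<partial>M) \<le> ennreal (((1/2)^j)\<^sup>2)" .
      qed
    qed simp
    finally show ?thesis .
  qed
  have dl2: "(\<lambda>x. f m x - g x) \<in> l2 M" if "m \<ge> N0 j" for m j
  proof -
    have "integrable M (\<lambda>x. (f m x - g x)\<^sup>2)"
      by (rule integrableI_bounded) (use fg[OF that] in \<open>auto intro: le_less_trans\<close>)
    then show ?thesis by (simp add: l2_def)
  qed
  have "g \<in> l2 M"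
    using l2_diff[OF f[of "N0 0"] dl2[of 0 "N0 0"]] by simp
  moreover have "(\<lambda>n. l2_norm M (\<lambda>x. f n x - g x)) \<longlonglongrightarrow> 0"
  proof (rule LIMSEQ_I)
    fix e :: real assume "e > 0"
    then obtain j where j: "(1/2::real)^j < e" using real_arch_pow_inv[of e "1/2"] by auto
    have "l2_norm M (\<lambda>x. f n x - g x) \<le> (1/2)^j" if "n \<ge> N0 j" for n
    proof (rule power2_le_imp_le)
      have "ennreal ((l2_norm M (\<lambda>x. f n x - g x))\<^sup>2) = (\<integral>\<^sup>+x. ennreal ((f n x - g x)\<^sup>2) \<partial>M)"
        unfolding l2_norm_power2 l2_inner_def using l2_square_integrable[OF dl2[OF that]]
        by (subst nn_integral_eq_integral) (auto simp: power2_eq_square)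
      also have "\<dots> \<le> ennreal (((1/2)^j)\<^sup>2)" by (rule fg[OF that])
      finally show "(l2_norm M (\<lambda>x. f n x - g x))\<^sup>2 \<le> ((1/2)^j)\<^sup>2"
        by (subst (asm) ennreal_le_iff) auto
    qed simp
    then have "l2_norm M (\<lambda>x. f n x - g x) < e" if "n \<ge> N0 j" for n
      using j that le_less_trans by blast
    then show "\<exists>no. \<forall>n\<ge>no. norm (l2_norm M (\<lambda>x. f n x - g x) - 0) < e"
      by (auto intro!: exI[of _ "N0 j"])
  qed
  ultimately show ?thesis using that by blast
qed

text \<open>Lax-Milgram for symmetric forms equivalent to the L2 product. With the product itself it
  yields the transposition solution, with the form of the Newton operator the Newton step.
  Coercivity makes the representing sequence Cauchy in norm; the upper bound lets the form pass to
  the limit.\<close>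

lemma l2_riesz:
  assumes fin: "finite_measure M" and "psd_form (l2 M) B"
    and coer: "\<And>f. f \<in> l2 M \<Longrightarrow> c * (l2_norm M f)\<^sup>2 \<le> B f f" "c > 0"
    and bd: "\<And>f. f \<in> l2 M \<Longrightarrow> B f f \<le> K * (l2_norm M f)\<^sup>2"
    and F_add: "\<And>f g. f \<in> l2 M \<Longrightarrow> g \<in> l2 M \<Longrightarrow> F (\<lambda>x. f x + g x) = F f + F g"
    and F_scale: "\<And>f c. f \<in> l2 M \<Longrightarrow> F (\<lambda>x. c * f x) = c * F f"
    and F_bd: "\<And>f. f \<in> l2 M \<Longrightarrow> \<bar>F f\<bar> \<le> C * l2_norm M f"
  obtains g where "g \<in> l2 M" "\<And>f. f \<in> l2 M \<Longrightarrow> B g f = F f"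
proof -
  interpret B: psd_form "l2 M" B by fact
  have nB: "l2_norm M f \<le> sqrt (B f f) / sqrt c" if "f \<in> l2 M" for f
  proof -
    have "(l2_norm M f)\<^sup>2 \<le> B f f / c" using coer(1)[OF that] \<open>c > 0\<close> by (simp add: field_simps)
    then have "sqrt ((l2_norm M f)\<^sup>2) \<le> sqrt (B f f / c)" by (rule real_sqrt_le_mono)
    then show ?thesis by (simp add: real_sqrt_divide)
  qed
  have F': "\<bar>F f\<bar> \<le> \<bar>C\<bar> / sqrt c * sqrt (B f f)" if "f \<in> l2 M" for f
  proof -
    have "\<bar>F f\<bar> \<le> \<bar>C\<bar> * l2_norm M f" using F_bd[OF that]
      by (meson abs_ge_self l2_norm_nonneg mult_right_mono order_trans)
    also have "\<dots> \<le> \<bar>C\<bar> * (sqrt (B f f) / sqrt c)" by (rule mult_left_mono[OF nB[OF that]]) simp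
    finally show ?thesis by simp
  qed
  obtain \<theta> where \<theta>: "\<And>n. \<theta> n \<in> l2 M"
    and cau: "\<And>e. 0 < e \<Longrightarrow> \<exists>N. \<forall>m\<ge>N. \<forall>n\<ge>N. B (\<lambda>x. \<theta> m x - \<theta> n x) (\<lambda>x. \<theta> m x - \<theta> n x) < e"
    and lim: "\<And>f. f \<in> l2 M \<Longrightarrow> (\<lambda>n. B (\<theta> n) f) \<longlonglongrightarrow> F f"
    using B.Riesz_sequence[OF F_add F_scale F'] by blast
  obtain g where g: "g \<in> l2 M" "(\<lambda>n. l2_norm M (\<lambda>x. \<theta> n x - g x)) \<longlonglongrightarrow> 0"
  proof (rule l2_complete[OF fin \<theta>])
    fix e :: real assume e: "0 < e"
    then have "0 < c * e\<^sup>2" using \<open>c > 0\<close> by simp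
    from cau[OF this] obtain N where N: "\<And>m n. m \<ge> N \<Longrightarrow> n \<ge> N \<Longrightarrow> B (\<lambda>x. \<theta> m x - \<theta> n x) (\<lambda>x. \<theta> m x - \<theta> n x) < c * e\<^sup>2"
      by blast
    have "l2_norm M (\<lambda>x. \<theta> m x - \<theta> n x) < e" if "m \<ge> N" "n \<ge> N" for m n
    proof (rule power2_less_imp_less)
      have "c * (l2_norm M (\<lambda>x. \<theta> m x - \<theta> n x))\<^sup>2 < c * e\<^sup>2"
        using coer(1)[OF l2_diff[OF \<theta> \<theta>], of m n] N[OF that] by linarith
      then show "(l2_norm M (\<lambda>x. \<theta> m x - \<theta> n x))\<^sup>2 < e\<^sup>2" using \<open>c > 0\<close> by simp
    qed (use e in auto)
    then show "\<exists>N. \<forall>m\<ge>N. \<forall>n\<ge>N. l2_norm M (\<lambda>x. \<theta> m x - \<theta> n x) < e" by blast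
  qed blast
  have "B g f = F f" if f: "f \<in> l2 M" for f
  proof (rule LIMSEQ_unique[OF _ lim[OF f]])
    have "(\<lambda>n. B (\<theta> n) f - B g f) \<longlonglongrightarrow> 0"
    proof (rule tendsto_rabs_zero_cancel, rule tendsto_sandwich[of "\<lambda>_. 0"])
      have "\<bar>B (\<theta> n) f - B g f\<bar> \<le> sqrt \<bar>K\<bar> * l2_norm M (\<lambda>x. \<theta> n x - g x) * sqrt (B f f)" for n
      proof -
        have d: "(\<lambda>x. \<theta> n x + (-1) * g x) \<in> l2 M" using l2_diff[OF \<theta> g(1)] by simp
        have "B (\<theta> n) f - B g f = B (\<lambda>x. \<theta> n x + (-1) * g x) f"
          using B.add_left[OF \<theta>[of n] l2_scale[OF g(1), of "-1"] f] B.scale_left[OF g(1) f, of "-1"] by simp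
        also have "\<bar>\<dots>\<bar> \<le> sqrt (B (\<lambda>x. \<theta> n x + (-1) * g x) (\<lambda>x. \<theta> n x + (-1) * g x)) * sqrt (B f f)"
          using real_sqrt_le_mono[OF B.Cauchy_Schwarz[OF d f]] by (simp add: real_sqrt_mult)
        also have "\<dots> \<le> sqrt \<bar>K\<bar> * l2_norm M (\<lambda>x. \<theta> n x - g x) * sqrt (B f f)"
        proof (rule mult_right_mono)
          have "B (\<lambda>x. \<theta> n x + (-1) * g x) (\<lambda>x. \<theta> n x + (-1) * g x) \<le> \<bar>K\<bar> * (l2_norm M (\<lambda>x. \<theta> n x - g x))\<^sup>2"
            using bd[OF d] mult_right_mono[OF abs_ge_self[of K], of "(l2_norm M (\<lambda>x. \<theta> n x - g x))\<^sup>2"] by simp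
          from real_sqrt_le_mono[OF this]
          show "sqrt (B (\<lambda>x. \<theta> n x + (-1) * g x) (\<lambda>x. \<theta> n x + (-1) * g x)) \<le> sqrt \<bar>K\<bar> * l2_norm M (\<lambda>x. \<theta> n x - g x)"
            by (simp add: real_sqrt_mult)
        qed (use B.nonneg f in auto)
        finally show ?thesis .
      qed
      then show "\<forall>\<^sub>F n in sequentially. \<bar>B (\<theta> n) f - B g f\<bar> \<le> sqrt \<bar>K\<bar> * l2_norm M (\<lambda>x. \<theta> n x - g x) * sqrt (B f f)"
        by simp
      show "(\<lambda>n. sqrt \<bar>K\<bar> * l2_norm M (\<lambda>x. \<theta> n x - g x) * sqrt (B f f)) \<longlonglongrightarrow> 0"
        using tendsto_mult_left_zero[OF tendsto_mult_right_zero[OF g(2)]] by simp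
    qed auto
    then show "(\<lambda>n. B (\<theta> n) f) \<longlonglongrightarrow> B g f" by (simp add: LIM_zero_iff)
  qed
  then show ?thesis using that g by blast
qed

section \<open>Smooth functions on the plane\<close>

lemma grad_has_derivative:
  assumes "f differentiable (at x)"
  shows "(f has_derivative (\<lambda>h. grad f x \<bullet> h)) (at x)"
proof -
  let ?D = "frechet_derivative f (at x)"
  have D: "(f has_derivative ?D) (at x)" using assms by (simp add: frechet_derivative_works)
  then have lin: "linear ?D" by (rule has_derivative_linear)
  have "?D h = grad f x \<bullet> h" for h
  proof -
    have "?D h = ?D (\<Sum>i\<in>UNIV. (h $ i) *s axis i 1)" by (simp add: basis_expansion)
    also have "\<dots> = (\<Sum>i\<in>UNIV. h $ i * ?D (axis i 1))"
      using lin by (simp add: linear_sum linear_scale scalar_mult_eq_scaleR)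
    also have "\<dots> = grad f x \<bullet> h" by (simp add: inner_vec_def grad_def mult.commute)
    finally show ?thesis .
  qed
  then have "?D = (\<lambda>h. grad f x \<bullet> h)" by auto
  then show ?thesis using D by simp
qed

lemma grad_eqI:
  assumes "(f has_derivative (\<lambda>h. g \<bullet> h)) (at x)"
  shows "grad f x = g"
proof -
  have "frechet_derivative f (at x) = (\<lambda>h. g \<bullet> h)"
    using frechet_derivative_at[OF assms] by simp
  then show ?thesis by (simp add: grad_def vec_eq_iff inner_axis)
qed

lemma grad_cong_ev: 
  assumes "eventually (\<lambda>y. f y = g y) (nhds x)"
  shows "grad f x = grad g x"
proof -
  have "eventually (\<lambda>y. f y = g y) (at x)" "f x = g x" using assms
    by (auto simp: eventually_nhds_conv_at)
  then have "(f has_derivative D) (at x) \<longleftrightarrow> (g has_derivative D) (at x)" for D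
    using has_derivative_transform_eventually[of f D x UNIV g] has_derivative_transform_eventually[of g D x UNIV f]
    by (auto simp: eq_commute)
  then show ?thesis by (simp add: grad_def frechet_derivative_def)
qed

lemma grad_const [simp]: "grad (\<lambda>x. c) x = 0"
  by (rule grad_eqI) simp

lemma grad_affine: "grad (\<lambda>x. c + a \<bullet> x) x = a"
  by (rule grad_eqI) (auto intro!: derivative_eq_intros)

lemma grad_add: "f differentiable (at x) \<Longrightarrow> g differentiable (at x) \<Longrightarrow>
    grad (\<lambda>x. f x + g x) x = grad f x + grad g x"
  by (rule grad_eqI) (auto intro!: derivative_eq_intros grad_has_derivative simp: inner_add_left)

lemma grad_diff: "f differentiable (at x) \<Longrightarrow> g differentiable (at x) \<Longrightarrow>
    grad (\<lambda>x. f x - g x) x = grad f x - grad g x"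
  by (rule grad_eqI) (auto intro!: derivative_eq_intros grad_has_derivative simp: inner_diff_left)

lemma grad_mult: "f differentiable (at x) \<Longrightarrow> g differentiable (at x) \<Longrightarrow>
    grad (\<lambda>x. f x * g x) x = f x *\<^sub>R grad g x + g x *\<^sub>R grad f x"
  by (rule grad_eqI) (auto intro!: derivative_eq_intros grad_has_derivative simp: inner_add_left)

lemma grad_scale: "f differentiable (at x) \<Longrightarrow> grad (\<lambda>x. c * f x) x = c *\<^sub>R grad f x"
  using grad_mult[of "\<lambda>_. c" x f] by simp

lemma grad_sum: "finite I \<Longrightarrow> (\<And>i. i \<in> I \<Longrightarrow> f i differentiable (at x)) \<Longrightarrow>
    grad (\<lambda>x. \<Sum>i\<in>I. f i x) x = (\<Sum>i\<in>I. grad (f i) x)"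
  by (rule grad_eqI) (auto intro!: derivative_eq_intros grad_has_derivative simp: inner_sum_left)

lemma grad_compose:
  assumes "(F has_real_derivative D) (at (f x))" "f differentiable (at x)"
  shows "grad (\<lambda>x. F (f x)) x = D *\<^sub>R grad f x"
proof (rule grad_eqI)
  have "(F has_derivative (*) D) (at (f x))" using assms(1) by (simp add: has_field_derivative_def)
  from has_derivative_compose[OF grad_has_derivative[OF assms(2)] this]
  moreover have "(\<lambda>h. D * (grad f x \<bullet> h)) = (\<bullet>) (D *\<^sub>R grad f x)" by auto
  ultimately show "((\<lambda>x. F (f x)) has_derivative (\<bullet>) (D *\<^sub>R grad f x)) (at x)" by (simp only:)
qed

lemma differentiable_compose_real:
  fixes f :: "real^2 \<Rightarrow> real"
  assumes "(F has_real_derivative D) (at (f x))" "f differentiable (at x)"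
  shows "(\<lambda>x. F (f x)) differentiable (at x)"
proof -
  have "(F has_derivative (*) D) (at (f x))" using assms(1) by (simp add: has_field_derivative_def)
  from has_derivative_compose[OF grad_has_derivative[OF assms(2)] this]
  show ?thesis by (auto simp: differentiable_def)
qed

lemma Ck_continuous: "Ck k f \<Longrightarrow> continuous_on UNIV f"
  by (cases k) (auto intro!: continuous_at_imp_continuous_on differentiable_imp_continuous_within)

lemma Ck_Suc_imp: "Ck (Suc k) f \<Longrightarrow> Ck k f"
proof (induction k arbitrary: f)
  case 0
  then show ?case using Ck_continuous by fastforce
next
  case (Suc k)
  then have "\<forall>x. f differentiable (at x)" and *: "\<forall>i. Ck (Suc k) (\<lambda>x. grad f x $ i)" by auto
  with Suc.IH show ?case by auto
qed

lemma Ck_const: "Ck k (\<lambda>x. c)"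
  by (induction k arbitrary: c) auto

lemma Ck_add: "Ck k f \<Longrightarrow> Ck k g \<Longrightarrow> Ck k (\<lambda>x. f x + g x)"
proof (induction k arbitrary: f g)
  case (Suc k)
  then have "(\<lambda>x. grad (\<lambda>x. f x + g x) x $ i) = (\<lambda>x. grad f x $ i + grad g x $ i)" for i
    by (auto simp: grad_add)
  with Suc show ?case by (auto intro: differentiable_add)
qed (auto intro: continuous_intros)

lemma Ck_mult: "Ck k f \<Longrightarrow> Ck k g \<Longrightarrow> Ck k (\<lambda>x. f x * g x)"
proof (induction k arbitrary: f g)
  case (Suc k)
  then have "(\<lambda>x. grad (\<lambda>x. f x * g x) x $ i) = (\<lambda>x. f x * grad g x $ i + g x * grad f x $ i)" for i
    by (auto simp: grad_mult)
  moreover have "Ck k f" "Ck k g" using Suc.prems Ck_Suc_imp by blast+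
  ultimately show ?case using Suc by (auto intro!: differentiable_mult Ck_add)
qed (auto intro: continuous_intros)

text \<open>The family \<open>D\<close> carries the derivatives of all orders: the chain rule leads
  from \<open>D n\<close> to \<open>D (Suc n)\<close>, so the induction must hold for every
  \<open>n\<close>. The set \<open>T\<close> admits outer functions such as the logarithm that are
  smooth only on a half-line.\<close>

lemma Ck_compose:
  assumes "\<And>n t. t \<in> T \<Longrightarrow> (D n has_real_derivative D (Suc n) t) (at t)" "range f \<subseteq> T"
  shows "Ck k f \<Longrightarrow> Ck k (\<lambda>x. D n (f x))"
proof (induction k arbitrary: n)
  case 0
  have "isCont (D n) (f x)" for x using assms DERIV_isCont by blast
  moreover have "isCont f x" for x using 0 by (simp add: continuous_on_eq_continuous_at)
  ultimately have "isCont (\<lambda>x. D n (f x)) x" for x by (rule isCont_o2[rotated])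
  then show ?case by (simp add: continuous_at_imp_continuous_on)
next
  case (Suc k)
  have D: "(D n has_real_derivative D (Suc n) (f x)) (at (f x))" for x using assms by blast
  have df: "f differentiable (at x)" for x using Suc.prems by simp
  have "(\<lambda>x. grad (\<lambda>x. D n (f x)) x $ i) = (\<lambda>x. D (Suc n) (f x) * grad f x $ i)" for i
    using grad_compose[OF D df] by auto
  moreover have "Ck k (\<lambda>x. D (Suc n) (f x))" using Suc.IH[OF Ck_Suc_imp[OF Suc.prems]] .
  ultimately show ?case using Suc.prems differentiable_compose_real[OF D df] by (auto intro: Ck_mult)
qed

lemma smooth_const [simp]: "smooth (\<lambda>x. c)"
  by (simp add: smooth_def Ck_const)

lemma smooth_add: "smooth f \<Longrightarrow> smooth g \<Longrightarrow> smooth (\<lambda>x. f x + g x)"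
  by (simp add: smooth_def Ck_add)

lemma smooth_mult: "smooth f \<Longrightarrow> smooth g \<Longrightarrow> smooth (\<lambda>x. f x * g x)"
  by (simp add: smooth_def Ck_mult)

lemma smooth_uminus: "smooth f \<Longrightarrow> smooth (\<lambda>x. - f x)"
  using smooth_mult[of "\<lambda>x. -1" f] by simp

lemma smooth_diff: "smooth f \<Longrightarrow> smooth g \<Longrightarrow> smooth (\<lambda>x. f x - g x)"
  using smooth_add[OF _ smooth_uminus, of f g] by simp

lemma smooth_sum: "(\<And>i. i \<in> I \<Longrightarrow> smooth (f i)) \<Longrightarrow> smooth (\<lambda>x. \<Sum>i\<in>I. f i x)"
  by (induction I rule: infinite_finite_induct) (auto intro: smooth_add)

lemma smooth_prod: "(\<And>i. i \<in> I \<Longrightarrow> smooth (f i)) \<Longrightarrow> smooth (\<lambda>x. \<Prod>i\<in>I. f i x)"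
  by (induction I rule: infinite_finite_induct) (auto intro: smooth_mult)

lemma smooth_power: "smooth f \<Longrightarrow> smooth (\<lambda>x. (f x) ^ n)"
  by (induction n) (auto intro: smooth_mult)

lemma smooth_differentiable: "smooth f \<Longrightarrow> f differentiable (at x)"
  unfolding smooth_def by (metis Ck.simps(2))

lemma smooth_continuous: "smooth f \<Longrightarrow> continuous_on S f"
  using Ck_continuous continuous_on_subset smooth_def by blast

lemma smooth_grad: "smooth f \<Longrightarrow> smooth (\<lambda>x. grad f x $ i)"
  unfolding smooth_def by (metis Ck.simps(2))

lemma grad_continuous: "smooth f \<Longrightarrow> continuous_on S (grad f)"
  using smooth_continuous[OF smooth_grad, of f S]
  by (subst continuous_on_componentwise) (auto simp: Basis_vec_def inner_axis)

lemma smooth_affine: "smooth (\<lambda>x. c + a \<bullet> x)"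
proof -
  have "Ck k (\<lambda>x. c + a \<bullet> x)" for k
    by (cases k) (auto simp: grad_affine Ck_const intro!: continuous_intros derivative_intros)
  then show ?thesis by (simp add: smooth_def)
qed

lemma smooth_component: "smooth (\<lambda>x. x $ i)"
  using smooth_affine[of 0 "axis i 1"] by (simp add: inner_axis')

lemma smooth_borel [measurable (raw)]: "smooth f \<Longrightarrow> f \<in> borel_measurable borel"
  by (intro borel_measurable_continuous_onI smooth_continuous)

lemma smooth_compose:
  assumes "smooth f" "range f \<subseteq> T"
    and "\<And>n t. t \<in> T \<Longrightarrow> (D n has_real_derivative D (Suc n) t) (at t)"
  shows "smooth (\<lambda>x. D n (f x))"
  using Ck_compose[of T D f] assms by (auto simp: smooth_def)

lemma smooth_exp: "smooth f \<Longrightarrow> smooth (\<lambda>x. exp (f x))"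
  by (rule smooth_compose[where D = "\<lambda>_. exp" and T = UNIV]) auto

lemma inverse_power_deriv:
  assumes "0 < (t::real)"
  shows "((\<lambda>t. (- 1) ^ n * fact n * inverse (t ^ Suc n)) has_real_derivative
          (- 1) ^ Suc n * fact (Suc n) * inverse (t ^ Suc (Suc n))) (at t)"
  using assms
  by (auto intro!: derivative_eq_intros simp: field_simps power_Suc simp del: power_Suc)
     (simp add: field_simps)

lemma smooth_inverse:
  assumes "smooth f" "\<And>x. 0 < f x"
  shows "smooth (\<lambda>x. inverse (f x))"
  using smooth_compose[OF assms(1), of "{0<..}" "\<lambda>n t. (- 1) ^ n * fact n * inverse (t ^ Suc n)" 0]
    inverse_power_deriv assms(2) by auto

lemma smooth_ln:
  assumes "smooth f" "\<And>x. 0 < f x"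
  shows "smooth (\<lambda>x. ln (f x))"
proof -
  define D where "D n t = (case n of 0 \<Rightarrow> ln t | Suc n \<Rightarrow> (- 1) ^ n * fact n * inverse (t ^ Suc n))"
    for n and t :: real
  have "(D n has_real_derivative D (Suc n) t) (at t)" if "0 < t" for n t
  proof (cases n)
    case 0
    then show ?thesis using that by (auto simp: D_def[abs_def] intro!: derivative_eq_intros simp: field_simps)
  next
    case (Suc m)
    then show ?thesis using inverse_power_deriv[OF that, of m] by (simp add: D_def[abs_def])
  qed
  then show ?thesis using smooth_compose[OF assms(1), of "{0<..}" D 0] assms(2) by (auto simp: D_def)
qed

section \<open>Cut-off functions built from exp(-1/t)\<close>

definition flat :: "real \<Rightarrow> real" where
  "flat t = (if t > 0 then exp (- inverse t) else 0)"

text \<open>Polynomials in 1/t times exp(-1/t): a class that contains \<open>flat\<close> and is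
  closed under differentiation.\<close>

definition flatp :: "real poly \<Rightarrow> real \<Rightarrow> real" where
  "flatp p t = (if t > 0 then poly p (inverse t) * exp (- inverse t) else 0)"

lemma poly_exp_minus_tendsto: "((\<lambda>s::real. poly p s * exp (- s)) \<longlongrightarrow> 0) at_top"
proof -
  have "((\<lambda>s::real. \<Sum>i\<le>degree p. coeff p i * (s ^ i / exp s)) \<longlongrightarrow> (\<Sum>i\<le>degree p. coeff p i * 0)) at_top"
    by (intro tendsto_intros tendsto_power_div_exp_0)
  moreover have "(\<lambda>s. \<Sum>i\<le>degree p. coeff p i * (s ^ i / exp s)) = (\<lambda>s. poly p s * exp (- s))"
    by (auto simp: poly_altdef sum_distrib_right exp_minus divide_inverse mult.assoc)
  ultimately show ?thesis by simp
qed

text \<open>With \<open>s = 1/t\<close> the derivative of \<open>p(s) exp(-s)\<close> is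
  \<open>s^2 (p - p')(s) exp(-s)\<close>. The only delicate point is \<open>t = 0\<close>, where the
  exponential beats every polynomial in 1/t.\<close>

lemma flatp_deriv:
  "(flatp p has_real_derivative flatp ([:0, 0, 1:] * (p - pderiv p)) t) (at t)"
proof -
  consider "t > 0" | "t < 0" | "t = 0" by linarith
  then show ?thesis
  proof cases
    case 1
    have "((\<lambda>t. poly p (inverse t) * exp (- inverse t)) has_real_derivative
        flatp ([:0, 0, 1:] * (p - pderiv p)) t) (at t)"
      using 1 by (auto intro!: derivative_eq_intros poly_DERIV[THEN DERIV_chain2]
          simp: flatp_def power2_eq_square algebra_simps)
    then show ?thesis
      by (rule DERIV_cong_ev[THEN iffD1, rotated 3])
        (use 1 eventually_nhds_in_open[of "{0<..}" t] in \<open>auto simp: flatp_def elim!: eventually_mono\<close>)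
  next
    case 2
    have "((\<lambda>t. 0) has_real_derivative flatp ([:0, 0, 1:] * (p - pderiv p)) t) (at t)"
      using 2 by (auto simp: flatp_def)
    then show ?thesis
      by (rule DERIV_cong_ev[THEN iffD1, rotated 3])
        (use 2 eventually_nhds_in_open[of "{..<0}" t] in \<open>auto simp: flatp_def elim!: eventually_mono\<close>)
  next
    case 3
    \<comment> \<open>The difference quotient at 0 is again of this class, with the polynomial
      multiplied by one more power of 1/h.\<close>
    have "((\<lambda>h. poly ([:0, 1:] * p) (inverse h) * exp (- inverse h)) \<longlongrightarrow> 0) (at_right 0)"
      using filterlim_compose[OF poly_exp_minus_tendsto[of "[:0, 1:] * p"] filterlim_inverse_at_top_right] .
    then have "((\<lambda>h. flatp p h / h) \<longlongrightarrow> 0) (at_right 0)"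
      by (rule Lim_transform_eventually)
        (auto simp: flatp_def eventually_at_right_field field_simps intro!: exI[of _ 1])
    moreover have "((\<lambda>h. flatp p h / h) \<longlongrightarrow> 0) (at_left 0)"
      by (rule tendsto_eventually) (auto simp: flatp_def eventually_at_left_field intro!: exI[of _ "-1"])
    ultimately have "((\<lambda>h. flatp p h / h) \<longlongrightarrow> 0) (at 0)" by (simp add: filterlim_split_at)
    then show ?thesis using 3 by (simp add: DERIV_def flatp_def)
  qed
qed

lemma flat_deriv: "(flat has_real_derivative flatp [:0, 0, 1:] t) (at t)"
proof -
  have "flatp [:1:] = flat" by (auto simp: flatp_def flat_def)
  then show ?thesis using flatp_deriv[of "[:1:]" t] by simp
qed

lemma smooth_flat:
  assumes "smooth f" shows "smooth (\<lambda>x. flat (f x))"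
proof -
  define p where "p n = ((\<lambda>p. [:0, 0, 1:] * (p - pderiv p)) ^^ n) [:1::real:]" for n
  have "smooth (\<lambda>x. flatp (p 0) (f x))"
    using smooth_compose[OF assms, of UNIV "\<lambda>n. flatp (p n)" 0] flatp_deriv by (auto simp: p_def)
  moreover have "flatp (p 0) = flat" by (auto simp: flatp_def flat_def p_def)
  ultimately show ?thesis by simp
qed

lemma flat_nonneg [simp]: "0 \<le> flat t" and flat_le_1 [simp]: "flat t \<le> 1"
  and flat_pos [simp]: "0 < flat t \<longleftrightarrow> 0 < t" and flat_zero [simp]: "t \<le> 0 \<Longrightarrow> flat t = 0"
  by (auto simp: flat_def)

definition step :: "real \<Rightarrow> real" where
  "step t = flat t / (flat t + flat (1 - t))"

lemma step_denom_pos: "0 < flat t + flat (1 - t)"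
proof (cases "0 < t")
  case True
  then show ?thesis by (simp add: add_pos_nonneg)
next
  case False
  then show ?thesis by (simp add: add_nonneg_pos)
qed

lemma step_0: "t \<le> 0 \<Longrightarrow> step t = 0" and step_1: "1 \<le> t \<Longrightarrow> step t = 1"
proof -
  show "t \<le> 0 \<Longrightarrow> step t = 0" by (simp add: step_def)
  show "step t = 1" if "1 \<le> t"
    using that step_denom_pos[of t] by (simp add: step_def flat_def)
qed

lemma smooth_step: "smooth f \<Longrightarrow> smooth (\<lambda>x. step (f x))"
  unfolding step_def divide_inverse
  by (intro smooth_mult smooth_inverse smooth_add smooth_flat smooth_diff smooth_const step_denom_pos)

section \<open>Test functions\<close>

lemma test_functionsD:
  assumes "\<theta> \<in> test_functions \<Omega>"
  shows "smooth \<theta>" "compact (closure {x. \<theta> x \<noteq> 0})" "closure {x. \<theta> x \<noteq> 0} \<subseteq> \<Omega>"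
    "x \<notin> \<Omega> \<Longrightarrow> \<theta> x = 0"
proof -
  show "smooth \<theta>" "compact (closure {x. \<theta> x \<noteq> 0})" and s: "closure {x. \<theta> x \<noteq> 0} \<subseteq> \<Omega>"
    using assms by (auto simp: test_functions_def)
  show "\<theta> x = 0" if "x \<notin> \<Omega>"
    using contra_subsetD[OF closure_subset, of x "{x. \<theta> x \<noteq> 0}"] that s by auto
qed

lemma test_functionsI:
  assumes "smooth \<theta>" "compact K" "K \<subseteq> \<Omega>" "\<And>x. x \<notin> K \<Longrightarrow> \<theta> x = 0"
  shows "\<theta> \<in> test_functions \<Omega>"
proof -
  have "closure {x. \<theta> x \<noteq> 0} \<subseteq> K"
    by (rule closure_minimal) (use assms compact_imp_closed in auto)
  moreover from this have "compact (closure {x. \<theta> x \<noteq> 0})"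
    using compact_Int_closed[OF assms(2) closed_closure, of "{x. \<theta> x \<noteq> 0}"] by (simp add: Int_absorb1)
  ultimately show ?thesis using assms by (auto simp: test_functions_def)
qed

lemma test_functions_zero: "(\<lambda>x. 0) \<in> test_functions \<Omega>"
  by (rule test_functionsI[of _ "{}"]) auto

lemma test_functions_add:
  assumes "\<theta> \<in> test_functions \<Omega>" "\<eta> \<in> test_functions \<Omega>"
  shows "(\<lambda>x. \<theta> x + \<eta> x) \<in> test_functions \<Omega>"
proof (rule test_functionsI)
  show "compact (closure {x. \<theta> x \<noteq> 0} \<union> closure {x. \<eta> x \<noteq> 0})"
    by (intro compact_Un assms[THEN test_functionsD(2)])
  show "closure {x. \<theta> x \<noteq> 0} \<union> closure {x. \<eta> x \<noteq> 0} \<subseteq> \<Omega>"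
    using assms[THEN test_functionsD(3)] by blast
  show "\<theta> x + \<eta> x = 0" if "x \<notin> closure {x. \<theta> x \<noteq> 0} \<union> closure {x. \<eta> x \<noteq> 0}" for x
  proof -
    have "x \<notin> closure {x. \<theta> x \<noteq> 0}" "x \<notin> closure {x. \<eta> x \<noteq> 0}" using that by simp_all
    from this[THEN contra_subsetD[OF closure_subset]] show ?thesis by simp
  qed
qed (intro smooth_add assms[THEN test_functionsD(1)])

lemma test_functions_mult_smooth:
  assumes "\<theta> \<in> test_functions \<Omega>" "smooth f"
  shows "(\<lambda>x. f x * \<theta> x) \<in> test_functions \<Omega>"
proof (rule test_functionsI[OF _ test_functionsD(2,3)[OF assms(1)]])
  show "f x * \<theta> x = 0" if "x \<notin> closure {x. \<theta> x \<noteq> 0}" for x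
    using contra_subsetD[OF closure_subset that] by simp
qed (intro smooth_mult assms test_functionsD(1)[OF assms(1)])

lemma test_functions_scale: "\<theta> \<in> test_functions \<Omega> \<Longrightarrow> (\<lambda>x. c * \<theta> x) \<in> test_functions \<Omega>"
  by (rule test_functions_mult_smooth) auto

lemma test_functions_diff: "\<theta> \<in> test_functions \<Omega> \<Longrightarrow> \<eta> \<in> test_functions \<Omega> \<Longrightarrow> (\<lambda>x. \<theta> x - \<eta> x) \<in> test_functions \<Omega>"
  using test_functions_add[OF _ test_functions_scale[of \<eta> \<Omega> "-1"]] by fastforce

lemma grad_zero_outside_closure:
  assumes "x \<notin> closure {x. f x \<noteq> 0}"
  shows "grad f x = 0"
proof -
  have "eventually (\<lambda>y. f y = 0) (nhds x)"
  proof (rule eventually_mono)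
    show "eventually (\<lambda>y. y \<in> - closure {x. f x \<noteq> 0}) (nhds x)"
      by (rule eventually_nhds_in_open) (use assms in auto)
    show "f y = 0" if "y \<in> - closure {x. f x \<noteq> 0}" for y
      using contra_subsetD[OF closure_subset, of y "{x. f x \<noteq> 0}"] that by simp
  qed
  then have "grad f x = grad (\<lambda>x. 0) x" by (rule grad_cong_ev)
  then show ?thesis by simp
qed

lemma test_functions_grad:
  assumes "\<theta> \<in> test_functions \<Omega>"
  shows "(\<lambda>x. grad \<theta> x $ i) \<in> test_functions \<Omega>"
  by (rule test_functionsI[OF _ test_functionsD(2,3)[OF assms]])
    (use smooth_grad[OF test_functionsD(1)[OF assms]] grad_zero_outside_closure[of _ \<theta>] in simp_all)

section \<open>Integration in rotated coordinates\<close>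

text \<open>Links pairs of reals, on which Fubini's theorem is available, to Lebesgue measure on
  \<open>real^2\<close>.\<close>

definition vec2 :: "real \<times> real \<Rightarrow> real^2" where
  "vec2 p = fst p *\<^sub>R axis 1 1 + snd p *\<^sub>R axis 2 1"

lemma vec2_component: "vec2 p $ 1 = fst p" "vec2 p $ 2 = snd p"
  by (simp_all add: vec2_def axis_def)

lemma lborel_vec2: "distr lborel borel vec2 = lborel"
proof (rule lborel_eqI[symmetric])
  have meas: "vec2 \<in> borel_measurable lborel"
    unfolding vec2_def[abs_def] by (simp, intro borel_measurable_continuous_onI continuous_intros)
  fix l u :: "real^2" assume lu: "\<And>b. b \<in> Basis \<Longrightarrow> l \<bullet> b \<le> u \<bullet> b"
  have le: "l $ i \<le> u $ i" for i using lu[of "axis i 1"] by (simp add: inner_axis)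
  have "vec2 -` box l u = box (l$1, l$2) (u$1, u$2)"
    by (auto simp: mem_box_cart forall_2 vec2_component mem_box Basis_prod_def)
  then have "emeasure (distr lborel borel vec2) (box l u) = emeasure lborel (box (l$1, l$2) (u$1, u$2))"
    using meas by (simp add: emeasure_distr)
  also have "\<dots> = ennreal (\<Prod>b\<in>Basis. ((u$1, u$2) - (l$1, l$2)) \<bullet> b)"
    by (rule emeasure_lborel_box) (use le in \<open>auto simp: Basis_prod_def\<close>)
  also have "(\<Prod>b\<in>Basis. ((u$1, u$2) - (l$1, l$2)) \<bullet> b) = (u$1 - l$1) * (u$2 - l$2)"
    by (simp add: Basis_prod_def prod.union_disjoint)
  also have "\<dots> = (\<Prod>b\<in>Basis. (u - l) \<bullet> b)"
  proof -
    have B: "(Basis :: (real^2) set) = {axis 1 1, axis 2 1}"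
      by (auto simp: Basis_vec_def UNIV_2)
    show ?thesis unfolding B by (simp add: axis_eq_axis inner_axis)
  qed
  finally show "emeasure (distr lborel borel vec2) (box l u) = ennreal (\<Prod>b\<in>Basis. (u - l) \<bullet> b)" .
qed simp

text \<open>Invariance is known for images of Lebesgue measurable sets, so the preimage of a box is
  rewritten as its image under the inverse map and measured with \<open>lebesgue\<close>.\<close>

lemma lborel_orthogonal_transformation:
  fixes Q :: "real^2 \<Rightarrow> real^2"
  assumes Q: "orthogonal_transformation Q"
  shows "distr lborel borel Q = lborel"
proof (rule lborel_eqI[symmetric])
  have meas: "Q \<in> borel_measurable lborel"
    using orthogonal_transformation_linear[OF Q] 
    by (simp, intro borel_measurable_continuous_onI linear_continuous_on linear_conv_bounded_linear[THEN iffD1])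
  obtain Q' where Q': "orthogonal_transformation Q'" "\<And>x. Q' (Q x) = x" "\<And>x. Q (Q' x) = x"
    using orthogonal_transformation_inv[OF Q] orthogonal_transformation_bij[OF Q]
    by (metis bij_inv_eq_iff)
  fix l u :: "real^2" assume lu: "\<And>b. b \<in> Basis \<Longrightarrow> l \<bullet> b \<le> u \<bullet> b"
  have im: "Q -` box l u = Q' ` box l u" by (auto simp: Q'(3)) (metis Q'(2) image_eqI)
  have os: "open (Q -` box l u)"
    using orthogonal_transformation_linear[OF Q]
    by (intro open_vimage linear_continuous_on linear_conv_bounded_linear[THEN iffD1]) auto
  have "emeasure (distr lborel borel Q) (box l u) = emeasure lborel (Q -` box l u)"
    using meas by (simp add: emeasure_distr)
  also have "\<dots> = emeasure lebesgue (Q' ` box l u)"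
    using os unfolding im by simp
  also have "\<dots> = ennreal (measure lebesgue (Q' ` box l u))"
    by (rule emeasure_eq_measure2[OF measurable_orthogonal_image[OF Q'(1)]]) simp
  also have "\<dots> = ennreal (measure lebesgue (box l u))"
    by (simp add: measure_orthogonal_image[OF Q'(1)])
  also have "\<dots> = ennreal (\<Prod>b\<in>Basis. (u - l) \<bullet> b)"
    using lu by simp
  finally show "emeasure (distr lborel borel Q) (box l u) = ennreal (\<Prod>b\<in>Basis. (u - l) \<bullet> b)" .
qed simp

text \<open>The basis of Fubini's theorem in an orthonormal frame with origin \<open>a\<close>:
  along coordinate lines for Ladyzhenskaya's inequality, along an edge and its normal for the
  boundary inequality.\<close>

lemma frame_distr:
  fixes a \<tau> n :: "real^2"
  assumes "norm \<tau> = 1" "norm n = 1" "\<tau> \<bullet> n = 0"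
  shows "distr lborel borel (\<lambda>p. a + fst p *\<^sub>R \<tau> + snd p *\<^sub>R n) = lborel"
proof -
  define Q where "Q x = x $ 1 *\<^sub>R \<tau> + x $ 2 *\<^sub>R n" for x :: "real^2"
  have lin: "linear Q" unfolding Q_def by (rule linearI) (auto simp: algebra_simps)
  have nn: "\<tau> \<bullet> \<tau> = 1" "n \<bullet> n = 1" using assms by (auto simp: norm_eq_sqrt_inner)
  have "Q x \<bullet> Q y = x \<bullet> y" for x y
    using assms(3) nn inner_commute[of n \<tau>]
    by (simp add: Q_def inner_add_left inner_add_right) (simp add: inner_vec_def sum_2)
  then have Q: "orthogonal_transformation Q" using lin by (simp add: orthogonal_transformation_def)
  have Qm: "Q \<in> borel_measurable borel"
    using lin by (intro borel_measurable_continuous_onI linear_continuous_on linear_conv_bounded_linear[THEN iffD1])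
  have v: "vec2 \<in> borel_measurable borel"
    unfolding vec2_def[abs_def] by (intro borel_measurable_continuous_onI continuous_intros)
  have "lborel = distr (distr (distr lborel borel vec2) borel Q) borel ((+) a)"
    by (simp add: lborel_vec2 lborel_orthogonal_transformation[OF Q] lborel_distr_plus)
  also have "\<dots> = distr lborel borel ((+) a \<circ> (Q \<circ> vec2))"
    using Qm v by (simp add: distr_distr)
  also have "(+) a \<circ> (Q \<circ> vec2) = (\<lambda>p. a + fst p *\<^sub>R \<tau> + snd p *\<^sub>R n)"
    by (auto simp: Q_def vec2_component add.assoc)
  finally show ?thesis by simp
qed

lemma frame_measurable [measurable]:
  "(\<lambda>p. a + fst p *\<^sub>R \<tau> + snd p *\<^sub>R n :: real^2) \<in> borel_measurable borel"
  by (intro borel_measurable_continuous_onI continuous_intros)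

lemma frame_nn_integral:
  fixes a \<tau> n :: "real^2"
  assumes "norm \<tau> = 1" "norm n = 1" "\<tau> \<bullet> n = 0" and [measurable]: "f \<in> borel_measurable borel"
  shows "(\<integral>\<^sup>+x. f x \<partial>lborel) = (\<integral>\<^sup>+s. \<integral>\<^sup>+t. f (a + s *\<^sub>R \<tau> + t *\<^sub>R n) \<partial>lborel \<partial>lborel)"
proof -
  have "(\<integral>\<^sup>+x. f x \<partial>lborel) = (\<integral>\<^sup>+p. f (a + fst p *\<^sub>R \<tau> + snd p *\<^sub>R n) \<partial>lborel)"
    by (subst frame_distr[OF assms(1-3), of a, symmetric]) (simp add: nn_integral_distr)
  also have "\<dots> = (\<integral>\<^sup>+p. f (a + fst p *\<^sub>R \<tau> + snd p *\<^sub>R n) \<partial>(lborel \<Otimes>\<^sub>M lborel))"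
    by (simp add: lborel_prod)
  also have "\<dots> = (\<integral>\<^sup>+s. \<integral>\<^sup>+t. f (a + s *\<^sub>R \<tau> + t *\<^sub>R n) \<partial>lborel \<partial>lborel)"
    by (subst lborel.nn_integral_fst[symmetric]) (auto simp: lborel_prod)
  finally show ?thesis .
qed

lemma frame_integral:
  fixes a \<tau> n :: "real^2" and f :: "real^2 \<Rightarrow> real"
  assumes "norm \<tau> = 1" "norm n = 1" "\<tau> \<bullet> n = 0" and f: "integrable lborel f"
  shows "integrable lborel (\<lambda>s. \<integral>t. f (a + s *\<^sub>R \<tau> + t *\<^sub>R n) \<partial>lborel)"
    and "(\<integral>x. f x \<partial>lborel) = (\<integral>s. \<integral>t. f (a + s *\<^sub>R \<tau> + t *\<^sub>R n) \<partial>lborel \<partial>lborel)"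
proof -
  have [measurable]: "f \<in> borel_measurable borel" using f by auto
  have "integrable (distr lborel borel (\<lambda>p. a + fst p *\<^sub>R \<tau> + snd p *\<^sub>R n)) f"
    using f by (simp add: frame_distr[OF assms(1-3)])
  then have "integrable lborel (\<lambda>p. f (a + fst p *\<^sub>R \<tau> + snd p *\<^sub>R n))"
    by (subst (asm) integrable_distr_eq) auto
  then have i: "integrable (lborel \<Otimes>\<^sub>M lborel) (\<lambda>p. f (a + fst p *\<^sub>R \<tau> + snd p *\<^sub>R n))"
    by (simp add: lborel_prod)
  show "integrable lborel (\<lambda>s. \<integral>t. f (a + s *\<^sub>R \<tau> + t *\<^sub>R n) \<partial>lborel)"
    using lborel_pair.integrable_fst'[OF i] by simp
  have "(\<integral>x. f x \<partial>lborel) = (\<integral>p. f (a + fst p *\<^sub>R \<tau> + snd p *\<^sub>R n) \<partial>lborel)"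
    by (subst frame_distr[OF assms(1-3), of a, symmetric]) (simp add: integral_distr)
  also have "\<dots> = (\<integral>p. f (a + fst p *\<^sub>R \<tau> + snd p *\<^sub>R n) \<partial>(lborel \<Otimes>\<^sub>M lborel))"
    by (simp add: lborel_prod)
  also have "\<dots> = (\<integral>s. \<integral>t. f (a + s *\<^sub>R \<tau> + t *\<^sub>R n) \<partial>lborel \<partial>lborel)"
    using lborel_pair.integral_fst'[OF i] by simp
  finally show "(\<integral>x. f x \<partial>lborel) = (\<integral>s. \<integral>t. f (a + s *\<^sub>R \<tau> + t *\<^sub>R n) \<partial>lborel \<partial>lborel)" .
qed

lemma line_derivative:
  fixes n :: "real^2"
  assumes "smooth f"
  shows "((\<lambda>t. f (x + t *\<^sub>R n)) has_real_derivative grad f (x + t *\<^sub>R n) \<bullet> n) (at t)"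
proof -
  have "((\<lambda>t. x + t *\<^sub>R n) has_derivative (\<lambda>h. h *\<^sub>R n)) (at t)"
    by (auto intro!: derivative_eq_intros)
  from has_derivative_compose[OF this grad_has_derivative[OF smooth_differentiable[OF assms]]]
  have "((\<lambda>t. f (x + t *\<^sub>R n)) has_derivative (\<lambda>h. h * (grad f (x + t *\<^sub>R n) \<bullet> n))) (at t)" by simp
  then show ?thesis by (simp add: has_field_derivative_def mult.commute[of _ "grad f _ \<bullet> n"])
qed

lemma grad_line_continuous: "smooth f \<Longrightarrow> continuous_on S (\<lambda>t. grad f (x + t *\<^sub>R n) \<bullet> n)"
  by (intro continuous_on_inner continuous_on_const continuous_on_compose2[OF grad_continuous[of f UNIV]] continuous_intros) auto

lemma smooth_line_continuous: "smooth f \<Longrightarrow> continuous_on S (\<lambda>t. f (x + t *\<^sub>R n))"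
  by (rule continuous_on_compose2[OF smooth_continuous[of f UNIV]]) (auto intro!: continuous_intros)

lemma test_function_radius:
  assumes "\<theta> \<in> test_functions \<Omega>"
  obtains R where "0 < R" "\<And>x. R \<le> norm x \<Longrightarrow> \<theta> x = 0"
proof -
  obtain R where R: "\<And>x. x \<in> closure {x. \<theta> x \<noteq> 0} \<Longrightarrow> norm x \<le> R"
    using compact_imp_bounded[OF test_functionsD(2)[OF assms]] by (auto simp: bounded_iff)
  have "\<theta> x = 0" if "\<bar>R\<bar> + 1 \<le> norm x" for x
  proof (rule ccontr)
    assume "\<theta> x \<noteq> 0"
    then have "norm x \<le> R" using R closure_subset[of "{x. \<theta> x \<noteq> 0}"] by blast
    with that show False by linarith
  qed
  then show ?thesis using that[of "\<bar>R\<bar> + 1"] by simp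
qed

lemma frame_norm_ge:
  fixes \<tau> n :: "real^2"
  assumes "norm \<tau> = 1" "norm n = 1" "\<tau> \<bullet> n = 0"
  shows "\<bar>t\<bar> \<le> norm (s *\<^sub>R \<tau> + t *\<^sub>R n)" "\<bar>s\<bar> \<le> norm (s *\<^sub>R \<tau> + t *\<^sub>R n)"
proof -
  have nn: "\<tau> \<bullet> \<tau> = 1" "n \<bullet> n = 1" using assms by (auto simp: norm_eq_sqrt_inner)
  have "\<bar>(s *\<^sub>R \<tau> + t *\<^sub>R n) \<bullet> n\<bar> \<le> norm (s *\<^sub>R \<tau> + t *\<^sub>R n) * norm n"
    "\<bar>(s *\<^sub>R \<tau> + t *\<^sub>R n) \<bullet> \<tau>\<bar> \<le> norm (s *\<^sub>R \<tau> + t *\<^sub>R n) * norm \<tau>"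
    by (rule Cauchy_Schwarz_ineq2)+
  then show "\<bar>t\<bar> \<le> norm (s *\<^sub>R \<tau> + t *\<^sub>R n)" "\<bar>s\<bar> \<le> norm (s *\<^sub>R \<tau> + t *\<^sub>R n)"
    using assms nn by (simp_all add: inner_add_left inner_commute[of n \<tau>])
qed

lemma test_function_integrable:
  assumes "\<theta> \<in> test_functions \<Omega>"
  shows "integrable lborel \<theta>"
proof -
  have "integrable lborel (\<lambda>x. indicator (closure {x. \<theta> x \<noteq> 0}) x *\<^sub>R \<theta> x)"
    using assms by (intro borel_integrable_compact test_functionsD smooth_continuous)
  moreover have "(\<lambda>x. indicator (closure {x. \<theta> x \<noteq> 0}) x *\<^sub>R \<theta> x) = \<theta>"
    using closure_subset[of "{x. \<theta> x \<noteq> 0}"] by (force simp: indicator_def)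
  ultimately show ?thesis by simp
qed

text \<open>The fundamental theorem of calculus on each line in direction \<open>i\<close>, at whose
  ends the function vanishes. Integration by parts in the domain rests on it.\<close>

lemma integral_grad_test_function:
  assumes \<theta>: "\<theta> \<in> test_functions \<Omega>"
  shows "(\<integral>x. grad \<theta> x $ i \<partial>lborel) = 0"
proof -
  obtain j :: 2 where j: "j \<noteq> i" using exhaust_2 by (metis zero_neq_one)
  let ?\<tau> = "axis j 1 :: real^2" and ?n = "axis i 1 :: real^2"
  have fr: "norm ?\<tau> = 1" "norm ?n = 1" "?\<tau> \<bullet> ?n = 0" using j by (auto simp: norm_axis_1 inner_axis_axis)
  obtain R where R: "0 < R" "\<And>x. R \<le> norm x \<Longrightarrow> \<theta> x = 0" using test_function_radius[OF \<theta>] by blast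
  have sm: "smooth \<theta>" using test_functionsD(1)[OF \<theta>] .
  have g0: "grad \<theta> x $ i = 0" if "R < norm x" for x
  proof -
    have "eventually (\<lambda>y. R < norm y) (nhds x)"
      using that by (intro eventually_nhds_in_open[of "{y. R < norm y}", simplified] open_Collect_less continuous_intros)
    then have "eventually (\<lambda>y. \<theta> y = 0) (nhds x)" by eventually_elim (use R in auto)
    then have "grad \<theta> x = grad (\<lambda>x. 0) x" by (rule grad_cong_ev)
    then show ?thesis by simp
  qed
  have "(\<integral>t. grad \<theta> (0 + s *\<^sub>R ?\<tau> + t *\<^sub>R ?n) $ i \<partial>lborel) = 0" for s
  proof -
    have "(\<integral>t. grad \<theta> (0 + s *\<^sub>R ?\<tau> + t *\<^sub>R ?n) $ i \<partial>lborel)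
        = (\<integral>t. (grad \<theta> (s *\<^sub>R ?\<tau> + t *\<^sub>R ?n) \<bullet> ?n) * indicator {-R..R} t \<partial>lborel)"
    proof (rule Bochner_Integration.integral_cong[OF refl])
      fix t
      show "grad \<theta> (0 + s *\<^sub>R ?\<tau> + t *\<^sub>R ?n) $ i = (grad \<theta> (s *\<^sub>R ?\<tau> + t *\<^sub>R ?n) \<bullet> ?n) * indicator {-R..R} t"
      proof (cases "\<bar>t\<bar> \<le> R")
        case False
        then have "R < norm (s *\<^sub>R ?\<tau> + t *\<^sub>R ?n)" using frame_norm_ge(1)[OF fr, of t s] by linarith
        then show ?thesis using False by (auto simp: g0 indicator_def)
      qed (auto simp: inner_axis indicator_def)
    qed
    also have "\<dots> = \<theta> (s *\<^sub>R ?\<tau> + R *\<^sub>R ?n) - \<theta> (s *\<^sub>R ?\<tau> + (-R) *\<^sub>R ?n)"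
    proof (rule integral_FTC_Icc_real)
      show "isCont (\<lambda>t. grad \<theta> (s *\<^sub>R ?\<tau> + t *\<^sub>R ?n) \<bullet> ?n) t" for t
        using grad_line_continuous[OF sm, of UNIV] by (simp add: continuous_on_eq_continuous_at)
    qed (use R line_derivative[OF sm] in \<open>auto\<close>)
    also have "\<dots> = 0"
      using R(1) frame_norm_ge(1)[OF fr, of R s] frame_norm_ge(1)[OF fr, of "-R" s] by (simp add: R(2))
    finally show ?thesis .
  qed
  then show ?thesis
    using frame_integral(2)[OF fr test_function_integrable[OF test_functions_grad[OF \<theta>, of i]], of 0] by simp
qed

text \<open>Stated with the nonnegative integral so that integrability of the derivative on the
  whole line does not have to be known.\<close>

lemma abs_le_nn_integral_deriv:
  fixes g g' :: "real \<Rightarrow> real"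
  assumes "\<And>t. (g has_real_derivative g' t) (at t)" "continuous_on UNIV g'" "g (-R) = 0" "- R \<le> t"
  shows "ennreal \<bar>g t\<bar> \<le> (\<integral>\<^sup>+s. ennreal \<bar>g' s\<bar> \<partial>lborel)"
proof -
  have c: "isCont g' s" for s using assms(2) by (simp add: continuous_on_eq_continuous_at)
  have b: "has_bochner_integral lborel (\<lambda>s. g' s * indicator {-R..t} s) (g t - g (-R))"
    by (rule has_bochner_integral_FTC_Icc_real) (use assms c in auto)
  then have "ennreal \<bar>g t\<bar> = ennreal \<bar>\<integral>s. g' s * indicator {-R..t} s \<partial>lborel\<bar>"
    using assms(3) by (simp add: has_bochner_integral_iff)
  also have "\<dots> \<le> ennreal (\<integral>s. \<bar>g' s * indicator {-R..t} s\<bar> \<partial>lborel)"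
    by (intro ennreal_leI integral_abs_bound)
  also have "\<dots> = (\<integral>\<^sup>+s. ennreal \<bar>g' s * indicator {-R..t} s\<bar> \<partial>lborel)"
    using b by (intro nn_integral_eq_integral[symmetric]) (auto simp: has_bochner_integral_iff)
  also have "\<dots> \<le> (\<integral>\<^sup>+s. ennreal \<bar>g' s\<bar> \<partial>lborel)"
    by (intro nn_integral_mono ennreal_leI) (auto simp: indicator_def)
  finally show ?thesis .
qed

text \<open>Ladyzhenskaya's argument: the square of a test function is bounded by its integrals along both
  coordinate lines.\<close>

lemma Ladyzhenskaya:
  assumes \<theta>: "\<theta> \<in> test_functions \<Omega>"
  shows "(\<integral>\<^sup>+x. ennreal ((\<theta> x)^4) \<partial>lborel)
    \<le> (\<integral>\<^sup>+x. ennreal \<bar>2 * \<theta> x * grad \<theta> x $ 1\<bar> \<partial>lborel) * (\<integral>\<^sup>+x. ennreal \<bar>2 * \<theta> x * grad \<theta> x $ 2\<bar> \<partial>lborel)"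
proof -
  let ?e = "\<lambda>i::2. axis i 1 :: real^2"
  have fr: "norm (?e 1) = 1" "norm (?e 2) = 1" "?e 1 \<bullet> ?e 2 = 0"
    and fr': "?e 2 \<bullet> ?e 1 = 0" by (auto simp: norm_axis_1 inner_axis_axis)
  obtain R where R: "0 < R" "\<And>x. R \<le> norm x \<Longrightarrow> \<theta> x = 0" using test_function_radius[OF \<theta>] by blast
  have sm: "smooth \<theta>" using test_functionsD(1)[OF \<theta>] .
  have sm2: "smooth (\<lambda>x. (\<theta> x)\<^sup>2)" by (rule smooth_power[OF sm])
  have g2: "grad (\<lambda>x. (\<theta> x)\<^sup>2) x = (2 * \<theta> x) *\<^sub>R grad \<theta> x" for x
    using grad_mult[OF smooth_differentiable[OF sm] smooth_differentiable[OF sm], of x]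
    by (simp add: power2_eq_square flip: scaleR_left_distrib)
  define h where "h i x = ennreal \<bar>2 * \<theta> x * grad \<theta> x $ i\<bar>" for i x
  have hm[measurable]: "h i \<in> borel_measurable borel" for i
    unfolding h_def using smooth_borel[OF sm] smooth_borel[OF smooth_grad[OF sm]] by measurable
  have bd: "ennreal ((\<theta> (x + t *\<^sub>R ?e i))\<^sup>2) \<le> (\<integral>\<^sup>+t. h i (x + t *\<^sub>R ?e i) \<partial>lborel)" for x t i
  proof -
    \<comment> \<open>The line is entered at \<open>- ?S\<close>: far enough out for the function to
      vanish, and not later than \<open>t\<close>.\<close>
    let ?S = "\<bar>R\<bar> + norm x + \<bar>t\<bar>"
    have "R \<le> norm (x + (- ?S) *\<^sub>R ?e i)"
    proof -
      have "norm ((- ?S) *\<^sub>R ?e i) - norm x \<le> norm (x + (- ?S) *\<^sub>R ?e i)"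
        using norm_diff_ineq[of "(- ?S) *\<^sub>R ?e i" x] by (simp only: add.commute)
      moreover have "norm ((- ?S) *\<^sub>R ?e i) = ?S"         by (simp only: norm_scaleR norm_axis_1 abs_minus_cancel mult_1_right
            abs_of_nonneg[OF add_nonneg_nonneg[OF add_nonneg_nonneg[OF abs_ge_zero norm_ge_zero] abs_ge_zero]])
      ultimately show ?thesis using R by linarith
    qed
    then have z: "\<theta> (x + (- ?S) *\<^sub>R ?e i) = 0" by (rule R(2))
    have "ennreal \<bar>(\<theta> (x + t *\<^sub>R ?e i))\<^sup>2\<bar> \<le> (\<integral>\<^sup>+s. ennreal \<bar>grad (\<lambda>x. (\<theta> x)\<^sup>2) (x + s *\<^sub>R ?e i) \<bullet> ?e i\<bar> \<partial>lborel)"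
      by (rule abs_le_nn_integral_deriv[OF line_derivative[OF sm2] grad_line_continuous[OF sm2], where R = ?S])
        (use z in simp, use norm_ge_zero[of x] in linarith)
    then show ?thesis by (simp add: h_def g2 inner_axis)
  qed
  \<comment> \<open>Of the two factors of the fourth power one is bounded by an integral that
    depends on \<open>s\<close> alone, the other by one that depends on \<open>t\<close> alone;
    hence the double integral factors.\<close>
  define A where "A s = (\<integral>\<^sup>+t. h 2 (0 + s *\<^sub>R ?e 1 + t *\<^sub>R ?e 2) \<partial>lborel)" for s
  define B where "B t = (\<integral>\<^sup>+s. h 1 (0 + t *\<^sub>R ?e 2 + s *\<^sub>R ?e 1) \<partial>lborel)" for t
  have Am[measurable]: "A \<in> borel_measurable borel"
  proof -
    have "(\<lambda>p. h 2 (0 + fst p *\<^sub>R ?e 1 + snd p *\<^sub>R ?e 2)) \<in> borel_measurable (borel \<Otimes>\<^sub>M lborel)"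
      by (simp add: borel_prod cong: measurable_cong_sets) 
    from lborel.borel_measurable_nn_integral_fst[OF this] show ?thesis by (simp add: A_def[abs_def])
  qed
  have Bm[measurable]: "B \<in> borel_measurable borel"
  proof -
    have "(\<lambda>p. h 1 (0 + fst p *\<^sub>R ?e 2 + snd p *\<^sub>R ?e 1)) \<in> borel_measurable (borel \<Otimes>\<^sub>M lborel)"
      by (simp add: borel_prod cong: measurable_cong_sets)
    from lborel.borel_measurable_nn_integral_fst[OF this] show ?thesis by (simp add: B_def[abs_def])
  qed
  have "(\<integral>\<^sup>+x. ennreal ((\<theta> x)^4) \<partial>lborel)
      = (\<integral>\<^sup>+s. \<integral>\<^sup>+t. ennreal ((\<theta> (0 + s *\<^sub>R ?e 1 + t *\<^sub>R ?e 2))^4) \<partial>lborel \<partial>lborel)"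
    by (rule frame_nn_integral[OF fr]) (use smooth_borel[OF sm] in measurable)
  also have "\<dots> \<le> (\<integral>\<^sup>+s. \<integral>\<^sup>+t. A s * B t \<partial>lborel \<partial>lborel)"
  proof (intro nn_integral_mono)
    fix s t
    let ?x = "s *\<^sub>R ?e 1 + t *\<^sub>R ?e 2"
    have "ennreal ((\<theta> ?x)^4) = ennreal ((\<theta> ?x)\<^sup>2) * ennreal ((\<theta> ?x)\<^sup>2)"
      by (simp flip: ennreal_mult add: power_add[symmetric])
    also have "\<dots> \<le> A s * B t"
      using bd[of "s *\<^sub>R ?e 1" t 2] bd[of "t *\<^sub>R ?e 2" s 1]
      by (intro mult_mono) (auto simp: A_def B_def add.commute)
    finally show "ennreal ((\<theta> (0 + s *\<^sub>R ?e 1 + t *\<^sub>R ?e 2))^4) \<le> A s * B t" by (simp only: add_0_left)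
  qed
  also have "\<dots> = (\<integral>\<^sup>+s. A s \<partial>lborel) * (\<integral>\<^sup>+t. B t \<partial>lborel)"
    by (simp add: nn_integral_cmult nn_integral_multc)
  also have "(\<integral>\<^sup>+s. A s \<partial>lborel) = (\<integral>\<^sup>+x. h 2 x \<partial>lborel)"
    unfolding A_def by (rule frame_nn_integral[OF fr, symmetric]) simp
  also have "(\<integral>\<^sup>+t. B t \<partial>lborel) = (\<integral>\<^sup>+x. h 1 x \<partial>lborel)"
    unfolding B_def by (rule frame_nn_integral[OF fr(2,1) fr', symmetric]) simp
  finally show ?thesis by (simp add: h_def mult.commute)
qed

text \<open>Integration of \<open>((H - t) f)' = (H - t) f' - f\<close> along a ray.\<close>

lemma ray_integral_ge:
  fixes x n :: "real^2"
  assumes sm: "smooth f" and pos: "\<And>x. 0 \<le> f x" and J: "J \<subseteq> {0<..H}"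
    and down: "\<And>t t'. t \<in> J \<Longrightarrow> 0 < t' \<Longrightarrow> t' \<le> t \<Longrightarrow> t' \<in> J" and H: "0 \<le> H"
  shows "- H * f x \<le> (\<integral>t. indicator J t * ((H - t) * (grad f (x + t *\<^sub>R n) \<bullet> n) - f (x + t *\<^sub>R n)) \<partial>lborel)"
proof (cases "J = {}")
  case True
  then show ?thesis using pos[of x] H by simp
next
  case False
  define T where "T = Sup J"
  have bdd: "bdd_above J" by (rule bdd_aboveI[of _ H]) (use J in auto)
  have T: "0 < T" "T \<le> H"
  proof -
    obtain t where "t \<in> J" using False by auto
    then show "0 < T" using J cSup_upper[OF _ bdd, of t] unfolding T_def by force
    show "T \<le> H" unfolding T_def by (rule cSup_least[OF False]) (use J in auto)
  qed
  \<comment> \<open>\<open>J\<close> is an interval starting at 0, so only its end points stay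
    undecided. This also yields the measurability of \<open>J\<close>.\<close>
  have JT: "t \<in> J \<longleftrightarrow> t \<in> {0..T}" if "t \<noteq> 0" "t \<noteq> T" for t
  proof
    assume "t \<in> J" then show "t \<in> {0..T}" using J cSup_upper[OF _ bdd, of t] unfolding T_def by force
  next
    assume t: "t \<in> {0..T}"
    then have "t < Sup J" using that T_def by auto
    then obtain t' where "t' \<in> J" "t < t'" using less_cSup_iff[OF False bdd] by blast
    then show "t \<in> J" using down[of t' t] t that by auto
  qed
  let ?g = "\<lambda>t. (H - t) * (grad f (x + t *\<^sub>R n) \<bullet> n) - f (x + t *\<^sub>R n)"
  have cont: "continuous_on UNIV ?g"
    by (intro continuous_intros grad_line_continuous smooth_line_continuous sm)
  have "(\<integral>t. indicator J t * ?g t \<partial>lborel) = (\<integral>t. ?g t * indicator {0..T} t \<partial>lborel)"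
  proof (rule integral_cong_AE)
    have "J = ({0<..<T} \<union> (J \<inter> {T}))"
    proof (rule set_eqI)
      fix t show "t \<in> J \<longleftrightarrow> t \<in> {0<..<T} \<union> (J \<inter> {T})"
        using JT[of t] J T by (cases "t = 0"; cases "t = T") auto
    qed
    moreover have "{0<..<T} \<union> (J \<inter> {T}) \<in> sets borel"
      by (cases "T \<in> J") auto
    ultimately have [measurable]: "J \<in> sets borel" by simp
    have gm[measurable]: "?g \<in> borel_measurable borel" by (rule borel_measurable_continuous_onI[OF cont])
    have "(\<lambda>t. indicator J t * ?g t) \<in> borel_measurable borel"
      by (rule borel_measurable_times[OF _ gm]) measurable
    then show "(\<lambda>t. indicator J t * ?g t) \<in> borel_measurable lborel" by simp
    have "(\<lambda>t. ?g t * indicator {0..T} t) \<in> borel_measurable borel"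
      by (rule borel_measurable_times[OF gm]) measurable
    then show "(\<lambda>t. ?g t * indicator {0..T} t) \<in> borel_measurable lborel" by simp
    have "AE t in lborel. t \<noteq> 0 \<and> t \<noteq> T"
      using AE_lborel_singleton[of 0] AE_lborel_singleton[of T] by eventually_elim auto
    then show "AE t in lborel. indicator J t * ?g t = ?g t * indicator {0..T} t"
      by eventually_elim (use JT in \<open>auto simp: indicator_def\<close>)
  qed
  also have "\<dots> = (H - T) * f (x + T *\<^sub>R n) - (H - 0) * f (x + 0 *\<^sub>R n)"
  proof (rule integral_FTC_Icc_real)
    show "((\<lambda>t. (H - t) * f (x + t *\<^sub>R n)) has_real_derivative ?g t) (at t)" for t
      by (auto intro!: derivative_eq_intros line_derivative[OF sm])
    show "isCont ?g t" for t using cont by (simp add: continuous_on_eq_continuous_at)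
  qed (use T in auto)
  finally show ?thesis using T pos[of "x + T *\<^sub>R n"] by simp
qed

section \<open>Functions determined by their integrals\<close>

lemma integral_zero_Int_stable:
  fixes g :: "real^2 \<Rightarrow> real"
  assumes M: "sets M = sets borel" and g: "integrable M g"
    and G: "Int_stable G" "sets borel = sigma_sets UNIV G"
    and zero: "\<And>A. A \<in> G \<Longrightarrow> (LINT x:A|M. g x) = 0" "(\<integral>x. g x \<partial>M) = 0"
    and A: "A \<in> sets borel"
  shows "(LINT x:A|M. g x) = 0"
proof -
  have int: "set_integrable M B g" if "B \<in> sets borel" for B
    unfolding set_integrable_def by (rule integrable_mult_indicator) (use that M g in auto)
  have GP: "G \<subseteq> Pow UNIV" by auto
  have sA: "A \<in> sigma_sets UNIV G" using A G(2) by simp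
  show ?thesis
    using G(1) GP sA
  proof (induction rule: sigma_sets_induct_disjoint)
    case (basic A) then show ?case by (rule zero)
  next
    case empty then show ?case by (simp add: set_lebesgue_integral_def)
  next
    case (compl A)
    then have [measurable]: "A \<in> sets borel" using G(2) by simp
    have "(LINT x:UNIV - A|M. g x) = (\<integral>x. g x - indicator A x * g x \<partial>M)"
      unfolding set_lebesgue_integral_def
      by (intro Bochner_Integration.integral_cong refl) (auto simp: indicator_def)
    also have "\<dots> = (\<integral>x. g x \<partial>M) - (LINT x:A|M. g x)"
      using int[of A] g by (simp add: set_lebesgue_integral_def set_integrable_def)
    finally show ?case using compl zero by simp
  next
    case (union A)
    then have m: "A i \<in> sets M" for i using G(2) M by auto
    have "(LINT x:(\<Union>i. A i)|M. g x) = (\<Sum>i. LINT x:A i|M. g x)"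
    proof (rule lebesgue_integral_countable_add[OF m])
      show "A i \<inter> A j = {}" if "i \<noteq> j" for i j
        using union(1) that by (auto simp: disjoint_family_on_def)
      show "set_integrable M (\<Union>i. A i) g" by (rule int) (use m M in auto)
    qed
    then show ?case using union by simp
  qed
qed

text \<open>Dynkin's argument extends vanishing integrals from an intersection-stable generator to
  all Borel sets, and then the two sets on which \<open>g\<close> has constant sign suffice. The
  generator is formed by boxes in the domain and by closed sets on the boundary.\<close>

lemma AE_zero_Int_stable:
  fixes g :: "real^2 \<Rightarrow> real"
  assumes M: "sets M = sets borel" and g: "integrable M g"
    and G: "Int_stable G" "sets borel = sigma_sets UNIV G"
    and zero: "\<And>A. A \<in> G \<Longrightarrow> (LINT x:A|M. g x) = 0" "(\<integral>x. g x \<partial>M) = 0"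
  shows "AE x in M. g x = 0"
proof -
  have gm: "g \<in> borel_measurable borel" using g M by (auto cong: measurable_cong_sets)
  have "AE x in M. indicator A x * g x = 0"
    if A: "A \<in> sets borel" and s: "(\<forall>x\<in>A. 0 \<le> g x) \<or> (\<forall>x\<in>A. g x \<le> 0)" for A
  proof -
    have int: "integrable M (\<lambda>x. indicator A x * g x)"
      using integrable_mult_indicator[of A M g] A M g by simp
    have z: "(\<integral>x. indicator A x * g x \<partial>M) = 0"
      using integral_zero_Int_stable[OF assms A] by (simp add: set_lebesgue_integral_def)
    from s show ?thesis
    proof
      assume "\<forall>x\<in>A. 0 \<le> g x"
      then have "AE x in M. 0 \<le> indicator A x * g x" by (auto simp: indicator_def)
      from integral_nonneg_eq_0_iff_AE[OF int this] z show ?thesis by simp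
    next
      assume "\<forall>x\<in>A. g x \<le> 0"
      then have "AE x in M. 0 \<le> - (indicator A x * g x)" by (auto simp: indicator_def)
      from integral_nonneg_eq_0_iff_AE[OF integrable_minus[OF int] this] z show ?thesis by simp
    qed
  qed
  from this[of "{x. 0 \<le> g x}"] this[of "{x. g x \<le> 0}"]
  have "AE x in M. indicator {x. 0 \<le> g x} x * g x = 0" "AE x in M. indicator {x. g x \<le> 0} x * g x = 0"
    using gm by auto
  then show ?thesis by eventually_elim (auto simp: indicator_def split: if_splits)
qed

section \<open>Weak derivatives on a bounded domain\<close>

locale bounded_domain =
  fixes \<Omega> :: "(real^2) set"
  assumes open_domain: "open \<Omega>" and bounded_domain: "bounded \<Omega>"
begin

abbreviation "L \<equiv> lebesgue_on \<Omega>"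

lemma domain_sets: "\<Omega> \<in> sets lebesgue"
  using open_domain by auto

lemma finite_L: "finite_measure L"
  using lmeasurable_open[OF bounded_domain open_domain] by (rule finite_measure_lebesgue_on)

lemma borel_imp_L: "f \<in> borel_measurable borel \<Longrightarrow> f \<in> borel_measurable L"
  by (intro measurable_restrict_space1 measurable_completion) simp

lemma AE_L_iff: "(AE x in L. P x) \<longleftrightarrow> (AE x in lebesgue. x \<in> \<Omega> \<longrightarrow> P x)"
  using domain_sets by (subst AE_restrict_space_iff) auto

lemma integral_L_eq: "(\<integral>x. f x \<partial>L) = (\<integral>x. indicator \<Omega> x * f x \<partial>lebesgue)" for f :: "_ \<Rightarrow> real"
  using domain_sets by (subst integral_restrict_space) auto

lemma integral_L_lborel:
  fixes f :: "_ \<Rightarrow> real"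
  assumes "f \<in> borel_measurable borel"
  shows "(\<integral>x. f x \<partial>L) = (\<integral>x. indicator \<Omega> x * f x \<partial>lborel)"
  unfolding integral_L_eq using assms open_domain by (intro integral_completion) auto

lemma integral_L_support:
  fixes f :: "_ \<Rightarrow> real"
  assumes "f \<in> borel_measurable borel" "\<And>x. x \<notin> \<Omega> \<Longrightarrow> f x = 0"
  shows "(\<integral>x. f x \<partial>L) = (\<integral>x. f x \<partial>lborel)"
  unfolding integral_L_lborel[OF assms(1)]
  by (intro Bochner_Integration.integral_cong) (use assms in \<open>auto simp: indicator_def\<close>)

lemma continuous_bounded:
  fixes f :: "_ \<Rightarrow> 'b::real_normed_vector"
  assumes "continuous_on UNIV f"
  obtains C where "0 \<le> C" "\<And>x. x \<in> \<Omega> \<Longrightarrow> norm (f x) \<le> C"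
proof -
  have "compact (f ` closure \<Omega>)"
    using bounded_domain assms by (intro compact_continuous_image continuous_on_subset[OF assms]) auto
  then obtain C where "0 < C" "\<And>y. y \<in> f ` closure \<Omega> \<Longrightarrow> norm y \<le> C"
    using compact_imp_bounded bounded_pos by metis
  then show ?thesis using that[of C] closure_subset by (metis imageI less_imp_le subsetD)
qed

lemma AE_L_I: "(\<And>x. x \<in> \<Omega> \<Longrightarrow> P x) \<Longrightarrow> AE x in L. P x"
  by (rule AE_I2) (auto simp: space_restrict_space)

lemma continuous_l2:
  assumes "continuous_on UNIV f"
  shows "f \<in> l2 L"
proof -
  obtain C where "\<And>x. x \<in> \<Omega> \<Longrightarrow> norm (f x) \<le> C" using continuous_bounded[OF assms] by blast
  then show ?thesis
    using assms by (intro l2_bounded[OF finite_L, of _ C] AE_L_I borel_imp_L borel_measurable_continuous_onI) auto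
qed

lemma smooth_l2: "smooth f \<Longrightarrow> f \<in> l2 L"
  by (intro continuous_l2 smooth_continuous)

lemma smooth_grad_l2: "smooth f \<Longrightarrow> (\<lambda>x. grad f x $ i) \<in> l2 L"
  by (intro smooth_l2 smooth_grad)

lemma test_l2: "\<theta> \<in> test_functions \<Omega> \<Longrightarrow> \<theta> \<in> l2 L"
  by (intro smooth_l2 test_functionsD)

lemma integral_L_grad_test:
  assumes "\<theta> \<in> test_functions \<Omega>"
  shows "(\<integral>x. grad \<theta> x $ i \<partial>L) = 0"
proof -
  note t = test_functions_grad[OF assms, of i]
  have "(\<integral>x. grad \<theta> x $ i \<partial>L) = (\<integral>x. grad \<theta> x $ i \<partial>lborel)"
    by (rule integral_L_support) (use test_functionsD[OF t] in \<open>auto intro: smooth_borel\<close>)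
  then show ?thesis using integral_grad_test_function[OF assms] by simp
qed

lemma integration_by_parts:
  assumes f: "smooth f" and \<theta>: "\<theta> \<in> test_functions \<Omega>"
  shows "l2_inner L f (\<lambda>x. grad \<theta> x $ i) = - l2_inner L (\<lambda>x. grad f x $ i) \<theta>"
proof -
  have s: "smooth \<theta>" using test_functionsD[OF \<theta>] by blast
  have "grad (\<lambda>x. f x * \<theta> x) x $ i = f x * grad \<theta> x $ i + grad f x $ i * \<theta> x" for x
    using grad_mult[OF smooth_differentiable[OF f] smooth_differentiable[OF s]] by simp
  then have "0 = (\<integral>x. f x * grad \<theta> x $ i + grad f x $ i * \<theta> x \<partial>L)"
    using integral_L_grad_test[OF test_functions_mult_smooth[OF \<theta> f], of i] by simp
  also have "\<dots> = l2_inner L f (\<lambda>x. grad \<theta> x $ i) + l2_inner L (\<lambda>x. grad f x $ i) \<theta>"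
    unfolding l2_inner_def using f s
    by (intro Bochner_Integration.integral_add l2_mult_integrable smooth_l2 smooth_grad)
  finally show ?thesis by simp
qed

lemma is_weak_grad_smooth: "smooth f \<Longrightarrow> is_weak_grad \<Omega> f (grad f)"
  unfolding is_weak_grad_def using smooth_l2 smooth_grad_l2 integration_by_parts by blast

text \<open>\<open>flat (n * c)\<close> tends to 1 for positive \<open>c\<close> and is 0 otherwise.
  So these products approximate the indicator of the open box boundedly, which replaces
  mollification.\<close>

lemma box_test_functions:
  fixes a b :: "real^2"
  assumes "cbox a b \<subseteq> \<Omega>"
  defines "\<theta> \<equiv> \<lambda>n::nat. \<lambda>x. \<Prod>i\<in>UNIV. flat (real n * (x $ i - a $ i)) * flat (real n * (b $ i - x $ i))"
  shows "\<theta> n \<in> test_functions \<Omega>" "\<bar>\<theta> n x\<bar> \<le> 1" "(\<lambda>n. \<theta> n x) \<longlonglongrightarrow> indicator (box a b) x"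
proof -
  have z: "\<theta> n x = 0" if x: "x \<notin> box a b" for n x
  proof -
    have "\<exists>i. \<not> (a $ i < x $ i \<and> x $ i < b $ i)" using x by (simp add: mem_box_cart)
    then obtain i where "x $ i \<le> a $ i \<or> b $ i \<le> x $ i" by (auto simp: not_less)
    then have "flat (real n * (x $ i - a $ i)) * flat (real n * (b $ i - x $ i)) = 0"
      by (auto simp: mult_nonneg_nonpos)
    then show ?thesis unfolding \<theta>_def using UNIV_I[of i] by (auto simp: prod_zero_iff simp del: mult_eq_0_iff)
  qed
  show "\<theta> n \<in> test_functions \<Omega>"
  proof (rule test_functionsI)
    show "smooth (\<theta> n)" unfolding \<theta>_def
      by (intro smooth_prod smooth_mult smooth_flat smooth_diff smooth_const smooth_component)
    show "\<theta> n x = 0" if "x \<notin> cbox a b" for x using z box_subset_cbox that by blast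
  qed (use assms in auto)
  have "0 \<le> \<theta> n x" unfolding \<theta>_def by (intro prod_nonneg) auto
  moreover have "\<theta> n x \<le> 1" unfolding \<theta>_def by (intro prod_le_1) (auto intro: mult_le_one)
  ultimately show "\<bar>\<theta> n x\<bar> \<le> 1" by simp
  show "(\<lambda>n. \<theta> n x) \<longlonglongrightarrow> indicator (box a b) x"
  proof (cases "x \<in> box a b")
    case False
    then show ?thesis using z by simp
  next
    case True
    have fl: "(\<lambda>n. flat (real n * c)) \<longlonglongrightarrow> 1" if "0 < c" for c
    proof -
      have "(\<lambda>n. exp (- inverse (real n * c))) \<longlonglongrightarrow> exp (- 0)"
        using that by (intro tendsto_intros tendsto_inverse_0_at_top filterlim_at_top_mult_tendsto_pos[of _ c] 
          filterlim_real_sequentially filterlim_tendsto_pos_mult_at_top[of "\<lambda>_. c", simplified mult.commute]) auto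
      then have "(\<lambda>n. exp (- inverse (real n * c))) \<longlonglongrightarrow> 1" by simp
      then show ?thesis
        by (rule Lim_transform_eventually) (use that in \<open>auto simp: flat_def eventually_sequentially intro!: exI[of _ 1]\<close>)
    qed
    have "(\<lambda>n. \<theta> n x) \<longlonglongrightarrow> (\<Prod>i\<in>(UNIV::2 set). 1 * 1)"
      unfolding \<theta>_def using True by (intro tendsto_intros fl) (auto simp: mem_box_cart)
    then show ?thesis using True by simp
  qed
qed

text \<open>The fundamental lemma of the calculus of variations. Test functions reach the indicators
  of boxes inside the domain, and boxes generate the Borel sets. Almost everywhere uniqueness of
  weak gradients and weak Laplacians rests on it.\<close>

lemma test_functions_determine:
  assumes g: "g \<in> l2 L" and zero: "\<And>\<theta>. \<theta> \<in> test_functions \<Omega> \<Longrightarrow> l2_inner L g \<theta> = 0"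
  shows "AE x in L. g x = 0"
proof -
  have one: "(\<lambda>x. 1) \<in> l2 L" by (rule smooth_l2) simp
  have gi: "integrable L g" using l2_mult_integrable[OF one g] by simp
  then have gi': "integrable lebesgue (\<lambda>x. indicator \<Omega> x * g x)"
    using domain_sets by (simp add: integrable_restrict_space)
  \<comment> \<open>\<open>L\<close> carries the Lebesgue sets but the generator argument works with
    Borel sets; hence a Borel version of the extension of \<open>g\<close> by zero.\<close>
  obtain h where hm: "h \<in> borel_measurable lborel" and hg: "AE x in lborel. indicator \<Omega> x * g x = h x"
    using completion_ex_borel_measurable_real[OF borel_measurable_integrable[OF gi']] by auto
  have hg': "AE x in lebesgue. indicator \<Omega> x * g x = h x" using AE_completion[OF hg] .
  have hm'[measurable]: "h \<in> borel_measurable borel" using hm by simp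
  have hm'': "h \<in> borel_measurable lebesgue" using measurable_completion[OF hm] .
  have "integrable lebesgue h" by (rule integrable_cong_AE_imp[OF gi' hm'']) (use hg' in auto)
  then have hi: "integrable lborel h" using integrable_completion[OF hm] by simp
  have boxz: "(\<integral>x. indicator (box a b) x * h x \<partial>lborel) = 0" if ab: "cbox a b \<subseteq> \<Omega>" for a b :: "real^2"
  proof -
    note bt = box_test_functions[OF ab]
    let ?\<theta> = "\<lambda>n::nat. \<lambda>x::real^2. \<Prod>i\<in>UNIV. flat (real n * (x $ i - a $ i)) * flat (real n * (b $ i - x $ i))"
    have tm: "?\<theta> n \<in> borel_measurable borel" for n using test_functionsD(1)[OF bt(1)] by (rule smooth_borel)
    have "(\<integral>x. ?\<theta> n x * h x \<partial>lborel) = 0" for n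
    proof -
      have "(\<integral>x. ?\<theta> n x * h x \<partial>lborel) = (\<integral>x. ?\<theta> n x * h x \<partial>lebesgue)"
        using tm by (intro integral_completion[symmetric]) auto
      also have "\<dots> = (\<integral>x. indicator \<Omega> x * (g x * ?\<theta> n x) \<partial>lebesgue)"
      proof (rule integral_cong_AE)
        have t: "?\<theta> n \<in> borel_measurable lebesgue" using measurable_completion[of "?\<theta> n" lborel] tm by simp
        show "(\<lambda>x. ?\<theta> n x * h x) \<in> borel_measurable lebesgue" by (intro borel_measurable_times t hm'')
        show "(\<lambda>x. indicator \<Omega> x * (g x * ?\<theta> n x)) \<in> borel_measurable lebesgue"
          using borel_measurable_times[OF borel_measurable_integrable[OF gi'] t] by (simp add: mult.assoc)
        show "AE x in lebesgue. ?\<theta> n x * h x = indicator \<Omega> x * (g x * ?\<theta> n x)"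
          using hg' by eventually_elim (auto simp: mult_ac)
      qed
      also have "\<dots> = l2_inner L g (?\<theta> n)" by (simp add: integral_L_eq l2_inner_def)
      finally show ?thesis using zero[OF bt(1)] by simp
    qed
    moreover have "(\<lambda>n. \<integral>x. ?\<theta> n x * h x \<partial>lborel) \<longlonglongrightarrow> (\<integral>x. indicator (box a b) x * h x \<partial>lborel)"
    proof (rule integral_dominated_convergence)
      show "integrable lborel (\<lambda>x. \<bar>h x\<bar>)" using hi by simp
      show "AE x in lborel. (\<lambda>n. ?\<theta> n x * h x) \<longlonglongrightarrow> indicator (box a b) x * h x"
        by (intro AE_I2 tendsto_mult bt(3) tendsto_const)
      show "AE x in lborel. norm (?\<theta> n x * h x) \<le> \<bar>h x\<bar>" for n
      proof (rule AE_I2)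
        fix x show "norm (?\<theta> n x * h x) \<le> \<bar>h x\<bar>"
          using mult_right_mono[OF bt(2)[of n x], of "\<bar>h x\<bar>"] by (simp add: abs_mult)
      qed
    qed (use tm in auto)
    ultimately show ?thesis using LIMSEQ_unique[OF _ tendsto_const] by fastforce
  qed
  have loc: "AE x in lborel. x \<in> box a b \<longrightarrow> h x = 0" if ab: "cbox a b \<subseteq> \<Omega>" for a b :: "real^2"
  proof -
    let ?h = "\<lambda>x. indicator (box a b) x * h x"
    have "AE x in lborel. ?h x = 0"
    proof (rule AE_zero_Int_stable)
      show "integrable lborel ?h" using integrable_mult_indicator[OF _ hi, of "box a b"] by simp
      show "Int_stable (range (\<lambda>(a, b). box a b :: (real^2) set))"
        by (auto simp: Int_stable_def box_Int_box)
      show "sets borel = sigma_sets UNIV (range (\<lambda>(a, b). box a b :: (real^2) set))"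
        by (simp add: borel_eq_box)
      show "(\<integral>x. ?h x \<partial>lborel) = 0" by (rule boxz[OF ab])
      fix A assume "A \<in> range (\<lambda>(a, b). box a b :: (real^2) set)"
      then obtain c d where A: "A = box c d" by auto
      define c' where "c' = (\<chi> i. max (a$i) (c$i))"
      define d' where "d' = (\<chi> i. min (b$i) (d$i))"
      \<comment> \<open>The intersection of two boxes is a box, and this one stays inside the
        domain, so \<open>boxz\<close> applies once more.\<close>
      have eq: "A \<inter> box a b = box c' d'" unfolding A c'_def d'_def by (auto simp: mem_box_cart)
      have "cbox c' d' \<subseteq> cbox a b" by (auto simp: mem_box_cart c'_def d'_def)
      then have "cbox c' d' \<subseteq> \<Omega>" using ab by blast
      from boxz[OF this] have "(\<integral>x. indicator (A \<inter> box a b) x * h x \<partial>lborel) = 0" by (simp add: eq)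
      then show "(LINT x:A|lborel. ?h x) = 0"
        by (simp add: set_lebesgue_integral_def indicator_inter_arith mult.assoc)
    qed simp
    then show ?thesis by eventually_elim (auto simp: indicator_def)
  qed

  \<comment> \<open>By Lindelof's theorem countably many boxes cover the domain, so the exceptional
    sets of the boxes unite to a null set.\<close>
  obtain D' where D': "countable D'" "\<And>X. X \<in> D' \<Longrightarrow> \<exists>a b. X = box a b \<and> cbox a b \<subseteq> \<Omega>" "\<Union>D' = \<Omega>"
  proof -
    let ?B = "{box a b | a b. cbox a b \<subseteq> \<Omega>}"
    obtain D where D: "D \<subseteq> ?B" "countable D" "\<Union>D = \<Union>?B"
      by (rule Lindelof[of ?B]) auto
    have "x \<in> \<Union>?B" if xO: "x \<in> \<Omega>" for x
    proof -
      obtain a b where "cbox a b \<subseteq> \<Omega>" "x \<in> box a b" using open_contains_cbox[OF open_domain xO] by metis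
      then show ?thesis by blast
    qed
    then have "\<Union>?B = \<Omega>" using box_subset_cbox by blast
    then have U: "\<Union>D = \<Omega>" using D(3) by simp
    show ?thesis
    proof (rule that[of D])
      show "\<exists>a b. X = box a b \<and> cbox a b \<subseteq> \<Omega>" if X: "X \<in> D" for X
        using subsetD[OF D(1) X] by simp
    qed (fact D(2) U)+
  qed
  have "AE x in lborel. \<forall>X\<in>D'. x \<in> X \<longrightarrow> h x = 0"
    using D' loc by (subst AE_ball_countable) auto
  then have "AE x in lborel. x \<in> \<Omega> \<longrightarrow> h x = 0"
    by eventually_elim (use D'(3) in blast)
  then have "AE x in lebesgue. x \<in> \<Omega> \<longrightarrow> h x = 0" by (rule AE_completion)
  with hg' have "AE x in lebesgue. x \<in> \<Omega> \<longrightarrow> g x = 0" by eventually_elim auto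
  then show ?thesis by (simp add: AE_L_iff)
qed

section \<open>Square integrable vector fields and limits in the H1-norm\<close>

definition vl2 :: "(real^2 \<Rightarrow> real^2) \<Rightarrow> bool" where
  "vl2 g \<longleftrightarrow> (\<forall>i. (\<lambda>x. g x $ i) \<in> l2 L)"

definition vinner :: "(real^2 \<Rightarrow> real^2) \<Rightarrow> (real^2 \<Rightarrow> real^2) \<Rightarrow> real" where
  "vinner g h = (\<Sum>i\<in>UNIV. l2_inner L (\<lambda>x. g x $ i) (\<lambda>x. h x $ i))"

definition vnorm :: "(real^2 \<Rightarrow> real^2) \<Rightarrow> real" where
  "vnorm g = sqrt (vinner g g)"

lemma vl2D: "vl2 g \<Longrightarrow> (\<lambda>x. g x $ i) \<in> l2 L"
  by (simp add: vl2_def)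

lemma vl2_add: "vl2 g \<Longrightarrow> vl2 h \<Longrightarrow> vl2 (\<lambda>x. g x + h x)"
  by (simp add: vl2_def l2_add)

lemma vl2_diff: "vl2 g \<Longrightarrow> vl2 h \<Longrightarrow> vl2 (\<lambda>x. g x - h x)"
  by (simp add: vl2_def l2_diff)

lemma vl2_scale: "vl2 g \<Longrightarrow> vl2 (\<lambda>x. c *\<^sub>R g x)"
  by (simp add: vl2_def l2_scale)

lemma vl2_grad: "smooth f \<Longrightarrow> vl2 (grad f)"
  by (simp add: vl2_def smooth_grad_l2)

lemma vl2_is_weak_grad: "is_weak_grad \<Omega> f g \<Longrightarrow> vl2 g"
  by (simp add: is_weak_grad_def vl2_def)

lemma vinner_commute: "vinner g h = vinner h g"
  by (simp add: vinner_def l2_inner_commute)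

lemma vinner_add_left: "vl2 g \<Longrightarrow> vl2 h \<Longrightarrow> vl2 k \<Longrightarrow> vinner (\<lambda>x. g x + h x) k = vinner g k + vinner h k"
  by (simp add: vinner_def vl2_def l2_inner_add_left sum.distrib)

lemma vinner_diff_left: "vl2 g \<Longrightarrow> vl2 h \<Longrightarrow> vl2 k \<Longrightarrow> vinner (\<lambda>x. g x - h x) k = vinner g k - vinner h k"
  by (simp add: vinner_def vl2_def l2_inner_diff_left sum_subtractf)

lemma vinner_scale_left: "vinner (\<lambda>x. c *\<^sub>R g x) k = c * vinner g k"
  by (simp add: vinner_def l2_inner_scale_left sum_distrib_left)

lemma vinner_add_right: "vl2 g \<Longrightarrow> vl2 h \<Longrightarrow> vl2 k \<Longrightarrow> vinner k (\<lambda>x. g x + h x) = vinner k g + vinner k h"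
  using vinner_add_left[of g h k] by (simp add: vinner_commute)

lemma vinner_diff_right: "vl2 g \<Longrightarrow> vl2 h \<Longrightarrow> vl2 k \<Longrightarrow> vinner k (\<lambda>x. g x - h x) = vinner k g - vinner k h"
  using vinner_diff_left[of g h k] by (simp add: vinner_commute)

lemma vinner_scale_right: "vinner k (\<lambda>x. c *\<^sub>R g x) = c * vinner k g"
  using vinner_scale_left[of c g k] by (simp add: vinner_commute)

lemma vinner_self_nonneg: "0 \<le> vinner g g"
  by (simp add: vinner_def sum_nonneg l2_inner_self_nonneg)

lemma vnorm_nonneg [simp]: "0 \<le> vnorm g"
  by (simp add: vnorm_def vinner_self_nonneg)

lemma vnorm_power2: "(vnorm g)\<^sup>2 = vinner g g"
  by (simp add: vnorm_def vinner_self_nonneg)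

lemma vinner_Cauchy_Schwarz:
  assumes "vl2 g" "vl2 h"
  shows "\<bar>vinner g h\<bar> \<le> vnorm g * vnorm h"
proof -
  have "(vinner g h)\<^sup>2 \<le> vinner g g * vinner h h"
  proof (rule quadratic_nonneg_imp)
    fix t :: real
    have "vinner (\<lambda>x. g x + t *\<^sub>R h x) (\<lambda>x. g x + t *\<^sub>R h x) = vinner g g + 2 * t * vinner g h + t\<^sup>2 * vinner h h"
      using assms by (simp add: vinner_add_left vinner_add_right vinner_scale_left vinner_scale_right
          vl2_add vl2_scale vinner_commute[of h g] power2_eq_square algebra_simps)
    then show "0 \<le> vinner g g + 2 * t * vinner g h + t\<^sup>2 * vinner h h"
      using vinner_self_nonneg[of "\<lambda>x. g x + t *\<^sub>R h x"] by (simp only:)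
  qed (rule vinner_self_nonneg)
  then have "\<bar>vinner g h\<bar>\<^sup>2 \<le> (vnorm g * vnorm h)\<^sup>2" by (simp add: power_mult_distrib vnorm_power2)
  then show ?thesis by (rule power2_le_imp_le) simp
qed

lemma vinner_integral:
  assumes "vl2 g" "vl2 h"
  shows "integrable L (\<lambda>x. g x \<bullet> h x)" "(\<integral>x. g x \<bullet> h x \<partial>L) = vinner g h"
proof -
  have i: "integrable L (\<lambda>x. g x $ i * h x $ i)" for i
    using assms by (intro l2_mult_integrable vl2D)
  then show "integrable L (\<lambda>x. g x \<bullet> h x)" by (simp add: inner_vec_def)
  show "(\<integral>x. g x \<bullet> h x \<partial>L) = vinner g h"
    using i by (simp add: inner_vec_def vinner_def l2_inner_def)
qed

lemma vinner_cong_AE: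
  assumes "AE x in L. g x = g' x" "vl2 g" "vl2 g'" "vl2 h"
  shows "vinner g h = vinner g' h"
  unfolding vinner_def
  by (intro sum.cong refl l2_inner_cong_AE)
    (use assms in \<open>auto intro!: l2_measurable vl2D elim!: eventually_mono\<close>)

lemma component_le_vnorm: "l2_norm L (\<lambda>x. g x $ i) \<le> vnorm g"
proof -
  have "l2_inner L (\<lambda>x. g x $ i) (\<lambda>x. g x $ i) \<le> vinner g g"
    unfolding vinner_def by (rule member_le_sum) (auto simp: l2_inner_self_nonneg)
  then show ?thesis unfolding vnorm_def l2_norm_def by (rule real_sqrt_le_mono)
qed

lemma vnorm_zero_imp_AE:
  assumes "vl2 g" "vinner g g = 0"
  shows "AE x in L. g x = 0"
proof -
  have "l2_norm L (\<lambda>x. g x $ i) = 0" for i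
    using component_le_vnorm[of g i] assms(2) l2_norm_nonneg[of L "\<lambda>x. g x $ i"]
    by (simp add: vnorm_def)
  then have "AE x in L. g x $ i = 0" for i using l2_norm_zero_iff vl2D[OF assms(1)] by blast
  then have "AE x in L. \<forall>i\<in>UNIV. g x $ i = 0" by (subst AE_ball_countable) auto
  then show ?thesis by eventually_elim (simp add: vec_eq_iff)
qed

text \<open>The approximants are arbitrary smooth functions, because limits with nonzero boundary
  values such as \<open>v + w\<close> are needed too. The limit gradient is an explicit argument
  since \<open>weak_grad\<close> is determined only up to null sets.\<close>

definition H1lim :: "(nat \<Rightarrow> real^2 \<Rightarrow> real) \<Rightarrow> (real^2 \<Rightarrow> real) \<Rightarrow> (real^2 \<Rightarrow> real^2) \<Rightarrow> bool" where
  "H1lim \<theta> f g \<longleftrightarrow> (\<forall>n. smooth (\<theta> n)) \<and> f \<in> l2 L \<and> vl2 g \<and>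
     (\<lambda>n. l2_norm L (\<lambda>x. \<theta> n x - f x)) \<longlonglongrightarrow> 0 \<and>
     (\<forall>i. (\<lambda>n. l2_norm L (\<lambda>x. grad (\<theta> n) x $ i - g x $ i)) \<longlonglongrightarrow> 0)"

lemma H1lim_inner:
  assumes "H1lim \<theta> f g" "h \<in> l2 L"
  shows "(\<lambda>n. l2_inner L (\<theta> n) h) \<longlonglongrightarrow> l2_inner L f h"
  using assms by (intro l2_inner_tendsto l2_norm_tendsto_const) (auto simp: H1lim_def smooth_l2)

lemma H1lim_vinner:
  assumes "H1lim \<theta> f g" "vl2 h"
  shows "(\<lambda>n. vinner (grad (\<theta> n)) h) \<longlonglongrightarrow> vinner g h"
  unfolding vinner_def using assms
  by (intro tendsto_sum l2_inner_tendsto l2_norm_tendsto_const) (auto simp: H1lim_def vl2_def smooth_grad_l2)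

lemma H1lim_vinner2:
  assumes "H1lim \<theta> f g" "H1lim \<eta> f' g'"
  shows "(\<lambda>n. vinner (grad (\<theta> n)) (grad (\<eta> n))) \<longlonglongrightarrow> vinner g g'"
  unfolding vinner_def using assms
  by (intro tendsto_sum l2_inner_tendsto) (auto simp: H1lim_def vl2_def smooth_grad_l2)

lemma H1lim_norm:
  assumes "H1lim \<theta> f g"
  shows "(\<lambda>n. l2_norm L (\<theta> n)) \<longlonglongrightarrow> l2_norm L f" "(\<lambda>n. vnorm (grad (\<theta> n))) \<longlonglongrightarrow> vnorm g"
proof -
  show "(\<lambda>n. l2_norm L (\<theta> n)) \<longlonglongrightarrow> l2_norm L f"
    using assms by (intro l2_norm_tendsto) (auto simp: H1lim_def smooth_l2)
  show "(\<lambda>n. vnorm (grad (\<theta> n))) \<longlonglongrightarrow> vnorm g"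
    unfolding vnorm_def by (rule tendsto_real_sqrt[OF H1lim_vinner2[OF assms assms]])
qed

lemma H1lim_cong_AE:
  assumes "H1lim \<theta> f g" "AE x in L. g x = g' x" "vl2 g'"
  shows "H1lim \<theta> f g'"
proof -
  have "l2_norm L (\<lambda>x. grad (\<theta> n) x $ i - g x $ i) = l2_norm L (\<lambda>x. grad (\<theta> n) x $ i - g' x $ i)" for n i
  proof (rule l2_norm_cong_AE)
    show "(\<lambda>x. grad (\<theta> n) x $ i - g x $ i) \<in> borel_measurable L" "(\<lambda>x. grad (\<theta> n) x $ i - g' x $ i) \<in> borel_measurable L"
      using assms by (auto simp: H1lim_def vl2_def intro!: l2_measurable l2_diff smooth_grad_l2)
    show "AE x in L. grad (\<theta> n) x $ i - g x $ i = grad (\<theta> n) x $ i - g' x $ i"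
      using assms(2) by eventually_elim simp
  qed
  then show ?thesis using assms by (simp add: H1lim_def)
qed

lemma H1lim_weak_grad:
  assumes "H1lim \<theta> f g"
  shows "is_weak_grad \<Omega> f g"
  unfolding is_weak_grad_def
proof (intro conjI allI ballI)
  show "f \<in> l2 L" "(\<lambda>x. g x $ i) \<in> l2 L" for i using assms by (auto simp: H1lim_def vl2_def)
  fix \<eta> i assume \<eta>: "\<eta> \<in> test_functions \<Omega>"
  note \<eta>2 = test_l2[OF \<eta>] test_l2[OF test_functions_grad[OF \<eta>, of i]]
  have s: "smooth (\<theta> n)" for n using assms by (simp add: H1lim_def)
  have "(\<lambda>n. l2_inner L (\<lambda>x. grad (\<theta> n) x $ i) \<eta>) \<longlonglongrightarrow> l2_inner L (\<lambda>x. g x $ i) \<eta>"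
    using assms \<eta>2 by (intro l2_inner_tendsto l2_norm_tendsto_const) (auto simp: H1lim_def vl2_def smooth_grad_l2)
  moreover have "l2_inner L (\<lambda>x. grad (\<theta> n) x $ i) \<eta> = - l2_inner L (\<theta> n) (\<lambda>x. grad \<eta> x $ i)" for n
    using integration_by_parts[OF s \<eta>] by simp
  moreover have "(\<lambda>n. - l2_inner L (\<theta> n) (\<lambda>x. grad \<eta> x $ i)) \<longlonglongrightarrow> - l2_inner L f (\<lambda>x. grad \<eta> x $ i)"
    by (intro tendsto_minus H1lim_inner[OF assms] \<eta>2)
  ultimately have "l2_inner L (\<lambda>x. g x $ i) \<eta> = - l2_inner L f (\<lambda>x. grad \<eta> x $ i)"
    using LIMSEQ_unique by simp
  then show "l2_inner L f (\<lambda>x. grad \<eta> x $ i) = - l2_inner L (\<lambda>x. g x $ i) \<eta>" by simp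
qed

lemma weak_grad_unique:
  assumes "is_weak_grad \<Omega> f g" "is_weak_grad \<Omega> f h"
  shows "AE x in L. g x = h x"
proof -
  have "AE x in L. g x $ i - h x $ i = 0" for i
  proof (rule test_functions_determine)
    show "(\<lambda>x. g x $ i - h x $ i) \<in> l2 L" using assms by (auto simp: is_weak_grad_def intro: l2_diff)
    show "l2_inner L (\<lambda>x. g x $ i - h x $ i) \<theta> = 0" if \<theta>: "\<theta> \<in> test_functions \<Omega>" for \<theta>
      using assms \<theta> test_l2[OF \<theta>] by (auto simp: is_weak_grad_def l2_inner_diff_left)
  qed
  then have "AE x in L. \<forall>i\<in>UNIV. g x $ i - h x $ i = 0" by (subst AE_ball_countable) auto
  then show ?thesis by eventually_elim (simp add: vec_eq_iff)
qed

lemma weak_grad_works: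
  assumes "is_weak_grad \<Omega> f g"
  shows "is_weak_grad \<Omega> f (weak_grad \<Omega> f)" "AE x in L. weak_grad \<Omega> f x = g x"
proof -
  show "is_weak_grad \<Omega> f (weak_grad \<Omega> f)" unfolding weak_grad_def using assms by (rule someI[of "is_weak_grad \<Omega> f"])
  then show "AE x in L. weak_grad \<Omega> f x = g x" using assms by (rule weak_grad_unique)
qed

lemma H10_I:
  assumes "H1lim \<theta> f g" "\<And>n. \<theta> n \<in> test_functions \<Omega>"
  shows "f \<in> H10 \<Omega>"
  unfolding H10_def using assms H1lim_weak_grad[OF assms(1)] by (auto simp: H1lim_def)

text \<open>The definition of \<open>H10\<close> provides some weak gradient; almost everywhere
  uniqueness replaces it by the chosen one.\<close>

lemma H10_E:
  assumes "f \<in> H10 \<Omega>"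
  obtains \<theta> where "H1lim \<theta> f (weak_grad \<Omega> f)" "\<And>n. \<theta> n \<in> test_functions \<Omega>"
proof -
  obtain g \<theta> where *: "is_weak_grad \<Omega> f g" "\<And>n. \<theta> n \<in> test_functions \<Omega>"
    "(\<lambda>n. l2_norm L (\<lambda>x. \<theta> n x - f x)) \<longlonglongrightarrow> 0"
    "\<And>i. (\<lambda>n. l2_norm L (\<lambda>x. grad (\<theta> n) x $ i - g x $ i)) \<longlonglongrightarrow> 0"
    using assms by (auto simp: H10_def)
  then have "H1lim \<theta> f g"
    by (auto simp: H1lim_def vl2_def is_weak_grad_def intro: test_functionsD)
  moreover have "AE x in L. g x = weak_grad \<Omega> f x"
    using weak_grad_works(2)[OF *(1)] by eventually_elim simp
  ultimately have "H1lim \<theta> f (weak_grad \<Omega> f)"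
    using H1lim_cong_AE weak_grad_works(1)[OF *(1)] vl2_is_weak_grad by blast
  then show ?thesis using that *(2) by blast
qed

lemma H10_l2: "f \<in> H10 \<Omega> \<Longrightarrow> f \<in> l2 L"
  and H10_vl2: "f \<in> H10 \<Omega> \<Longrightarrow> vl2 (weak_grad \<Omega> f)"
  and H10_is_weak_grad: "f \<in> H10 \<Omega> \<Longrightarrow> is_weak_grad \<Omega> f (weak_grad \<Omega> f)"
  using H10_E H1lim_weak_grad by (metis H1lim_def)+

lemma test_H10: "\<theta> \<in> test_functions \<Omega> \<Longrightarrow> \<theta> \<in> H10 \<Omega>"
  by (rule H10_I[of "\<lambda>_. \<theta>" \<theta> "grad \<theta>"])
    (auto simp: H1lim_def vl2_grad test_functionsD(1) test_l2 smooth_grad_l2 l2_norm_def l2_inner_def)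

text \<open>\<open>\<rho>\<close> and its gradient are bounded on the bounded domain, so both terms
  of the product rule pass to the limit.\<close>

lemma H1lim_mult:
  assumes lim: "H1lim \<theta> f g" and \<rho>: "smooth \<rho>"
  shows "H1lim (\<lambda>n x. \<rho> x * \<theta> n x) (\<lambda>x. \<rho> x * f x) (\<lambda>x. \<rho> x *\<^sub>R g x + f x *\<^sub>R grad \<rho> x)"
proof -
  have s: "smooth (\<theta> n)" for n using lim by (simp add: H1lim_def)
  have f: "f \<in> l2 L" and g: "vl2 g" using lim by (auto simp: H1lim_def)
  obtain C where C: "0 \<le> C" "\<And>x. x \<in> \<Omega> \<Longrightarrow> norm (\<rho> x) \<le> C"
    using continuous_bounded[OF smooth_continuous[OF \<rho>]] by blast
  obtain D where D: "0 \<le> D" "\<And>x. x \<in> \<Omega> \<Longrightarrow> norm (grad \<rho> x) \<le> D"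
    using continuous_bounded[OF grad_continuous[OF \<rho>]] by blast
  have D': "\<bar>grad \<rho> x $ i\<bar> \<le> D" if "x \<in> \<Omega>" for x i
    using D(2)[OF that] component_le_norm_cart[of "grad \<rho> x" i] by linarith
  have m1: "(\<lambda>x. \<rho> x * h x) \<in> l2 L" "l2_norm L (\<lambda>x. \<rho> x * h x) \<le> C * l2_norm L h" if h: "h \<in> l2 L" for h
  proof -
    show *: "(\<lambda>x. \<rho> x * h x) \<in> l2 L"
      by (rule l2_mult_bounded[OF h, of _ C]) (use C \<rho> in \<open>auto intro!: AE_L_I borel_imp_L smooth_borel\<close>)
    show "l2_norm L (\<lambda>x. \<rho> x * h x) \<le> C * l2_norm L h"
      by (rule l2_norm_mono[OF h l2_measurable[OF *] _ C(1)])
        (use C in \<open>auto intro!: AE_L_I mult_right_mono simp: abs_mult\<close>)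
  qed
  have m2: "(\<lambda>x. h x * grad \<rho> x $ i) \<in> l2 L" "l2_norm L (\<lambda>x. h x * grad \<rho> x $ i) \<le> D * l2_norm L h"
    if h: "h \<in> l2 L" for h i
  proof -
    have "(\<lambda>x. grad \<rho> x $ i * h x) \<in> l2 L"
      by (rule l2_mult_bounded[OF h, of _ D]) (use D' \<rho> in \<open>auto intro!: AE_L_I borel_imp_L smooth_borel smooth_grad\<close>)
    then show *: "(\<lambda>x. h x * grad \<rho> x $ i) \<in> l2 L" by (simp add: mult.commute)
    show "l2_norm L (\<lambda>x. h x * grad \<rho> x $ i) \<le> D * l2_norm L h"
    proof (rule l2_norm_mono[OF h l2_measurable[OF *] _ D(1)])
      show "AE x in L. \<bar>h x * grad \<rho> x $ i\<bar> \<le> D * \<bar>h x\<bar>"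
      proof (rule AE_L_I)
        fix x assume "x \<in> \<Omega>"
        from mult_right_mono[OF D'[OF this, of i], of "\<bar>h x\<bar>"]
        show "\<bar>h x * grad \<rho> x $ i\<bar> \<le> D * \<bar>h x\<bar>" by (simp add: abs_mult mult.commute)
      qed
    qed
  qed
  have gr: "grad (\<lambda>x. \<rho> x * \<theta> n x) x = \<rho> x *\<^sub>R grad (\<theta> n) x + \<theta> n x *\<^sub>R grad \<rho> x" for n x
    by (rule grad_mult) (intro smooth_differentiable \<rho> s)+
  show ?thesis
    unfolding H1lim_def
  proof (intro conjI allI)
    show "smooth (\<lambda>x. \<rho> x * \<theta> n x)" for n by (intro smooth_mult \<rho> s)
    show "(\<lambda>x. \<rho> x * f x) \<in> l2 L" by (rule m1(1)[OF f])
    show "vl2 (\<lambda>x. \<rho> x *\<^sub>R g x + f x *\<^sub>R grad \<rho> x)"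
      using m1(1)[OF vl2D[OF g]] m2(1)[OF f] by (simp add: vl2_def l2_add)
    have d: "(\<lambda>x. \<theta> n x - f x) \<in> l2 L" for n by (intro l2_diff smooth_l2[OF s] f)
    show "(\<lambda>n. l2_norm L (\<lambda>x. \<rho> x * \<theta> n x - \<rho> x * f x)) \<longlonglongrightarrow> 0"
    proof (rule tendsto_sandwich[of "\<lambda>_. 0"])
      show "\<forall>\<^sub>F n in sequentially. l2_norm L (\<lambda>x. \<rho> x * \<theta> n x - \<rho> x * f x) \<le> C * l2_norm L (\<lambda>x. \<theta> n x - f x)"
        using m1(2)[OF d] by (simp add: right_diff_distrib)
      show "(\<lambda>n. C * l2_norm L (\<lambda>x. \<theta> n x - f x)) \<longlonglongrightarrow> 0"
        using lim by (intro tendsto_mult_right_zero) (simp add: H1lim_def)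
    qed auto
    fix i
    have d': "(\<lambda>x. grad (\<theta> n) x $ i - g x $ i) \<in> l2 L" for n
      by (intro l2_diff smooth_grad_l2[OF s] vl2D[OF g])
    show "(\<lambda>n. l2_norm L (\<lambda>x. grad (\<lambda>x. \<rho> x * \<theta> n x) x $ i - (\<rho> x *\<^sub>R g x + f x *\<^sub>R grad \<rho> x) $ i)) \<longlonglongrightarrow> 0"
    proof (rule tendsto_sandwich[of "\<lambda>_. 0"])
      have "l2_norm L (\<lambda>x. grad (\<lambda>x. \<rho> x * \<theta> n x) x $ i - (\<rho> x *\<^sub>R g x + f x *\<^sub>R grad \<rho> x) $ i)
         \<le> C * l2_norm L (\<lambda>x. grad (\<theta> n) x $ i - g x $ i) + D * l2_norm L (\<lambda>x. \<theta> n x - f x)" for n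
      proof -
        have "(\<lambda>x. grad (\<lambda>x. \<rho> x * \<theta> n x) x $ i - (\<rho> x *\<^sub>R g x + f x *\<^sub>R grad \<rho> x) $ i)
          = (\<lambda>x. \<rho> x * (grad (\<theta> n) x $ i - g x $ i) + (\<theta> n x - f x) * grad \<rho> x $ i)"
          by (auto simp: gr algebra_simps)
        then show ?thesis
          using l2_norm_triangle[OF m1(1)[OF d'[of n]] m2(1)[OF d[of n], of i]] m1(2)[OF d'[of n]] m2(2)[OF d[of n], of i]
          by simp
      qed
      then show "\<forall>\<^sub>F n in sequentially. l2_norm L (\<lambda>x. grad (\<lambda>x. \<rho> x * \<theta> n x) x $ i - (\<rho> x *\<^sub>R g x + f x *\<^sub>R grad \<rho> x) $ i)
         \<le> C * l2_norm L (\<lambda>x. grad (\<theta> n) x $ i - g x $ i) + D * l2_norm L (\<lambda>x. \<theta> n x - f x)" by simp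
      have "(\<lambda>n. C * l2_norm L (\<lambda>x. grad (\<theta> n) x $ i - g x $ i) + D * l2_norm L (\<lambda>x. \<theta> n x - f x)) \<longlonglongrightarrow> C * 0 + D * 0"
        using lim by (intro tendsto_intros) (auto simp: H1lim_def)
      then show "(\<lambda>n. C * l2_norm L (\<lambda>x. grad (\<theta> n) x $ i - g x $ i) + D * l2_norm L (\<lambda>x. \<theta> n x - f x)) \<longlonglongrightarrow> 0" by simp
    qed auto
  qed
qed

lemma H1lim_add_smooth:
  assumes "H1lim \<theta> f g" "smooth v"
  shows "H1lim (\<lambda>n x. v x + \<theta> n x) (\<lambda>x. v x + f x) (\<lambda>x. grad v x + g x)"
proof -
  have "grad (\<lambda>x. v x + \<theta> n x) x = grad v x + grad (\<theta> n) x" for n x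
    using assms by (intro grad_add smooth_differentiable) (auto simp: H1lim_def)
  then show ?thesis using assms
    by (simp add: H1lim_def smooth_add l2_add smooth_l2 vl2_add vl2_grad)
qed

text \<open>Integrating \<open>x_1 \<theta>\<close> by parts against the first derivative of
  \<open>\<theta>\<close> gives
  \<open>|\<theta>|^2 = -2 (x_1 \<theta>, \<partial>_1 \<theta>)\<close>; bounding
  \<open>x_1\<close> by the radius \<open>R\<close> yields the constant \<open>2 R\<close>.\<close>

lemma Poincare:
  obtains C where "0 < C" "\<And>\<theta>. \<theta> \<in> test_functions \<Omega> \<Longrightarrow> l2_norm L \<theta> \<le> C * vnorm (grad \<theta>)"
proof -
  obtain R where R: "0 < R" "\<And>x. x \<in> \<Omega> \<Longrightarrow> norm x \<le> R"
    using bounded_domain by (auto simp: bounded_pos)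
  have "l2_norm L \<theta> \<le> (2 * R) * vnorm (grad \<theta>)" if \<theta>: "\<theta> \<in> test_functions \<Omega>" for \<theta>
  proof -
    have s: "smooth \<theta>" using test_functionsD(1)[OF \<theta>] .
    let ?x = "\<lambda>x :: real^2. x $ 1"
    let ?d = "\<lambda>x. grad \<theta> x $ 1"
    have gx: "grad ?x y $ 1 = 1" for y :: "real^2"
    proof -
      have "grad (\<lambda>x::real^2. 0 + axis 1 1 \<bullet> x) y $ 1 = 1"
        by (subst grad_affine) (simp add: axis_def)
      then show ?thesis by (simp add: inner_axis')
    qed
    have sx: "smooth (\<lambda>x. ?x x * \<theta> x)" by (intro smooth_mult smooth_component s)
    have "grad (\<lambda>x. ?x x * \<theta> x) x $ 1 = ?x x * ?d x + \<theta> x" for x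
      using grad_mult[OF smooth_differentiable[OF smooth_component] smooth_differentiable[OF s], of 1 x]
      by (simp add: gx)
    then have "l2_inner L (\<lambda>x. ?x x * \<theta> x) ?d = - l2_inner L (\<lambda>x. ?x x * ?d x + \<theta> x) \<theta>"
      using integration_by_parts[OF sx \<theta>, of 1] by simp
    also have "l2_inner L (\<lambda>x. ?x x * ?d x + \<theta> x) \<theta> = l2_inner L (\<lambda>x. ?x x * ?d x) \<theta> + l2_inner L \<theta> \<theta>"
      by (intro l2_inner_add_left smooth_l2 smooth_mult smooth_component smooth_grad s)
    also have "l2_inner L (\<lambda>x. ?x x * ?d x) \<theta> = l2_inner L (\<lambda>x. ?x x * \<theta> x) ?d"
      by (simp add: l2_inner_def mult_ac)
    finally have "l2_inner L \<theta> \<theta> = - 2 * l2_inner L (\<lambda>x. ?x x * \<theta> x) ?d" by simp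
    also have "\<dots> \<le> 2 * (l2_norm L (\<lambda>x. ?x x * \<theta> x) * l2_norm L ?d)"
      using l2_Cauchy_Schwarz[OF smooth_l2[OF sx] smooth_grad_l2[OF s, of 1]] by linarith
    also have "\<dots> \<le> 2 * ((R * l2_norm L \<theta>) * vnorm (grad \<theta>))"
    proof (intro mult_left_mono mult_mono component_le_vnorm)
      show "l2_norm L (\<lambda>x. ?x x * \<theta> x) \<le> R * l2_norm L \<theta>"
      proof (rule l2_norm_mono)
        show "AE x in L. \<bar>?x x * \<theta> x\<bar> \<le> R * \<bar>\<theta> x\<bar>"
        proof (rule AE_L_I)
          fix x assume "x \<in> \<Omega>"
          then have "\<bar>x $ 1\<bar> \<le> R" using R(2)[of x] component_le_norm_cart[of x 1] by linarith
          then show "\<bar>?x x * \<theta> x\<bar> \<le> R * \<bar>\<theta> x\<bar>" by (simp add: abs_mult mult_right_mono)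
        qed
      qed (use R s sx in \<open>auto intro: smooth_l2 l2_measurable\<close>)
    qed (use R in auto)
    finally have *: "l2_norm L \<theta> * l2_norm L \<theta> \<le> (2 * R * vnorm (grad \<theta>)) * l2_norm L \<theta>"
      by (simp add: l2_norm_power2[symmetric] power2_eq_square mult_ac)
    show ?thesis
    proof (cases "l2_norm L \<theta> = 0")
      case False
      then have "0 < l2_norm L \<theta>" using l2_norm_nonneg[of L \<theta>] by linarith
      with * show ?thesis by (simp add: mult_le_cancel_right)
    qed (use R in simp)
  qed
  then show ?thesis using that[of "2 * R"] R(1) by auto
qed

definition CP :: real where
  "CP = (SOME C. 0 < C \<and> (\<forall>\<theta>\<in>test_functions \<Omega>. l2_norm L \<theta> \<le> C * vnorm (grad \<theta>)))"

lemma CP_pos: "0 < CP" and CP_test: "\<theta> \<in> test_functions \<Omega> \<Longrightarrow> l2_norm L \<theta> \<le> CP * vnorm (grad \<theta>)"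
proof -
  have "\<exists>C. 0 < C \<and> (\<forall>\<theta>\<in>test_functions \<Omega>. l2_norm L \<theta> \<le> C * vnorm (grad \<theta>))"
    using Poincare by metis
  from someI_ex[OF this] show "0 < CP" "\<theta> \<in> test_functions \<Omega> \<Longrightarrow> l2_norm L \<theta> \<le> CP * vnorm (grad \<theta>)"
    by (auto simp: CP_def)
qed

lemma CP_H10:
  assumes "f \<in> H10 \<Omega>"
  shows "l2_norm L f \<le> CP * vnorm (weak_grad \<Omega> f)"
proof -
  obtain \<theta> where \<theta>: "H1lim \<theta> f (weak_grad \<Omega> f)" "\<And>n. \<theta> n \<in> test_functions \<Omega>"
    using H10_E[OF assms] by blast
  show ?thesis
    by (rule LIMSEQ_le[OF H1lim_norm(1)[OF \<theta>(1)] tendsto_mult_left[OF H1lim_norm(2)[OF \<theta>(1)]]])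
      (use CP_test \<theta>(2) in auto)
qed

section \<open>Weak solutions of the Poisson problem\<close>

lemma Dirichlet_form: "psd_form (test_functions \<Omega>) (\<lambda>\<theta> \<eta>. vinner (grad \<theta>) (grad \<eta>))"
proof
  show "test_functions \<Omega> \<noteq> {}" using test_functions_zero[of \<Omega>] by blast
next
  fix f g h :: "real^2 \<Rightarrow> real" and c :: real
  assume f: "f \<in> test_functions \<Omega>" and g: "g \<in> test_functions \<Omega>"
  show "(\<lambda>x. f x + g x) \<in> test_functions \<Omega>" using f g by (rule test_functions_add)
  show "vinner (grad f) (grad g) = vinner (grad g) (grad f)" by (rule vinner_commute)
  have "grad (\<lambda>x. f x + g x) = (\<lambda>x. grad f x + grad g x)" "grad (\<lambda>x. c * f x) = (\<lambda>x. c *\<^sub>R grad f x)"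
    using f g by (auto intro!: grad_add grad_scale smooth_differentiable test_functionsD)
  then show "vinner (grad (\<lambda>x. c * f x)) (grad g) = c * vinner (grad f) (grad g)"
    and "h \<in> test_functions \<Omega> \<Longrightarrow> vinner (grad (\<lambda>x. f x + g x)) (grad h) = vinner (grad f) (grad h) + vinner (grad g) (grad h)"
    using f g by (simp_all add: vinner_scale_left vinner_add_left vl2_grad test_functionsD(1))
  show "(\<lambda>x. c * f x) \<in> test_functions \<Omega>" using f by (rule test_functions_scale)

  show "0 \<le> vinner (grad f) (grad f)" by (rule vinner_self_nonneg)
qed

text \<open>The representing sequence consists of test functions; Poincare's inequality and
  completeness of L2, for the function and for each partial derivative, supply its limit. Both the
  weak solutions and the harmonic extensions of smooth boundary values come from here.\<close>

lemma H10_Riesz: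
  assumes F_add: "\<And>f g. f \<in> test_functions \<Omega> \<Longrightarrow> g \<in> test_functions \<Omega> \<Longrightarrow> F (\<lambda>x. f x + g x) = F f + F g"
    and F_scale: "\<And>f c. f \<in> test_functions \<Omega> \<Longrightarrow> F (\<lambda>x. c * f x) = c * F f"
    and F_bd: "\<And>f. f \<in> test_functions \<Omega> \<Longrightarrow> \<bar>F f\<bar> \<le> C * vnorm (grad f)"
  obtains w where "w \<in> H10 \<Omega>" "\<And>\<eta>. \<eta> \<in> test_functions \<Omega> \<Longrightarrow> vinner (weak_grad \<Omega> w) (grad \<eta>) = F \<eta>"
proof -
  interpret D: psd_form "test_functions \<Omega>" "\<lambda>\<theta> \<eta>. vinner (grad \<theta>) (grad \<eta>)" by (rule Dirichlet_form)
  obtain \<theta> where \<theta>: "\<And>n. \<theta> n \<in> test_functions \<Omega>"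
    and cau: "\<And>e. 0 < e \<Longrightarrow> \<exists>N. \<forall>m\<ge>N. \<forall>n\<ge>N. vinner (grad (\<lambda>x. \<theta> m x - \<theta> n x)) (grad (\<lambda>x. \<theta> m x - \<theta> n x)) < e"
    and lim: "\<And>\<eta>. \<eta> \<in> test_functions \<Omega> \<Longrightarrow> (\<lambda>n. vinner (grad (\<theta> n)) (grad \<eta>)) \<longlonglongrightarrow> F \<eta>"
    using D.Riesz_sequence[OF F_add F_scale F_bd[unfolded vnorm_def]] by blast
  have d: "(\<lambda>x. \<theta> m x - \<theta> n x) \<in> test_functions \<Omega>" for m n using \<theta> by (intro test_functions_diff)
  have s: "smooth (\<theta> n)" for n using \<theta> test_functionsD(1) by blast
  have cau': "\<exists>N. \<forall>m\<ge>N. \<forall>n\<ge>N. vnorm (grad (\<lambda>x. \<theta> m x - \<theta> n x)) < e" if e: "0 < e" for e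
  proof -
    obtain N where N: "\<And>m n. m \<ge> N \<Longrightarrow> n \<ge> N \<Longrightarrow> vinner (grad (\<lambda>x. \<theta> m x - \<theta> n x)) (grad (\<lambda>x. \<theta> m x - \<theta> n x)) < e\<^sup>2"
      using cau[OF zero_less_power[OF e, of 2]] by blast
    have "vnorm (grad (\<lambda>x. \<theta> m x - \<theta> n x)) < e" if "m \<ge> N" "n \<ge> N" for m n
      by (rule power2_less_imp_less) (use N[OF that] e in \<open>auto simp: vnorm_power2\<close>)
    then show ?thesis by blast
  qed
  obtain f where f: "f \<in> l2 L" "(\<lambda>n. l2_norm L (\<lambda>x. \<theta> n x - f x)) \<longlonglongrightarrow> 0"
  proof (rule l2_complete[OF finite_L, of \<theta>])
    show "\<theta> n \<in> l2 L" for n by (rule test_l2[OF \<theta>])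
    fix e :: real assume "0 < e"
    then obtain N where N: "\<And>m n. m \<ge> N \<Longrightarrow> n \<ge> N \<Longrightarrow> vnorm (grad (\<lambda>x. \<theta> m x - \<theta> n x)) < e / CP"
      using cau'[of "e / CP"] CP_pos by auto
    have "l2_norm L (\<lambda>x. \<theta> m x - \<theta> n x) < e" if "m \<ge> N" "n \<ge> N" for m n
      using CP_test[OF d[of m n]] N[OF that] CP_pos by (simp add: field_simps)
    then show "\<exists>N. \<forall>m\<ge>N. \<forall>n\<ge>N. l2_norm L (\<lambda>x. \<theta> m x - \<theta> n x) < e" by blast
  qed blast
  have "\<exists>g. g \<in> l2 L \<and> (\<lambda>n. l2_norm L (\<lambda>x. grad (\<theta> n) x $ i - g x)) \<longlonglongrightarrow> 0" for i
  proof -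
    obtain g where "g \<in> l2 L" "(\<lambda>n. l2_norm L (\<lambda>x. grad (\<theta> n) x $ i - g x)) \<longlonglongrightarrow> 0"
    proof (rule l2_complete[OF finite_L, of "\<lambda>n x. grad (\<theta> n) x $ i"])
      show "(\<lambda>x. grad (\<theta> n) x $ i) \<in> l2 L" for n by (rule smooth_grad_l2[OF s])
      fix e :: real assume "0 < e"
      then obtain N where N: "\<And>m n. m \<ge> N \<Longrightarrow> n \<ge> N \<Longrightarrow> vnorm (grad (\<lambda>x. \<theta> m x - \<theta> n x)) < e"
        using cau'[of e] by auto
      have "l2_norm L (\<lambda>x. grad (\<theta> m) x $ i - grad (\<theta> n) x $ i) < e" if "m \<ge> N" "n \<ge> N" for m n
      proof -
        have "grad (\<lambda>x. \<theta> m x - \<theta> n x) = (\<lambda>x. grad (\<theta> m) x - grad (\<theta> n) x)"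
          using s by (auto intro!: grad_diff smooth_differentiable)
        then show ?thesis
          using component_le_vnorm[of "grad (\<lambda>x. \<theta> m x - \<theta> n x)" i] N[OF that] by simp
      qed
      then show "\<exists>N. \<forall>m\<ge>N. \<forall>n\<ge>N. l2_norm L (\<lambda>x. grad (\<theta> m) x $ i - grad (\<theta> n) x $ i) < e" by blast
    qed blast
    then show ?thesis by blast
  qed
  then have "\<forall>i. \<exists>g. g \<in> l2 L \<and> (\<lambda>n. l2_norm L (\<lambda>x. grad (\<theta> n) x $ i - g x)) \<longlonglongrightarrow> 0" by blast
  from choice[OF this] obtain g where
    g: "\<And>i. g i \<in> l2 L" "\<And>i. (\<lambda>n. l2_norm L (\<lambda>x. grad (\<theta> n) x $ i - g i x)) \<longlonglongrightarrow> 0"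
    by blast
  have H: "H1lim \<theta> f (vec_lambda \<circ> (\<lambda>x i. g i x))"
    using s f g by (simp add: H1lim_def vl2_def)
  have fH: "f \<in> H10 \<Omega>" by (rule H10_I[OF H \<theta>])
  have "vinner (weak_grad \<Omega> f) (grad \<eta>) = F \<eta>" if \<eta>: "\<eta> \<in> test_functions \<Omega>" for \<eta>
  proof -
    have v: "vl2 (grad \<eta>)" using \<eta> by (intro vl2_grad test_functionsD)
    have "F \<eta> = vinner (vec_lambda \<circ> (\<lambda>x i. g i x)) (grad \<eta>)"
      using LIMSEQ_unique[OF lim[OF \<eta>] H1lim_vinner[OF H v]] .
    also have "\<dots> = vinner (weak_grad \<Omega> f) (grad \<eta>)"
      by (rule vinner_cong_AE[symmetric])
        (use weak_grad_works[OF H1lim_weak_grad[OF H]] H10_vl2[OF fH] v vl2_is_weak_grad[OF H1lim_weak_grad[OF H]] in auto)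
    finally show ?thesis by simp
  qed
  then show ?thesis using that fH by blast
qed

lemma H10_extend:
  assumes h: "vl2 h" and z: "z \<in> l2 L"
    and eq: "\<And>\<eta>. \<eta> \<in> test_functions \<Omega> \<Longrightarrow> vinner h (grad \<eta>) = l2_inner L z \<eta>"
    and v: "v \<in> H10 \<Omega>"
  shows "vinner h (weak_grad \<Omega> v) = l2_inner L z v"
proof -
  obtain \<theta> where \<theta>: "H1lim \<theta> v (weak_grad \<Omega> v)" "\<And>n. \<theta> n \<in> test_functions \<Omega>" using H10_E[OF v] by blast
  have "(\<lambda>n. vinner h (grad (\<theta> n))) \<longlonglongrightarrow> vinner h (weak_grad \<Omega> v)"
    using H1lim_vinner[OF \<theta>(1) h] by (simp add: vinner_commute)
  moreover have "(\<lambda>n. l2_inner L z (\<theta> n)) \<longlonglongrightarrow> l2_inner L z v"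
    using H1lim_inner[OF \<theta>(1) z] by (simp add: l2_inner_commute)
  ultimately show ?thesis using eq[OF \<theta>(2)] LIMSEQ_unique by simp
qed

text \<open>Density allows testing with test functions only, and their classical gradient agrees
  almost everywhere with the chosen weak one.\<close>

lemma weak_sol_iff:
  assumes z: "z \<in> l2 L"
  shows "weak_sol \<Omega> z \<phi> \<longleftrightarrow> \<phi> \<in> H10 \<Omega> \<and>
    (\<forall>\<eta>\<in>test_functions \<Omega>. vinner (weak_grad \<Omega> \<phi>) (grad \<eta>) = l2_inner L z \<eta>)"
proof (cases "\<phi> \<in> H10 \<Omega>")
  case True
  have *: "(\<integral>x. weak_grad \<Omega> \<phi> x \<bullet> weak_grad \<Omega> v x \<partial>L) = vinner (weak_grad \<Omega> \<phi>) (weak_grad \<Omega> v)"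
    if "v \<in> H10 \<Omega>" for v using True that by (intro vinner_integral H10_vl2)
  have "vinner (weak_grad \<Omega> \<phi>) (weak_grad \<Omega> \<eta>) = vinner (weak_grad \<Omega> \<phi>) (grad \<eta>)"
    if \<eta>: "\<eta> \<in> test_functions \<Omega>" for \<eta>
    unfolding vinner_commute[of "weak_grad \<Omega> \<phi>"]
    by (rule vinner_cong_AE)
      (use weak_grad_works[OF is_weak_grad_smooth[OF test_functionsD(1)[OF \<eta>]]] vl2_is_weak_grad
         vl2_grad[OF test_functionsD(1)[OF \<eta>]] H10_vl2[OF True] in auto)
  then show ?thesis
    unfolding weak_sol_def using True * H10_extend[OF H10_vl2[OF True] z] test_H10 by force
qed (simp add: weak_sol_def)

lemma weak_sol_exists:
  assumes z: "z \<in> l2 L"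
  shows "\<exists>\<phi>. weak_sol \<Omega> z \<phi>"
proof -
  obtain w where "w \<in> H10 \<Omega>" "\<And>\<eta>. \<eta> \<in> test_functions \<Omega> \<Longrightarrow> vinner (weak_grad \<Omega> w) (grad \<eta>) = l2_inner L z \<eta>"
  proof (rule H10_Riesz[where F = "l2_inner L z" and C = "l2_norm L z * CP"])
    show "l2_inner L z (\<lambda>x. f x + g x) = l2_inner L z f + l2_inner L z g"
      if "f \<in> test_functions \<Omega>" "g \<in> test_functions \<Omega>" for f g
      using that by (intro l2_inner_add_right test_l2 z)
    show "l2_inner L z (\<lambda>x. c * f x) = c * l2_inner L z f" for f c by (rule l2_inner_scale_right)
    show "\<bar>l2_inner L z f\<bar> \<le> l2_norm L z * CP * vnorm (grad f)" if "f \<in> test_functions \<Omega>" for f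
      using l2_Cauchy_Schwarz[OF z test_l2[OF that]] mult_left_mono[OF CP_test[OF that] l2_norm_nonneg[of L z]]
      by (simp add: mult.assoc)
  qed blast
  then show ?thesis using weak_sol_iff[OF z] by blast
qed

lemma weak_sol_self:
  assumes z: "z \<in> l2 L" and \<phi>: "weak_sol \<Omega> z \<phi>" and v: "v \<in> H10 \<Omega>"
  shows "vinner (weak_grad \<Omega> \<phi>) (weak_grad \<Omega> v) = l2_inner L z v"
  using \<phi> v unfolding weak_sol_def by (metis vinner_integral(2) H10_vl2)

text \<open>The partial derivatives of a test function are themselves test functions for the weak
  gradient.\<close>

lemma is_weak_grad_laplace:
  assumes f: "is_weak_grad \<Omega> f g" and \<theta>: "\<theta> \<in> test_functions \<Omega>"
  shows "l2_inner L f (laplace \<theta>) = - vinner g (grad \<theta>)"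
proof -
  have t: "(\<lambda>x. grad (\<lambda>y. grad \<theta> y $ i) x $ i) \<in> l2 L" for i
    by (intro test_l2 test_functions_grad \<theta>)
  have fl: "f \<in> l2 L" using f by (simp add: is_weak_grad_def)
  have "laplace \<theta> = (\<lambda>x. grad (\<lambda>y. grad \<theta> y $ 1) x $ 1 + grad (\<lambda>y. grad \<theta> y $ 2) x $ 2)"
    by (auto simp: laplace_def sum_2)
  then have "l2_inner L f (laplace \<theta>) = l2_inner L f (\<lambda>x. grad (\<lambda>y. grad \<theta> y $ 1) x $ 1)
      + l2_inner L f (\<lambda>x. grad (\<lambda>y. grad \<theta> y $ 2) x $ 2)"
    using t fl by (simp add: l2_inner_add_right)
  then show ?thesis
    using f test_functions_grad[OF \<theta>] by (simp add: is_weak_grad_def vinner_def sum_2)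
qed

lemma weak_laplace_works:
  assumes "is_weak_laplace \<Omega> f z"
  shows "is_weak_laplace \<Omega> f (weak_laplace \<Omega> f)" "AE x in L. weak_laplace \<Omega> f x = z x"
proof -
  show *: "is_weak_laplace \<Omega> f (weak_laplace \<Omega> f)"
    unfolding weak_laplace_def using assms by (rule someI[of "is_weak_laplace \<Omega> f"])
  have "AE x in L. weak_laplace \<Omega> f x - z x = 0"
  proof (rule test_functions_determine)
    show "(\<lambda>x. weak_laplace \<Omega> f x - z x) \<in> l2 L"
      using * assms by (auto simp: is_weak_laplace_def intro: l2_diff)
    show "l2_inner L (\<lambda>x. weak_laplace \<Omega> f x - z x) \<theta> = 0" if "\<theta> \<in> test_functions \<Omega>" for \<theta>
      using * assms that test_l2[OF that] by (simp add: is_weak_laplace_def l2_inner_diff_left)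
  qed
  then show "AE x in L. weak_laplace \<Omega> f x = z x" by eventually_elim simp
qed

text \<open>Together with the converse \<open>Phi_weak_sol\<close> this identifies
  \<open>Phi\<close> with the weak solutions for all square integrable right hand sides, so that the
  test space of the transposition solution is parametrized by \<open>z\<close>.\<close>

lemma weak_sol_Phi:
  assumes z: "z \<in> l2 L" and \<phi>: "weak_sol \<Omega> z \<phi>"
  shows "\<phi> \<in> Phi \<Omega>" "AE x in L. weak_laplace \<Omega> \<phi> x = - z x" "weak_laplace \<Omega> \<phi> \<in> l2 L"
proof -
  have H: "\<phi> \<in> H10 \<Omega>" using \<phi> by (simp add: weak_sol_def)
  have *: "is_weak_laplace \<Omega> \<phi> (\<lambda>x. - z x)"
    unfolding is_weak_laplace_def
    using l2_uminus[OF z] is_weak_grad_laplace[OF H10_is_weak_grad[OF H]] \<phi> weak_sol_iff[OF z]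
    by (simp add: l2_inner_uminus_left)
  then show "\<phi> \<in> Phi \<Omega>" using H by (auto simp: Phi_def)
  show "AE x in L. weak_laplace \<Omega> \<phi> x = - z x" by (rule weak_laplace_works(2)[OF *])
  show "weak_laplace \<Omega> \<phi> \<in> l2 L"
    using weak_laplace_works(1)[OF *] by (simp add: is_weak_laplace_def)
qed

lemma Phi_weak_sol:
  assumes "\<phi> \<in> Phi \<Omega>"
  shows "(\<lambda>x. - weak_laplace \<Omega> \<phi> x) \<in> l2 L" "weak_sol \<Omega> (\<lambda>x. - weak_laplace \<Omega> \<phi> x) \<phi>"
proof -
  obtain z where "is_weak_laplace \<Omega> \<phi> z" and H: "\<phi> \<in> H10 \<Omega>" using assms by (auto simp: Phi_def)
  from weak_laplace_works(1)[OF this(1)] have *: "is_weak_laplace \<Omega> \<phi> (weak_laplace \<Omega> \<phi>)" .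
  then show l: "(\<lambda>x. - weak_laplace \<Omega> \<phi> x) \<in> l2 L" by (auto simp: is_weak_laplace_def intro: l2_uminus)
  have "vinner (weak_grad \<Omega> \<phi>) (grad \<eta>) = l2_inner L (\<lambda>x. - weak_laplace \<Omega> \<phi> x) \<eta>"
    if "\<eta> \<in> test_functions \<Omega>" for \<eta>
    using * that is_weak_grad_laplace[OF H10_is_weak_grad[OF H] that]
    by (simp add: is_weak_laplace_def l2_inner_uminus_left)
  then show "weak_sol \<Omega> (\<lambda>x. - weak_laplace \<Omega> \<phi> x) \<phi>" using H weak_sol_iff[OF l] by blast
qed

text \<open>The difference field is orthogonal to the weak gradients of all \<open>H10\<close>
  functions and is itself a combination of such gradients, hence zero almost everywhere. Comparing
  gradients is enough for later, because Green's functional sees a solution only through its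
  gradient and its right hand side.\<close>

lemma weak_sol_linear:
  assumes z: "z \<in> l2 L" "z1 \<in> l2 L" "z2 \<in> l2 L"
    and \<phi>: "weak_sol \<Omega> z \<phi>" "weak_sol \<Omega> z1 \<phi>1" "weak_sol \<Omega> z2 \<phi>2"
    and eq: "AE x in L. z x = c * z1 x + z2 x"
  shows "AE x in L. weak_grad \<Omega> \<phi> x = c *\<^sub>R weak_grad \<Omega> \<phi>1 x + weak_grad \<Omega> \<phi>2 x"
proof -
  have H: "\<phi> \<in> H10 \<Omega>" "\<phi>1 \<in> H10 \<Omega>" "\<phi>2 \<in> H10 \<Omega>" using \<phi> by (auto simp: weak_sol_def)
  note v = H[THEN H10_vl2]
  define h where "h x = weak_grad \<Omega> \<phi> x - (c *\<^sub>R weak_grad \<Omega> \<phi>1 x + weak_grad \<Omega> \<phi>2 x)" for x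
  have hv: "vl2 h" unfolding h_def using v by (intro vl2_diff vl2_add vl2_scale)
  have expand: "vinner k h = vinner k (weak_grad \<Omega> \<phi>) - (c * vinner k (weak_grad \<Omega> \<phi>1) + vinner k (weak_grad \<Omega> \<phi>2))"
    if k: "vl2 k" for k
    unfolding h_def using v k by (simp add: vinner_diff_right vinner_add_right vinner_scale_right vl2_add vl2_scale)
  have test: "vinner h (grad \<eta>) = l2_inner L (\<lambda>x. 0) \<eta>" if \<eta>: "\<eta> \<in> test_functions \<Omega>" for \<eta>
  proof -
    have "vinner (weak_grad \<Omega> \<phi>) (grad \<eta>) = l2_inner L z \<eta>"
      "vinner (weak_grad \<Omega> \<phi>1) (grad \<eta>) = l2_inner L z1 \<eta>"
      "vinner (weak_grad \<Omega> \<phi>2) (grad \<eta>) = l2_inner L z2 \<eta>"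
      using \<phi> weak_sol_iff z \<eta> by blast+
    moreover have "l2_inner L z \<eta> = l2_inner L (\<lambda>x. c * z1 x + z2 x) \<eta>"
      by (rule l2_inner_cong_AE) (use eq z test_l2[OF \<eta>] in \<open>auto intro!: l2_measurable l2_add l2_scale\<close>)
    then have "l2_inner L z \<eta> = c * l2_inner L z1 \<eta> + l2_inner L z2 \<eta>"
      using z test_l2[OF \<eta>] by (simp add: l2_inner_add_left l2_inner_scale_left l2_scale)
    ultimately show ?thesis
      using expand[OF vl2_grad[OF test_functionsD(1)[OF \<eta>]]]
      by (simp add: vinner_commute[of _ "grad \<eta>"] l2_inner_def)
  qed
  have "vinner h (weak_grad \<Omega> v) = 0" if "v \<in> H10 \<Omega>" for v
    using H10_extend[OF hv l2_zero test that] by (simp add: l2_inner_def)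
  then have "vinner h h = 0" using expand[OF hv] H by simp
  from vnorm_zero_imp_AE[OF hv this] show ?thesis
    by eventually_elim (simp add: h_def)
qed

section \<open>The gain on sets of small measure\<close>

text \<open>Each factor in Ladyzhenskaya's inequality is at most twice the product of the norms of
  \<open>\<theta>\<close> and its gradient; Poincare's inequality then removes the norm of
  \<open>\<theta>\<close>.\<close>

lemma test_function_fourth_power:
  assumes \<theta>: "\<theta> \<in> test_functions \<Omega>"
  shows "l2_norm L (\<lambda>x. (\<theta> x)\<^sup>2) \<le> 2 * CP * (vnorm (grad \<theta>))\<^sup>2"
proof -
  have s: "smooth \<theta>" using test_functionsD(1)[OF \<theta>] .
  have t4: "(\<lambda>x. (\<theta> x)^4) \<in> test_functions \<Omega>"
    using test_functions_mult_smooth[OF \<theta> smooth_power[OF s, of 3]] by (simp add: power_Suc2[symmetric])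
  have td: "(\<lambda>x. 2 * \<theta> x * grad \<theta> x $ i) \<in> test_functions \<Omega>" for i
    by (intro test_functions_mult_smooth test_functions_grad \<theta> smooth_mult smooth_const s)
  have "(\<integral>\<^sup>+x. ennreal ((\<theta> x)^4) \<partial>lborel) = ennreal (\<integral>x. (\<theta> x)^4 \<partial>lborel)"
    by (rule nn_integral_eq_integral[OF test_function_integrable[OF t4]]) simp
  also have "(\<integral>x. (\<theta> x)^4 \<partial>lborel) = (\<integral>x. (\<theta> x)^4 \<partial>L)"
    by (rule integral_L_support[symmetric])
      (use test_functionsD[OF t4] in \<open>auto intro: smooth_borel\<close>)
  also have "\<dots> = (l2_norm L (\<lambda>x. (\<theta> x)\<^sup>2))\<^sup>2"
    by (simp add: l2_norm_power2 l2_inner_def flip: power_add)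
  finally have e1: "(\<integral>\<^sup>+x. ennreal ((\<theta> x)^4) \<partial>lborel) = ennreal ((l2_norm L (\<lambda>x. (\<theta> x)\<^sup>2))\<^sup>2)" .
  have e2: "(\<integral>\<^sup>+x. ennreal \<bar>2 * \<theta> x * grad \<theta> x $ i\<bar> \<partial>lborel) \<le> ennreal (2 * CP * (vnorm (grad \<theta>))\<^sup>2)" for i
  proof -
    have "(\<integral>\<^sup>+x. ennreal \<bar>2 * \<theta> x * grad \<theta> x $ i\<bar> \<partial>lborel) = ennreal (\<integral>x. \<bar>2 * \<theta> x * grad \<theta> x $ i\<bar> \<partial>lborel)"
      using test_function_integrable[OF td] by (intro nn_integral_eq_integral) auto
    also have "(\<integral>x. \<bar>2 * \<theta> x * grad \<theta> x $ i\<bar> \<partial>lborel) = (\<integral>x. \<bar>2 * \<theta> x * grad \<theta> x $ i\<bar> \<partial>L)"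
      by (rule integral_L_support[symmetric])
        (use test_functionsD[OF td] in \<open>auto intro!: borel_measurable_abs smooth_borel\<close>)
    also have "\<dots> = 2 * l2_inner L (\<lambda>x. \<bar>\<theta> x\<bar>) (\<lambda>x. \<bar>grad \<theta> x $ i\<bar>)"
      by (simp add: l2_inner_def abs_mult mult.assoc)
    also have "\<dots> \<le> 2 * (l2_norm L \<theta> * l2_norm L (\<lambda>x. grad \<theta> x $ i))"
    proof -
      have a: "(\<lambda>x. \<bar>h x\<bar>) \<in> l2 L" "l2_norm L (\<lambda>x. \<bar>h x\<bar>) = l2_norm L h" if "h \<in> l2 L" for h
        using that by (auto simp: l2_def l2_norm_def l2_inner_def)
      have "l2_inner L (\<lambda>x. \<bar>\<theta> x\<bar>) (\<lambda>x. \<bar>grad \<theta> x $ i\<bar>) \<le> l2_norm L \<theta> * l2_norm L (\<lambda>x. grad \<theta> x $ i)"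
        using l2_Cauchy_Schwarz[OF a(1)[OF smooth_l2[OF s]] a(1)[OF smooth_grad_l2[OF s, of i]]]
        by (simp add: a(2)[OF smooth_l2[OF s]] a(2)[OF smooth_grad_l2[OF s, of i]])
      then show ?thesis by simp
    qed
    also have "\<dots> \<le> 2 * ((CP * vnorm (grad \<theta>)) * vnorm (grad \<theta>))"
      using CP_pos by (intro mult_left_mono mult_mono CP_test[OF \<theta>] component_le_vnorm) auto
    finally show ?thesis by (simp add: power2_eq_square mult.assoc ennreal_leI)
  qed
  have nn: "0 \<le> 2 * CP * (vnorm (grad \<theta>))\<^sup>2" using CP_pos by simp
  have "ennreal ((l2_norm L (\<lambda>x. (\<theta> x)\<^sup>2))\<^sup>2) \<le> ennreal (2 * CP * (vnorm (grad \<theta>))\<^sup>2) * ennreal (2 * CP * (vnorm (grad \<theta>))\<^sup>2)"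
    unfolding e1[symmetric] by (rule order_trans[OF Ladyzhenskaya[OF \<theta>]]) (intro mult_mono e2; simp)
  also have "\<dots> = ennreal ((2 * CP * (vnorm (grad \<theta>))\<^sup>2)\<^sup>2)"
    using nn by (simp add: power2_eq_square[of "2 * CP * _"] flip: ennreal_mult)
  finally have "(l2_norm L (\<lambda>x. (\<theta> x)\<^sup>2))\<^sup>2 \<le> (2 * CP * (vnorm (grad \<theta>))\<^sup>2)\<^sup>2"
    by (subst (asm) ennreal_le_iff) auto
  then show ?thesis by (rule power2_le_imp_le) (rule nn)
qed

text \<open>By Cauchy-Schwarz the integral of \<open>\<theta>^2\<close> over \<open>A\<close> is at
  most the root of the measure times the L2-norm of \<open>\<theta>^2\<close>; taking the root once
  more leaves the fourth root of the measure. Density carries this over to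
  \<open>H10\<close>.\<close>

lemma H10_small_set:
  assumes f: "f \<in> H10 \<Omega>" and A: "A \<in> sets L"
  shows "l2_norm L (\<lambda>x. indicator A x * f x) \<le> sqrt (2 * CP) * sqrt (sqrt (measure L A)) * vnorm (weak_grad \<Omega> f)"
proof -
  have im: "indicator A \<in> borel_measurable L" using A by simp
  have m1: "(\<lambda>x. indicator A x * h x) \<in> l2 L" if "h \<in> l2 L" for h
    by (rule l2_mult_bounded[OF that im, of 1]) (auto simp: indicator_def)
  have m2: "l2_norm L (\<lambda>x. indicator A x * h x) \<le> 1 * l2_norm L h" if "h \<in> l2 L" for h
    by (rule l2_norm_mono[OF that l2_measurable[OF m1[OF that]]]) (auto simp: indicator_def)
  have il: "indicator A \<in> l2 L" using m1[OF smooth_l2[OF smooth_const[of 1]]] by simp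
  have test: "l2_norm L (\<lambda>x. indicator A x * \<theta> x) \<le> sqrt (2 * CP) * sqrt (sqrt (measure L A)) * vnorm (grad \<theta>)"
    if \<theta>: "\<theta> \<in> test_functions \<Omega>" for \<theta>
  proof (rule power2_le_imp_le)
    have s: "smooth (\<lambda>x. (\<theta> x)\<^sup>2)" by (intro smooth_power test_functionsD(1)[OF \<theta>])
    have "(l2_norm L (\<lambda>x. indicator A x * \<theta> x))\<^sup>2 = l2_inner L (indicator A) (\<lambda>x. (\<theta> x)\<^sup>2)"
      unfolding l2_norm_power2 l2_inner_def
      by (intro Bochner_Integration.integral_cong refl) (auto simp: indicator_def power2_eq_square)
    also have "\<dots> \<le> l2_norm L (indicator A) * l2_norm L (\<lambda>x. (\<theta> x)\<^sup>2)"
      using l2_Cauchy_Schwarz[OF il smooth_l2[OF s]] by simp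
    also have "l2_norm L (indicator A) = sqrt (measure L A)"
    proof -
      have "l2_inner L (indicator A) (indicator A) = (\<integral>x. indicator A x \<partial>L)"
        unfolding l2_inner_def by (intro Bochner_Integration.integral_cong refl) (auto simp: indicator_def)
      also have "\<dots> = measure L A" using A sets.sets_into_space[OF A] by (simp add: Int_absorb2)
      finally show ?thesis by (simp add: l2_norm_def)
    qed
    also have "sqrt (measure L A) * l2_norm L (\<lambda>x. (\<theta> x)\<^sup>2) \<le> sqrt (measure L A) * (2 * CP * (vnorm (grad \<theta>))\<^sup>2)"
      by (intro mult_left_mono test_function_fourth_power \<theta>) auto
    also have "\<dots> = (sqrt (2 * CP) * sqrt (sqrt (measure L A)) * vnorm (grad \<theta>))\<^sup>2"
      using CP_pos by (simp add: power_mult_distrib)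
    finally show "(l2_norm L (\<lambda>x. indicator A x * \<theta> x))\<^sup>2 \<le> (sqrt (2 * CP) * sqrt (sqrt (measure L A)) * vnorm (grad \<theta>))\<^sup>2" .
  qed (use CP_pos in auto)
  obtain \<theta> where \<theta>: "H1lim \<theta> f (weak_grad \<Omega> f)" "\<And>n. \<theta> n \<in> test_functions \<Omega>" using H10_E[OF f] by blast
  have fl: "f \<in> l2 L" by (rule H10_l2[OF f])
  have "(\<lambda>n. l2_norm L (\<lambda>x. indicator A x * \<theta> n x)) \<longlonglongrightarrow> l2_norm L (\<lambda>x. indicator A x * f x)"
  proof (rule l2_norm_tendsto)
    show "(\<lambda>x. indicator A x * \<theta> n x) \<in> l2 L" for n by (rule m1[OF test_l2[OF \<theta>(2)]])
    show "(\<lambda>x. indicator A x * f x) \<in> l2 L" by (rule m1[OF fl])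
    show "(\<lambda>n. l2_norm L (\<lambda>x. indicator A x * \<theta> n x - indicator A x * f x)) \<longlonglongrightarrow> 0"
    proof (rule tendsto_sandwich[of "\<lambda>_. 0"])
      show "(\<lambda>n. l2_norm L (\<lambda>x. \<theta> n x - f x)) \<longlonglongrightarrow> 0" using \<theta>(1) by (simp add: H1lim_def)
      show "\<forall>\<^sub>F n in sequentially. l2_norm L (\<lambda>x. indicator A x * \<theta> n x - indicator A x * f x) \<le> l2_norm L (\<lambda>x. \<theta> n x - f x)"
        using m2[OF l2_diff[OF test_l2[OF \<theta>(2)] fl]] by (simp add: right_diff_distrib)
    qed auto
  qed
  moreover have "(\<lambda>n. sqrt (2 * CP) * sqrt (sqrt (measure L A)) * vnorm (grad (\<theta> n)))
      \<longlonglongrightarrow> sqrt (2 * CP) * sqrt (sqrt (measure L A)) * vnorm (weak_grad \<Omega> f)"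
    by (intro tendsto_mult_left H1lim_norm(2)[OF \<theta>(1)])
  ultimately show ?thesis by (rule LIMSEQ_le) (use test \<theta>(2) in auto)
qed

end

section \<open>Convex polygons\<close>

locale polygon = bounded_domain +
  assumes nonempty_domain: "\<Omega> \<noteq> {}" and convex_domain: "convex \<Omega>"
    and polytope_domain: "polytope (closure \<Omega>)"
begin

definition facets :: "(real^2) set set" where
  "facets = {F. F facet_of closure \<Omega>}"

definition facet_line :: "(real^2) set \<Rightarrow> (real^2) \<times> real" where
  "facet_line F = (SOME p. norm (fst p) = 1 \<and> (\<forall>x\<in>closure \<Omega>. 0 \<le> snd p + fst p \<bullet> x) \<and>
     F = {x\<in>closure \<Omega>. snd p + fst p \<bullet> x = 0})"

definition nrm :: "(real^2) set \<Rightarrow> real^2" where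
  "nrm F = fst (facet_line F)"

text \<open>Since \<open>nrm F\<close> is the inward unit normal, this is the distance to the line through \<open>F\<close>,
  with positive sign on the side of the polygon.\<close>

definition dst :: "(real^2) set \<Rightarrow> real^2 \<Rightarrow> real" where
  "dst F x = snd (facet_line F) + nrm F \<bullet> x"

lemma interior_closure_domain: "interior (closure \<Omega>) = \<Omega>"
  using convex_interior_closure[OF convex_domain] open_domain by (simp add: interior_open)

lemma polyhedron_domain: "polyhedron (closure \<Omega>)"
  using polytope_domain by (rule polytope_imp_polyhedron)

lemma finite_facets: "finite facets"
  unfolding facets_def by (rule finite_polyhedron_facets[OF polyhedron_domain])

lemma facet_line_works:
  assumes "F \<in> facets"
  shows "norm (nrm F) = 1" "\<And>x. x \<in> closure \<Omega> \<Longrightarrow> 0 \<le> dst F x" "F = {x\<in>closure \<Omega>. dst F x = 0}"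
proof -
  obtain a b where ab: "a \<noteq> 0" "closure \<Omega> \<subseteq> {x. a \<bullet> x \<le> b}" "F = closure \<Omega> \<inter> {x. a \<bullet> x = b}"
    using facet_of_polyhedron[OF polyhedron_domain, of F] assms by (auto simp: facets_def)
  \<comment> \<open>The supporting inequality \<open>a \<bullet> x \<le> b\<close>, turned inward
    and scaled to a unit normal.\<close>
  let ?p = "((- 1 / norm a) *\<^sub>R a, b / norm a)"
  have e: "snd ?p + fst ?p \<bullet> x = (b - a \<bullet> x) / norm a" for x by (simp add: diff_divide_distrib)
  have "norm (fst ?p) = 1" using ab(1) by simp
  moreover have "\<forall>x\<in>closure \<Omega>. 0 \<le> snd ?p + fst ?p \<bullet> x" unfolding e using ab(2) by auto
  moreover have "F = {x\<in>closure \<Omega>. snd ?p + fst ?p \<bullet> x = 0}" unfolding e using ab(1,3) by auto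
  ultimately have "\<exists>p. norm (fst p) = 1 \<and> (\<forall>x\<in>closure \<Omega>. 0 \<le> snd p + fst p \<bullet> x) \<and>
     F = {x\<in>closure \<Omega>. snd p + fst p \<bullet> x = 0}" by blast
  from someI_ex[OF this] have *: "norm (nrm F) = 1 \<and> (\<forall>x\<in>closure \<Omega>. 0 \<le> dst F x) \<and> F = {x\<in>closure \<Omega>. dst F x = 0}"
    unfolding facet_line_def[symmetric] nrm_def[symmetric] dst_def[symmetric] .
  then show "norm (nrm F) = 1" "\<And>x. x \<in> closure \<Omega> \<Longrightarrow> 0 \<le> dst F x" "F = {x\<in>closure \<Omega>. dst F x = 0}"
    by blast+
qed

lemma dst_affine: "dst F (x + t *\<^sub>R h) = dst F x + t * (nrm F \<bullet> h)"
  by (simp add: dst_def inner_add_right)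

lemma dst_continuous: "continuous_on S (dst F)"
  unfolding dst_def[abs_def] by (intro continuous_intros)

lemma smooth_dst: "smooth (dst F)"
  unfolding dst_def[abs_def] by (rule smooth_affine)

lemma grad_dst: "grad (dst F) x = nrm F"
  unfolding dst_def[abs_def] by (rule grad_affine)

lemma Union_facets: "closure \<Omega> - \<Omega> = \<Union>facets"
proof -
  have "rel_interior (closure \<Omega>) = \<Omega>"
    using rel_interior_nonempty_interior[of "closure \<Omega>"] interior_closure_domain nonempty_domain by simp
  then show ?thesis using rel_boundary_of_polyhedron[OF polyhedron_domain] by (simp add: facets_def)
qed

lemma frontier_domain: "frontier \<Omega> = closure \<Omega> - \<Omega>"
  using open_domain by (simp add: frontier_def interior_open)

lemma dst_pos_domain:
  assumes "F \<in> facets" "x \<in> \<Omega>"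
  shows "0 < dst F x"
proof -
  have c: "x \<in> closure \<Omega>" using assms(2) closure_subset by blast
  have "x \<notin> F" using Union_facets assms by blast
  then have "dst F x \<noteq> 0" using facet_line_works(3)[OF assms(1)] c by blast
  with facet_line_works(2)[OF assms(1) c] show ?thesis by simp
qed

text \<open>Otherwise the segment from an interior point to \<open>x\<close> would leave the polygon
  through some facet. There the affine function \<open>dst F\<close> would vanish before the end of
  the segment, although it is positive at the start and nonnegative at the end.\<close>

lemma dst_nonneg_imp_closure:
  assumes "\<And>F. F \<in> facets \<Longrightarrow> 0 \<le> dst F x"
  shows "x \<in> closure \<Omega>"
proof (rule ccontr)
  assume x: "x \<notin> closure \<Omega>"
  obtain c where c: "c \<in> \<Omega>" using nonempty_domain by blast
  have "closed_segment c x \<inter> frontier \<Omega> \<noteq> {}"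
    by (rule connected_Int_frontier) (use c x closure_subset in auto)
  then obtain p where p: "p \<in> closed_segment c x" "p \<in> closure \<Omega>" "p \<notin> \<Omega>"
    using frontier_domain by blast
  then obtain F where F: "F \<in> facets" "p \<in> F" using Union_facets by blast
  then have z: "dst F p = 0" using facet_line_works(3)[OF F(1)] by blast
  obtain s where s: "0 \<le> s" "s \<le> 1" "p = (1 - s) *\<^sub>R c + s *\<^sub>R x" using p(1) by (auto simp: in_segment)
  have "s < 1" using s x p(2) by (cases "s = 1") auto
  have "p = c + s *\<^sub>R (x - c)" using s(3) by (simp add: algebra_simps)
  then have "dst F p = dst F c + s * (dst F x - dst F c)"
    using dst_affine[of F c s "x - c"] by (simp add: dst_def inner_diff_right)
  then have "0 = (1 - s) * dst F c + s * dst F x" using z by (simp add: algebra_simps)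
  moreover have "0 < (1 - s) * dst F c" using dst_pos_domain[OF F(1) c] \<open>s < 1\<close> by simp
  moreover have "0 \<le> s * dst F x" using assms[OF F(1)] s by simp
  ultimately show False by simp
qed

lemma dst_pos_imp_domain:
  assumes "\<And>F. F \<in> facets \<Longrightarrow> 0 < dst F x"
  shows "x \<in> \<Omega>"
proof (rule ccontr)
  assume "x \<notin> \<Omega>"
  moreover have "x \<in> closure \<Omega>" using dst_nonneg_imp_closure assms by (simp add: less_imp_le)
  ultimately obtain F where F: "F \<in> facets" "x \<in> F" using Union_facets by blast
  then have "dst F x = 0" using facet_line_works(3)[OF F(1)] by blast
  then show False using assms[OF F(1)] by simp
qed

lemma facets_nonempty: "facets \<noteq> {}"
proof
  assume "facets = {}"
  then have "\<Omega> = UNIV" using dst_pos_imp_domain by blast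
  then show False using bounded_domain by simp
qed

text \<open>Ties lie on a bisecting line of two edges. If the normals agree, the two affine
  functions differ by a nonzero constant, since otherwise the facets would coincide, and there are
  no ties at all.\<close>

lemma ties_negligible:
  assumes "F \<in> facets" "G \<in> facets" "F \<noteq> G"
  shows "negligible {x. dst F x = dst G x}"
proof -
  have "{x. dst F x = dst G x} = {x. (nrm F - nrm G) \<bullet> x = snd (facet_line G) - snd (facet_line F)}"
    by (auto simp: dst_def inner_diff_left algebra_simps)
  moreover have "nrm F - nrm G \<noteq> 0 \<or> snd (facet_line G) - snd (facet_line F) \<noteq> 0"
  proof (rule ccontr)
    assume "\<not> ?thesis"
    then have "dst F = dst G" by (auto simp: dst_def)
    then show False using facet_line_works(3)[OF assms(1)] facet_line_works(3)[OF assms(2)] assms(3) by simp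
  qed
  ultimately show ?thesis by (simp only: negligible_hyperplane)
qed

section \<open>Edges and their orientations\<close>

lemma edge_of_iff_facet: "F edge_of closure \<Omega> \<longleftrightarrow> F \<in> facets"
proof -
  have "aff_dim (closure \<Omega>) = 2"
    using aff_dim_nonempty_interior[of "closure \<Omega>"] interior_closure_domain nonempty_domain by simp
  then show ?thesis by (auto simp: edge_of_def facets_def facet_of_def)
qed

lemma facet_segment:
  assumes "F \<in> facets"
  obtains p q where "p \<noteq> q" "F = closed_segment p q"
proof -
  have F: "F face_of closure \<Omega>" "aff_dim F = 1"
    using assms edge_of_iff_facet[of F] by (auto simp: edge_of_def)
  have "polytope F" using face_of_polytope_polytope[OF polytope_domain F(1)] .
  moreover have "F \<noteq> {}" using F(2) by auto
  moreover have "collinear F" using F(2) by (simp add: collinear_aff_dim)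
  ultimately obtain p q where pq: "F = closed_segment p q"
    using compact_convex_collinear_segment[of F] polytope_imp_compact polytope_imp_convex by blast
  then have "p \<noteq> q" using F(2) by auto
  then show ?thesis using that pq by blast
qed

definition ends :: "(real^2) set \<Rightarrow> (real^2) \<times> (real^2)" where
  "ends F = (SOME p. fst p \<noteq> snd p \<and> F = closed_segment (fst p) (snd p))"

lemma ends_works:
  assumes "F \<in> facets"
  shows "fst (ends F) \<noteq> snd (ends F)" "F = closed_segment (fst (ends F)) (snd (ends F))"
proof -
  have "\<exists>p. fst p \<noteq> snd p \<and> F = closed_segment (fst p) (snd p)"
    using facet_segment[OF assms] by (metis fst_conv snd_conv)
  from someI_ex[OF this]
  show "fst (ends F) \<noteq> snd (ends F)" "F = closed_segment (fst (ends F)) (snd (ends F))"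
    by (simp_all add: ends_def)
qed

lemma edge_ends_eq: "edge_ends \<Omega> = ends ` facets \<union> prod.swap ` ends ` facets"
proof (intro set_eqI iffI)
  fix e assume "e \<in> edge_ends \<Omega>"
  then obtain p q where e: "e = (p, q)" and F: "closed_segment p q \<in> facets"
    by (auto simp: edge_ends_def edge_of_iff_facet)
  have "{p, q} = {fst (ends (closed_segment p q)), snd (ends (closed_segment p q))}"
    using ends_works(2)[OF F] closed_segment_eq by metis
  then have "ends (closed_segment p q) = (p, q) \<or> ends (closed_segment p q) = (q, p)"
    by (auto simp: doubleton_eq_iff prod_eq_iff)
  then show "e \<in> ends ` facets \<union> prod.swap ` ends ` facets"
    using e F by (metis UnCI image_eqI swap_simp)
next
  fix e assume "e \<in> ends ` facets \<union> prod.swap ` ends ` facets"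
  then obtain F where F: "F \<in> facets" and e: "e = ends F \<or> e = prod.swap (ends F)" by blast
  have "closed_segment (fst e) (snd e) = F"
    using e ends_works(2)[OF F] closed_segment_commute by (metis fst_swap snd_swap)
  then show "e \<in> edge_ends \<Omega>" using F by (auto simp: edge_ends_def edge_of_iff_facet split: prod.splits)
qed

lemma finite_edge_ends: "finite (edge_ends \<Omega>)"
  using finite_facets by (simp add: edge_ends_eq)

text \<open>Each facet is hit by exactly two oriented pairs, because its end points are distinct and
  determine it. The factor 1/2 in \<open>bdry\<close> compensates for this.\<close>

lemma sum_edge_ends:
  fixes g :: "_ \<Rightarrow> real"
  shows "(\<Sum>e\<in>edge_ends \<Omega>. g e) = (\<Sum>F\<in>facets. g (ends F) + g (prod.swap (ends F)))"
proof -
  have inj: "inj_on ends facets" using ends_works(2) by (metis inj_onI)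
  have neq: "ends F \<noteq> prod.swap (ends G)" if "F \<in> facets" "G \<in> facets" for F G
  proof
    assume eq: "ends F = prod.swap (ends G)"
    have "F = closed_segment (snd (ends G)) (fst (ends G))" using ends_works(2)[OF that(1)] eq by simp
    then have "F = G" using ends_works(2)[OF that(2)] closed_segment_commute by metis
    then show False using eq ends_works(1)[OF that(2)] by (metis fst_swap)
  qed
  have "e \<noteq> e'" if "e \<in> ends ` facets" "e' \<in> prod.swap ` ends ` facets" for e e'
  proof -
    from that(1) obtain F where F: "F \<in> facets" "e = ends F" by (rule imageE)
    from that(2) obtain G where G: "G \<in> facets" "e' = prod.swap (ends G)" by (auto simp only: image_iff)
    show ?thesis using neq[OF F(1) G(1)] F(2) G(2) by simp
  qed
  then have disj: "ends ` facets \<inter> prod.swap ` ends ` facets = {}" by blast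
  have "inj_on (prod.swap \<circ> ends) facets" using inj by (simp add: comp_inj_on)
  then have "(\<Sum>e\<in>prod.swap ` ends ` facets. g e) = (\<Sum>F\<in>facets. g (prod.swap (ends F)))"
    by (simp add: image_comp sum.reindex comp_def)
  then show ?thesis
    unfolding edge_ends_eq using finite_facets disj inj
    by (simp add: sum.union_disjoint sum.reindex sum.distrib)
qed

section \<open>The boundary measure\<close>

abbreviation "\<Gamma> \<equiv> bdry \<Omega>"

definition seg_int :: "(real^2 \<Rightarrow> real) \<Rightarrow> (real^2) \<times> (real^2) \<Rightarrow> real" where
  "seg_int f e = dist (fst e) (snd e) * (\<integral>t. indicator {0..1} t * f (linepath (fst e) (snd e) t) \<partial>lborel)"

lemma linepath_in_frontier:
  assumes "e \<in> edge_ends \<Omega>" "t \<in> {0..1}"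
  shows "linepath (fst e) (snd e) t \<in> frontier \<Omega>"
proof -
  have "closed_segment (fst e) (snd e) \<in> facets"
    using assms(1) by (auto simp: edge_ends_def edge_of_iff_facet)
  moreover have "linepath (fst e) (snd e) t \<in> closed_segment (fst e) (snd e)"
    using assms(2) linepath_in_path by auto
  ultimately show ?thesis unfolding frontier_domain Union_facets by blast
qed

lemma linepath_borel: "(\<lambda>t. linepath p q t :: real^2) \<in> borel_measurable borel"
  by (intro borel_measurable_continuous_onI continuous_on_linepath)

lemma space_bdry: "space \<Gamma> = frontier \<Omega>" and sets_bdry: "sets \<Gamma> = sets (restrict_space borel (frontier \<Omega>))"
  by (simp_all add: bdry_def space_restrict_space)

lemma borel_imp_bdry: "f \<in> borel_measurable borel \<Longrightarrow> f \<in> borel_measurable \<Gamma>"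
  unfolding measurable_cong_sets[OF sets_bdry refl] by (rule measurable_restrict_space1)

text \<open>Unwinds image measure, density and product measure; the counting measure lives on
  finitely many oriented edges, so the outer integral is a sum.\<close>

lemma nn_integral_bdry:
  assumes f: "f \<in> borel_measurable borel"
  shows "(\<integral>\<^sup>+x. f x \<partial>\<Gamma>) = (\<Sum>e\<in>edge_ends \<Omega>. \<integral>\<^sup>+t. ennreal (dist (fst e) (snd e) / 2) * f (linepath (fst e) (snd e) t)
      * indicator {0..1} t \<partial>lborel)"
proof -
  let ?I = "restrict_space lborel {0..1::real}"
  let ?P = "count_space (edge_ends \<Omega>) \<Otimes>\<^sub>M ?I"
  let ?w = "\<lambda>((p, q), t). ennreal (dist p q / 2)"
  let ?h = "\<lambda>((p, q), t). linepath p q t"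
  have ce: "countable (edge_ends \<Omega>)" using finite_edge_ends by (rule countable_finite)
  have w: "?w \<in> borel_measurable ?P"
    by (rule measurable_pair_measure_countable1[OF ce]) (auto split: prod.splits)
  have h: "?h \<in> ?P \<rightarrow>\<^sub>M restrict_space borel (frontier \<Omega>)"
  proof (rule measurable_pair_measure_countable1[OF ce])
    fix e assume e: "e \<in> edge_ends \<Omega>"
    have "(\<lambda>t. linepath (fst e) (snd e) t) \<in> ?I \<rightarrow>\<^sub>M restrict_space borel (frontier \<Omega>)"
    proof (rule measurable_restrict_space2)
      show "(\<lambda>t. linepath (fst e) (snd e) t) \<in> space ?I \<rightarrow> frontier \<Omega>"
        using linepath_in_frontier[OF e] by (auto simp: space_restrict_space)
      show "(\<lambda>t. linepath (fst e) (snd e) t) \<in> borel_measurable ?I"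
        by (rule measurable_restrict_space1) (simp add: linepath_borel)
    qed
    then show "(\<lambda>t. ?h (e, t)) \<in> ?I \<rightarrow>\<^sub>M restrict_space borel (frontier \<Omega>)"
      by (simp add: split_beta)
  qed
  have f': "f \<in> borel_measurable (restrict_space borel (frontier \<Omega>))"
    by (rule measurable_restrict_space1[OF f])
  have fh: "(\<lambda>x. f (?h x)) \<in> borel_measurable ?P" using measurable_compose[OF h f'] .
  have sI: "sigma_finite_measure ?I"
    by (rule finite_measure.axioms(1), rule finite_measureI) (simp add: emeasure_restrict_space space_restrict_space)
  have "(\<integral>\<^sup>+x. f x \<partial>\<Gamma>) = (\<integral>\<^sup>+x. f (?h x) \<partial>density ?P ?w)"
    unfolding bdry_def by (rule nn_integral_distr) (use h f' in auto)
  also have "\<dots> = (\<integral>\<^sup>+x. ?w x * f (?h x) \<partial>?P)" by (rule nn_integral_density[OF w fh])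
  also have "\<dots> = (\<integral>\<^sup>+e. \<integral>\<^sup>+t. ?w (e, t) * f (?h (e, t)) \<partial>?I \<partial>count_space (edge_ends \<Omega>))"
    by (rule sigma_finite_measure.nn_integral_fst[OF sI, symmetric]) (use w fh in \<open>auto intro: borel_measurable_times_ennreal\<close>)
  also have "\<dots> = (\<Sum>e\<in>edge_ends \<Omega>. \<integral>\<^sup>+t. ?w (e, t) * f (?h (e, t)) \<partial>?I)"
    by (rule nn_integral_count_space_finite[OF finite_edge_ends])
  also have "\<dots> = (\<Sum>e\<in>edge_ends \<Omega>. \<integral>\<^sup>+t. ennreal (dist (fst e) (snd e) / 2) * f (linepath (fst e) (snd e) t)
      * indicator {0..1} t \<partial>lborel)"
    by (intro sum.cong refl, subst nn_integral_restrict_space) (auto simp: split_beta)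
  finally show ?thesis .
qed

lemma finite_bdry: "finite_measure \<Gamma>"
proof (rule finite_measureI)
  have "emeasure \<Gamma> (space \<Gamma>) = (\<integral>\<^sup>+x. 1 \<partial>\<Gamma>)" by simp
  also have "\<dots> = (\<Sum>e\<in>edge_ends \<Omega>. ennreal (dist (fst e) (snd e) / 2))"
    by (subst nn_integral_bdry) (simp_all add: nn_integral_cmult)
  also have "\<dots> \<noteq> \<infinity>" using finite_edge_ends by (simp add: sum_ennreal)
  finally show "emeasure \<Gamma> (space \<Gamma>) \<noteq> \<infinity>" .
qed

lemma compact_frontier_domain: "compact (frontier \<Omega>)"
  using bounded_domain by (simp add: compact_frontier_bounded)

lemma continuous_integrable_bdry:
  fixes f :: "_ \<Rightarrow> real"
  assumes "continuous_on UNIV f"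
  obtains C where "\<And>x. x \<in> frontier \<Omega> \<Longrightarrow> \<bar>f x\<bar> \<le> C" "integrable \<Gamma> f"
proof -
  have "compact (f ` frontier \<Omega>)"
    using compact_continuous_image[OF continuous_on_subset[OF assms] compact_frontier_domain] by simp
  then obtain C where C: "\<And>x. x \<in> frontier \<Omega> \<Longrightarrow> \<bar>f x\<bar> \<le> C"
    using compact_imp_bounded by (fastforce simp: bounded_iff)
  have "integrable \<Gamma> f"
    by (rule finite_measure.integrable_const_bound[OF finite_bdry, of _ C])
      (use C assms in \<open>auto simp: space_bdry intro!: borel_imp_bdry borel_measurable_continuous_onI\<close>)
  then show ?thesis using that C by blast
qed

lemma continuous_l2_bdry:
  assumes "continuous_on UNIV f" shows "f \<in> l2 \<Gamma>"
proof -
  obtain C where "\<And>x. x \<in> frontier \<Omega> \<Longrightarrow> \<bar>f x\<bar> \<le> C" using continuous_integrable_bdry[OF assms] by blast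
  then show ?thesis using assms
    by (intro l2_bounded[OF finite_bdry, of _ C]) (auto simp: space_bdry intro!: borel_imp_bdry borel_measurable_continuous_onI)
qed

lemma smooth_l2_bdry: "smooth f \<Longrightarrow> f \<in> l2 \<Gamma>"
  by (intro continuous_l2_bdry smooth_continuous)

text \<open>Nonnegativity lets the computation run through \<open>nn_integral_bdry\<close>; each
  facet then contributes the mean over its two orientations.\<close>

lemma integral_bdry:
  assumes f: "continuous_on UNIV f" and pos: "\<And>x. 0 \<le> f x"
  shows "(\<integral>x. f x \<partial>\<Gamma>) = (\<Sum>F\<in>facets. (seg_int f (ends F) + seg_int f (prod.swap (ends F))) / 2)"
proof -
  have i: "integrable \<Gamma> f" using continuous_integrable_bdry[OF f] by blast
  have fb[measurable]: "f \<in> borel_measurable borel" using f by (rule borel_measurable_continuous_onI)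
  have seg: "(\<integral>\<^sup>+t. ennreal (dist (fst e) (snd e) / 2) * ennreal (f (linepath (fst e) (snd e) t)) * indicator {0..1} t \<partial>lborel)
     = ennreal (seg_int f e / 2)" for e
  proof -
    let ?g = "\<lambda>t. indicator {0..1} t * f (linepath (fst e) (snd e) t)"
    have "continuous_on {0..1} (\<lambda>t. f (linepath (fst e) (snd e) t))"
      by (rule continuous_on_compose2[OF f continuous_on_linepath]) auto
    then have gi: "integrable lborel ?g"
      using borel_integrable_compact[of "{0..1::real}" "\<lambda>t. f (linepath (fst e) (snd e) t)"] by simp
    have "(\<integral>\<^sup>+t. ennreal (dist (fst e) (snd e) / 2) * ennreal (f (linepath (fst e) (snd e) t)) * indicator {0..1} t \<partial>lborel)
      = (\<integral>\<^sup>+t. ennreal (dist (fst e) (snd e) / 2 * ?g t) \<partial>lborel)"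
      using pos by (intro nn_integral_cong) (auto simp: indicator_def simp flip: ennreal_mult)
    also have "\<dots> = ennreal (\<integral>t. dist (fst e) (snd e) / 2 * ?g t \<partial>lborel)"
      by (rule nn_integral_eq_integral) (use gi pos in auto)
    also have "(\<integral>t. dist (fst e) (snd e) / 2 * ?g t \<partial>lborel) = seg_int f e / 2"
      by (simp add: seg_int_def)
    finally show ?thesis .
  qed
  have sp: "0 \<le> seg_int f e" for e
    unfolding seg_int_def by (intro mult_nonneg_nonneg integral_nonneg) (use pos in auto)
  have "ennreal (\<integral>x. f x \<partial>\<Gamma>) = (\<integral>\<^sup>+x. ennreal (f x) \<partial>\<Gamma>)"
    by (rule nn_integral_eq_integral[symmetric, OF i]) (use pos in auto)
  also have "\<dots> = (\<Sum>e\<in>edge_ends \<Omega>. ennreal (seg_int f e / 2))"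
    by (subst nn_integral_bdry) (simp_all add: seg)
  also have "\<dots> = ennreal (\<Sum>e\<in>edge_ends \<Omega>. seg_int f e / 2)"
    using sp by (intro sum_ennreal) simp
  finally have "(\<integral>x. f x \<partial>\<Gamma>) = (\<Sum>e\<in>edge_ends \<Omega>. seg_int f e / 2)"
    using sp pos by (subst (asm) ennreal_inj) (auto intro!: sum_nonneg integral_nonneg)
  then show ?thesis by (simp add: sum_edge_ends add_divide_distrib)
qed

end

lemma l2_mult_tendsto:
  assumes f: "\<And>n. f n \<in> l2 M" "f0 \<in> l2 M" "(\<lambda>n. l2_norm M (\<lambda>x. f n x - f0 x)) \<longlonglongrightarrow> 0"
    and h: "h \<in> borel_measurable M" "AE x in M. \<bar>h x\<bar> \<le> C"
  shows "(\<lambda>n. l2_norm M (\<lambda>x. h x * f n x - h x * f0 x)) \<longlonglongrightarrow> 0"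
proof (rule tendsto_sandwich[of "\<lambda>_. 0"])
  have "l2_norm M (\<lambda>x. h x * f n x - h x * f0 x) \<le> \<bar>C\<bar> * l2_norm M (\<lambda>x. f n x - f0 x)" for n
  proof (rule l2_norm_mono[OF l2_diff[OF f(1,2)]])
    show "(\<lambda>x. h x * f n x - h x * f0 x) \<in> borel_measurable M"
      using h(1) f l2_measurable by measurable
    show "AE x in M. \<bar>h x * f n x - h x * f0 x\<bar> \<le> \<bar>C\<bar> * \<bar>f n x - f0 x\<bar>"
      using h(2)
    proof eventually_elim
      case (elim x)
      then have "\<bar>h x\<bar> \<le> \<bar>C\<bar>" by linarith
      then show ?case by (simp add: abs_mult mult_right_mono flip: right_diff_distrib)
    qed
  qed auto
  then show "\<forall>\<^sub>F n in sequentially. l2_norm M (\<lambda>x. h x * f n x - h x * f0 x) \<le> \<bar>C\<bar> * l2_norm M (\<lambda>x. f n x - f0 x)"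
    by simp
  show "(\<lambda>n. \<bar>C\<bar> * l2_norm M (\<lambda>x. f n x - f0 x)) \<longlonglongrightarrow> 0" by (intro tendsto_mult_right_zero f)
qed auto

section \<open>The boundary inequality\<close>

context polygon
begin

text \<open>A bound for all edge distances, which keeps the factors \<open>Hb - dst F x\<close>
  nonnegative in the domain. Its square root becomes the norm bound of \<open>S_op\<close> and
  \<open>S_adj\<close>.\<close>

definition Hb :: real where
  "Hb = (SOME H. 0 < H \<and> (\<forall>F\<in>facets. \<forall>x\<in>\<Omega>. dst F x \<le> H))"

lemma Hb_pos: "0 < Hb" and dst_le_Hb: "F \<in> facets \<Longrightarrow> x \<in> \<Omega> \<Longrightarrow> dst F x \<le> Hb"
proof -
  have "\<exists>C. \<forall>x\<in>\<Omega>. dst F x \<le> C" for F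
    using continuous_bounded[OF dst_continuous[of UNIV F]] by (metis abs_le_D1 real_norm_def)
  then obtain C where C: "\<And>F x. x \<in> \<Omega> \<Longrightarrow> dst F x \<le> C F" by metis
  let ?H = "(\<Sum>F\<in>facets. \<bar>C F\<bar>) + 1"
  have "0 < ?H" by (simp add: add_nonneg_pos sum_nonneg)
  moreover have "dst F x \<le> ?H" if "F \<in> facets" "x \<in> \<Omega>" for F x
  proof -
    have "\<bar>C F\<bar> \<le> (\<Sum>F\<in>facets. \<bar>C F\<bar>)" by (rule member_le_sum) (use that finite_facets in auto)
    then show ?thesis using C[OF that(2), of F] by linarith
  qed
  ultimately have "\<exists>H. 0 < H \<and> (\<forall>F\<in>facets. \<forall>x\<in>\<Omega>. dst F x \<le> H)" by blast
  from someI_ex[OF this] show "0 < Hb" "F \<in> facets \<Longrightarrow> x \<in> \<Omega> \<Longrightarrow> dst F x \<le> Hb"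
    by (auto simp: Hb_def)
qed

text \<open>The points whose nearest boundary line is that of \<open>F\<close>. Points with ties
  belong to several regions, which the estimates below tolerate.\<close>

definition region :: "(real^2) set \<Rightarrow> (real^2) set" where
  "region F = {x\<in>\<Omega>. \<forall>G\<in>facets. dst F x \<le> dst G x}"

lemma region_borel: "region F \<in> sets borel"
proof -
  have "region F = \<Omega> \<inter> (\<Inter>G\<in>facets. {x. dst F x \<le> dst G x})" by (auto simp: region_def)
  also have "\<dots> \<in> sets borel"
    by (rule sets.Int[OF borel_open[OF open_domain]], intro borel_closed closed_INT ballI closed_Collect_le dst_continuous)
  finally show ?thesis .
qed

lemma region_cover:
  assumes "x \<in> \<Omega>"
  obtains F where "F \<in> facets" "x \<in> region F"
proof -
  let ?D = "(\<lambda>F. dst F x) ` facets"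
  have fin: "finite ?D" "?D \<noteq> {}" using finite_facets facets_nonempty by auto
  obtain F where F: "F \<in> facets" "Min ?D = dst F x" using Min_in[OF fin] by blast
  have "dst F x \<le> dst G x" if "G \<in> facets" for G
    using Min_le[OF fin(1), of "dst G x"] that F(2) by simp
  then show ?thesis using that[OF F(1)] assms by (simp add: region_def)
qed

lemma region_integrable:
  fixes f :: "_ \<Rightarrow> real"
  assumes "continuous_on UNIV f"
  shows "integrable lborel (\<lambda>x. indicator (region F) x * f x)"
proof -
  have "integrable lborel (\<lambda>x. indicator (closure \<Omega>) x *\<^sub>R f x)"
    by (rule borel_integrable_compact) (use bounded_domain assms in \<open>auto intro: continuous_on_subset\<close>)
  from integrable_mult_indicator[OF _ this, of "region F"]
  have "integrable lborel (\<lambda>x. indicator (region F) x *\<^sub>R indicator (closure \<Omega>) x *\<^sub>R f x)"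
    using region_borel by simp
  moreover have "region F \<subseteq> closure \<Omega>" using closure_subset by (auto simp: region_def)
  then have "(\<lambda>x. indicator (region F) x *\<^sub>R indicator (closure \<Omega>) x *\<^sub>R f x) = (\<lambda>x. indicator (region F) x * f x)"
    by (intro ext) (auto split: split_indicator)
  ultimately show ?thesis by simp
qed

text \<open>The foot of the perpendicular from a point of the region of \<open>F\<close> to the line through \<open>F\<close>
  lies in \<open>F\<close>, because the disc around that point touching the line is contained in the polygon.\<close>

lemma region_foot:
  assumes F: "F \<in> facets" and y: "dst F y = 0" and t: "y + t *\<^sub>R nrm F \<in> region F"
  shows "0 < t" "t \<le> Hb" "y \<in> F" "\<And>t'. 0 < t' \<Longrightarrow> t' \<le> t \<Longrightarrow> y + t' *\<^sub>R nrm F \<in> region F"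
proof -
  have n1: "nrm G \<bullet> nrm G = 1" if "G \<in> facets" for G
    using facet_line_works(1)[OF that] by (simp add: norm_eq_1)
  have dF: "dst F (y + s *\<^sub>R nrm F) = s" for s using y n1[OF F] by (simp add: dst_affine)
  show t0: "0 < t" using dst_pos_domain[OF F, of "y + t *\<^sub>R nrm F"] t dF by (simp add: region_def)
  show "t \<le> Hb" using dst_le_Hb[OF F, of "y + t *\<^sub>R nrm F"] t dF by (simp add: region_def)
  have le: "t \<le> dst G y + t * (nrm G \<bullet> nrm F)" if "G \<in> facets" for G
    using t that dF[of t] by (auto simp: region_def dst_affine)
  \<comment> \<open>Moving by \<open>t\<close> along a unit normal changes \<open>dst G\<close> by
    at most \<open>t\<close>, and at the end of the move it is at least \<open>t\<close>.\<close>
  have y0: "0 \<le> dst G y" if G: "G \<in> facets" for G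
  proof -
    have "nrm G \<bullet> nrm F \<le> 1"
      using norm_cauchy_schwarz[of "nrm G" "nrm F"] facet_line_works(1)[OF G] facet_line_works(1)[OF F] by simp
    then have "t * (nrm G \<bullet> nrm F) \<le> t * 1" using t0 by (intro mult_left_mono) auto
    then show ?thesis using le[OF G] by simp
  qed
  then have "y \<in> closure \<Omega>" by (rule dst_nonneg_imp_closure)
  then show "y \<in> F" using facet_line_works(3)[OF F] y by blast
  fix t' :: real assume t': "0 < t'" "t' \<le> t"
  \<comment> \<open>Along the normal \<open>dst G\<close> is affine, nonnegative at the foot and at
    least \<open>t\<close> at parameter \<open>t\<close>; hence it is at least \<open>t'\<close> at
    parameter \<open>t'\<close>.\<close>
  have *: "t' \<le> dst G (y + t' *\<^sub>R nrm F)" if G: "G \<in> facets" for G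
  proof -
    have "t' * t \<le> t' * (dst G y + t * (nrm G \<bullet> nrm F))" using le[OF G] t' by (intro mult_left_mono) auto
    also have "\<dots> \<le> t * dst G y + t * (t' * (nrm G \<bullet> nrm F))"
      using mult_right_mono[OF t'(2) y0[OF G]] by (simp add: algebra_simps)
    finally have "t * t' \<le> t * dst G (y + t' *\<^sub>R nrm F)" by (simp add: dst_affine algebra_simps)
    then show ?thesis using t0 by simp
  qed
  then have "y + t' *\<^sub>R nrm F \<in> \<Omega>" using dst_pos_imp_domain[of "y + t' *\<^sub>R nrm F"] t'(1) by force
  then show "y + t' *\<^sub>R nrm F \<in> region F" using * dF by (simp add: region_def)
qed

text \<open>Fubini's theorem in the frame of the edge, with \<open>fst e\<close> as origin. Over
  each point of the edge the region is a possibly empty initial piece of the normal ray, where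
  \<open>ray_integral_ge\<close> applies; over the other points of the line it is empty by
  \<open>region_foot\<close>. The orientation of \<open>e\<close> is arbitrary.\<close>

lemma fibre_inequality:
  assumes F: "F \<in> facets" and e: "fst e \<noteq> snd e" "F = closed_segment (fst e) (snd e)"
    and sm: "smooth f" and pos: "\<And>x. 0 \<le> f x"
  shows "- Hb * seg_int f e \<le> (\<integral>x. indicator (region F) x * ((Hb - dst F x) * (grad f x \<bullet> nrm F) - f x) \<partial>lborel)"
proof -
  define p where "p = fst e"
  define q where "q = snd e"
  define d where "d = dist p q"
  define \<tau> where "\<tau> = (1 / d) *\<^sub>R (q - p)"
  let ?n = "nrm F"
  have d: "0 < d" using e(1) by (simp add: d_def p_def q_def)
  have \<tau>1: "norm \<tau> = 1" using d by (simp add: \<tau>_def d_def dist_norm norm_minus_commute)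
  have n1: "norm ?n = 1" by (rule facet_line_works(1)[OF F])
  have "p \<in> F" "q \<in> F" using e by (auto simp: p_def q_def)
  then have pz: "dst F p = 0" and qz: "dst F q = 0" using facet_line_works(3)[OF F] by blast+
  have \<tau>n: "\<tau> \<bullet> ?n = 0"
    using pz qz by (simp add: \<tau>_def dst_def inner_diff_right inner_commute[of _ ?n])
  have yz: "dst F (p + s *\<^sub>R \<tau>) = 0" for s
    using pz \<tau>n by (simp add: dst_affine inner_commute[of ?n])
  let ?X = "\<lambda>x. (Hb - dst F x) * (grad f x \<bullet> ?n) - f x"
  have Xc: "continuous_on UNIV ?X"
    by (intro continuous_intros dst_continuous grad_continuous smooth_continuous sm)
  define \<Phi> where "\<Phi> s = (\<integral>t. indicator (region F) (p + s *\<^sub>R \<tau> + t *\<^sub>R ?n) * ?X (p + s *\<^sub>R \<tau> + t *\<^sub>R ?n) \<partial>lborel)" for s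
  note fr = frame_integral[OF \<tau>1 n1 \<tau>n region_integrable[OF Xc, of F], of p]
  have \<Phi>i: "integrable lborel \<Phi>" and \<Phi>eq: "(\<integral>x. indicator (region F) x * ?X x \<partial>lborel) = (\<integral>s. \<Phi> s \<partial>lborel)"
    using fr unfolding \<Phi>_def by simp_all
  have fc: "continuous_on S (\<lambda>s. f (p + s *\<^sub>R \<tau>))" for S by (rule smooth_line_continuous[OF sm])
  have lower: "- Hb * (indicator {0..d} s * f (p + s *\<^sub>R \<tau>)) \<le> \<Phi> s" for s
  proof -
    define J where "J = {t. p + s *\<^sub>R \<tau> + t *\<^sub>R ?n \<in> region F}"
    note foot = region_foot[OF F yz[of s]]
    have "\<Phi> s = (\<integral>t. indicator J t * ((Hb - t) * (grad f (p + s *\<^sub>R \<tau> + t *\<^sub>R ?n) \<bullet> ?n) - f (p + s *\<^sub>R \<tau> + t *\<^sub>R ?n)) \<partial>lborel)"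
      unfolding \<Phi>_def
      by (intro Bochner_Integration.integral_cong refl)
        (use yz[of s] n1 in \<open>auto simp: indicator_def J_def dst_affine[of F "p + s *\<^sub>R \<tau>"] norm_eq_1\<close>)
    moreover have "- Hb * f (p + s *\<^sub>R \<tau>) \<le>
      (\<integral>t. indicator J t * ((Hb - t) * (grad f (p + s *\<^sub>R \<tau> + t *\<^sub>R ?n) \<bullet> ?n) - f (p + s *\<^sub>R \<tau> + t *\<^sub>R ?n)) \<partial>lborel)"
    proof (rule ray_integral_ge[OF sm pos])
      show "J \<subseteq> {0<..Hb}" using foot(1,2) by (auto simp: J_def)
      show "t' \<in> J" if "t \<in> J" "0 < t'" "t' \<le> t" for t t'
        using foot(4)[of t t'] that by (simp add: J_def)
    qed (use Hb_pos in simp)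
    moreover have "\<Phi> s = 0" if "s \<notin> {0..d}"
    proof -
      have "p + s *\<^sub>R \<tau> + t *\<^sub>R ?n \<notin> region F" for t
      proof
        assume "p + s *\<^sub>R \<tau> + t *\<^sub>R ?n \<in> region F"
        from foot(3)[OF this] have "p + s *\<^sub>R \<tau> \<in> closed_segment p q" using e(2) by (simp add: p_def q_def)
        then obtain u where u: "0 \<le> u" "u \<le> 1" "p + s *\<^sub>R \<tau> = (1 - u) *\<^sub>R p + u *\<^sub>R q" by (auto simp: in_segment)
        have qp: "q - p = d *\<^sub>R \<tau>" using d by (simp add: \<tau>_def)
        have "(1 - u) *\<^sub>R p + u *\<^sub>R q = p + u *\<^sub>R (q - p)" by (simp add: algebra_simps)
        then have "p + s *\<^sub>R \<tau> = p + (u * d) *\<^sub>R \<tau>" using u(3) qp by simp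
        then have "s = u * d" using \<tau>1 by (metis add_left_cancel norm_zero scaleR_right_imp_eq zero_neq_one)
        then show False using that u d by (simp add: mult_le_cancel_right1 mult_left_le_one_le)
      qed
      then show ?thesis by (simp add: \<Phi>_def)
    qed
    ultimately show ?thesis by (cases "s \<in> {0..d}") auto
  qed
  have bi: "integrable lborel (\<lambda>s. indicator {0..d} s * f (p + s *\<^sub>R \<tau>))"
    using borel_integrable_compact[of "{0..d}" "\<lambda>s. f (p + s *\<^sub>R \<tau>)"] fc by simp
  \<comment> \<open>Passing from arc length to the parameter of \<open>linepath\<close> produces the
    factor \<open>dist\<close> in \<open>seg_int\<close>.\<close>
  have "(\<integral>s. indicator {0..d} s * f (p + s *\<^sub>R \<tau>) \<partial>lborel) = d * (\<integral>t. indicator {0..d} (d * t) * f (p + (d * t) *\<^sub>R \<tau>) \<partial>lborel)"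
    using d by (subst lborel_integral_real_affine[where c = d and t = 0]) auto
  also have "(\<integral>t. indicator {0..d} (d * t) * f (p + (d * t) *\<^sub>R \<tau>) \<partial>lborel) = (\<integral>t. indicator {0..1} t * f (linepath p q t) \<partial>lborel)"
  proof (intro Bochner_Integration.integral_cong refl)
    fix t
    have "(indicator {0..d} (d * t) :: real) = indicator {0..1} t"
      using d by (auto simp: indicator_def zero_le_mult_iff)
    moreover have "p + (d * t) *\<^sub>R \<tau> = linepath p q t"
      using d by (simp add: \<tau>_def linepath_def algebra_simps)
    ultimately show "indicator {0..d} (d * t) * f (p + (d * t) *\<^sub>R \<tau>) = indicator {0..1} t * f (linepath p q t)" by simp
  qed
  finally have "seg_int f e = (\<integral>s. indicator {0..d} s * f (p + s *\<^sub>R \<tau>) \<partial>lborel)"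
    by (simp add: seg_int_def p_def q_def d_def)
  then have "- Hb * seg_int f e = (\<integral>s. - Hb * (indicator {0..d} s * f (p + s *\<^sub>R \<tau>)) \<partial>lborel)" by simp
  also have "\<dots> \<le> (\<integral>s. \<Phi> s \<partial>lborel)"
    by (rule integral_mono) (use bi \<Phi>i lower in auto)
  finally show ?thesis using \<Phi>eq by simp
qed

text \<open>The almost everywhere gradient of \<open>H m - m\<^sup>2/2\<close> for the distance \<open>m\<close> to the boundary.\<close>

definition qf :: "real^2 \<Rightarrow> real^2" where
  "qf x = (\<Sum>F\<in>facets. (indicator (region F) x * (Hb - dst F x)) *\<^sub>R nrm F)"

text \<open>Formally this is Green's formula for \<open>f\<close> and the weight, whose Laplacian is
  at most -1 and whose inward slope on the boundary is \<open>Hb\<close>. It is obtained by summing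
  the fibre estimates over all facets.\<close>

lemma boundary_inequality:
  assumes sm: "smooth f" and pos: "\<And>x. 0 \<le> f x"
  shows "(\<integral>x. f x \<partial>L) - Hb * (\<integral>x. f x \<partial>\<Gamma>) \<le> (\<integral>x. grad f x \<bullet> qf x \<partial>L)"
proof -
  define A where "A F = (\<integral>x. indicator (region F) x * ((Hb - dst F x) * (grad f x \<bullet> nrm F)) \<partial>lborel)" for F
  define B where "B F = (\<integral>x. indicator (region F) x * f x \<partial>lborel)" for F
  have c1: "continuous_on UNIV (\<lambda>x. (Hb - dst F x) * (grad f x \<bullet> nrm F))" for F
    by (intro continuous_intros dst_continuous grad_continuous sm)
  have fc: "continuous_on UNIV f" by (rule smooth_continuous[OF sm])
  note i1 = region_integrable[OF c1] and i2 = region_integrable[OF fc]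
  \<comment> \<open>Both orientations satisfy the fibre estimate, hence so does their mean, which is
    the share of \<open>F\<close> in the boundary integral.\<close>
  have "- Hb * ((seg_int f (ends F) + seg_int f (prod.swap (ends F))) / 2) \<le> A F - B F" if F: "F \<in> facets" for F
  proof -
    have AB: "A F - B F = (\<integral>x. indicator (region F) x * ((Hb - dst F x) * (grad f x \<bullet> nrm F) - f x) \<partial>lborel)"
      unfolding A_def B_def using i1[of F F] i2[of F] by (simp add: right_diff_distrib)
    have "- Hb * seg_int f (ends F) \<le> A F - B F"
      unfolding AB using ends_works[OF F] by (intro fibre_inequality[OF F _ _ sm pos])
    moreover have "- Hb * seg_int f (prod.swap (ends F)) \<le> A F - B F"
      unfolding AB using ends_works[OF F]
      by (intro fibre_inequality[OF F _ _ sm pos]) (auto simp: closed_segment_commute)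
    ultimately show ?thesis by (simp add: field_simps)
  qed
  then have "(\<Sum>F\<in>facets. - Hb * ((seg_int f (ends F) + seg_int f (prod.swap (ends F))) / 2)) \<le> (\<Sum>F\<in>facets. A F - B F)"
    by (rule sum_mono)
  then have 1: "- Hb * (\<integral>x. f x \<partial>\<Gamma>) \<le> (\<Sum>F\<in>facets. A F) - (\<Sum>F\<in>facets. B F)"
    unfolding integral_bdry[OF fc pos] by (simp add: sum_distrib_left sum_subtractf)
  have fb: "f \<in> borel_measurable borel" by (rule smooth_borel[OF sm])
  have "(\<integral>x. f x \<partial>L) = (\<integral>x. indicator \<Omega> x * f x \<partial>lborel)" by (rule integral_L_lborel[OF fb])
  \<comment> \<open>The regions cover the domain, and overlaps at ties only enlarge the right hand
    side because \<open>f\<close> is nonnegative.\<close>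
  also have "\<dots> \<le> (\<integral>x. (\<Sum>F\<in>facets. indicator (region F) x * f x) \<partial>lborel)"
  proof (rule integral_mono_AE')
    show "integrable lborel (\<lambda>x. \<Sum>F\<in>facets. indicator (region F) x * f x)" using i2 by simp
    show "AE x in lborel. indicator \<Omega> x * f x \<le> (\<Sum>F\<in>facets. indicator (region F) x * f x)"
    proof (rule AE_I2)
      fix x
      show "indicator \<Omega> x * f x \<le> (\<Sum>F\<in>facets. indicator (region F) x * f x)"
      proof (cases "x \<in> \<Omega>")
        case True
        obtain F where F: "F \<in> facets" "x \<in> region F" using region_cover[OF True] by blast
        have "indicator (region F) x * f x \<le> (\<Sum>F\<in>facets. indicator (region F) x * f x)"
          by (rule member_le_sum) (use F finite_facets pos in auto)
        then show ?thesis using F True by simp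
      qed (use pos in \<open>auto intro!: sum_nonneg\<close>)
    qed
  qed (use pos in \<open>auto intro!: AE_I2 sum_nonneg\<close>)
  also have "\<dots> = (\<Sum>F\<in>facets. B F)" unfolding B_def using i2 by simp
  finally have 2: "(\<integral>x. f x \<partial>L) \<le> (\<Sum>F\<in>facets. B F)" .
  have eq: "grad f x \<bullet> qf x = (\<Sum>F\<in>facets. indicator (region F) x * ((Hb - dst F x) * (grad f x \<bullet> nrm F)))" for x
    by (simp add: qf_def inner_sum_right mult.assoc)
  have "(\<Sum>F\<in>facets. A F) = (\<integral>x. grad f x \<bullet> qf x \<partial>lborel)"
    unfolding A_def eq using i1 by simp
  also have "\<dots> = (\<integral>x. grad f x \<bullet> qf x \<partial>L)"
  proof (rule integral_L_support[symmetric])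
    have "integrable lborel (\<lambda>x. \<Sum>F\<in>facets. indicator (region F) x * ((Hb - dst F x) * (grad f x \<bullet> nrm F)))"
      using i1 by simp
    then show "(\<lambda>x. grad f x \<bullet> qf x) \<in> borel_measurable borel" unfolding eq by simp
    show "grad f x \<bullet> qf x = 0" if "x \<notin> \<Omega>" for x using that by (simp add: qf_def region_def)
  qed
  finally show ?thesis using 1 2 by simp
qed

lemma qf_borel: "(\<lambda>x. qf x $ i) \<in> borel_measurable borel"
proof -
  have [measurable]: "region F \<in> sets borel" for F by (rule region_borel)
  have [measurable]: "dst F \<in> borel_measurable borel" for F
    by (intro smooth_borel smooth_dst)
  have "(\<lambda>x. qf x $ i) = (\<lambda>x. \<Sum>F\<in>facets. indicator (region F) x * (Hb - dst F x) * nrm F $ i)"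
    by (auto simp: qf_def)
  then show ?thesis by simp
qed

lemma qf_bound:
  assumes "x \<in> \<Omega>"
  shows "\<bar>qf x $ i\<bar> \<le> real (card facets) * Hb"
proof -
  have "\<bar>indicator (region F) x * (Hb - dst F x) * nrm F $ i\<bar> \<le> Hb" if F: "F \<in> facets" for F
  proof -
    have a: "\<bar>indicator (region F) x * (Hb - dst F x)\<bar> \<le> Hb"
      using dst_pos_domain[OF F assms] dst_le_Hb[OF F assms] by (auto simp: indicator_def)
    have "\<bar>nrm F $ i\<bar> \<le> 1" using component_le_norm_cart[of "nrm F" i] facet_line_works(1)[OF F] by simp
    then show ?thesis using mult_mono[OF a, of "\<bar>nrm F $ i\<bar>" 1] Hb_pos by (simp add: abs_mult)
  qed
  then have "(\<Sum>F\<in>facets. \<bar>indicator (region F) x * (Hb - dst F x) * nrm F $ i\<bar>) \<le> real (card facets) * Hb"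
    by (rule sum_bounded_above)
  moreover have "\<bar>qf x $ i\<bar> \<le> (\<Sum>F\<in>facets. \<bar>indicator (region F) x * (Hb - dst F x) * nrm F $ i\<bar>)"
    by (simp add: qf_def sum_abs)
  ultimately show ?thesis by linarith
qed

section \<open>Smooth compactly supported approximations of the weight\<close>

text \<open>The log-sum-exp replacement of the smallest edge distance: never above it, and below it
  by at most the logarithm of the number of facets divided by \<open>Suc k\<close>.\<close>

definition softmin :: "nat \<Rightarrow> real^2 \<Rightarrow> real" where
  "softmin k x = - (1 / real (Suc k)) * ln (\<Sum>F\<in>facets. exp (- real (Suc k) * dst F x))"

text \<open>The factor \<open>flat\<close> vanishes where \<open>softmin\<close> is at most 1/(k+1).
  This covers a neighbourhood of the boundary and the whole exterior, where some edge distance is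
  nonpositive, and so produces compact support.\<close>

definition cutmin :: "nat \<Rightarrow> real^2 \<Rightarrow> real" where
  "cutmin k x = softmin k x * flat (real (Suc k) * softmin k x - 1)"

definition weight :: "nat \<Rightarrow> real^2 \<Rightarrow> real" where
  "weight k x = Hb * cutmin k x - (cutmin k x)\<^sup>2 / 2"

lemma softsum_pos: "0 < (\<Sum>F\<in>facets. exp (- real (Suc k) * dst F x))"
  using finite_facets facets_nonempty by (intro sum_pos) auto

lemma softmin_le:
  assumes "F \<in> facets"
  shows "softmin k x \<le> dst F x"
proof -
  have "exp (- real (Suc k) * dst F x) \<le> (\<Sum>F\<in>facets. exp (- real (Suc k) * dst F x))"
    by (rule member_le_sum) (use assms finite_facets in auto)
  then have "- real (Suc k) * dst F x \<le> ln (\<Sum>F\<in>facets. exp (- real (Suc k) * dst F x))"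
    using softsum_pos[of k x] by (subst ln_ge_iff) auto
  then have "- (1 / real (Suc k)) * ln (\<Sum>F\<in>facets. exp (- real (Suc k) * dst F x))
      \<le> - (1 / real (Suc k)) * (- real (Suc k) * dst F x)"
    by (intro mult_left_mono_neg) auto
  moreover have "- (1 / real (Suc k)) * (- real (Suc k) * dst F x) = dst F x" by (simp del: of_nat_Suc)
  ultimately show ?thesis by (simp only: softmin_def)
qed

lemma softmin_ge:
  assumes "\<And>F. F \<in> facets \<Longrightarrow> m \<le> dst F x"
  shows "m - ln (real (card facets)) / real (Suc k) \<le> softmin k x"
proof -
  have c: "0 < card facets" using finite_facets facets_nonempty by (simp add: card_gt_0_iff)
  have "(\<Sum>F\<in>facets. exp (- real (Suc k) * dst F x)) \<le> real (card facets) * exp (- real (Suc k) * m)"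
    by (rule sum_bounded_above) (use assms in \<open>auto intro!: mult_left_mono\<close>)
  then have "ln (\<Sum>F\<in>facets. exp (- real (Suc k) * dst F x)) \<le> ln (real (card facets) * exp (- real (Suc k) * m))"
    using softsum_pos[of k x] c by (subst ln_le_cancel_iff) auto
  also have "\<dots> = ln (real (card facets)) - real (Suc k) * m" using c by (subst ln_mult) (auto simp del: of_nat_Suc)
  finally have "- (1 / real (Suc k)) * (ln (real (card facets)) - real (Suc k) * m) \<le> softmin k x"
    unfolding softmin_def by (intro mult_left_mono_neg) auto
  moreover have "- (1 / real (Suc k)) * (ln (real (card facets)) - real (Suc k) * m)
     = m - ln (real (card facets)) / real (Suc k)" by (simp add: field_simps)
  ultimately show ?thesis by (simp only:)
qed

lemma smooth_softmin: "smooth (softmin k)"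
proof -
  have "smooth (\<lambda>x. - (1 / real (Suc k)) * ln (\<Sum>F\<in>facets. exp (- real (Suc k) * dst F x)))"
    by (intro smooth_mult smooth_const smooth_ln smooth_sum smooth_exp smooth_dst softsum_pos)
  then show ?thesis by (simp add: softmin_def[abs_def])
qed

text \<open>The weights with which the edge normals enter the gradient of \<open>softmin\<close>.
  They form a convex combination, so that this gradient has norm at most 1.\<close>

definition softw :: "nat \<Rightarrow> (real^2) set \<Rightarrow> real^2 \<Rightarrow> real" where
  "softw k F x = exp (- real (Suc k) * dst F x) / (\<Sum>G\<in>facets. exp (- real (Suc k) * dst G x))"

lemma softw_nonneg: "0 \<le> softw k F x"
  using softsum_pos[of k x] by (simp add: softw_def)

lemma softw_sum: "(\<Sum>F\<in>facets. softw k F x) = 1"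
  using softsum_pos[of k x] by (simp add: softw_def flip: sum_divide_distrib)

lemma grad_softmin: "grad (softmin k) x = (\<Sum>F\<in>facets. softw k F x *\<^sub>R nrm F)"
proof -
  let ?k = "real (Suc k)"
  let ?S = "\<lambda>x. \<Sum>F\<in>facets. exp (- ?k * dst F x)"
  have e1: "grad (\<lambda>x. - ?k * dst F x) x = (- ?k) *\<^sub>R nrm F" for F
    using grad_scale[OF smooth_differentiable[OF smooth_dst], of "- ?k" F x] by (simp only: grad_dst)
  have s1: "smooth (\<lambda>x. - ?k * dst F x)" for F by (intro smooth_mult smooth_const smooth_dst)
  have e2: "grad (\<lambda>x. exp (- ?k * dst F x)) x = exp (- ?k * dst F x) *\<^sub>R ((- ?k) *\<^sub>R nrm F)" for F
    using grad_compose[OF DERIV_exp smooth_differentiable[OF s1]] by (simp only: e1)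
  have e3: "grad ?S x = (\<Sum>F\<in>facets. exp (- ?k * dst F x) *\<^sub>R ((- ?k) *\<^sub>R nrm F))"
    using grad_sum[OF finite_facets smooth_differentiable[OF smooth_exp[OF s1]]] by (simp only: e2)
  have s3: "smooth ?S" by (intro smooth_sum smooth_exp s1)
  have "grad (\<lambda>x. ln (?S x)) x = inverse (?S x) *\<^sub>R grad ?S x"
    using grad_compose[OF DERIV_ln[OF softsum_pos] smooth_differentiable[OF s3]] by blast
  moreover have "grad (softmin k) x = - (1 / ?k) *\<^sub>R grad (\<lambda>x. ln (?S x)) x"
    using grad_scale[OF smooth_differentiable[OF smooth_ln[OF s3 softsum_pos]], of "- (1 / ?k)" x]
    by (simp add: softmin_def[abs_def])
  ultimately have "grad (softmin k) x = (\<Sum>F\<in>facets. (- (1 / ?k) * (inverse (?S x) * (exp (- ?k * dst F x) * (- ?k)))) *\<^sub>R nrm F)"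
    unfolding e3 by (simp only: scaleR_sum_right scaleR_scaleR)
  moreover have "- (1 / ?k) * (inverse (?S x) * (exp (- ?k * dst F x) * (- ?k))) = softw k F x" for F
    using softsum_pos[of k x] by (simp add: softw_def field_simps del: of_nat_Suc)
  ultimately show ?thesis by (simp only:)
qed

lemma norm_grad_softmin: "norm (grad (softmin k) x) \<le> 1"
proof -
  have "norm (grad (softmin k) x) \<le> (\<Sum>F\<in>facets. norm (softw k F x *\<^sub>R nrm F))"
    unfolding grad_softmin by (rule norm_sum)
  also have "\<dots> = (\<Sum>F\<in>facets. softw k F x)"
    using softw_nonneg by (intro sum.cong refl) (simp add: facet_line_works(1))
  finally show ?thesis by (simp add: softw_sum)
qed

text \<open>The derivative of \<open>cutmin\<close> with respect to \<open>softmin\<close>, written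
  in the variable \<open>s = (k+1) softmin - 1\<close>; the factor \<open>s + 1\<close> is
  \<open>(k+1) softmin\<close>. In this form it no longer depends on \<open>k\<close>.\<close>

definition cutd :: "real \<Rightarrow> real" where
  "cutd s = flat s + (s + 1) * flatp [:0, 0, 1:] s"

lemma flatp_eq: "flatp [:0, 0, 1:] s = (if 0 < s then exp (- inverse s) / s\<^sup>2 else 0)"
  by (simp add: flatp_def power2_eq_square divide_inverse)

text \<open>With \<open>r = 1/s\<close> the second summand is \<open>(r + r^2) exp(-r)\<close>,
  which is at most 2 since \<open>exp r\<close> is at least \<open>1 + r + r^2/2\<close>;
  \<open>flat\<close> adds at most 1. The bound is uniform in \<open>k\<close>, as dominated
  convergence requires.\<close>

lemma cutd_bound: "0 \<le> cutd s" "cutd s \<le> 3"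
proof -
  have "0 \<le> (s + 1) * flatp [:0, 0, 1:] s \<and> (s + 1) * flatp [:0, 0, 1:] s \<le> 2"
  proof (cases "0 < s")
    case True
    define r where "r = inverse s"
    have r: "0 < r" using True by (simp add: r_def)
    have "(s + 1) * flatp [:0, 0, 1:] s = (r + r\<^sup>2) * exp (- r)"
      using True by (simp add: flatp_eq r_def power2_eq_square field_simps)
    also have "\<dots> \<le> 2"
    proof -
      have "1 + r + r\<^sup>2 / 2 \<le> exp r" using r by (intro exp_lower_Taylor_quadratic) auto
      then have "r + r\<^sup>2 \<le> 2 * exp r" using r by (simp add: field_simps)
      then show ?thesis by (simp add: exp_minus field_simps)
    qed
    finally show ?thesis using True by (simp add: flatp_eq)
  qed (simp add: flatp_eq)
  then show "0 \<le> cutd s" "cutd s \<le> 3" using flat_nonneg[of s] flat_le_1[of s] unfolding cutd_def by linarith+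
qed

lemma flat_tendsto_1: "(flat \<longlongrightarrow> 1) at_top"
proof -
  have "((\<lambda>s::real. exp (- inverse s)) \<longlongrightarrow> exp (- 0)) at_top"
    by (intro tendsto_intros tendsto_inverse_0_at_top filterlim_ident)
  then have "((\<lambda>s::real. exp (- inverse s)) \<longlongrightarrow> 1) at_top" by simp
  then show ?thesis
    by (rule Lim_transform_eventually) (use eventually_gt_at_top[of 0] in eventually_elim, simp add: flat_def)
qed

lemma cutd_tendsto_1: "(cutd \<longlongrightarrow> 1) at_top"
proof -
  have "((\<lambda>s. (s + 1) * flatp [:0, 0, 1:] s) \<longlongrightarrow> 0) at_top"
  proof (rule tendsto_sandwich[of "\<lambda>_. 0"])
    show "\<forall>\<^sub>F s in at_top. 0 \<le> (s + 1) * flatp [:0, 0, 1:] s"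
      using eventually_gt_at_top[of 0] by eventually_elim (simp add: flatp_eq)
    show "\<forall>\<^sub>F s in at_top. (s + 1) * flatp [:0, 0, 1:] s \<le> inverse s + inverse s * inverse s"
      using eventually_gt_at_top[of 0]
    proof eventually_elim
      case (elim s)
      then have "(s + 1) * flatp [:0, 0, 1:] s = (inverse s + inverse s * inverse s) * exp (- inverse s)"
        by (simp add: flatp_eq power2_eq_square field_simps)
      also have "\<dots> \<le> (inverse s + inverse s * inverse s) * 1"
        using elim by (intro mult_left_mono) auto
      finally show ?case by simp
    qed
    have "((\<lambda>s::real. inverse s + inverse s * inverse s) \<longlongrightarrow> 0 + 0 * 0) at_top"
      by (intro tendsto_intros tendsto_inverse_0_at_top filterlim_ident)
    then show "((\<lambda>s::real. inverse s + inverse s * inverse s) \<longlongrightarrow> 0) at_top" by simp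
  qed simp
  from tendsto_add[OF flat_tendsto_1 this] show ?thesis by (simp add: cutd_def[abs_def])
qed

lemma smooth_cutmin: "smooth (cutmin k)"
  unfolding cutmin_def[abs_def]
  by (intro smooth_mult smooth_softmin smooth_flat smooth_diff smooth_const)

lemma grad_cutmin: "grad (cutmin k) x = cutd (real (Suc k) * softmin k x - 1) *\<^sub>R grad (softmin k) x"
proof -
  let ?k = "real (Suc k)"
  let ?s = "\<lambda>x. ?k * softmin k x - 1"
  have ss: "smooth ?s" by (intro smooth_diff smooth_mult smooth_const smooth_softmin)
  have "grad (\<lambda>x. ?k * softmin k x) x = ?k *\<^sub>R grad (softmin k) x"
    by (rule grad_scale[OF smooth_differentiable[OF smooth_softmin]])
  moreover have "grad ?s x = grad (\<lambda>x. ?k * softmin k x) x - grad (\<lambda>x. 1) x"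
    by (rule grad_diff) (intro smooth_differentiable smooth_mult smooth_const smooth_softmin)+
  ultimately have gs: "grad ?s x = ?k *\<^sub>R grad (softmin k) x" by simp
  have "grad (\<lambda>x. flat (?s x)) x = flatp [:0, 0, 1:] (?s x) *\<^sub>R grad ?s x"
    by (rule grad_compose[OF flat_deriv smooth_differentiable[OF ss]])
  then have "grad (cutmin k) x = softmin k x *\<^sub>R (flatp [:0, 0, 1:] (?s x) *\<^sub>R (?k *\<^sub>R grad (softmin k) x)) + flat (?s x) *\<^sub>R grad (softmin k) x"
    using grad_mult[OF smooth_differentiable[OF smooth_softmin] smooth_differentiable[OF smooth_flat[OF ss]], of k x]
    by (simp add: cutmin_def[abs_def] gs del: of_nat_Suc)
  then show ?thesis by (simp add: cutd_def algebra_simps flip: scaleR_left_distrib)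
qed

lemma cutmin_bounds:
  assumes "x \<in> \<Omega>"
  shows "0 \<le> cutmin k x" "cutmin k x \<le> Hb"
proof -
  obtain F where F: "F \<in> facets" using facets_nonempty by blast
  have le: "softmin k x \<le> Hb" using softmin_le[OF F, of k x] dst_le_Hb[OF F assms] by simp
  show "0 \<le> cutmin k x"
  proof (cases "0 \<le> softmin k x")
    case False
    then have "real (Suc k) * softmin k x - 1 \<le> 0" using mult_nonneg_nonpos[of "real (Suc k)" "softmin k x"] by simp
    then show ?thesis by (simp add: cutmin_def)
  qed (simp add: cutmin_def)
  show "cutmin k x \<le> Hb"
  proof (cases "0 \<le> softmin k x")
    case True
    then have "cutmin k x \<le> softmin k x * 1" unfolding cutmin_def by (intro mult_left_mono) auto
    then show ?thesis using le by simp
  next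
    case False
    then have "cutmin k x \<le> 0" unfolding cutmin_def by (intro mult_nonpos_nonneg) auto
    then show ?thesis using Hb_pos by simp
  qed
qed

lemma weight_nonneg: "x \<in> \<Omega> \<Longrightarrow> 0 \<le> weight k x"
proof -
  assume x: "x \<in> \<Omega>"
  have "weight k x = cutmin k x * (Hb - cutmin k x / 2)" by (simp add: weight_def power2_eq_square algebra_simps)
  also have "0 \<le> \<dots>" using cutmin_bounds[OF x, of k] by (intro mult_nonneg_nonneg) auto
  finally show ?thesis .
qed

lemma grad_weight: "grad (weight k) x = (Hb - cutmin k x) *\<^sub>R grad (cutmin k) x"
proof -
  have D: "((\<lambda>t. Hb * t - t\<^sup>2 / 2) has_real_derivative Hb - t) (at t)" for t
    by (auto intro!: derivative_eq_intros)
  show ?thesis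
    using grad_compose[OF D smooth_differentiable[OF smooth_cutmin]] by (simp add: weight_def[abs_def])
qed

lemma norm_grad_weight:
  assumes "x \<in> \<Omega>"
  shows "norm (grad (weight k) x) \<le> 3 * Hb"
proof -
  have "norm (grad (weight k) x) = \<bar>Hb - cutmin k x\<bar> * (\<bar>cutd (real (Suc k) * softmin k x - 1)\<bar> * norm (grad (softmin k) x))"
    by (simp add: grad_weight grad_cutmin abs_mult)
  also have "\<dots> \<le> Hb * (3 * 1)"
    using cutmin_bounds[OF assms, of k] cutd_bound norm_grad_softmin Hb_pos by (intro mult_mono) auto
  finally show ?thesis by simp
qed

text \<open>Where some edge distance is below 1/(k+1), so is \<open>softmin\<close>, and the cut-off
  vanishes. The remaining set is closed, bounded and contained in the domain.\<close>

lemma weight_test: "weight k \<in> test_functions \<Omega>"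
proof (rule test_functionsI)
  let ?K = "{x. \<forall>F\<in>facets. 1 / real (Suc k) \<le> dst F x}"
  have sub: "?K \<subseteq> \<Omega>"
  proof
    fix x assume x: "x \<in> ?K"
    have "0 < dst F x" if "F \<in> facets" for F
    proof -
      have "0 < 1 / real (Suc k)" by simp
      also have "\<dots> \<le> dst F x" using x that by blast
      finally show ?thesis .
    qed
    then show "x \<in> \<Omega>" by (rule dst_pos_imp_domain)
  qed
  then show "?K \<subseteq> \<Omega>" .
  have "?K = (\<Inter>F\<in>facets. {x. 1 / real (Suc k) \<le> dst F x})" by auto
  moreover have "closed \<dots>" by (intro closed_INT ballI closed_Collect_le dst_continuous continuous_on_const)
  ultimately have "closed ?K" by simp
  then show "compact ?K" using bounded_subset[OF bounded_domain sub] by (simp add: compact_eq_bounded_closed)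
  show "weight k x = 0" if xK: "x \<notin> ?K" for x
  proof -
    obtain F where F: "F \<in> facets" "dst F x < 1 / real (Suc k)" using xK by (auto simp: not_le simp del: of_nat_Suc)
    have "softmin k x \<le> 1 / real (Suc k)" using softmin_le[OF F(1), of k x] F(2) by linarith
    then have "real (Suc k) * softmin k x - 1 \<le> 0" by (simp add: field_simps)
    then show ?thesis by (simp add: weight_def cutmin_def)
  qed
  show "smooth (weight k)"
  proof -
    have "smooth (\<lambda>x. Hb * cutmin k x - (1 / 2) * (cutmin k x)\<^sup>2)"
      by (intro smooth_diff smooth_mult smooth_const smooth_power smooth_cutmin)
    then show ?thesis by (simp add: weight_def[abs_def])
  qed
qed

text \<open>If the nearest edge is unique, the weights of all other edges decay exponentially, so
  the gradient of \<open>softmin\<close> tends to the normal of that edge. Meanwhile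
  \<open>softmin\<close> tends to its distance, which is positive, and the argument of the cut-off
  to infinity.\<close>

lemma grad_weight_tendsto:
  assumes x: "x \<in> \<Omega>" and no_tie: "\<And>F G. F \<in> facets \<Longrightarrow> G \<in> facets \<Longrightarrow> F \<noteq> G \<Longrightarrow> dst F x \<noteq> dst G x"
  shows "(\<lambda>k. grad (weight k) x) \<longlonglongrightarrow> qf x"
proof -
  obtain F where F: "F \<in> facets" "x \<in> region F" using region_cover[OF x] by blast
  have min: "dst F x \<le> dst G x" if "G \<in> facets" for G using F that by (auto simp: region_def)
  have sl: "dst F x < dst G x" if "G \<in> facets" "G \<noteq> F" for G
    using min[OF that(1)] no_tie[OF that(1) F(1) that(2)] by simp
  then have nr: "x \<notin> region G" if "G \<in> facets" "G \<noteq> F" for G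
    using that F(1) by (force simp: region_def not_le)
  have qf: "qf x = (Hb - dst F x) *\<^sub>R nrm F"
  proof -
    have "qf x = (\<Sum>G\<in>facets. if G = F then (Hb - dst F x) *\<^sub>R nrm F else 0)"
      unfolding qf_def by (rule sum.cong) (use F nr in auto)
    then show ?thesis using finite_facets F(1) by simp
  qed
  have k_inf: "filterlim (\<lambda>k. real (Suc k)) at_top sequentially"
    using filterlim_compose[OF filterlim_real_sequentially filterlim_Suc] .
  have m: "(\<lambda>k. softmin k x) \<longlonglongrightarrow> dst F x"
  proof (rule tendsto_sandwich)
    show "\<forall>\<^sub>F k in sequentially. dst F x - ln (real (card facets)) / real (Suc k) \<le> softmin k x"
      using softmin_ge[OF min] by simp
    show "\<forall>\<^sub>F k in sequentially. softmin k x \<le> dst F x" using softmin_le[OF F(1)] by simp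
    have "(\<lambda>k. dst F x - ln (real (card facets)) * inverse (real (Suc k))) \<longlonglongrightarrow> dst F x - ln (real (card facets)) * 0"
      by (intro tendsto_intros LIMSEQ_inverse_real_of_nat)
    then show "(\<lambda>k. dst F x - ln (real (card facets)) / real (Suc k)) \<longlonglongrightarrow> dst F x"
      by (simp add: divide_inverse)
  qed simp
  have s: "filterlim (\<lambda>k. real (Suc k) * softmin k x - 1) at_top sequentially"
  proof -
    have "filterlim (\<lambda>k. softmin k x * real (Suc k)) at_top sequentially"
      by (rule filterlim_tendsto_pos_mult_at_top[OF m dst_pos_domain[OF F(1) x] k_inf])
    then have "filterlim (\<lambda>k. - 1 + softmin k x * real (Suc k)) at_top sequentially"
      by (rule filterlim_tendsto_add_at_top[OF tendsto_const])
    then show ?thesis by (simp add: algebra_simps)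
  qed
  have d: "(\<lambda>k. cutmin k x) \<longlonglongrightarrow> dst F x"
    using tendsto_mult[OF m filterlim_compose[OF flat_tendsto_1 s]] by (simp add: cutmin_def)
  have w0: "(\<lambda>k. softw k G x) \<longlonglongrightarrow> 0" if G: "G \<in> facets" "G \<noteq> F" for G
  proof (rule tendsto_sandwich[of "\<lambda>_. 0"])
    have "softw k G x \<le> exp (- ((dst G x - dst F x) * real (Suc k)))" for k
    proof -
      have "exp (- real (Suc k) * dst F x) \<le> (\<Sum>G\<in>facets. exp (- real (Suc k) * dst G x))"
        by (rule member_le_sum) (use F finite_facets in auto)
      then have "softw k G x \<le> exp (- real (Suc k) * dst G x) / exp (- real (Suc k) * dst F x)"
        unfolding softw_def using softsum_pos[of k x] by (intro divide_left_mono) auto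
      then show ?thesis by (simp add: algebra_simps flip: exp_diff)
    qed
    then show "\<forall>\<^sub>F k in sequentially. softw k G x \<le> exp (- ((dst G x - dst F x) * real (Suc k)))" by simp
    have "filterlim (\<lambda>k. (dst G x - dst F x) * real (Suc k)) at_top sequentially"
      using sl[OF G] by (intro filterlim_tendsto_pos_mult_at_top[OF tendsto_const _ k_inf]) simp
    then show "(\<lambda>k. exp (- ((dst G x - dst F x) * real (Suc k)))) \<longlonglongrightarrow> 0"
      by (intro filterlim_compose[OF exp_at_bot] filterlim_compose[OF filterlim_uminus_at_bot_at_top])
  qed (use softw_nonneg in auto)
  have w1: "(\<lambda>k. softw k F x) \<longlonglongrightarrow> 1"
  proof -
    have "softw k F x = 1 - (\<Sum>G\<in>facets - {F}. softw k G x)" for k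
      using softw_sum[of k x] sum.remove[OF finite_facets F(1), of "\<lambda>G. softw k G x"] by simp
    moreover have "(\<lambda>k. 1 - (\<Sum>G\<in>facets - {F}. softw k G x)) \<longlonglongrightarrow> 1 - (\<Sum>G\<in>facets - {F}. 0)"
      by (intro tendsto_intros w0) auto
    ultimately show ?thesis by simp
  qed
  have g: "(\<lambda>k. grad (softmin k) x) \<longlonglongrightarrow> nrm F"
  proof -
    have "(\<lambda>k. \<Sum>G\<in>facets. softw k G x *\<^sub>R nrm G) \<longlonglongrightarrow> (\<Sum>G\<in>facets. (if G = F then 1 else 0) *\<^sub>R nrm G)"
      by (intro tendsto_sum tendsto_scaleR tendsto_const) (use w0 w1 in auto)
    moreover have "(\<Sum>G\<in>facets. (if G = F then 1 else 0) *\<^sub>R nrm G) = (\<Sum>G\<in>facets. if G = F then nrm G else 0)"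
      by (intro sum.cong) auto
    ultimately show ?thesis using finite_facets F(1) by (simp add: grad_softmin)
  qed
  have "(\<lambda>k. (Hb - cutmin k x) *\<^sub>R (cutd (real (Suc k) * softmin k x - 1) *\<^sub>R grad (softmin k) x))
      \<longlonglongrightarrow> (Hb - dst F x) *\<^sub>R (1 *\<^sub>R nrm F)"
    by (intro tendsto_intros d g filterlim_compose[OF cutd_tendsto_1 s])
  then show ?thesis by (simp add: qf grad_weight grad_cutmin)
qed

lemma AE_no_tie: "AE x in L. \<forall>F\<in>facets. \<forall>G\<in>facets. F \<noteq> G \<longrightarrow> dst F x \<noteq> dst G x"
proof -
  have "AE x in lebesgue. F \<noteq> G \<longrightarrow> dst F x \<noteq> dst G x" if "F \<in> facets" "G \<in> facets" for F G
  proof (cases "F = G")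
    case False
    have "{x. dst F x = dst G x} \<in> null_sets lebesgue"
      using ties_negligible[OF that False] by (simp add: negligible_iff_null_sets)
    from AE_not_in[OF this] show ?thesis by eventually_elim auto
  qed simp
  then have "AE x in lebesgue. \<forall>F\<in>facets. \<forall>G\<in>facets. F \<noteq> G \<longrightarrow> dst F x \<noteq> dst G x"
    using countable_finite[OF finite_facets] by (simp add: AE_ball_countable)
  then show ?thesis unfolding AE_L_iff by eventually_elim blast
qed

text \<open>The \<open>L\<^sup>2\<close>-bound for harmonic functions in terms of their boundary values, by testing with
  the product of the function and the weight \<open>H m - m\<^sup>2/2\<close>, whose distributional Laplacian is at most \<open>-1\<close>.\<close>

lemma harmonic_bound:
  assumes v: "smooth v" and w: "w \<in> H10 \<Omega>"
    and harm: "\<And>\<eta>. \<eta> \<in> test_functions \<Omega> \<Longrightarrow> vinner (\<lambda>x. grad v x + weak_grad \<Omega> w x) (grad \<eta>) = 0"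
  shows "(l2_norm L (\<lambda>x. v x + w x))\<^sup>2 \<le> Hb * (l2_norm \<Gamma> v)\<^sup>2"
proof -
  let ?V = "\<lambda>x. v x + w x"
  let ?g = "\<lambda>x. grad v x + weak_grad \<Omega> w x"
  obtain \<theta> where \<theta>: "H1lim \<theta> w (weak_grad \<Omega> w)" "\<And>n. \<theta> n \<in> test_functions \<Omega>" using H10_E[OF w] by blast
  \<comment> \<open>Smooth approximations of the harmonic function that keep its boundary values
    exactly, since every \<open>\<theta> n\<close> vanishes on the boundary.\<close>
  let ?W = "\<lambda>n x. v x + \<theta> n x"
  have lim: "H1lim ?W ?V ?g" by (rule H1lim_add_smooth[OF \<theta>(1) v])
  have sW: "smooth (?W n)" for n using lim by (simp add: H1lim_def)
  have Vl: "?V \<in> l2 L" and gv: "vl2 ?g" using lim by (auto simp: H1lim_def)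
  note gl = vl2D[OF gv]
  have Vg: "integrable L (\<lambda>x. ?V x * ?g x $ i)" for i by (rule l2_mult_integrable[OF Vl gl])
  have one: "(\<integral>x. ?V x * (grad (weight k) x \<bullet> ?g x) \<partial>L) \<le> 0" for k
  proof -
    let ?Q = "weight k"
    have sQ: "smooth ?Q" using weight_test test_functionsD(1) by blast
    have limQ: "H1lim (\<lambda>n x. ?Q x * ?W n x) (\<lambda>x. ?Q x * ?V x) (\<lambda>x. ?Q x *\<^sub>R ?g x + ?V x *\<^sub>R grad ?Q x)"
      by (rule H1lim_mult[OF lim sQ])
    have gQ: "vl2 (\<lambda>x. ?Q x *\<^sub>R ?g x + ?V x *\<^sub>R grad ?Q x)" using limQ by (simp add: H1lim_def)
    \<comment> \<open>Multiplied by the weight, \<open>?W n\<close> becomes an admissible test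
      function although it need not vanish on the boundary.\<close>
    have z: "vinner (grad (\<lambda>x. ?Q x * ?W n x)) ?g = 0" for n
      using harm[OF test_functions_mult_smooth[OF weight_test sW]] by (simp add: vinner_commute mult.commute)
    have "vinner (\<lambda>x. ?Q x *\<^sub>R ?g x + ?V x *\<^sub>R grad ?Q x) ?g = 0"
      using H1lim_vinner[OF limQ gv] unfolding z by (rule LIMSEQ_unique[OF _ tendsto_const])
    then have eq: "(\<integral>x. (?Q x *\<^sub>R ?g x + ?V x *\<^sub>R grad ?Q x) \<bullet> ?g x \<partial>L) = 0"
      by (simp add: vinner_integral(2)[OF gQ gv])
    have i1: "integrable L (\<lambda>x. (?Q x *\<^sub>R ?g x + ?V x *\<^sub>R grad ?Q x) \<bullet> ?g x)"
      by (rule vinner_integral(1)[OF gQ gv])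
    have i2: "integrable L (\<lambda>x. ?V x * (grad ?Q x \<bullet> ?g x))"
    proof -
      have "vl2 (\<lambda>x. ?V x *\<^sub>R grad ?Q x)"
      proof -
        obtain D where "\<And>x. x \<in> \<Omega> \<Longrightarrow> norm (grad ?Q x) \<le> D"
          using continuous_bounded[OF grad_continuous[OF sQ]] by blast
        then have D: "\<bar>grad ?Q x $ i\<bar> \<le> D" if "x \<in> \<Omega>" for x i
          using component_le_norm_cart[of "grad ?Q x" i] that by (meson order_trans)
        have "(\<lambda>x. grad ?Q x $ i * ?V x) \<in> l2 L" for i
          by (rule l2_mult_bounded[OF Vl, of _ D]) (use D sQ in \<open>auto intro!: AE_L_I borel_imp_L smooth_borel smooth_grad\<close>)
        then show ?thesis by (simp add: vl2_def mult.commute)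
      qed
      from vinner_integral(1)[OF this gv] show ?thesis by simp
    qed
    \<comment> \<open>The term with the weight times the squared gradient of \<open>?V\<close> is
      nonnegative and is dropped from the tested equation.\<close>
    have "(\<integral>x. ?V x * (grad ?Q x \<bullet> ?g x) \<partial>L) \<le> (\<integral>x. (?Q x *\<^sub>R ?g x + ?V x *\<^sub>R grad ?Q x) \<bullet> ?g x \<partial>L)"
    proof (rule integral_mono_AE[OF i2 i1], rule AE_L_I)
      fix x assume "x \<in> \<Omega>"
      then have "0 \<le> ?Q x * (?g x \<bullet> ?g x)" by (intro mult_nonneg_nonneg weight_nonneg inner_ge_zero)
      moreover have "(?Q x *\<^sub>R ?g x + ?V x *\<^sub>R grad ?Q x) \<bullet> ?g x = ?Q x * (?g x \<bullet> ?g x) + ?V x * (grad ?Q x \<bullet> ?g x)"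
        by (simp only: inner_add_left[of "?Q x *\<^sub>R ?g x"] inner_scaleR_left)
      ultimately show "?V x * (grad ?Q x \<bullet> ?g x) \<le> (?Q x *\<^sub>R ?g x + ?V x *\<^sub>R grad ?Q x) \<bullet> ?g x" by linarith
    qed
    then show ?thesis using eq by simp
  qed
  \<comment> \<open>Removes the smoothing of the weight: the gradients converge off the ties and are
    bounded by \<open>3 * Hb\<close>.\<close>
  have lim1: "(\<lambda>k. \<integral>x. ?V x * (grad (weight k) x \<bullet> ?g x) \<partial>L) \<longlonglongrightarrow> (\<integral>x. ?V x * (qf x \<bullet> ?g x) \<partial>L)"
  proof (rule integral_dominated_convergence)
    have Vm: "?V \<in> borel_measurable L" using Vl by (rule l2_measurable)
    have gm: "(\<lambda>x. ?g x $ i) \<in> borel_measurable L" for i using gl by (rule l2_measurable)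
    have qm: "(\<lambda>x. qf x $ i) \<in> borel_measurable L" for i by (intro borel_imp_L qf_borel)
    have wm: "(\<lambda>x. grad (weight k) x $ i) \<in> borel_measurable L" for i k
      using weight_test test_functionsD(1) by (intro borel_imp_L smooth_borel smooth_grad) blast
    show "(\<lambda>x. ?V x * (qf x \<bullet> ?g x)) \<in> borel_measurable L"
      unfolding inner_vec_def inner_real_def
      by (intro borel_measurable_times Vm borel_measurable_sum qm gm)
    show "(\<lambda>x. ?V x * (grad (weight k) x \<bullet> ?g x)) \<in> borel_measurable L" for k
      unfolding inner_vec_def inner_real_def
      by (intro borel_measurable_times Vm borel_measurable_sum wm gm)
    show "integrable L (\<lambda>x. \<Sum>i\<in>UNIV. (3 * Hb) * \<bar>?V x * ?g x $ i\<bar>)"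
      using Vg by (intro Bochner_Integration.integrable_sum integrable_mult_right integrable_abs)
    show "AE x in L. norm (?V x * (grad (weight k) x \<bullet> ?g x)) \<le> (\<Sum>i\<in>UNIV. (3 * Hb) * \<bar>?V x * ?g x $ i\<bar>)" for k
    proof (rule AE_L_I)
      fix x assume x: "x \<in> \<Omega>"
      have b: "\<bar>grad (weight k) x $ i\<bar> \<le> 3 * Hb" for i
        using norm_grad_weight[OF x, of k] component_le_norm_cart[of "grad (weight k) x" i] by linarith
      have "norm (?V x * (grad (weight k) x \<bullet> ?g x)) = \<bar>\<Sum>i\<in>UNIV. grad (weight k) x $ i * (?V x * ?g x $ i)\<bar>"
        by (simp add: inner_vec_def sum_distrib_left mult_ac)
      also have "\<dots> \<le> (\<Sum>i\<in>UNIV. \<bar>grad (weight k) x $ i * (?V x * ?g x $ i)\<bar>)" by (rule sum_abs)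
      also have "\<dots> \<le> (\<Sum>i\<in>UNIV. (3 * Hb) * \<bar>?V x * ?g x $ i\<bar>)"
        unfolding abs_mult[of "grad (weight k) x $ _"] by (intro sum_mono mult_right_mono b) simp
      finally show "norm (?V x * (grad (weight k) x \<bullet> ?g x)) \<le> (\<Sum>i\<in>UNIV. (3 * Hb) * \<bar>?V x * ?g x $ i\<bar>)" .
    qed
    have "AE x in L. x \<in> \<Omega>" by (rule AE_L_I)
    with AE_no_tie show "AE x in L. (\<lambda>k. ?V x * (grad (weight k) x \<bullet> ?g x)) \<longlonglongrightarrow> ?V x * (qf x \<bullet> ?g x)"
      by eventually_elim (intro tendsto_intros grad_weight_tendsto; blast)
  qed
  then have two: "(\<integral>x. ?V x * (qf x \<bullet> ?g x) \<partial>L) \<le> 0"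
    by (rule LIMSEQ_le_const2) (use one in auto)
  have qm: "(\<lambda>x. qf x $ i) \<in> borel_measurable L" for i by (intro borel_imp_L qf_borel)
  have qb: "AE x in L. \<bar>qf x $ i\<bar> \<le> real (card facets) * Hb" for i by (intro AE_L_I qf_bound)
  have split: "(\<integral>x. h x * (qf x \<bullet> k x) \<partial>L) = (\<Sum>i\<in>UNIV. l2_inner L (\<lambda>x. qf x $ i * h x) (\<lambda>x. k x $ i))"
    if h: "h \<in> l2 L" and k: "vl2 k" for h k
  proof -
    have "integrable L (\<lambda>x. qf x $ i * h x * k x $ i)" for i
      by (intro l2_mult_integrable l2_mult_bounded[OF h qm qb] vl2D k)
    then have "(\<Sum>i\<in>UNIV. l2_inner L (\<lambda>x. qf x $ i * h x) (\<lambda>x. k x $ i)) = (\<integral>x. (\<Sum>i\<in>UNIV. qf x $ i * h x * k x $ i) \<partial>L)"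
      by (simp add: l2_inner_def)
    also have "\<dots> = (\<integral>x. h x * (qf x \<bullet> k x) \<partial>L)"
      by (intro Bochner_Integration.integral_cong refl) (simp add: inner_vec_def sum_distrib_left mult_ac)
    finally show ?thesis by simp
  qed
  have Wl: "?W n \<in> l2 L" for n by (rule smooth_l2[OF sW])
  have "(\<lambda>n. \<Sum>i\<in>UNIV. l2_inner L (\<lambda>x. qf x $ i * ?W n x) (\<lambda>x. grad (?W n) x $ i))
     \<longlonglongrightarrow> (\<Sum>i\<in>UNIV. l2_inner L (\<lambda>x. qf x $ i * ?V x) (\<lambda>x. ?g x $ i))"
  proof (intro tendsto_sum l2_inner_tendsto)
    fix i n
    show "(\<lambda>x. qf x $ i * ?W n x) \<in> l2 L" by (rule l2_mult_bounded[OF Wl qm qb])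
    show "(\<lambda>x. qf x $ i * ?V x) \<in> l2 L" by (rule l2_mult_bounded[OF Vl qm qb])
    show "(\<lambda>x. grad (?W n) x $ i) \<in> l2 L" by (rule smooth_grad_l2[OF sW])
    show "(\<lambda>x. ?g x $ i) \<in> l2 L" by (rule gl)
    show "(\<lambda>n. l2_norm L (\<lambda>x. qf x $ i * ?W n x - qf x $ i * ?V x)) \<longlonglongrightarrow> 0"
      using lim by (intro l2_mult_tendsto[OF Wl Vl _ qm qb]) (simp add: H1lim_def)
    show "(\<lambda>n. l2_norm L (\<lambda>x. grad (?W n) x $ i - ?g x $ i)) \<longlonglongrightarrow> 0"
      using lim by (simp add: H1lim_def)
  qed
  then have lim2: "(\<lambda>n. \<integral>x. ?W n x * (qf x \<bullet> grad (?W n) x) \<partial>L) \<longlonglongrightarrow> (\<integral>x. ?V x * (qf x \<bullet> ?g x) \<partial>L)"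
    using split[OF Wl vl2_grad[OF sW]] split[OF Vl gv] by simp
  \<comment> \<open>The boundary inequality asks for a smooth function, so it is applied to the
    squares of the approximations; for every \<open>n\<close> their boundary integral is that of the
    square of \<open>v\<close>.\<close>
  have three: "(l2_norm L (?W n))\<^sup>2 - Hb * (l2_norm \<Gamma> v)\<^sup>2 \<le> 2 * (\<integral>x. ?W n x * (qf x \<bullet> grad (?W n) x) \<partial>L)" for n
  proof -
    have s2: "smooth (\<lambda>x. (?W n x)\<^sup>2)" by (rule smooth_power[OF sW])
    have "grad (\<lambda>x. ?W n x * ?W n x) x = ?W n x *\<^sub>R grad (?W n) x + ?W n x *\<^sub>R grad (?W n) x" for x
      by (rule grad_mult) (rule smooth_differentiable[OF sW])+
    then have "grad (\<lambda>x. (?W n x)\<^sup>2) x = (2 * ?W n x) *\<^sub>R grad (?W n) x" for x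
      by (simp add: power2_eq_square flip: scaleR_left_distrib)
    then have "(\<integral>x. grad (\<lambda>x. (?W n x)\<^sup>2) x \<bullet> qf x \<partial>L) = 2 * (\<integral>x. ?W n x * (qf x \<bullet> grad (?W n) x) \<partial>L)"
      by (simp add: inner_commute mult.assoc del: distrib_left_numeral)
    moreover have "(\<integral>x. (?W n x)\<^sup>2 \<partial>\<Gamma>) = (l2_norm \<Gamma> v)\<^sup>2"
      unfolding l2_norm_power2 l2_inner_def
    proof (intro Bochner_Integration.integral_cong refl)
      fix x assume "x \<in> space \<Gamma>"
      then have "x \<notin> \<Omega>" by (simp add: space_bdry frontier_domain)
      then show "(?W n x)\<^sup>2 = v x * v x" using test_functionsD(4)[OF \<theta>(2)] by (simp add: power2_eq_square)
    qed
    ultimately show ?thesis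
      using boundary_inequality[OF s2] unfolding l2_norm_power2[of L]
      by (simp add: l2_inner_def power2_eq_square[of "?W n _"])
  qed
  have "(l2_norm L ?V)\<^sup>2 - Hb * (l2_norm \<Gamma> v)\<^sup>2 \<le> 2 * (\<integral>x. ?V x * (qf x \<bullet> ?g x) \<partial>L)"
  proof (rule LIMSEQ_le)
    show "(\<lambda>n. (l2_norm L (?W n))\<^sup>2 - Hb * (l2_norm \<Gamma> v)\<^sup>2) \<longlonglongrightarrow> (l2_norm L ?V)\<^sup>2 - Hb * (l2_norm \<Gamma> v)\<^sup>2"
      by (intro tendsto_intros H1lim_norm(1)[OF lim])
    show "(\<lambda>n. 2 * (\<integral>x. ?W n x * (qf x \<bullet> grad (?W n) x) \<partial>L)) \<longlonglongrightarrow> 2 * (\<integral>x. ?V x * (qf x \<bullet> ?g x) \<partial>L)"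
      by (intro tendsto_intros lim2)
  qed (use three in blast)
  then show ?thesis using two by simp
qed

end

section \<open>Normal derivatives\<close>

text \<open>Makes the approximants of the Stone-Weierstrass theorem admissible as smooth functions
  on the boundary.\<close>

lemma smooth_real_polynomial_function:
  fixes f :: "real^2 \<Rightarrow> real"
  assumes "real_polynomial_function f"
  shows "smooth f"
  using assms
proof (induction rule: real_polynomial_function.induct)
  case (linear f)
  interpret bounded_linear f by fact
  have *: "0 + (\<chi> i. f (axis i 1)) \<bullet> x = f x" for x
  proof -
    have "f x = f (\<Sum>i\<in>UNIV. (x $ i) *\<^sub>R axis i 1)"
      using basis_expansion[of x] by (simp add: scalar_mult_eq_scaleR)
    also have "\<dots> = (\<Sum>i\<in>UNIV. x $ i * f (axis i 1))" by (simp add: sum scaleR)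
    finally show ?thesis by (simp add: inner_vec_def mult.commute)
  qed
  show ?case using smooth_affine[of 0 "\<chi> i. f (axis i 1)"] unfolding * .
qed (auto intro: smooth_add smooth_mult)

context polygon
begin

text \<open>Polynomials approximate \<open>f\<close> uniformly on the compact boundary, so a nonzero
  integral against \<open>f\<close> would persist for one of them.\<close>

lemma bdry_integral_zero_continuous:
  assumes g: "g \<in> l2 \<Gamma>" and zero: "\<And>v. smooth v \<Longrightarrow> l2_inner \<Gamma> g v = 0"
    and f: "continuous_on UNIV f"
  shows "(\<integral>x. g x * f x \<partial>\<Gamma>) = 0"
proof (rule ccontr)
  let ?I = "\<integral>x. g x * f x \<partial>\<Gamma>"
  let ?N = "\<integral>x. \<bar>g x\<bar> \<partial>\<Gamma>"
  assume I: "?I \<noteq> 0"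
  have gi: "integrable \<Gamma> g" using l2_mult_integrable[OF g smooth_l2_bdry[OF smooth_const[of 1]]] by simp
  have N: "0 \<le> ?N" by simp
  \<comment> \<open>The tolerance is chosen so that the approximation error, weighted with
    \<open>g\<close>, stays strictly below the assumed integral; adding 1 avoids division by
    zero.\<close>
  obtain p where p: "real_polynomial_function p" "\<And>x. x \<in> frontier \<Omega> \<Longrightarrow> \<bar>f x - p x\<bar> < \<bar>?I\<bar> / (?N + 1)"
    using Stone_Weierstrass_real_polynomial_function[OF compact_frontier_domain continuous_on_subset[OF f subset_UNIV], of "\<bar>?I\<bar> / (?N + 1)"] I N
    by (auto simp: divide_simps)
  have sp: "smooth p" by (rule smooth_real_polynomial_function[OF p(1)])
  have i1: "integrable \<Gamma> (\<lambda>x. g x * f x)" by (rule l2_mult_integrable[OF g continuous_l2_bdry[OF f]])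
  have i2: "integrable \<Gamma> (\<lambda>x. g x * p x)" by (rule l2_mult_integrable[OF g smooth_l2_bdry[OF sp]])
  have "?I = (\<integral>x. g x * f x - g x * p x \<partial>\<Gamma>)"
    using zero[OF sp] i1 i2 by (simp add: l2_inner_def)
  then have "\<bar>?I\<bar> \<le> (\<integral>x. \<bar>g x * f x - g x * p x\<bar> \<partial>\<Gamma>)" by simp
  also have "\<dots> \<le> (\<integral>x. \<bar>?I\<bar> / (?N + 1) * \<bar>g x\<bar> \<partial>\<Gamma>)"
  proof (rule integral_mono)
    fix x assume "x \<in> space \<Gamma>"
    then have "\<bar>f x - p x\<bar> \<le> \<bar>?I\<bar> / (?N + 1)" using p(2)[of x] by (simp add: space_bdry)
    moreover have "\<bar>g x * f x - g x * p x\<bar> = \<bar>f x - p x\<bar> * \<bar>g x\<bar>"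
    proof -
      have "g x * f x - g x * p x = (f x - p x) * g x" by (simp add: algebra_simps)
      then show ?thesis by (simp only: abs_mult)
    qed
    ultimately show "\<bar>g x * f x - g x * p x\<bar> \<le> \<bar>?I\<bar> / (?N + 1) * \<bar>g x\<bar>"
      using mult_right_mono[of "\<bar>f x - p x\<bar>" "\<bar>?I\<bar> / (?N + 1)" "\<bar>g x\<bar>"] by (simp only: abs_ge_zero)
  qed (use i1 i2 gi in auto)
  also have "\<dots> = \<bar>?I\<bar> / (?N + 1) * ?N" by simp
  also have "\<dots> < \<bar>?I\<bar>"
  proof -
    have "0 < ?N + 1" using N by linarith
    then have "\<bar>?I\<bar> / (?N + 1) * ?N < \<bar>?I\<bar> \<longleftrightarrow> \<bar>?I\<bar> * ?N < \<bar>?I\<bar> * (?N + 1)"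
      by (simp only: times_divide_eq_left pos_divide_less_eq)
    then show ?thesis using I by simp
  qed
  finally show False by simp
qed

text \<open>The analogue of \<open>test_functions_determine\<close> on the boundary: from smooth to
  continuous functions, from these to indicators of closed sets, which generate the Borel sets. It
  makes normal derivatives unique almost everywhere.\<close>

lemma bdry_determine:
  assumes g: "g \<in> l2 \<Gamma>" and zero: "\<And>v. smooth v \<Longrightarrow> l2_inner \<Gamma> g v = 0"
  shows "AE x in \<Gamma>. g x = 0"
proof -
  have cz: "(\<integral>x. g x * f x \<partial>\<Gamma>) = 0" if "continuous_on UNIV f" for f
    using g zero that by (rule bdry_integral_zero_continuous)
  have gi: "integrable \<Gamma> g" using l2_mult_integrable[OF g smooth_l2_bdry[OF smooth_const[of 1]]] by simp
  have fs: "frontier \<Omega> \<in> sets borel" by (intro borel_closed frontier_closed)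
  have idm: "(\<lambda>x. x) \<in> \<Gamma> \<rightarrow>\<^sub>M borel" by (rule borel_imp_bdry) simp
  \<comment> \<open>The uniqueness argument lives on the whole plane, so the boundary measure is
    pushed forward and \<open>g\<close> is extended by zero.\<close>
  define M where "M = distr \<Gamma> borel (\<lambda>x. x)"
  define h where "h x = indicator (frontier \<Omega>) x * g x" for x
  have hm: "h \<in> borel_measurable borel"
  proof -
    have "g \<in> borel_measurable (restrict_space borel (frontier \<Omega>))"
      using l2_measurable[OF g] by (simp add: measurable_cong_sets[OF sets_bdry refl])
    then show ?thesis using fs by (simp add: borel_measurable_restrict_space_iff h_def[abs_def])
  qed
  have hg: "h x = g x" if "x \<in> space \<Gamma>" for x using that by (simp add: h_def space_bdry)
  have intM: "(\<integral>x. k x * h x \<partial>M) = (\<integral>x. k x * g x \<partial>\<Gamma>)" if "k \<in> borel_measurable borel" for k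
  proof -
    have "(\<integral>x. k x * h x \<partial>M) = (\<integral>x. k x * h x \<partial>\<Gamma>)"
      unfolding M_def by (rule integral_distr[OF idm]) (use that hm in simp)
    also have "\<dots> = (\<integral>x. k x * g x \<partial>\<Gamma>)"
      by (rule Bochner_Integration.integral_cong) (auto simp: hg)
    finally show ?thesis .
  qed
  have "AE x in M. h x = 0"
  proof (rule AE_zero_Int_stable)
    show "sets M = sets borel" by (simp add: M_def)
    have "integrable \<Gamma> h" using gi by (subst Bochner_Integration.integrable_cong[OF refl hg])
    then show "integrable M h" unfolding M_def by (subst integrable_distr_eq[OF idm]) (use hm in auto)
    show "Int_stable {F :: (real^2) set. closed F}" by (auto simp: Int_stable_def)
    show "sets borel = sigma_sets UNIV {F :: (real^2) set. closed F}" by (simp add: borel_eq_closed)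
    show "(\<integral>x. h x \<partial>M) = 0" using intM[of "\<lambda>_. 1"] cz[of "\<lambda>_. 1"] by simp
    fix F :: "(real^2) set" assume "F \<in> {F. closed F}"
    then have F: "closed F" by simp
    show "(LINT x:F|M. h x) = 0"
    proof (cases "F = {}")
      case False
      define k where "k n x = max 0 (1 - real n * infdist x F)" for n x
      have kc: "continuous_on UNIV (k n)" for n
        unfolding k_def by (intro continuous_intros)
      have k1: "\<bar>k n x\<bar> \<le> 1" for n x
        using mult_nonneg_nonneg[OF of_nat_0_le_iff[of n] infdist_nonneg[of x F]] by (simp add: k_def)
      have kl: "(\<lambda>n. k n x) \<longlonglongrightarrow> indicator F x" for x
      proof (cases "x \<in> F")
        case True
        then show ?thesis by (simp add: k_def)
      next
        case nF: False
        then have d: "0 < infdist x F" using F False by (simp add: infdist_pos_not_in_closed)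
        obtain N where N: "1 < real N * infdist x F" using reals_Archimedean3[OF d] by blast
        have "k n x = 0" if "n \<ge> N" for n
        proof -
          have "real N * infdist x F \<le> real n * infdist x F" using that d by (intro mult_right_mono) auto
          then show ?thesis using N by (simp add: k_def)
        qed
        then have "(\<lambda>n. k n x) \<longlonglongrightarrow> 0" by (intro tendsto_eventually eventually_sequentiallyI[of N])
        then show ?thesis using nF by simp
      qed
      have "(\<lambda>n. \<integral>x. k n x * g x \<partial>\<Gamma>) \<longlonglongrightarrow> (\<integral>x. indicator F x * g x \<partial>\<Gamma>)"
      proof (rule integral_dominated_convergence)
        show "integrable \<Gamma> (\<lambda>x. \<bar>g x\<bar>)" using gi by simp
        have gm: "g \<in> borel_measurable \<Gamma>" using gi by simp
        show "(\<lambda>x. indicator F x * g x) \<in> borel_measurable \<Gamma>"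
          by (intro borel_measurable_times gm borel_imp_bdry) (use F in auto)
        show "(\<lambda>x. k n x * g x) \<in> borel_measurable \<Gamma>" for n
          by (intro borel_measurable_times gm borel_imp_bdry borel_measurable_continuous_onI kc)
        show "AE x in \<Gamma>. (\<lambda>n. k n x * g x) \<longlonglongrightarrow> indicator F x * g x"
          by (intro AE_I2 tendsto_mult kl tendsto_const)
        show "AE x in \<Gamma>. norm (k n x * g x) \<le> \<bar>g x\<bar>" for n
        proof (rule AE_I2)
          fix x show "norm (k n x * g x) \<le> \<bar>g x\<bar>"
            using mult_right_mono[OF k1[of n x], of "\<bar>g x\<bar>"] by (simp add: abs_mult)
        qed
      qed
      moreover have "(\<integral>x. k n x * g x \<partial>\<Gamma>) = 0" for n using cz[OF kc] by (simp add: mult.commute)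
      ultimately have "(\<integral>x. indicator F x * g x \<partial>\<Gamma>) = 0" by (simp add: LIMSEQ_const_iff)
      moreover have "(indicator F :: _ \<Rightarrow> real) \<in> borel_measurable borel" using F by simp
      ultimately show ?thesis using intM[of "indicator F"] by (simp add: set_lebesgue_integral_def)
    qed (simp add: set_lebesgue_integral_def)
  qed
  moreover have "{x. h x = 0} \<in> sets borel" using hm by simp
  ultimately have "AE x in \<Gamma>. h x = 0" unfolding M_def by (subst (asm) AE_distr_iff[OF idm]) auto
  then show ?thesis using AE_space by eventually_elim (simp add: hg)
qed

text \<open>Green's functional with \<open>-z\<close> in place of the Laplacian: what the normal
  derivative has to represent.\<close>

definition nd_form :: "(real^2 \<Rightarrow> real) \<Rightarrow> (real^2 \<Rightarrow> real) \<Rightarrow> (real^2 \<Rightarrow> real) \<Rightarrow> real" where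
  "nd_form z \<phi> v = vinner (weak_grad \<Omega> \<phi>) (grad v) - l2_inner L z v"

text \<open>Adding \<open>w \<in> H10\<close> to \<open>v\<close> does not change Green's
  functional, by the equation of \<open>\<phi>\<close>. If \<open>v + w\<close> is harmonic, the
  gradient term vanishes and \<open>- (z, v + w)\<close> remains, which
  \<open>harmonic_bound\<close> controls by the boundary values.\<close>

lemma nd_form_bound:
  assumes z: "z \<in> l2 L" and \<phi>: "weak_sol \<Omega> z \<phi>" and v: "smooth v"
  shows "\<bar>nd_form z \<phi> v\<bar> \<le> sqrt Hb * l2_norm L z * l2_norm \<Gamma> v"
proof -
  have H: "\<phi> \<in> H10 \<Omega>" using \<phi> by (simp add: weak_sol_def)
  note gv = vl2_grad[OF v]
  \<comment> \<open>The correction that turns \<open>v\<close> into its harmonic extension.\<close>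
  obtain w where w: "w \<in> H10 \<Omega>"
    and w2: "\<And>\<eta>. \<eta> \<in> test_functions \<Omega> \<Longrightarrow> vinner (weak_grad \<Omega> w) (grad \<eta>) = - vinner (grad v) (grad \<eta>)"
  proof (rule H10_Riesz[where F = "\<lambda>\<eta>. - vinner (grad v) (grad \<eta>)" and C = "vnorm (grad v)"])
    interpret D: psd_form "test_functions \<Omega>" "\<lambda>\<theta> \<eta>. vinner (grad \<theta>) (grad \<eta>)" by (rule Dirichlet_form)
    fix f g :: "real^2 \<Rightarrow> real" and c :: real
    assume f: "f \<in> test_functions \<Omega>"
    note sf = test_functionsD(1)[OF f]
    have "grad (\<lambda>x. c * f x) = (\<lambda>x. c *\<^sub>R grad f x)" using sf by (auto intro!: grad_scale smooth_differentiable)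
    then show "- vinner (grad v) (grad (\<lambda>x. c * f x)) = c * (- vinner (grad v) (grad f))"
      by (simp add: vinner_scale_right)
    show "\<bar>- vinner (grad v) (grad f)\<bar> \<le> vnorm (grad v) * vnorm (grad f)"
      using vinner_Cauchy_Schwarz[OF gv vl2_grad[OF sf]] by simp
    assume g: "g \<in> test_functions \<Omega>"
    note sg = test_functionsD(1)[OF g]
    have "grad (\<lambda>x. f x + g x) = (\<lambda>x. grad f x + grad g x)"
      using sf sg by (auto intro!: grad_add smooth_differentiable)
    then show "- vinner (grad v) (grad (\<lambda>x. f x + g x)) = - vinner (grad v) (grad f) + - vinner (grad v) (grad g)"
      using gv vl2_grad[OF sf] vl2_grad[OF sg] by (simp add: vinner_add_right)
  qed blast
  note gw = H10_vl2[OF w]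
  let ?g = "\<lambda>x. grad v x + weak_grad \<Omega> w x"
  have gg: "vl2 ?g" using gv gw by (rule vl2_add)
  have harm: "vinner ?g (grad \<eta>) = 0" if "\<eta> \<in> test_functions \<Omega>" for \<eta>
    using w2[OF that] gv gw vl2_grad[OF test_functionsD(1)[OF that]] by (simp add: vinner_add_left)
  have "vinner ?g (weak_grad \<Omega> \<phi>) = l2_inner L (\<lambda>x. 0) \<phi>"
    by (rule H10_extend[OF gg l2_zero _ H]) (simp add: harm l2_inner_def)
  then have "vinner (weak_grad \<Omega> \<phi>) (grad v) + vinner (weak_grad \<Omega> \<phi>) (weak_grad \<Omega> w) = 0"
    using gv gw H10_vl2[OF H] by (simp add: vinner_add_left vinner_commute[of _ "weak_grad \<Omega> \<phi>"] l2_inner_def vinner_add_right)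
  moreover have "vinner (weak_grad \<Omega> \<phi>) (weak_grad \<Omega> w) = l2_inner L z w" by (rule weak_sol_self[OF z \<phi> w])
  ultimately have "nd_form z \<phi> v = - l2_inner L z (\<lambda>x. v x + w x)"
    using z smooth_l2[OF v] H10_l2[OF w] by (simp add: nd_form_def l2_inner_add_right)
  then have "\<bar>nd_form z \<phi> v\<bar> \<le> l2_norm L z * l2_norm L (\<lambda>x. v x + w x)"
    using l2_Cauchy_Schwarz[OF z l2_add[OF smooth_l2[OF v] H10_l2[OF w]]] by simp
  also have "\<dots> \<le> l2_norm L z * (sqrt Hb * l2_norm \<Gamma> v)"
  proof (rule mult_left_mono)
    have "sqrt ((l2_norm L (\<lambda>x. v x + w x))\<^sup>2) \<le> sqrt (Hb * (l2_norm \<Gamma> v)\<^sup>2)"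
      by (rule real_sqrt_le_mono[OF harmonic_bound[OF v w harm]])
    then show "l2_norm L (\<lambda>x. v x + w x) \<le> sqrt Hb * l2_norm \<Gamma> v" by (simp add: real_sqrt_mult)
  qed simp
  finally show ?thesis by (simp add: mult_ac)
qed

lemma nd_form_integral:
  assumes z: "z \<in> l2 L" and \<phi>: "weak_sol \<Omega> z \<phi>" and v: "smooth v"
  shows "(\<integral>x. weak_grad \<Omega> \<phi> x \<bullet> grad v x + weak_laplace \<Omega> \<phi> x * v x \<partial>L) = nd_form z \<phi> v"
proof -
  have g: "vl2 (weak_grad \<Omega> \<phi>)" using \<phi> by (intro H10_vl2) (simp add: weak_sol_def)
  note l = weak_sol_Phi[OF z \<phi>]
  have "(\<integral>x. weak_grad \<Omega> \<phi> x \<bullet> grad v x + weak_laplace \<Omega> \<phi> x * v x \<partial>L)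
      = vinner (weak_grad \<Omega> \<phi>) (grad v) + l2_inner L (weak_laplace \<Omega> \<phi>) v"
    unfolding l2_inner_def using vinner_integral[OF g vl2_grad[OF v]] l2_mult_integrable[OF l(3) smooth_l2[OF v]]
    by simp
  also have "l2_inner L (weak_laplace \<Omega> \<phi>) v = l2_inner L (\<lambda>x. - z x) v"
    by (rule l2_inner_cong_AE) (use l z smooth_l2[OF v] in \<open>auto intro!: l2_measurable l2_uminus\<close>)
  finally show ?thesis by (simp add: nd_form_def l2_inner_uminus_left)
qed

lemma nd_form_linear:
  assumes g: "vl2 (weak_grad \<Omega> \<phi>)" and z: "z \<in> l2 L"
  shows "smooth f \<Longrightarrow> smooth h \<Longrightarrow> nd_form z \<phi> (\<lambda>x. f x + h x) = nd_form z \<phi> f + nd_form z \<phi> h"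
    and "smooth f \<Longrightarrow> nd_form z \<phi> (\<lambda>x. c * f x) = c * nd_form z \<phi> f"
proof -
  assume f: "smooth f"
  have "grad (\<lambda>x. c * f x) = (\<lambda>x. c *\<^sub>R grad f x)" using f by (auto intro!: grad_scale smooth_differentiable)
  then show "nd_form z \<phi> (\<lambda>x. c * f x) = c * nd_form z \<phi> f"
    by (simp add: nd_form_def vinner_scale_right l2_inner_scale_right right_diff_distrib)
  assume h: "smooth h"
  have "grad (\<lambda>x. f x + h x) = (\<lambda>x. grad f x + grad h x)" using f h by (auto intro!: grad_add smooth_differentiable)
  then show "nd_form z \<phi> (\<lambda>x. f x + h x) = nd_form z \<phi> f + nd_form z \<phi> h"
    using f h g z by (simp add: nd_form_def vinner_add_right vl2_grad l2_inner_add_right smooth_l2)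
qed

lemma smooth_form: "psd_form (Collect smooth) (l2_inner \<Gamma>)"
proof
  show "Collect smooth \<noteq> {}" using smooth_const by blast
  fix f g h :: "real^2 \<Rightarrow> real" and c :: real
  assume f: "f \<in> Collect smooth" and g: "g \<in> Collect smooth"
  show "(\<lambda>x. f x + g x) \<in> Collect smooth" using f g by (simp add: smooth_add)
  show "l2_inner \<Gamma> f g = l2_inner \<Gamma> g f" by (rule l2_inner_commute)
  show "l2_inner \<Gamma> (\<lambda>x. c * f x) g = c * l2_inner \<Gamma> f g" by (rule l2_inner_scale_left)
  show "l2_inner \<Gamma> (\<lambda>x. f x + g x) h = l2_inner \<Gamma> f h + l2_inner \<Gamma> g h" if "h \<in> Collect smooth"
    using that f g by (intro l2_inner_add_left smooth_l2_bdry) auto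
next
  fix f :: "real^2 \<Rightarrow> real" and c :: real
  assume f: "f \<in> Collect smooth"
  show "(\<lambda>x. c * f x) \<in> Collect smooth" using f by (simp add: smooth_mult)
  show "0 \<le> l2_inner \<Gamma> f f" by (rule l2_inner_self_nonneg)
qed

text \<open>Riesz on the smooth functions yields only a Cauchy sequence in the boundary norm; its
  limit is taken in L2 of the boundary. Testing the limit with the sequence itself carries the bound
  of the functional over to the norm.\<close>

lemma normal_deriv_exists:
  assumes z: "z \<in> l2 L" and \<phi>: "weak_sol \<Omega> z \<phi>"
  obtains g where "g \<in> l2 \<Gamma>" "\<And>v. smooth v \<Longrightarrow> l2_inner \<Gamma> g v = nd_form z \<phi> v"
    "l2_norm \<Gamma> g \<le> sqrt Hb * l2_norm L z"
proof -
  have gv: "vl2 (weak_grad \<Omega> \<phi>)" using \<phi> by (intro H10_vl2) (simp add: weak_sol_def)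
  interpret S: psd_form "Collect smooth" "l2_inner \<Gamma>" by (rule smooth_form)
  obtain \<theta> where \<theta>: "\<And>n. \<theta> n \<in> Collect smooth"
    and cau: "\<And>e. 0 < e \<Longrightarrow> \<exists>N. \<forall>m\<ge>N. \<forall>n\<ge>N. l2_inner \<Gamma> (\<lambda>x. \<theta> m x - \<theta> n x) (\<lambda>x. \<theta> m x - \<theta> n x) < e"
    and lim: "\<And>f. f \<in> Collect smooth \<Longrightarrow> (\<lambda>n. l2_inner \<Gamma> (\<theta> n) f) \<longlonglongrightarrow> nd_form z \<phi> f"
  proof (rule S.Riesz_sequence[where F = "nd_form z \<phi>" and C = "sqrt Hb * l2_norm L z"])
    show "\<bar>nd_form z \<phi> f\<bar> \<le> sqrt Hb * l2_norm L z * sqrt (l2_inner \<Gamma> f f)" if "f \<in> Collect smooth" for f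
      using nd_form_bound[OF z \<phi>, of f] that by (simp add: l2_norm_def)
  qed (use nd_form_linear[OF gv z] in \<open>auto\<close>)
  have \<theta>l: "\<theta> n \<in> l2 \<Gamma>" for n using \<theta> by (intro smooth_l2_bdry) simp
  obtain g where g: "g \<in> l2 \<Gamma>" "(\<lambda>n. l2_norm \<Gamma> (\<lambda>x. \<theta> n x - g x)) \<longlonglongrightarrow> 0"
  proof (rule l2_complete[OF finite_bdry \<theta>l])
    fix e :: real assume e: "0 < e"
    then obtain N where N: "\<And>m n. m \<ge> N \<Longrightarrow> n \<ge> N \<Longrightarrow> l2_inner \<Gamma> (\<lambda>x. \<theta> m x - \<theta> n x) (\<lambda>x. \<theta> m x - \<theta> n x) < e\<^sup>2"
      using cau[OF zero_less_power[OF e, of 2]] by blast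
    have "l2_norm \<Gamma> (\<lambda>x. \<theta> m x - \<theta> n x) < e" if "m \<ge> N" "n \<ge> N" for m n
      by (rule power2_less_imp_less) (use N[OF that] e in \<open>auto simp: l2_norm_power2\<close>)
    then show "\<exists>N. \<forall>m\<ge>N. \<forall>n\<ge>N. l2_norm \<Gamma> (\<lambda>x. \<theta> m x - \<theta> n x) < e" by blast
  qed blast
  have eq: "l2_inner \<Gamma> g v = nd_form z \<phi> v" if v: "smooth v" for v
  proof -
    have vl: "v \<in> l2 \<Gamma>" by (rule smooth_l2_bdry[OF v])
    have "(\<lambda>n. l2_inner \<Gamma> (\<theta> n) v) \<longlonglongrightarrow> l2_inner \<Gamma> g v"
      by (intro l2_inner_tendsto \<theta>l g vl l2_norm_tendsto_const)
    then show ?thesis using lim[of v] v LIMSEQ_unique by blast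
  qed
  have "(l2_norm \<Gamma> g)\<^sup>2 \<le> sqrt Hb * l2_norm L z * l2_norm \<Gamma> g"
  proof (rule LIMSEQ_le)
    show "(\<lambda>n. l2_inner \<Gamma> g (\<theta> n)) \<longlonglongrightarrow> (l2_norm \<Gamma> g)\<^sup>2"
      unfolding l2_norm_power2 by (intro l2_inner_tendsto \<theta>l g l2_norm_tendsto_const)
    show "(\<lambda>n. sqrt Hb * l2_norm L z * l2_norm \<Gamma> (\<theta> n)) \<longlonglongrightarrow> sqrt Hb * l2_norm L z * l2_norm \<Gamma> g"
      by (intro tendsto_mult_left l2_norm_tendsto \<theta>l g)
    show "\<exists>N. \<forall>n\<ge>N. l2_inner \<Gamma> g (\<theta> n) \<le> sqrt Hb * l2_norm L z * l2_norm \<Gamma> (\<theta> n)"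
      using eq nd_form_bound[OF z \<phi>] \<theta> by (metis abs_le_D1 mem_Collect_eq)
  qed
  then have "l2_norm \<Gamma> g \<le> sqrt Hb * l2_norm L z"
  proof (cases "l2_norm \<Gamma> g = 0")
    case False
    then have "0 < l2_norm \<Gamma> g" using l2_norm_nonneg[of \<Gamma> g] by linarith
    then show ?thesis using \<open>(l2_norm \<Gamma> g)\<^sup>2 \<le> _\<close> by (simp add: power2_eq_square)
  qed (use Hb_pos in simp)
  then show ?thesis using that g(1) eq by blast
qed

text \<open>Almost everywhere uniqueness transfers the norm bound from the constructed function to
  the chosen one.\<close>

lemma normal_deriv_works:
  assumes z: "z \<in> l2 L" and \<phi>: "weak_sol \<Omega> z \<phi>"
  shows "normal_deriv \<Omega> \<phi> \<in> l2 \<Gamma>" "\<And>v. smooth v \<Longrightarrow> l2_inner \<Gamma> (normal_deriv \<Omega> \<phi>) v = nd_form z \<phi> v"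
    "l2_norm \<Gamma> (normal_deriv \<Omega> \<phi>) \<le> sqrt Hb * l2_norm L z"
proof -
  obtain g where g: "g \<in> l2 \<Gamma>" "\<And>v. smooth v \<Longrightarrow> l2_inner \<Gamma> g v = nd_form z \<phi> v"
    "l2_norm \<Gamma> g \<le> sqrt Hb * l2_norm L z" using normal_deriv_exists[OF z \<phi>] by blast
  have "is_normal_deriv \<Omega> \<phi> g"
    unfolding is_normal_deriv_def using g(1,2) nd_form_integral[OF z \<phi>] by simp
  then have "is_normal_deriv \<Omega> \<phi> (normal_deriv \<Omega> \<phi>)"
    unfolding normal_deriv_def by (rule someI[of "is_normal_deriv \<Omega> \<phi>"])
  then show n: "normal_deriv \<Omega> \<phi> \<in> l2 \<Gamma>" "\<And>v. smooth v \<Longrightarrow> l2_inner \<Gamma> (normal_deriv \<Omega> \<phi>) v = nd_form z \<phi> v"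
    using nd_form_integral[OF z \<phi>] by (auto simp: is_normal_deriv_def)
  have "AE x in \<Gamma>. normal_deriv \<Omega> \<phi> x - g x = 0"
    by (rule bdry_determine) (use n g(1,2) in \<open>auto intro: l2_diff simp: l2_inner_diff_left smooth_l2_bdry\<close>)
  then have "AE x in \<Gamma>. normal_deriv \<Omega> \<phi> x = g x" by eventually_elim simp
  then have "l2_norm \<Gamma> (normal_deriv \<Omega> \<phi>) = l2_norm \<Gamma> g"
    by (rule l2_norm_cong_AE) (use n(1) g(1) l2_measurable in auto)
  then show "l2_norm \<Gamma> (normal_deriv \<Omega> \<phi>) \<le> sqrt Hb * l2_norm L z" using g(3) by simp
qed

lemma normal_deriv_eqI:
  assumes z: "z \<in> l2 L" "weak_sol \<Omega> z \<phi>" and g: "g \<in> l2 \<Gamma>"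
    and eq: "\<And>v. smooth v \<Longrightarrow> l2_inner \<Gamma> g v = nd_form z \<phi> v"
  shows "AE x in \<Gamma>. normal_deriv \<Omega> \<phi> x = g x"
proof -
  note n = normal_deriv_works[OF z]
  have "AE x in \<Gamma>. normal_deriv \<Omega> \<phi> x - g x = 0"
    by (rule bdry_determine) (use n(1,2) g eq in \<open>auto intro: l2_diff simp: l2_inner_diff_left smooth_l2_bdry\<close>)
  then show ?thesis by eventually_elim simp
qed

lemma normal_deriv_linear:
  assumes z: "z \<in> l2 L" "z1 \<in> l2 L" "z2 \<in> l2 L"
    and \<phi>: "weak_sol \<Omega> z \<phi>" "weak_sol \<Omega> z1 \<phi>1" "weak_sol \<Omega> z2 \<phi>2"
    and eq: "AE x in L. z x = c * z1 x + z2 x"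
  shows "AE x in \<Gamma>. normal_deriv \<Omega> \<phi> x = c * normal_deriv \<Omega> \<phi>1 x + normal_deriv \<Omega> \<phi>2 x"
proof (rule normal_deriv_eqI[OF z(1) \<phi>(1)])
  note n1 = normal_deriv_works[OF z(2) \<phi>(2)] and n2 = normal_deriv_works[OF z(3) \<phi>(3)]
  show "(\<lambda>x. c * normal_deriv \<Omega> \<phi>1 x + normal_deriv \<Omega> \<phi>2 x) \<in> l2 \<Gamma>"
    using n1 n2 by (intro l2_add l2_scale)
  fix v assume v: "smooth v"
  have H: "\<phi> \<in> H10 \<Omega>" "\<phi>1 \<in> H10 \<Omega>" "\<phi>2 \<in> H10 \<Omega>" using \<phi> by (auto simp: weak_sol_def)
  note g = H[THEN H10_vl2] and gv = vl2_grad[OF v]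
  have "l2_inner \<Gamma> (\<lambda>x. c * normal_deriv \<Omega> \<phi>1 x + normal_deriv \<Omega> \<phi>2 x) v = c * nd_form z1 \<phi>1 v + nd_form z2 \<phi>2 v"
    using n1 n2 v by (simp add: l2_inner_add_left l2_scale l2_inner_scale_left smooth_l2_bdry)
  moreover have "vinner (weak_grad \<Omega> \<phi>) (grad v) = vinner (\<lambda>x. c *\<^sub>R weak_grad \<Omega> \<phi>1 x + weak_grad \<Omega> \<phi>2 x) (grad v)"
    by (rule vinner_cong_AE[OF weak_sol_linear[OF z \<phi> eq]]) (use g gv in \<open>auto intro: vl2_add vl2_scale\<close>)
  moreover have "l2_inner L z v = l2_inner L (\<lambda>x. c * z1 x + z2 x) v"
    by (rule l2_inner_cong_AE[OF eq]) (use z smooth_l2[OF v] in \<open>auto intro!: l2_measurable l2_add l2_scale\<close>)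
  ultimately show "l2_inner \<Gamma> (\<lambda>x. c * normal_deriv \<Omega> \<phi>1 x + normal_deriv \<Omega> \<phi>2 x) v = nd_form z \<phi> v"
    using g gv z smooth_l2[OF v]
    by (simp add: nd_form_def vinner_add_left vl2_scale vinner_scale_left l2_inner_add_left l2_scale l2_inner_scale_left
        right_diff_distrib)
qed

section \<open>The solution operator and its adjoint\<close>

lemma S_adj_sol:
  assumes "z \<in> l2 L"
  shows "weak_sol \<Omega> z (SOME \<phi>. weak_sol \<Omega> z \<phi>)"
  using weak_sol_exists[OF assms] by (rule someI_ex)

lemma S_adj_l2: "z \<in> l2 L \<Longrightarrow> S_adj \<Omega> z \<in> l2 \<Gamma>"
  unfolding S_adj_def by (intro l2_uminus normal_deriv_works(1)[OF _ S_adj_sol])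

lemma S_adj_bound: "z \<in> l2 L \<Longrightarrow> l2_norm \<Gamma> (S_adj \<Omega> z) \<le> sqrt Hb * l2_norm L z"
  unfolding S_adj_def l2_norm_uminus by (rule normal_deriv_works(3)[OF _ S_adj_sol])

lemma S_adj_linear:
  assumes z: "z \<in> l2 L" "z1 \<in> l2 L" "z2 \<in> l2 L" and eq: "AE x in L. z x = c * z1 x + z2 x"
  shows "AE x in \<Gamma>. S_adj \<Omega> z x = c * S_adj \<Omega> z1 x + S_adj \<Omega> z2 x"
  using normal_deriv_linear[OF z z[THEN S_adj_sol] eq]
  unfolding S_adj_def by eventually_elim simp

lemma S_adj_cong:
  assumes z: "z \<in> l2 L" "z' \<in> l2 L" and eq: "AE x in L. z x = z' x"
  shows "AE x in \<Gamma>. S_adj \<Omega> z x = S_adj \<Omega> z' x"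
proof -
  have "AE x in L. z x = 0 * z x + z' x" using eq by eventually_elim simp
  from S_adj_linear[OF z(1,1,2) this] show ?thesis by simp
qed

lemma S_adj_normal_deriv:
  assumes z: "z \<in> l2 L" and \<phi>: "weak_sol \<Omega> z \<phi>"
  shows "AE x in \<Gamma>. S_adj \<Omega> z x = - normal_deriv \<Omega> \<phi> x"
proof -
  have "AE x in L. z x = 0 * z x + z x" by simp
  from normal_deriv_linear[OF z z z S_adj_sol[OF z] \<phi> \<phi> this] show ?thesis
    unfolding S_adj_def by eventually_elim simp
qed

text \<open>Since \<open>Phi\<close> consists of the weak solutions for all \<open>z\<close>, the
  defining identity is a duality statement between \<open>y\<close> and
  \<open>S_adj\<close>.\<close>

lemma transposition_sol_iff:
  assumes u: "u \<in> l2 \<Gamma>"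
  shows "transposition_sol \<Omega> u y \<longleftrightarrow> y \<in> l2 L \<and> (\<forall>z\<in>l2 L. l2_inner L y z = l2_inner \<Gamma> u (S_adj \<Omega> z))"
proof (cases "y \<in> l2 L")
  case y: True
  have *: "l2_inner \<Gamma> u (S_adj \<Omega> z) = - l2_inner \<Gamma> u (normal_deriv \<Omega> \<phi>)"
    if z: "z \<in> l2 L" and \<phi>: "weak_sol \<Omega> z \<phi>" for z \<phi>
  proof -
    note n = normal_deriv_works(1)[OF z \<phi>]
    have "l2_inner \<Gamma> u (S_adj \<Omega> z) = l2_inner \<Gamma> u (\<lambda>x. - normal_deriv \<Omega> \<phi> x)"
      by (rule l2_inner_cong_AE[OF _ S_adj_normal_deriv[OF z \<phi>]])
        (use u n S_adj_l2[OF z] in \<open>auto intro!: l2_measurable l2_uminus\<close>)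
    then show ?thesis by (simp add: l2_inner_uminus_right)
  qed
  show ?thesis
  proof
    assume t: "transposition_sol \<Omega> u y"
    have "l2_inner L y z = l2_inner \<Gamma> u (S_adj \<Omega> z)" if z: "z \<in> l2 L" for z
    proof -
      obtain \<phi> where \<phi>: "weak_sol \<Omega> z \<phi>" using weak_sol_exists[OF z] by blast
      note P = weak_sol_Phi[OF z \<phi>]
      have "l2_inner L y z = l2_inner L y (\<lambda>x. - weak_laplace \<Omega> \<phi> x)"
      proof (rule l2_inner_cong_AE)
        show "AE x in L. z x = - weak_laplace \<Omega> \<phi> x" using P(2) by eventually_elim simp
      qed (use y z P(3) in \<open>auto intro!: l2_measurable l2_uminus\<close>)
      also have "\<dots> = - l2_inner \<Gamma> u (normal_deriv \<Omega> \<phi>)" using t P(1) by (simp add: transposition_sol_def)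
      finally show ?thesis using *[OF z \<phi>] by simp
    qed
    then show "y \<in> l2 L \<and> (\<forall>z\<in>l2 L. l2_inner L y z = l2_inner \<Gamma> u (S_adj \<Omega> z))" using y by blast
  next
    assume "y \<in> l2 L \<and> (\<forall>z\<in>l2 L. l2_inner L y z = l2_inner \<Gamma> u (S_adj \<Omega> z))"
    then show "transposition_sol \<Omega> u y"
      unfolding transposition_sol_def using * Phi_weak_sol by simp
  qed
qed (simp add: transposition_sol_def)

lemma S_adj_inner_linear:
  assumes u: "u \<in> l2 \<Gamma>" and z: "z \<in> l2 L" "z1 \<in> l2 L" "z2 \<in> l2 L" and eq: "AE x in L. z x = c * z1 x + z2 x"
  shows "l2_inner \<Gamma> u (S_adj \<Omega> z) = c * l2_inner \<Gamma> u (S_adj \<Omega> z1) + l2_inner \<Gamma> u (S_adj \<Omega> z2)"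
proof -
  note s = z[THEN S_adj_l2]
  have "l2_inner \<Gamma> u (S_adj \<Omega> z) = l2_inner \<Gamma> u (\<lambda>x. c * S_adj \<Omega> z1 x + S_adj \<Omega> z2 x)"
    by (rule l2_inner_cong_AE[OF _ S_adj_linear[OF z eq]]) (use u s in \<open>auto intro!: l2_measurable l2_add l2_scale\<close>)
  then show ?thesis using u s by (simp add: l2_inner_add_right l2_scale l2_inner_scale_right)
qed

text \<open>\<open>S_adj\<close> is linear only almost everywhere, but inside the inner product this
  is true linearity; the functional is bounded by \<open>S_adj_bound\<close>, and Riesz represents
  it.\<close>

lemma S_op_works:
  assumes u: "u \<in> l2 \<Gamma>"
  shows "transposition_sol \<Omega> u (S_op \<Omega> u)" "S_op \<Omega> u \<in> l2 L"
    "\<And>z. z \<in> l2 L \<Longrightarrow> l2_inner L (S_op \<Omega> u) z = l2_inner \<Gamma> u (S_adj \<Omega> z)"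
proof -
  have zero: "l2_inner \<Gamma> u (S_adj \<Omega> (\<lambda>x. 0)) = 0"
    using S_adj_inner_linear[OF u l2_zero l2_zero l2_zero, of 1] by simp
  obtain y where "y \<in> l2 L" "\<And>z. z \<in> l2 L \<Longrightarrow> l2_inner L y z = l2_inner \<Gamma> u (S_adj \<Omega> z)"
  proof (rule l2_riesz[OF finite_L l2.psd_form_axioms, where F = "\<lambda>z. l2_inner \<Gamma> u (S_adj \<Omega> z)"
      and c = 1 and K = 1 and C = "l2_norm \<Gamma> u * sqrt Hb"])
    show "l2_inner \<Gamma> u (S_adj \<Omega> (\<lambda>x. f x + g x)) = l2_inner \<Gamma> u (S_adj \<Omega> f) + l2_inner \<Gamma> u (S_adj \<Omega> g)"
      if "f \<in> l2 L" "g \<in> l2 L" for f g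
      using S_adj_inner_linear[OF u l2_add[OF that] that, of 1] by simp
    show "l2_inner \<Gamma> u (S_adj \<Omega> (\<lambda>x. c * f x)) = c * l2_inner \<Gamma> u (S_adj \<Omega> f)" if "f \<in> l2 L" for f c
      using S_adj_inner_linear[OF u l2_scale[OF that] that l2_zero, of c c] zero by simp
    show "\<bar>l2_inner \<Gamma> u (S_adj \<Omega> f)\<bar> \<le> l2_norm \<Gamma> u * sqrt Hb * l2_norm L f" if "f \<in> l2 L" for f
      using l2_Cauchy_Schwarz[OF u S_adj_l2[OF that]] mult_left_mono[OF S_adj_bound[OF that] l2_norm_nonneg[of \<Gamma> u]]
      by (simp add: mult.assoc)
  qed (auto simp: l2_norm_power2)
  then have "\<exists>y. transposition_sol \<Omega> u y" using transposition_sol_iff[OF u] by blast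
  then show t: "transposition_sol \<Omega> u (S_op \<Omega> u)" unfolding S_op_def by (rule someI_ex)
  then show "S_op \<Omega> u \<in> l2 L" "\<And>z. z \<in> l2 L \<Longrightarrow> l2_inner L (S_op \<Omega> u) z = l2_inner \<Gamma> u (S_adj \<Omega> z)"
    using transposition_sol_iff[OF u] by blast+
qed

lemma S_op_linear:
  assumes u: "u \<in> l2 \<Gamma>" "u1 \<in> l2 \<Gamma>" "u2 \<in> l2 \<Gamma>"
    and t: "transposition_sol \<Omega> u y" and eq: "AE x in \<Gamma>. u x = c * u1 x + u2 x"
  shows "AE x in L. y x = c * S_op \<Omega> u1 x + S_op \<Omega> u2 x"
proof -
  note s = u[THEN S_op_works(2)]
  have y: "y \<in> l2 L" "\<And>z. z \<in> l2 L \<Longrightarrow> l2_inner L y z = l2_inner \<Gamma> u (S_adj \<Omega> z)"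
    using t transposition_sol_iff[OF u(1)] by blast+
  let ?d = "\<lambda>x. y x - (c * S_op \<Omega> u1 x + S_op \<Omega> u2 x)"
  have d: "?d \<in> l2 L" using y s by (intro l2_diff l2_add l2_scale)
  have "l2_inner L ?d z = 0" if z: "z \<in> l2 L" for z
  proof -
    have "l2_inner \<Gamma> u (S_adj \<Omega> z) = l2_inner \<Gamma> (\<lambda>x. c * u1 x + u2 x) (S_adj \<Omega> z)"
      by (rule l2_inner_cong_AE[OF eq]) (use u S_adj_l2[OF z] in \<open>auto intro!: l2_measurable l2_add l2_scale\<close>)
    then show ?thesis using y s u S_adj_l2[OF z] z S_op_works(3)
      by (simp add: l2_inner_diff_left l2_inner_add_left l2_add l2_scale l2_inner_scale_left)
  qed
  from this[OF d] have "l2_norm L ?d = 0" by (simp add: l2_norm_def)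
  then have "AE x in L. ?d x = 0" using l2_norm_zero_iff[OF d] by blast
  then show ?thesis by eventually_elim simp
qed

lemma S_op_unique:
  assumes u: "u \<in> l2 \<Gamma>" and t: "transposition_sol \<Omega> u y"
  shows "AE x in L. y x = S_op \<Omega> u x"
proof -
  have "AE x in \<Gamma>. u x = 0 * u x + u x" by simp
  from S_op_linear[OF u u u t this] show ?thesis by simp
qed

text \<open>Duality with \<open>z = S_op \<Omega> u\<close> transfers the bound of the
  adjoint.\<close>

lemma S_op_bound:
  assumes u: "u \<in> l2 \<Gamma>"
  shows "l2_norm L (S_op \<Omega> u) \<le> sqrt Hb * l2_norm \<Gamma> u"
proof (cases "l2_norm L (S_op \<Omega> u) = 0")
  case False
  note s = S_op_works[OF u]
  have "(l2_norm L (S_op \<Omega> u))\<^sup>2 = l2_inner \<Gamma> u (S_adj \<Omega> (S_op \<Omega> u))"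
    using s(3)[OF s(2)] by (simp add: l2_norm_power2)
  also have "\<dots> \<le> l2_norm \<Gamma> u * (sqrt Hb * l2_norm L (S_op \<Omega> u))"
    using l2_Cauchy_Schwarz[OF u S_adj_l2[OF s(2)]] mult_left_mono[OF S_adj_bound[OF s(2)] l2_norm_nonneg[of \<Gamma> u]]
    by linarith
  finally have "l2_norm L (S_op \<Omega> u) * l2_norm L (S_op \<Omega> u) \<le> (sqrt Hb * l2_norm \<Gamma> u) * l2_norm L (S_op \<Omega> u)"
    by (simp add: power2_eq_square mult_ac)
  moreover have "0 < l2_norm L (S_op \<Omega> u)" using False l2_norm_nonneg[of L "S_op \<Omega> u"] by linarith
  ultimately show ?thesis by (simp add: mult_le_cancel_right)
qed (use Hb_pos in simp)

end

section \<open>Interior smoothing of the adjoint\<close>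

context polygon
begin

lemma cutoff:
  assumes C: "compact C" "C \<subseteq> \<Omega>"
  obtains \<tau> where "\<tau> \<in> test_functions \<Omega>" "\<And>x. x \<in> C \<Longrightarrow> \<tau> x = 1"
proof -
  have "\<exists>c>0. \<forall>x\<in>C. c \<le> dst F x" if F: "F \<in> facets" for F
  proof (cases "C = {}")
    case False
    obtain y where y: "y \<in> C" "\<And>x. x \<in> C \<Longrightarrow> dst F y \<le> dst F x"
      using continuous_attains_inf[OF C(1) False dst_continuous] by blast
    then show ?thesis using dst_pos_domain[OF F, of y] C(2) by blast
  qed (auto intro: exI[of _ 1])
  then obtain c0 where c0: "\<And>F. F \<in> facets \<Longrightarrow> 0 < c0 F" "\<And>F x. F \<in> facets \<Longrightarrow> x \<in> C \<Longrightarrow> c0 F \<le> dst F x"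
    by metis
  define c where "c = Min (c0 ` facets)"
  have fin: "finite (c0 ` facets)" "c0 ` facets \<noteq> {}" using finite_facets facets_nonempty by auto
  have c: "0 < c" unfolding c_def using fin c0(1) by (subst Min_gr_iff) auto
  have cle: "c \<le> dst F x" if "F \<in> facets" "x \<in> C" for F x
    unfolding c_def using Min_le[OF fin(1), of "c0 F"] c0(2)[OF that] that(1) by auto
  \<comment> \<open>\<open>step ((2 / c) * d - 1)\<close> is 0 for \<open>d \<le> c/2\<close> and 1
    for \<open>d \<ge> c\<close>; the product combines this over all edges.\<close>
  define \<tau> where "\<tau> x = (\<Prod>F\<in>facets. step ((2 / c) * dst F x - 1))" for x
  show ?thesis
  proof (rule that)
    show "\<tau> x = 1" if "x \<in> C" for x
      unfolding \<tau>_def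
    proof (rule prod.neutral, rule ballI, rule step_1)
      fix F assume "F \<in> facets"
      from cle[OF this that] show "1 \<le> (2 / c) * dst F x - 1" using c by (simp add: field_simps)
    qed
    let ?K = "{x. \<forall>F\<in>facets. c / 2 \<le> dst F x}"
    have sub: "?K \<subseteq> \<Omega>"
    proof
      fix x assume x: "x \<in> ?K"
      have "0 < dst F x" if "F \<in> facets" for F
      proof -
        have "c / 2 \<le> dst F x" using x that by blast
        then show ?thesis using c by linarith
      qed
      then show "x \<in> \<Omega>" by (rule dst_pos_imp_domain)
    qed
    show "\<tau> \<in> test_functions \<Omega>"
    proof (rule test_functionsI)
      show "smooth \<tau>" unfolding \<tau>_def[abs_def]
        by (intro smooth_prod smooth_step smooth_diff smooth_mult smooth_const smooth_dst)
      have "?K = (\<Inter>F\<in>facets. {x. c / 2 \<le> dst F x})" by auto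
      moreover have "closed \<dots>" by (intro closed_INT ballI closed_Collect_le dst_continuous continuous_on_const)
      ultimately have "closed ?K" by simp
      then show "compact ?K" using bounded_subset[OF bounded_domain sub] by (simp add: compact_eq_bounded_closed)
      show "?K \<subseteq> \<Omega>" by (rule sub)
      show "\<tau> x = 0" if xK: "x \<notin> ?K" for x
      proof -
        obtain F where F: "F \<in> facets" "dst F x < c / 2" using xK by (auto simp: not_le)
        then have "step ((2 / c) * dst F x - 1) = 0" using c by (intro step_0) (simp add: field_simps)
        then show ?thesis unfolding \<tau>_def using F(1) finite_facets by (auto simp: prod_zero_iff)
      qed
    qed
  qed
qed

lemma smooth_mult_l2:
  assumes s: "smooth s"
  shows "\<exists>D\<ge>0. \<forall>h\<in>l2 L. (\<lambda>x. s x * h x) \<in> l2 L \<and> l2_norm L (\<lambda>x. s x * h x) \<le> D * l2_norm L h"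
proof -
  obtain D where D: "0 \<le> D" "\<And>x. x \<in> \<Omega> \<Longrightarrow> norm (s x) \<le> D"
    using continuous_bounded[OF smooth_continuous[OF s]] by blast
  have 1: "(\<lambda>x. s x * h x) \<in> l2 L" if "h \<in> l2 L" for h
    by (rule l2_mult_bounded[OF that, of _ D]) (use D s in \<open>auto intro!: AE_L_I borel_imp_L smooth_borel\<close>)
  moreover have "l2_norm L (\<lambda>x. s x * h x) \<le> D * l2_norm L h" if "h \<in> l2 L" for h
    by (rule l2_norm_mono[OF that l2_measurable[OF 1[OF that]] _ D(1)])
      (use D in \<open>auto intro!: AE_L_I mult_right_mono simp: abs_mult\<close>)
  ultimately show ?thesis using D(1) by blast
qed

text \<open>Away from the support of \<open>z\<close> the solution is harmonic. Multiplying it by a function that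
  equals one near the boundary keeps the normal derivative, and the new right hand side involves only
  first derivatives of the solution, which are controlled by a weak norm of \<open>z\<close>.\<close>

lemma localized_solution:
  assumes \<tau>: "\<tau> \<in> test_functions \<Omega>"
  obtains K where "0 \<le> K" "\<And>z \<phi>. z \<in> l2 L \<Longrightarrow> (\<forall>x\<in>\<Omega>. \<tau> x \<noteq> 1 \<longrightarrow> z x = 0) \<Longrightarrow> weak_sol \<Omega> z \<phi> \<Longrightarrow>
    l2_norm \<Gamma> (normal_deriv \<Omega> \<phi>) \<le> K * vnorm (weak_grad \<Omega> \<phi>)"
proof -
  define \<rho> where "\<rho> x = 1 - \<tau> x" for x
  have s\<tau>: "smooth \<tau>" using test_functionsD(1)[OF \<tau>] .
  have s: "smooth \<rho>" unfolding \<rho>_def[abs_def] by (intro smooth_diff smooth_const s\<tau>)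
  let ?d = "\<lambda>i x. grad \<rho> x $ i"
  let ?dd = "\<lambda>i x. grad (?d i) x $ i"
  have sd: "smooth (?d i)" and sdd: "smooth (?dd i)" for i by (intro smooth_grad s)+
  have gr: "grad \<rho> x = - grad \<tau> x" for x
    using grad_diff[OF smooth_differentiable[OF smooth_const] smooth_differentiable[OF s\<tau>], of 1 x]
    by (simp add: \<rho>_def[abs_def])
  \<comment> \<open>\<open>\<rho>\<close> is constant near the boundary, so its derivatives have
    compact support although \<open>\<rho>\<close> has not.\<close>
  have td: "(\<lambda>x. v x * ?d i x) \<in> test_functions \<Omega>" if "smooth v" for v i
    using test_functions_mult_smooth[OF test_functions_grad[OF \<tau>, of i] smooth_mult[OF smooth_const[of "-1"] that]]
    by (simp add: gr)
  have "\<forall>i. \<exists>D. 0 \<le> D \<and> (\<forall>h\<in>l2 L. (\<lambda>x. ?d i x * h x) \<in> l2 L \<and> l2_norm L (\<lambda>x. ?d i x * h x) \<le> D * l2_norm L h)"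
    by (rule allI) (rule smooth_mult_l2[OF sd])
  from choice[OF this] obtain D where
    D: "\<And>i. 0 \<le> D i" "\<And>i h. h \<in> l2 L \<Longrightarrow> l2_norm L (\<lambda>x. ?d i x * h x) \<le> D i * l2_norm L h" by blast
  have "\<forall>i. \<exists>D. 0 \<le> D \<and> (\<forall>h\<in>l2 L. (\<lambda>x. ?dd i x * h x) \<in> l2 L \<and> l2_norm L (\<lambda>x. ?dd i x * h x) \<le> D * l2_norm L h)"
    by (rule allI) (rule smooth_mult_l2[OF sdd])
  from choice[OF this] obtain E where
    E: "\<And>i. 0 \<le> E i" "\<And>i h. h \<in> l2 L \<Longrightarrow> l2_norm L (\<lambda>x. ?dd i x * h x) \<le> E i * l2_norm L h" by blast
  have ml: "(\<lambda>x. k x * h x) \<in> l2 L" if "smooth k" "h \<in> l2 L" for k h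
    using smooth_mult_l2[OF that(1)] that(2) by blast
  let ?K = "sqrt Hb * (\<Sum>i\<in>UNIV. 2 * D i + E i * CP)"
  have "l2_norm \<Gamma> (normal_deriv \<Omega> \<phi>) \<le> ?K * vnorm (weak_grad \<Omega> \<phi>)"
    if z: "z \<in> l2 L" and supp: "\<forall>x\<in>\<Omega>. \<tau> x \<noteq> 1 \<longrightarrow> z x = 0" and \<phi>: "weak_sol \<Omega> z \<phi>" for z \<phi>
  proof -
    have H: "\<phi> \<in> H10 \<Omega>" using \<phi> by (simp add: weak_sol_def)
    define g where "g = weak_grad \<Omega> \<phi>"
    have gv: "vl2 g" unfolding g_def by (rule H10_vl2[OF H])
    note gl = vl2D[OF gv]
    have \<phi>l: "\<phi> \<in> l2 L" by (rule H10_l2[OF H])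
    let ?r = "\<lambda>i x. 2 * (?d i x * g x $ i) + ?dd i x * \<phi> x"
    have r: "?r i \<in> l2 L" for i by (intro l2_add l2_scale ml sd sdd gl \<phi>l)
    \<comment> \<open>Minus the Laplacian of \<open>\<rho> \<phi>\<close> by the product rule. The
      term \<open>\<rho> z\<close> is absent because \<open>\<rho>\<close> vanishes wherever
      \<open>z\<close> does not.\<close>
    define z' where "z' x = - (?r 1 x + ?r 2 x)" for x
    have z'l: "z' \<in> l2 L" unfolding z'_def by (intro l2_uminus l2_add r)
    have rn: "l2_norm L (?r i) \<le> (2 * D i + E i * CP) * vnorm g" for i
    proof -
      have "l2_norm L (?r i) \<le> l2_norm L (\<lambda>x. 2 * (?d i x * g x $ i)) + l2_norm L (\<lambda>x. ?dd i x * \<phi> x)"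
        by (intro l2_norm_triangle l2_scale ml sd sdd gl \<phi>l)
      also have "\<dots> \<le> 2 * (D i * l2_norm L (\<lambda>x. g x $ i)) + E i * l2_norm L \<phi>"
        using D(2)[OF gl[of i], of i] E(2)[OF \<phi>l, of i] by (simp add: l2_norm_scale)
      also have "\<dots> \<le> 2 * (D i * vnorm g) + E i * (CP * vnorm g)"
        using CP_H10[OF H] by (intro add_mono mult_left_mono component_le_vnorm D E) (auto simp: g_def)
      finally show ?thesis by (simp add: algebra_simps)
    qed
    have z'n: "l2_norm L z' \<le> (\<Sum>i\<in>UNIV. 2 * D i + E i * CP) * vnorm g"
    proof -
      have "l2_norm L z' \<le> l2_norm L (?r 1) + l2_norm L (?r 2)"
        unfolding z'_def l2_norm_uminus by (rule l2_norm_triangle[OF r r])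
      then show ?thesis using rn[of 1] rn[of 2] by (simp add: sum_2 algebra_simps)
    qed
    obtain \<theta> where \<theta>: "H1lim \<theta> \<phi> (weak_grad \<Omega> \<phi>)" "\<And>n. \<theta> n \<in> test_functions \<Omega>" using H10_E[OF H] by blast
    define \<psi> where "\<psi> x = \<rho> x * \<phi> x" for x
    let ?g = "\<lambda>x. \<rho> x *\<^sub>R g x + \<phi> x *\<^sub>R grad \<rho> x"
    have lim: "H1lim (\<lambda>n x. \<rho> x * \<theta> n x) \<psi> ?g"
      unfolding \<psi>_def g_def by (rule H1lim_mult[OF \<theta>(1) s])
    have \<psi>H: "\<psi> \<in> H10 \<Omega>" by (rule H10_I[OF lim]) (intro test_functions_mult_smooth \<theta>(2) s)
    have gg: "vl2 ?g" using lim by (simp add: H1lim_def)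
    have gAE: "AE x in L. weak_grad \<Omega> \<psi> x = ?g x" by (rule weak_grad_works(2)[OF H1lim_weak_grad[OF lim]])
    \<comment> \<open>The product rule in weak form. It takes one integration by parts, namely the
      weak gradient of \<open>\<phi>\<close> tested with
      \<open>v \<partial>_i \<rho>\<close>.\<close>
    have key: "vinner (weak_grad \<Omega> \<psi>) (grad v) - l2_inner L z' v = vinner g (grad (\<lambda>x. \<rho> x * v x))"
      if v: "smooth v" for v
    proof -
      let ?v = "\<lambda>i x. grad v x $ i"
      have vl: "v \<in> l2 L" "?v i \<in> l2 L" for i by (intro smooth_l2 smooth_grad v)+
      have comp: "l2_inner L (\<lambda>x. ?g x $ i) (?v i) + l2_inner L (?r i) v = l2_inner L (\<lambda>x. g x $ i) (\<lambda>x. grad (\<lambda>x. \<rho> x * v x) x $ i)" for i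
      proof -
        have e1: "grad (\<lambda>x. v x * ?d i x) x $ i = v x * ?dd i x + ?d i x * ?v i x" for x
          using grad_mult[OF smooth_differentiable[OF v] smooth_differentiable[OF sd[of i]], of x] by simp
        have e2: "grad (\<lambda>x. \<rho> x * v x) x $ i = \<rho> x * ?v i x + v x * ?d i x" for x
          using grad_mult[OF smooth_differentiable[OF s] smooth_differentiable[OF v], of x] by simp
        have w: "l2_inner L \<phi> (\<lambda>x. v x * ?dd i x + ?d i x * ?v i x) = - l2_inner L (\<lambda>x. g x $ i) (\<lambda>x. v x * ?d i x)"
          using H10_is_weak_grad[OF H] td[OF v, of i] unfolding is_weak_grad_def e1[symmetric] g_def by blast
        have i1: "integrable L (\<lambda>x. ?g x $ i * ?v i x)" by (rule l2_mult_integrable[OF vl2D[OF gg] vl(2)])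
        have i2: "integrable L (\<lambda>x. ?r i x * v x)" by (rule l2_mult_integrable[OF r vl(1)])
        have i3: "integrable L (\<lambda>x. g x $ i * (\<rho> x * ?v i x + v x * ?d i x))"
          by (intro l2_mult_integrable gl l2_add smooth_l2 smooth_mult s v sd smooth_grad)
        have i4: "integrable L (\<lambda>x. \<phi> x * (v x * ?dd i x + ?d i x * ?v i x))"
          by (intro l2_mult_integrable \<phi>l l2_add smooth_l2 smooth_mult s v sd sdd smooth_grad)
        have i5: "integrable L (\<lambda>x. g x $ i * (v x * ?d i x))"
          by (intro l2_mult_integrable gl smooth_l2 smooth_mult v sd)
        have "(\<integral>x. ?g x $ i * ?v i x \<partial>L) + (\<integral>x. ?r i x * v x \<partial>L)
          = (\<integral>x. g x $ i * (\<rho> x * ?v i x + v x * ?d i x) + \<phi> x * (v x * ?dd i x + ?d i x * ?v i x) + g x $ i * (v x * ?d i x) \<partial>L)"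
          unfolding Bochner_Integration.integral_add[OF i1 i2, symmetric]
          by (intro Bochner_Integration.integral_cong refl) (simp add: algebra_simps)
        also have "\<dots> = (\<integral>x. g x $ i * (\<rho> x * ?v i x + v x * ?d i x) \<partial>L)
            + (\<integral>x. \<phi> x * (v x * ?dd i x + ?d i x * ?v i x) \<partial>L) + (\<integral>x. g x $ i * (v x * ?d i x) \<partial>L)"
          by (simp only: Bochner_Integration.integral_add[OF Bochner_Integration.integrable_add[OF i3 i4] i5]
              Bochner_Integration.integral_add[OF i3 i4])
        finally show ?thesis using w unfolding l2_inner_def e2 by linarith
      qed
      have "vinner (weak_grad \<Omega> \<psi>) (grad v) = vinner ?g (grad v)"
        by (rule vinner_cong_AE[OF gAE H10_vl2[OF \<psi>H] gg vl2_grad[OF v]])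
      also have "\<dots> = l2_inner L (\<lambda>x. ?g x $ 1) (?v 1) + l2_inner L (\<lambda>x. ?g x $ 2) (?v 2)" by (simp add: vinner_def sum_2)
      moreover have "l2_inner L z' v = - (l2_inner L (?r 1) v + l2_inner L (?r 2) v)"
        unfolding z'_def l2_inner_uminus_left by (simp only: l2_inner_add_left[OF r r vl(1)])
      moreover have "vinner g (grad (\<lambda>x. \<rho> x * v x)) = l2_inner L (\<lambda>x. g x $ 1) (\<lambda>x. grad (\<lambda>x. \<rho> x * v x) x $ 1)
          + l2_inner L (\<lambda>x. g x $ 2) (\<lambda>x. grad (\<lambda>x. \<rho> x * v x) x $ 2)" by (simp only: vinner_def sum_2)
      ultimately show ?thesis using comp[of 1] comp[of 2] by linarith
    qed
    have test: "vinner g (grad \<eta>) = l2_inner L z \<eta>" if "\<eta> \<in> test_functions \<Omega>" for \<eta>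
      using \<phi> weak_sol_iff[OF z] that by (simp add: g_def)
    have sol: "weak_sol \<Omega> z' \<psi>"
      unfolding weak_sol_iff[OF z'l]
    proof (intro conjI ballI \<psi>H)
      fix \<eta> assume \<eta>: "\<eta> \<in> test_functions \<Omega>"
      have "vinner g (grad (\<lambda>x. \<rho> x * \<eta> x)) = l2_inner L z (\<lambda>x. \<rho> x * \<eta> x)"
        by (rule test[OF test_functions_mult_smooth[OF \<eta> s]])
      also have "\<dots> = l2_inner L (\<lambda>x. 0) \<eta>"
        unfolding l2_inner_def using supp
        by (intro Bochner_Integration.integral_cong refl) (auto simp: space_restrict_space \<rho>_def)
      finally show "vinner (weak_grad \<Omega> \<psi>) (grad \<eta>) = l2_inner L z' \<eta>"
        using key[OF test_functionsD(1)[OF \<eta>]] by (simp add: l2_inner_def)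
    qed
    \<comment> \<open>\<open>v\<close> and \<open>\<rho> v\<close> differ by the test function
      \<open>\<tau> v\<close>, for which the weak equation holds; where \<open>z\<close> does not
      vanish, \<open>\<tau> v\<close> equals \<open>v\<close>.\<close>
    have nd: "nd_form z' \<psi> v = nd_form z \<phi> v" if v: "smooth v" for v
    proof -
      have "grad (\<lambda>x. \<rho> x * v x) x = grad v x - grad (\<lambda>x. v x * \<tau> x) x" for x
        using grad_diff[OF smooth_differentiable[OF v] smooth_differentiable[OF smooth_mult[OF v s\<tau>]], of x]
        by (simp add: \<rho>_def algebra_simps)
      then have "vinner g (grad (\<lambda>x. \<rho> x * v x)) = vinner g (\<lambda>x. grad v x - grad (\<lambda>x. v x * \<tau> x) x)" by presburger
      also have "\<dots> = vinner g (grad v) - vinner g (grad (\<lambda>x. v x * \<tau> x))"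
        by (intro vinner_diff_right gv vl2_grad smooth_mult v s\<tau>)
      also have "vinner g (grad (\<lambda>x. v x * \<tau> x)) = l2_inner L z (\<lambda>x. v x * \<tau> x)"
        by (rule test[OF test_functions_mult_smooth[OF \<tau> v]])
      also have "\<dots> = l2_inner L z v"
        unfolding l2_inner_def using supp
        by (intro Bochner_Integration.integral_cong refl) (auto simp: space_restrict_space)
      finally show ?thesis using key[OF v] by (simp add: nd_form_def g_def)
    qed
    note n' = normal_deriv_works[OF z'l sol]
    have "AE x in \<Gamma>. normal_deriv \<Omega> \<phi> x = normal_deriv \<Omega> \<psi> x"
      by (rule normal_deriv_eqI[OF z \<phi> n'(1)]) (simp add: n'(2) nd)
    then have "l2_norm \<Gamma> (normal_deriv \<Omega> \<phi>) = l2_norm \<Gamma> (normal_deriv \<Omega> \<psi>)"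
      by (rule l2_norm_cong_AE) (use n'(1) normal_deriv_works(1)[OF z \<phi>] l2_measurable in auto)
    also have "\<dots> \<le> sqrt Hb * l2_norm L z'" by (rule n'(3))
    also have "\<dots> \<le> sqrt Hb * ((\<Sum>i\<in>UNIV. 2 * D i + E i * CP) * vnorm g)"
      by (rule mult_left_mono[OF z'n]) (use Hb_pos in simp)
    finally show ?thesis by (simp add: g_def mult.assoc)
  qed
  moreover have "0 \<le> ?K" using D(1) E(1) CP_pos Hb_pos by (intro mult_nonneg_nonneg sum_nonneg add_nonneg_nonneg) auto
  ultimately show ?thesis using that by blast
qed

text \<open>The squared energy norm of the solution is \<open>(z, \<phi>)\<close>, which sees
  \<open>\<phi>\<close> only on \<open>A\<close>, where \<open>H10_small_set\<close> gains the
  fourth root of the measure. \<open>localized_solution\<close> then bounds the normal derivative by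
  the energy norm, since the cut-off is 1 on \<open>C\<close>.\<close>

lemma S_adj_small_support:
  assumes C: "compact C" "C \<subseteq> \<Omega>"
  obtains K where "0 \<le> K" "\<And>z A. z \<in> l2 L \<Longrightarrow> A \<in> sets L \<Longrightarrow> A \<subseteq> C \<Longrightarrow> (\<And>x. x \<in> \<Omega> - A \<Longrightarrow> z x = 0) \<Longrightarrow>
    l2_norm \<Gamma> (S_adj \<Omega> z) \<le> K * sqrt (sqrt (measure L A)) * l2_norm L z"
proof -
  obtain \<tau> where \<tau>: "\<tau> \<in> test_functions \<Omega>" "\<And>x. x \<in> C \<Longrightarrow> \<tau> x = 1" using cutoff[OF C] by blast
  obtain K where K: "0 \<le> K" "\<And>z \<phi>. z \<in> l2 L \<Longrightarrow> (\<forall>x\<in>\<Omega>. \<tau> x \<noteq> 1 \<longrightarrow> z x = 0) \<Longrightarrow> weak_sol \<Omega> z \<phi> \<Longrightarrow>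
    l2_norm \<Gamma> (normal_deriv \<Omega> \<phi>) \<le> K * vnorm (weak_grad \<Omega> \<phi>)" using localized_solution[OF \<tau>(1)] by blast
  have "l2_norm \<Gamma> (S_adj \<Omega> z) \<le> (K * sqrt (2 * CP)) * sqrt (sqrt (measure L A)) * l2_norm L z"
    if z: "z \<in> l2 L" and A: "A \<in> sets L" "A \<subseteq> C" and z0: "\<And>x. x \<in> \<Omega> - A \<Longrightarrow> z x = 0" for z A
  proof -
    define \<phi> where "\<phi> = (SOME \<phi>. weak_sol \<Omega> z \<phi>)"
    have \<phi>: "weak_sol \<Omega> z \<phi>" unfolding \<phi>_def by (rule S_adj_sol[OF z])
    have H: "\<phi> \<in> H10 \<Omega>" using \<phi> by (simp add: weak_sol_def)
    let ?g = "vnorm (weak_grad \<Omega> \<phi>)"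
    let ?s = "sqrt (2 * CP) * sqrt (sqrt (measure L A))"
    have il: "(\<lambda>x. indicator A x * \<phi> x) \<in> l2 L"
      by (rule l2_mult_bounded[OF H10_l2[OF H], of _ 1]) (use A in \<open>auto simp: indicator_def\<close>)
    have "?g\<^sup>2 = l2_inner L z \<phi>" unfolding vnorm_power2 by (rule weak_sol_self[OF z \<phi> H])
    also have "\<dots> = l2_inner L z (\<lambda>x. indicator A x * \<phi> x)"
      unfolding l2_inner_def using z0
      by (intro Bochner_Integration.integral_cong refl) (auto simp: space_restrict_space indicator_def)
    also have "\<dots> \<le> l2_norm L z * l2_norm L (\<lambda>x. indicator A x * \<phi> x)"
      using l2_Cauchy_Schwarz[OF z il] by simp
    also have "\<dots> \<le> l2_norm L z * (?s * ?g)"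
      by (rule mult_left_mono[OF H10_small_set[OF H A(1)]]) simp
    finally have *: "?g * ?g \<le> (?s * l2_norm L z) * ?g" by (simp add: power2_eq_square mult_ac)
    have "?g \<le> ?s * l2_norm L z"
    proof (cases "?g = 0")
      case False
      then have "0 < ?g" using vnorm_nonneg[of "weak_grad \<Omega> \<phi>"] by linarith
      with * show ?thesis by (simp add: mult_le_cancel_right)
    next
      case True
      then show ?thesis using CP_pos by (simp add: mult_nonneg_nonneg)
    qed
    have "\<forall>x\<in>\<Omega>. \<tau> x \<noteq> 1 \<longrightarrow> z x = 0" using \<tau>(2) A(2) z0 by blast
    then have "l2_norm \<Gamma> (normal_deriv \<Omega> \<phi>) \<le> K * ?g" by (rule K(2)[OF z _ \<phi>])
    also have "\<dots> \<le> K * (?s * l2_norm L z)" by (rule mult_left_mono[OF \<open>?g \<le> _\<close> K(1)])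
    finally show ?thesis
      unfolding S_adj_def l2_norm_uminus \<phi>_def[symmetric] by (simp add: mult.assoc)
  qed
  then show ?thesis using that[of "K * sqrt (2 * CP)"] K(1) CP_pos by simp
qed

end

section \<open>The semismooth Newton method\<close>

locale newton = polygon \<Omega> for \<Omega> +
  fixes \<omega> :: "(real^2) set" and \<nu> \<gamma> q :: real and y\<Omega> b \<mu> :: "real^2 \<Rightarrow> real"
  assumes \<omega>_sub: "closure \<omega> \<subseteq> \<Omega>" and \<nu>_pos: "\<nu> > 0" and \<gamma>_pos: "\<gamma> > 0"
    and y\<Omega>_l2: "y\<Omega> \<in> l2 (lebesgue_on \<Omega>)" and b_cont: "continuous_on (closure \<omega>) b"
    and q: "q > 2" and \<mu>_lp: "\<mu> \<in> lp q (lebesgue_on (closure \<omega>))"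
begin

abbreviation "W \<equiv> closure \<omega>"
abbreviation "S \<equiv> S_op \<Omega>"
abbreviation "S' \<equiv> S_adj \<Omega>"
abbreviation "pen \<equiv> penalty \<omega> \<gamma> \<mu> b"
abbreviation "G \<equiv> G_op \<Omega> \<omega> \<nu> \<gamma> y\<Omega> b \<mu>"
abbreviation "M \<equiv> M_op \<Omega> \<omega> \<nu> \<gamma> b \<mu>"
abbreviation "act \<equiv> active_set \<Omega> \<omega> \<gamma> b \<mu>"
abbreviation "step_rel \<equiv> newton_step \<Omega> \<omega> \<nu> \<gamma> y\<Omega> b \<mu>"

lemma compact_W: "compact W"
  using bounded_subset[OF bounded_domain \<omega>_sub] by (simp add: compact_eq_bounded_closed)

lemma W_L: "W \<in> sets L"
  using \<omega>_sub by (auto simp: sets_restrict_space image_iff intro!: bexI[of _ W])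

text \<open>\<open>t^2 \<le> 1 + |t|^q\<close> on a set of finite measure; extension by zero moves
  the function to the domain.\<close>

lemma \<mu>_l2: "(\<lambda>x. indicator W x * \<mu> x) \<in> l2 L"
proof -
  have Wl: "W \<in> lmeasurable" using compact_W by (rule lmeasurable_compact)
  have m: "\<mu> \<in> borel_measurable (lebesgue_on W)" and i: "integrable (lebesgue_on W) (\<lambda>x. \<bar>\<mu> x\<bar> powr q)"
    using \<mu>_lp by (auto simp: lp_def)
  have "integrable (lebesgue_on W) (\<lambda>x. (\<mu> x)\<^sup>2)"
  proof (rule Bochner_Integration.integrable_bound)
    show "integrable (lebesgue_on W) (\<lambda>x. 1 + \<bar>\<mu> x\<bar> powr q)"
      using i finite_measure.integrable_const[OF finite_measure_lebesgue_on[OF Wl], of "1::real"]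
      by (rule Bochner_Integration.integrable_add[rotated])
    show "AE x in lebesgue_on W. norm ((\<mu> x)\<^sup>2) \<le> norm (1 + \<bar>\<mu> x\<bar> powr q)"
    proof (rule AE_I2)
      fix x
      have "(\<mu> x)\<^sup>2 \<le> 1 + \<bar>\<mu> x\<bar> powr q"
      proof (cases "\<bar>\<mu> x\<bar> \<le> 1")
        case True
        then have "(\<mu> x)\<^sup>2 \<le> 1" by (simp add: abs_square_le_1)
        then show ?thesis using powr_ge_zero[of "\<bar>\<mu> x\<bar>" q] by linarith
      next
        case False
        then have "(\<mu> x)\<^sup>2 = \<bar>\<mu> x\<bar> powr 2" by simp
        also have "\<dots> \<le> \<bar>\<mu> x\<bar> powr q" using False q by (intro powr_mono) auto
        finally show ?thesis by simp
      qed
      then show "norm ((\<mu> x)\<^sup>2) \<le> norm (1 + \<bar>\<mu> x\<bar> powr q)" by simp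
    qed
  qed (use m in simp)
  then have "integrable lebesgue (\<lambda>x. indicator W x *\<^sub>R (\<mu> x)\<^sup>2)"
    by (subst (asm) integrable_restrict_space) auto
  moreover have "indicator \<Omega> x *\<^sub>R (indicator W x * \<mu> x)\<^sup>2 = indicator W x *\<^sub>R (\<mu> x)\<^sup>2" for x
    using \<omega>_sub by (auto split: split_indicator)
  ultimately have "integrable L (\<lambda>x. (indicator W x * \<mu> x)\<^sup>2)"
    using domain_sets by (subst integrable_restrict_space) auto
  moreover have "(\<lambda>x. indicator W x *\<^sub>R \<mu> x) \<in> borel_measurable lebesgue"
    using m by (subst (asm) borel_measurable_restrict_space_iff) auto
  then have "(\<lambda>x. indicator W x * \<mu> x) \<in> borel_measurable L"
    by (intro measurable_restrict_space1) simp
  ultimately show ?thesis by (simp add: l2_def)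
qed

lemma b_l2: "(\<lambda>x. indicator W x * b x) \<in> l2 L"
proof -
  have "compact (b ` W)" using compact_continuous_image[OF b_cont compact_W] .
  then obtain C where C: "\<And>x. x \<in> W \<Longrightarrow> \<bar>b x\<bar> \<le> C"
    using compact_imp_bounded by (fastforce simp: bounded_iff)
  have "(\<lambda>x. indicator W x *\<^sub>R b x) \<in> borel_measurable borel"
    by (rule borel_measurable_continuous_on_indicator[OF _ b_cont]) simp
  then show ?thesis
    by (intro l2_bounded[OF finite_L, of _ "\<bar>C\<bar>"] borel_imp_L AE_I2) (use C in \<open>force split: split_indicator\<close>)+
qed

text \<open>The argument of the maximum, extended by zero off \<open>closure \<omega>\<close>. The
  extension affects neither the penalty term nor the active set, because the value 0 counts as
  inactive.\<close>

definition wf :: "(real^2 \<Rightarrow> real) \<Rightarrow> real^2 \<Rightarrow> real" where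
  "wf y x = indicator W x * (\<mu> x + \<gamma> * (y x - b x))"

lemma ind_l2: "y \<in> l2 L \<Longrightarrow> A \<in> sets L \<Longrightarrow> (\<lambda>x. indicator A x * y x) \<in> l2 L"
  by (rule l2_mult_bounded[of _ _ _ 1]) (auto simp: indicator_def)

lemma wf_l2:
  assumes "y \<in> l2 L"
  shows "wf y \<in> l2 L"
proof -
  have "(\<lambda>x. indicator W x * \<mu> x + \<gamma> * (indicator W x * y x - indicator W x * b x)) \<in> l2 L"
    by (intro l2_add l2_scale l2_diff \<mu>_l2 b_l2 ind_l2 assms W_L)
  then show ?thesis by (simp add: wf_def[abs_def] algebra_simps)
qed

lemma pen_eq: "pen y x = max 0 (wf y x)"
  by (simp add: penalty_def wf_def split: split_indicator)

lemma pen_l2: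
  assumes "y \<in> l2 L"
  shows "pen y \<in> l2 L"
proof (rule l2_bound[OF wf_l2[OF assms], of _ 1])
  show "pen y \<in> borel_measurable L"
    unfolding pen_eq[abs_def] using l2_measurable[OF wf_l2[OF assms]] by simp
qed (simp add: pen_eq)

lemma act_eq: "act u = {x \<in> space L. 0 < wf (S u) x}"
  using \<omega>_sub by (auto simp: active_set_def wf_def space_restrict_space split: split_indicator_asm)

lemma act_sets: "u \<in> l2 \<Gamma> \<Longrightarrow> act u \<in> sets L"
  unfolding act_eq using l2_measurable[OF wf_l2[OF S_op_works(2)]] by measurable

lemma G_l2: "u \<in> l2 \<Gamma> \<Longrightarrow> G u \<in> l2 \<Gamma>"
  unfolding G_op_def by (intro l2_add l2_diff l2_scale S_adj_l2 S_op_works(2) y\<Omega>_l2 pen_l2)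

lemma M_l2: "u \<in> l2 \<Gamma> \<Longrightarrow> v \<in> l2 \<Gamma> \<Longrightarrow> M u v \<in> l2 \<Gamma>"
  unfolding M_op_def by (intro l2_add l2_scale S_adj_l2 S_op_works(2) ind_l2 act_sets)

lemma S_linear:
  assumes "u1 \<in> l2 \<Gamma>" "u2 \<in> l2 \<Gamma>"
  shows "AE x in L. S (\<lambda>x. c * u1 x + u2 x) x = c * S u1 x + S u2 x"
proof (rule S_op_linear)
  show u: "(\<lambda>x. c * u1 x + u2 x) \<in> l2 \<Gamma>" using assms by (intro l2_add l2_scale)
  show "transposition_sol \<Omega> (\<lambda>x. c * u1 x + u2 x) (S (\<lambda>x. c * u1 x + u2 x))" by (rule S_op_works(1)[OF u])
qed (use assms in auto)

lemma S_adj_state: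
  assumes y: "y \<in> l2 L"
  shows "AE x in \<Gamma>. S' (\<lambda>x. y x - y\<Omega> x + pen y x) x = S' y x - S' y\<Omega> x + S' (pen y) x"
proof -
  have d: "(\<lambda>x. y x - y\<Omega> x) \<in> l2 L" using y y\<Omega>_l2 by (rule l2_diff)
  have "AE x in \<Gamma>. S' (\<lambda>x. y x - y\<Omega> x + pen y x) x = 1 * S' (\<lambda>x. y x - y\<Omega> x) x + S' (pen y) x"
    by (rule S_adj_linear) (use d pen_l2[OF y] in \<open>auto intro: l2_add\<close>)
  moreover have "AE x in \<Gamma>. S' (\<lambda>x. y x - y\<Omega> x) x = (-1) * S' y\<Omega> x + S' y x"
    by (rule S_adj_linear) (use d y y\<Omega>_l2 in auto)
  ultimately show ?thesis by eventually_elim simp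
qed

text \<open>\<open>S_adj\<close> is minus the normal derivative, so the gradient equation says that
  \<open>\<nu> u\<close> and \<open>S_adj\<close> of the adjoint right hand side cancel. The system
  admits every representative of state and adjoint state while \<open>G\<close> uses the chosen
  ones; almost everywhere uniqueness reconciles the two.\<close>

lemma optimality_iff:
  assumes u: "u \<in> l2 \<Gamma>"
  shows "(\<exists>y \<phi>. optimality_system \<Omega> \<omega> \<nu> \<gamma> y\<Omega> b \<mu> u y \<phi>) \<longleftrightarrow> (AE x in \<Gamma>. G u x = 0)"
proof -
  let ?R = "\<lambda>y x. y x - y\<Omega> x + pen y x"
  note s = S_op_works[OF u]
  have R: "?R y \<in> l2 L" if "y \<in> l2 L" for y
    using that y\<Omega>_l2 pen_l2 by (intro l2_add l2_diff)
  have G: "AE x in \<Gamma>. G u x = \<nu> * u x + S' (?R (S u)) x"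
    using S_adj_state[OF s(2)] by eventually_elim (simp add: G_op_def)
  show ?thesis
  proof
    assume "\<exists>y \<phi>. optimality_system \<Omega> \<omega> \<nu> \<gamma> y\<Omega> b \<mu> u y \<phi>"
    then obtain y \<phi> where t: "transposition_sol \<Omega> u y" and \<phi>: "weak_sol \<Omega> (?R y) \<phi>"
      and eq: "AE x in \<Gamma>. \<nu> * u x = normal_deriv \<Omega> \<phi> x" by (auto simp: optimality_system_def)
    have y: "y \<in> l2 L" using t by (simp add: transposition_sol_def)
    have "AE x in L. ?R y x = ?R (S u) x"
      using S_op_unique[OF u t] by eventually_elim (simp add: penalty_def)
    from S_adj_cong[OF R[OF y] R[OF s(2)] this] S_adj_normal_deriv[OF R[OF y] \<phi>] eq G
    show "AE x in \<Gamma>. G u x = 0" by eventually_elim simp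
  next
    assume z: "AE x in \<Gamma>. G u x = 0"
    obtain \<phi> where \<phi>: "weak_sol \<Omega> (?R (S u)) \<phi>" using weak_sol_exists[OF R[OF s(2)]] by blast
    have "AE x in \<Gamma>. \<nu> * u x = normal_deriv \<Omega> \<phi> x"
      using S_adj_normal_deriv[OF R[OF s(2)] \<phi>] z G by eventually_elim simp
    then show "\<exists>y \<phi>. optimality_system \<Omega> \<omega> \<nu> \<gamma> y\<Omega> b \<mu> u y \<phi>"
      using u s(1) \<phi> by (auto simp: optimality_system_def)
  qed
qed

section \<open>Solvability and uniqueness of the Newton step\<close>

text \<open>Moving the adjoint to the other argument exhibits a symmetric form with three
  nonnegative terms on the diagonal.\<close>

lemma M_inner:
  assumes u: "u \<in> l2 \<Gamma>" and v: "v \<in> l2 \<Gamma>" and e: "e \<in> l2 \<Gamma>"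
  shows "l2_inner \<Gamma> (M u v) e = \<nu> * l2_inner \<Gamma> v e + l2_inner L (S v) (S e)
    + \<gamma> * l2_inner L (\<lambda>x. indicator (act u) x * S v x) (S e)"
proof -
  note sv = S_op_works(2)[OF v] and iv = ind_l2[OF S_op_works(2)[OF v] act_sets[OF u]]
  have adj: "l2_inner \<Gamma> (S' z) e = l2_inner L z (S e)" if "z \<in> l2 L" for z
    using S_op_works(3)[OF e that] by (simp add: l2_inner_commute)
  have "l2_inner \<Gamma> (M u v) e = \<nu> * l2_inner \<Gamma> v e + l2_inner \<Gamma> (S' (S v)) e
      + \<gamma> * l2_inner \<Gamma> (S' (\<lambda>x. indicator (act u) x * S v x)) e"
    unfolding M_op_def using v e S_adj_l2[OF sv] S_adj_l2[OF iv]
    by (simp add: l2_inner_add_left l2_add l2_scale l2_inner_scale_left)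
  then show ?thesis using adj[OF sv] adj[OF iv] by simp
qed

lemma M_coercive:
  assumes u: "u \<in> l2 \<Gamma>" and v: "v \<in> l2 \<Gamma>" and r: "r \<in> l2 \<Gamma>" and eq: "AE x in \<Gamma>. M u v x = r x"
  shows "\<nu> * l2_norm \<Gamma> v \<le> l2_norm \<Gamma> r"
proof -
  have "0 \<le> l2_inner L (\<lambda>x. indicator (act u) x * S v x) (S v)"
    unfolding l2_inner_def by (intro Bochner_Integration.integral_nonneg) (auto split: split_indicator)
  then have "\<nu> * l2_inner \<Gamma> v v \<le> l2_inner \<Gamma> (M u v) v"
    using M_inner[OF u v v] l2_inner_self_nonneg[of L "S v"] \<gamma>_pos by (simp add: mult_nonneg_nonneg)
  also have "l2_inner \<Gamma> (M u v) v = l2_inner \<Gamma> r v"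
    by (rule l2_inner_cong_AE[OF eq]) (use M_l2[OF u v] r v l2_measurable in auto)
  also have "\<dots> \<le> l2_norm \<Gamma> r * l2_norm \<Gamma> v" using l2_Cauchy_Schwarz[OF r v] by simp
  finally have "(\<nu> * l2_norm \<Gamma> v) * l2_norm \<Gamma> v \<le> l2_norm \<Gamma> r * l2_norm \<Gamma> v"
    by (simp add: power2_eq_square mult.assoc flip: l2_norm_power2)
  then show ?thesis
  proof (cases "l2_norm \<Gamma> v = 0")
    case False
    then have "0 < l2_norm \<Gamma> v" using l2_norm_nonneg[of \<Gamma> v] by linarith
    then show ?thesis using \<open>(\<nu> * l2_norm \<Gamma> v) * l2_norm \<Gamma> v \<le> _\<close> by (simp add: mult_le_cancel_right)
  qed simp
qed

lemma M_linear:
  assumes u: "u \<in> l2 \<Gamma>" and v: "v1 \<in> l2 \<Gamma>" "v2 \<in> l2 \<Gamma>"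
  shows "AE x in \<Gamma>. M u (\<lambda>x. c * v1 x + v2 x) x = c * M u v1 x + M u v2 x"
proof -
  let ?v = "\<lambda>x. c * v1 x + v2 x"
  have vl: "?v \<in> l2 \<Gamma>" using v by (intro l2_add l2_scale)
  note s = S_op_works(2)[OF vl] S_op_works(2)[OF v(1)] S_op_works(2)[OF v(2)]
  note i = s[THEN ind_l2, OF act_sets[OF u]]
  have 1: "AE x in L. S ?v x = c * S v1 x + S v2 x" by (rule S_linear[OF v])
  then have 2: "AE x in L. indicator (act u) x * S ?v x = c * (indicator (act u) x * S v1 x) + indicator (act u) x * S v2 x"
    by eventually_elim (simp add: algebra_simps)
  from S_adj_linear[OF s 1] S_adj_linear[OF i 2] show ?thesis
    by eventually_elim (simp add: M_op_def algebra_simps)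
qed

lemma M_form:
  assumes u: "u \<in> l2 \<Gamma>"
  shows "psd_form (l2 \<Gamma>) (\<lambda>v e. l2_inner \<Gamma> (M u v) e)"
proof
  show "l2 \<Gamma> \<noteq> {}" using l2_zero by blast
  fix f g h :: "real^2 \<Rightarrow> real" and c :: real
  assume f: "f \<in> l2 \<Gamma>" and g: "g \<in> l2 \<Gamma>"
  show "(\<lambda>x. f x + g x) \<in> l2 \<Gamma>" using f g by (rule l2_add)
  show "l2_inner \<Gamma> (M u f) g = l2_inner \<Gamma> (M u g) f"
    unfolding M_inner[OF u f g] M_inner[OF u g f]
    by (simp add: l2_inner_commute[of \<Gamma> f] l2_inner_commute[of L "S f"]) (simp add: l2_inner_def mult_ac)
  have lin: "l2_inner \<Gamma> (M u (\<lambda>x. c * f x + g x)) h = c * l2_inner \<Gamma> (M u f) h + l2_inner \<Gamma> (M u g) h"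
    if f: "f \<in> l2 \<Gamma>" and g: "g \<in> l2 \<Gamma>" and h: "h \<in> l2 \<Gamma>" for f g h c
  proof -
    note m = M_l2[OF u f] M_l2[OF u g] M_l2[OF u l2_add[OF l2_scale[OF f] g]]
    have "l2_inner \<Gamma> (M u (\<lambda>x. c * f x + g x)) h = l2_inner \<Gamma> (\<lambda>x. c * M u f x + M u g x) h"
      by (rule l2_inner_cong_AE[OF M_linear[OF u f g]]) (use m h in \<open>auto intro!: l2_measurable l2_add l2_scale\<close>)
    then show ?thesis using m h by (simp add: l2_inner_add_left l2_scale l2_inner_scale_left)
  qed
  show "l2_inner \<Gamma> (M u (\<lambda>x. f x + g x)) h = l2_inner \<Gamma> (M u f) h + l2_inner \<Gamma> (M u g) h" if "h \<in> l2 \<Gamma>"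
    using lin[OF f g that, of 1] by simp
  show "l2_inner \<Gamma> (M u (\<lambda>x. c * f x)) g = c * l2_inner \<Gamma> (M u f) g"
    using lin[OF f l2_zero g, of c] lin[OF l2_zero l2_zero g, of 1] by simp
next
  fix f :: "real^2 \<Rightarrow> real" and c :: real
  assume f: "f \<in> l2 \<Gamma>"
  show "(\<lambda>x. c * f x) \<in> l2 \<Gamma>" using f by (rule l2_scale)
  have "0 \<le> l2_inner L (\<lambda>x. indicator (act u) x * S f x) (S f)"
    unfolding l2_inner_def by (intro Bochner_Integration.integral_nonneg) (auto split: split_indicator)
  then show "0 \<le> l2_inner \<Gamma> (M u f) f"
    unfolding M_inner[OF u f f] using \<nu>_pos \<gamma>_pos by (intro add_nonneg_nonneg mult_nonneg_nonneg l2_inner_self_nonneg) auto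
qed

text \<open>The form is bounded, and coercive with constant \<open>\<nu>\<close>, so
  \<open>l2_riesz\<close> gives a weak solution; testing with the residual itself turns this into an
  identity almost everywhere.\<close>

lemma M_solvable:
  assumes u: "u \<in> l2 \<Gamma>" and r: "r \<in> l2 \<Gamma>"
  obtains v where "v \<in> l2 \<Gamma>" "AE x in \<Gamma>. M u v x = r x"
proof -
  have sq: "(l2_norm L (S f))\<^sup>2 \<le> Hb * (l2_norm \<Gamma> f)\<^sup>2" if "f \<in> l2 \<Gamma>" for f
    using power_mono[OF S_op_bound[OF that], of 2] Hb_pos by (simp add: power_mult_distrib)
  obtain v where v: "v \<in> l2 \<Gamma>" "\<And>f. f \<in> l2 \<Gamma> \<Longrightarrow> l2_inner \<Gamma> (M u v) f = l2_inner \<Gamma> r f"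
  proof (rule l2_riesz[OF finite_bdry M_form[OF u], where F = "l2_inner \<Gamma> r" and c = \<nu>
        and K = "\<nu> + Hb + \<gamma> * Hb" and C = "l2_norm \<Gamma> r"])
    fix f assume f: "f \<in> l2 \<Gamma>"
    note sf = S_op_works(2)[OF f]
    let ?i = "l2_inner L (\<lambda>x. indicator (act u) x * S f x) (S f)"
    have i0: "0 \<le> ?i" unfolding l2_inner_def by (intro Bochner_Integration.integral_nonneg) (auto split: split_indicator)
    have i1: "?i \<le> l2_inner L (S f) (S f)"
      unfolding l2_inner_def
      by (rule integral_mono) (use l2_mult_integrable[OF ind_l2[OF sf act_sets[OF u]] sf] l2_mult_integrable[OF sf sf] in
        \<open>auto split: split_indicator\<close>)
    show "\<nu> * (l2_norm \<Gamma> f)\<^sup>2 \<le> l2_inner \<Gamma> (M u f) f"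
      using i0 \<gamma>_pos l2_inner_self_nonneg[of L "S f"] by (simp add: M_inner[OF u f f] l2_norm_power2)
    have "\<gamma> * ?i \<le> \<gamma> * (Hb * (l2_norm \<Gamma> f)\<^sup>2)"
      using i1 sq[OF f] \<gamma>_pos by (intro mult_left_mono) (auto simp: l2_norm_power2)
    then show "l2_inner \<Gamma> (M u f) f \<le> (\<nu> + Hb + \<gamma> * Hb) * (l2_norm \<Gamma> f)\<^sup>2"
      using sq[OF f] by (simp add: M_inner[OF u f f] l2_norm_power2 algebra_simps)
    show "\<bar>l2_inner \<Gamma> r f\<bar> \<le> l2_norm \<Gamma> r * l2_norm \<Gamma> f" by (rule l2_Cauchy_Schwarz[OF r f])
  qed (use r \<nu>_pos in \<open>auto intro: l2_inner_add_right l2_inner_scale_right\<close>)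
  let ?d = "\<lambda>x. M u v x - r x"
  have d: "?d \<in> l2 \<Gamma>" by (intro l2_diff M_l2 u v r)
  have "l2_inner \<Gamma> ?d ?d = 0"
    using v(2)[OF d] by (simp add: l2_inner_diff_left[OF M_l2[OF u v(1)] r d])
  then have "l2_norm \<Gamma> ?d = 0" by (simp add: l2_norm_def)
  then have "AE x in \<Gamma>. ?d x = 0" using l2_norm_zero_iff[OF d] by blast
  then have "AE x in \<Gamma>. M u v x = r x" by eventually_elim simp
  then show ?thesis using that v(1) by blast
qed

lemma newton_step_exists:
  assumes u: "u \<in> l2 \<Gamma>"
  shows "\<exists>u'. step_rel u u'"
proof -
  obtain v where v: "v \<in> l2 \<Gamma>" "AE x in \<Gamma>. M u v x = - G u x"
    using M_solvable[OF u l2_uminus[OF G_l2[OF u]]] by blast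
  have "step_rel u (\<lambda>x. u x + v x)"
    using u v by (simp add: newton_step_def l2_add)
  then show ?thesis by blast
qed

lemma newton_step_unique:
  assumes "step_rel u u1" "step_rel u u2"
  shows "AE x in \<Gamma>. u1 x = u2 x"
proof -
  have u: "u \<in> l2 \<Gamma>" "u1 \<in> l2 \<Gamma>" "u2 \<in> l2 \<Gamma>"
    and e: "AE x in \<Gamma>. M u (\<lambda>x. u1 x - u x) x = - G u x" "AE x in \<Gamma>. M u (\<lambda>x. u2 x - u x) x = - G u x"
    using assms by (auto simp: newton_step_def)
  note d = l2_diff[OF u(2,1)] l2_diff[OF u(3,1)]
  have eq: "(\<lambda>x. (-1) * (u2 x - u x) + (u1 x - u x)) = (\<lambda>x. u1 x - u2 x)" by auto
  have "AE x in \<Gamma>. M u (\<lambda>x. u1 x - u2 x) x = 0"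
    using M_linear[OF u(1) d(2,1), of "-1"] e unfolding eq by eventually_elim simp
  from M_coercive[OF u(1) l2_diff[OF u(2,3)] l2_zero this]
  have "\<nu> * l2_norm \<Gamma> (\<lambda>x. u1 x - u2 x) \<le> 0" by (simp add: l2_norm_def l2_inner_def)
  then have "l2_norm \<Gamma> (\<lambda>x. u1 x - u2 x) = 0"
    using \<nu>_pos l2_norm_nonneg[of \<Gamma> "\<lambda>x. u1 x - u2 x"] by (simp add: mult_le_0_iff)
  then have "AE x in \<Gamma>. u1 x - u2 x = 0" using l2_norm_zero_iff[OF l2_diff[OF u(2,3)]] by blast
  then show ?thesis by eventually_elim simp
qed

section \<open>The linearization error and local convergence\<close>

text \<open>Encloses the points where linearizing the maximum at \<open>w\<close> with an increment
  of size at most \<open>\<gamma> |t|\<close> can fail to be exact. Leaving out the zeros of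
  \<open>w\<close> is what makes its measure small.\<close>

definition crit :: "(real^2 \<Rightarrow> real) \<Rightarrow> (real^2 \<Rightarrow> real) \<Rightarrow> (real^2) set" where
  "crit w t = {x \<in> space L. w x \<noteq> 0 \<and> \<bar>w x\<bar> \<le> \<gamma> * \<bar>t x\<bar>}"

lemma crit_sets:
  assumes [measurable]: "w \<in> borel_measurable L" "t \<in> borel_measurable L"
  shows "crit w t \<in> sets L"
  unfolding crit_def by measurable

text \<open>A small L2-norm of \<open>t\<close> gives no pointwise smallness. Where
  \<open>|t| < s\<close> the set lies in \<open>D n\<close>, whose measure tends to 0 because the
  sets \<open>D n\<close> decrease to the empty set; where \<open>|t| \<ge> s\<close> Markov's
  inequality applies.\<close>

lemma crit_small:
  assumes w: "w \<in> l2 L" and e: "0 < e"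
  obtains d where "0 < d" "\<And>t. t \<in> l2 L \<Longrightarrow> l2_norm L t < d \<Longrightarrow> measure L (crit w t) < e"
proof -
  interpret finite_measure L by (rule finite_L)
  note wm[measurable] = l2_measurable[OF w]
  define D where "D n = {x \<in> space L. w x \<noteq> 0 \<and> \<bar>w x\<bar> \<le> \<gamma> * inverse (real (Suc n))}" for n
  have Dm: "D n \<in> sets L" for n unfolding D_def by measurable
  have "(\<lambda>n. measure L (D n)) \<longlonglongrightarrow> measure L (\<Inter>n. D n)"
  proof (rule finite_Lim_measure_decseq)
    show "range D \<subseteq> sets L" using Dm by blast
    show "decseq D"
    proof (rule decseq_SucI)
      fix n
      have "\<gamma> * inverse (real (Suc (Suc n))) \<le> \<gamma> * inverse (real (Suc n))"
        using \<gamma>_pos by (intro mult_left_mono le_imp_inverse_le) auto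
      then show "D (Suc n) \<subseteq> D n" unfolding D_def by auto
    qed
  qed
  moreover have "(\<Inter>n. D n) = {}"
  proof (rule ccontr)
    assume "(\<Inter>n. D n) \<noteq> {}"
    then obtain x where x: "\<And>n. x \<in> D n" by blast
    then have w0: "0 < \<bar>w x\<bar> / \<gamma>" using \<gamma>_pos by (simp add: D_def)
    obtain n where "inverse (real (Suc n)) < \<bar>w x\<bar> / \<gamma>" using reals_Archimedean[OF w0] by blast
    then have "\<gamma> * inverse (real (Suc n)) < \<bar>w x\<bar>" using \<gamma>_pos by (simp only: pos_less_divide_eq mult.commute)
    then show False using x[of n] by (simp add: D_def)
  qed
  ultimately have "(\<lambda>n. measure L (D n)) \<longlonglongrightarrow> 0" by simp
  then have "eventually (\<lambda>n. measure L (D n) < e / 2) sequentially"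
    using e by (intro order_tendstoD) auto
  then obtain n where n: "measure L (D n) < e / 2" by (auto simp: eventually_sequentially)
  define s where "s = inverse (real (Suc n))"
  have s: "0 < s" by (simp add: s_def)
  show ?thesis
  proof (rule that)
    show "0 < s * sqrt (e / 2)" using s e by simp
    fix t assume t: "t \<in> l2 L" and tn: "l2_norm L t < s * sqrt (e / 2)"
    note tm[measurable] = l2_measurable[OF t]
    let ?T = "{x \<in> space L. s\<^sup>2 \<le> (t x)\<^sup>2}"
    have Tm: "?T \<in> sets L" by measurable
    have "crit w t \<subseteq> D n \<union> ?T"
    proof
      fix x assume x: "x \<in> crit w t"
      show "x \<in> D n \<union> ?T"
      proof (cases "s \<le> \<bar>t x\<bar>")
        case True
        then have "s\<^sup>2 \<le> \<bar>t x\<bar>\<^sup>2" using s by (intro power_mono) auto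
        then show ?thesis using x by (simp add: crit_def)
      next
        case False
        then have "\<gamma> * \<bar>t x\<bar> \<le> \<gamma> * s" using \<gamma>_pos by (intro mult_left_mono) auto
        then show ?thesis using x by (auto simp: crit_def D_def s_def)
      qed
    qed
    then have "measure L (crit w t) \<le> measure L (D n \<union> ?T)"
      using Dm Tm by (intro finite_measure_mono) auto
    also have "\<dots> \<le> measure L (D n) + measure L ?T"
      using Dm Tm by (intro measure_Un_le)
    also have "measure L ?T \<le> (\<integral>x. (t x)\<^sup>2 \<partial>L) / s\<^sup>2"
      by (rule integral_Markov_inequality_measure[where A = "{}"]) (use l2_square_integrable[OF t] s in auto)
    also have "(\<integral>x. (t x)\<^sup>2 \<partial>L) / s\<^sup>2 < e / 2"
    proof -
      have "(\<integral>x. (t x)\<^sup>2 \<partial>L) = (l2_norm L t)\<^sup>2" unfolding l2_norm_power2 l2_inner_def by (simp only: power2_eq_square)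
      also have "\<dots> < (s * sqrt (e / 2))\<^sup>2" using tn by (intro power_strict_mono) auto
      also have "\<dots> = s\<^sup>2 * (e / 2)" using e by (simp add: power_mult_distrib)
      finally show ?thesis using s by (simp add: divide_less_eq mult.commute)
    qed
    finally show "measure L (crit w t) < e" using n by simp
  qed
qed

text \<open>The slope is taken at the perturbed argument \<open>w + t\<close>. Hence the error
  vanishes unless the increment carries a nonzero \<open>w\<close> to or across 0, and from
  \<open>w = 0\<close> there is none.\<close>

lemma max_remainder:
  fixes w t :: real
  defines "r \<equiv> max 0 (w + t) - max 0 w - (if 0 < w + t then t else 0)"
  shows "\<bar>r\<bar> \<le> \<bar>t\<bar>" "r \<noteq> 0 \<Longrightarrow> w \<noteq> 0 \<and> \<bar>w\<bar> \<le> \<bar>t\<bar>"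
  unfolding r_def by (auto split: if_splits)

lemma newton_error:
  assumes us: "us \<in> l2 \<Gamma>" "AE x in \<Gamma>. G us x = 0" and e: "0 < e"
  obtains d where "0 < d" "\<And>u u'. step_rel u u' \<Longrightarrow> l2_norm \<Gamma> (\<lambda>x. u x - us x) < d \<Longrightarrow>
    l2_norm \<Gamma> (\<lambda>x. u' x - us x) \<le> e * l2_norm \<Gamma> (\<lambda>x. u x - us x)"
proof -
  obtain K where K: "0 \<le> K" "\<And>z A. z \<in> l2 L \<Longrightarrow> A \<in> sets L \<Longrightarrow> A \<subseteq> W \<Longrightarrow> (\<And>x. x \<in> \<Omega> - A \<Longrightarrow> z x = 0) \<Longrightarrow>
    l2_norm \<Gamma> (S' z) \<le> K * sqrt (sqrt (measure L A)) * l2_norm L z"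
    using S_adj_small_support[OF compact_W \<omega>_sub] by blast
  let ?w = "wf (S us)"
  have wl: "?w \<in> l2 L" by (intro wf_l2 S_op_works(2) us)
  \<comment> \<open>Collects the constants of the final estimate: \<open>K\<close> from the adjoint,
    \<open>\<gamma> * sqrt Hb\<close> from the bound of the remainder by the current error, and
    \<open>\<nu>\<close> from coercivity. \<open>K + 1\<close> keeps it positive.\<close>
  define c where "c = (K + 1) * \<gamma> * sqrt Hb / \<nu>"
  have c: "0 < c" unfolding c_def using K(1) \<gamma>_pos \<nu>_pos Hb_pos by simp
  \<comment> \<open>The fourth power undoes the fourth root of the measure in the estimate of the
    adjoint.\<close>
  obtain d where d: "0 < d" "\<And>t. t \<in> l2 L \<Longrightarrow> l2_norm L t < d \<Longrightarrow> measure L (crit ?w t) < (e / c)^4"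
    using crit_small[OF wl, of "(e / c)^4"] e c by auto
  show ?thesis
  proof (rule that)
    show "0 < d / sqrt Hb" using d Hb_pos by simp
    fix u u' assume st: "step_rel u u'" and small: "l2_norm \<Gamma> (\<lambda>x. u x - us x) < d / sqrt Hb"
    have u: "u \<in> l2 \<Gamma>" "u' \<in> l2 \<Gamma>" and Mu: "AE x in \<Gamma>. M u (\<lambda>x. u' x - u x) x = - G u x"
      using st by (auto simp: newton_step_def)
    let ?h = "\<lambda>x. u x - us x" and ?e = "\<lambda>x. u' x - us x"
    have h: "?h \<in> l2 \<Gamma>" and el: "?e \<in> l2 \<Gamma>" using u us by (auto intro: l2_diff)
    note s = S_op_works(2)[OF u(1)] S_op_works(2)[OF us(1)] S_op_works(2)[OF h]
    let ?A = "act u"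
    define t where "t x = S u x - S us x" for x
    have tl: "t \<in> l2 L" unfolding t_def using s by (intro l2_diff)
    have "(\<lambda>x. (-1) * us x + u x) = ?h" by auto
    then have tS: "AE x in L. S ?h x = t x"
      using S_linear[OF us(1) u(1), of "-1"] by (simp add: t_def)
    have "l2_norm L t = l2_norm L (S ?h)"
      by (rule l2_norm_cong_AE) (use tS tl s l2_measurable in \<open>auto elim: eventually_mono\<close>)
    then have tn: "l2_norm L t \<le> sqrt Hb * l2_norm \<Gamma> ?h" using S_op_bound[OF h] by simp
    have iA: "(\<lambda>x. indicator ?A x * t x) \<in> l2 L" by (rule ind_l2[OF tl act_sets[OF u(1)]])
    define R where "R x = pen (S u) x - pen (S us) x - \<gamma> * (indicator ?A x * t x)" for x
    have p: "pen (S u) \<in> l2 L" "pen (S us) \<in> l2 L" using s by (auto intro: pen_l2)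
    have Rl: "R \<in> l2 L" unfolding R_def by (intro l2_diff l2_scale p iA)
    have Rx: "R x = max 0 (?w x + indicator W x * (\<gamma> * t x)) - max 0 (?w x)
        - (if 0 < ?w x + indicator W x * (\<gamma> * t x) then indicator W x * (\<gamma> * t x) else 0)" if "x \<in> \<Omega>" for x
    proof -
      have e1: "wf (S u) x = ?w x + indicator W x * (\<gamma> * t x)" by (simp add: wf_def t_def algebra_simps)
      have e2: "x \<in> ?A \<longleftrightarrow> 0 < ?w x + indicator W x * (\<gamma> * t x)"
        unfolding act_eq using that by (simp add: space_restrict_space e1)
      have "x \<in> ?A \<Longrightarrow> x \<in> W" by (simp add: active_set_def)
      then show ?thesis unfolding R_def pen_eq e1 using e2 by (auto simp: indicator_def)
    qed
    have ti: "\<bar>indicator W x * (\<gamma> * t x)\<bar> \<le> \<gamma> * \<bar>t x\<bar>" for x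
      using \<gamma>_pos by (simp add: abs_mult split: split_indicator)
    have Rb: "\<bar>R x\<bar> \<le> \<gamma> * \<bar>t x\<bar>" if "x \<in> \<Omega>" for x
      unfolding Rx[OF that] using max_remainder(1)[of "?w x" "indicator W x * (\<gamma> * t x)"] ti[of x] by linarith
    have R0: "R x = 0" if "x \<in> \<Omega> - crit ?w t" for x
    proof (rule ccontr)
      assume "R x \<noteq> 0"
      then have "?w x \<noteq> 0 \<and> \<bar>?w x\<bar> \<le> \<bar>indicator W x * (\<gamma> * t x)\<bar>"
        using that Rx[of x] max_remainder(2)[of "?w x" "indicator W x * (\<gamma> * t x)"] by simp
      then have "x \<in> crit ?w t" using that ti[of x] by (auto simp: crit_def space_restrict_space)
      then show False using that by blast
    qed
    have cW: "crit ?w t \<subseteq> W" by (auto simp: crit_def wf_def split: split_indicator_asm)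
    have cs: "crit ?w t \<in> sets L" by (intro crit_sets l2_measurable wl tl)
    have "l2_norm \<Gamma> ?h * sqrt Hb < d" using small Hb_pos by (simp add: pos_less_divide_eq)
    then have "l2_norm L t < d" using tn by (simp add: mult.commute)
    then have m: "measure L (crit ?w t) < (e / c)^4" by (rule d(2)[OF tl])
    have sm: "sqrt (sqrt (measure L (crit ?w t))) \<le> e / c"
    proof -
      have "sqrt (sqrt (measure L (crit ?w t))) \<le> sqrt (sqrt ((e / c)^4))"
        using m by (intro real_sqrt_le_mono) simp
      also have "sqrt ((e / c)^4) = (e / c)\<^sup>2" by (rule real_sqrt_unique) auto
      also have "sqrt ((e / c)\<^sup>2) = e / c" by (rule real_sqrt_unique) (use e c in auto)
      finally show ?thesis .
    qed
    have Rn: "l2_norm L R \<le> \<gamma> * l2_norm L t"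
      by (rule l2_norm_mono[OF tl l2_measurable[OF Rl]]) (use Rb \<gamma>_pos in \<open>auto intro!: AE_L_I\<close>)
    have "l2_norm \<Gamma> (S' R) \<le> K * sqrt (sqrt (measure L (crit ?w t))) * l2_norm L R"
      by (rule K(2)[OF Rl cs cW R0])
    also have "\<dots> \<le> (K + 1) * (e / c) * (\<gamma> * (sqrt Hb * l2_norm \<Gamma> ?h))"
    proof (rule mult_mono)
      show "K * sqrt (sqrt (measure L (crit ?w t))) \<le> (K + 1) * (e / c)"
        using K(1) sm by (intro mult_mono) auto
      show "l2_norm L R \<le> \<gamma> * (sqrt Hb * l2_norm \<Gamma> ?h)"
        using Rn mult_left_mono[OF tn, of \<gamma>] \<gamma>_pos by linarith
      show "0 \<le> (K + 1) * (e / c)" using K(1) e c by simp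
    qed simp
    also have "\<dots> = \<nu> * (e * l2_norm \<Gamma> ?h)"
    proof -
      have "(K + 1) * (e / c) * (\<gamma> * (sqrt Hb * l2_norm \<Gamma> ?h)) = ((K + 1) * \<gamma> * sqrt Hb) * (e / c) * l2_norm \<Gamma> ?h"
        by (simp only: mult_ac)
      also have "(K + 1) * \<gamma> * sqrt Hb = \<nu> * c" using \<nu>_pos by (simp add: c_def)
      finally show ?thesis using c by simp
    qed
    finally have SR: "l2_norm \<Gamma> (S' R) \<le> \<nu> * (e * l2_norm \<Gamma> ?h)" .
    \<comment> \<open>The new error is the Newton update plus the old error \<open>?h\<close>, so
      \<open>M\<close> maps it to \<open>G us - G u + M u ?h\<close>, where \<open>G us\<close> is
      zero. The \<open>\<nu>\<close> and \<open>S' S\<close> terms cancel, and what remains is the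
      adjoint of the linearization error.\<close>
    have "AE x in \<Gamma>. M u ?e x = - S' R x"
    proof -
      have "(\<lambda>x. 1 * (u' x - u x) + ?h x) = ?e" by auto
      then have m1: "AE x in \<Gamma>. M u ?e x = M u (\<lambda>x. u' x - u x) x + M u ?h x"
        using M_linear[OF u(1) l2_diff[OF u(2,1)] h, of 1] by simp
      have ih: "(\<lambda>x. indicator ?A x * S ?h x) \<in> l2 L" by (rule ind_l2[OF s(3) act_sets[OF u(1)]])
      have m2: "AE x in \<Gamma>. S' (S ?h) x = (-1) * S' (S us) x + S' (S u) x"
        by (rule S_adj_linear[OF s(3,2,1)]) (use tS in \<open>auto simp: t_def elim: eventually_mono\<close>)
      have pd: "(\<lambda>x. pen (S u) x - pen (S us) x) \<in> l2 L" by (intro l2_diff p)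
      have m3: "AE x in \<Gamma>. S' R x = (- \<gamma>) * S' (\<lambda>x. indicator ?A x * S ?h x) x + S' (\<lambda>x. pen (S u) x - pen (S us) x) x"
      proof (rule S_adj_linear[OF Rl ih pd])
        show "AE x in L. R x = (- \<gamma>) * (indicator ?A x * S ?h x) + (pen (S u) x - pen (S us) x)"
          using tS by eventually_elim (simp add: R_def)
      qed
      have m4: "AE x in \<Gamma>. S' (\<lambda>x. pen (S u) x - pen (S us) x) x = (-1) * S' (pen (S us)) x + S' (pen (S u)) x"
        by (rule S_adj_linear[OF pd p(2,1)]) simp
      from m1 m2 m3 m4 Mu us(2) show ?thesis
        by eventually_elim (simp add: M_op_def G_op_def algebra_simps)
    qed
    from M_coercive[OF u(1) el l2_uminus[OF S_adj_l2[OF Rl]] this]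
    have "\<nu> * l2_norm \<Gamma> ?e \<le> l2_norm \<Gamma> (S' R)" by (simp add: l2_norm_uminus)
    then have "\<nu> * l2_norm \<Gamma> ?e \<le> \<nu> * (e * l2_norm \<Gamma> ?h)" using SR by linarith
    then show "l2_norm \<Gamma> ?e \<le> e * l2_norm \<Gamma> ?h" using \<nu>_pos by simp
  qed
qed

text \<open>The rate 1/2 keeps the iterates in the ball in which it is valid, which gives
  convergence. Every smaller rate then holds eventually, and this is superlinearity.\<close>

lemma newton_convergence:
  assumes us: "us \<in> l2 \<Gamma>" "AE x in \<Gamma>. G us x = 0"
  obtains d where "0 < d" "\<And>uk. l2_norm \<Gamma> (\<lambda>x. uk 0 x - us x) < d \<Longrightarrow> (\<And>k. step_rel (uk k) (uk (Suc k))) \<Longrightarrow>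
    q_superlinear \<Gamma> uk us"
proof -
  obtain d where d: "0 < d" "\<And>u u'. step_rel u u' \<Longrightarrow> l2_norm \<Gamma> (\<lambda>x. u x - us x) < d \<Longrightarrow>
    l2_norm \<Gamma> (\<lambda>x. u' x - us x) \<le> (1/2) * l2_norm \<Gamma> (\<lambda>x. u x - us x)"
    using newton_error[OF us, of "1/2"] by auto
  show ?thesis
  proof (rule that[OF d(1)])
    fix uk :: "nat \<Rightarrow> real^2 \<Rightarrow> real"
    assume start: "l2_norm \<Gamma> (\<lambda>x. uk 0 x - us x) < d" and st: "\<And>k. step_rel (uk k) (uk (Suc k))"
    let ?n = "\<lambda>k. l2_norm \<Gamma> (\<lambda>x. uk k x - us x)"
    have bd: "?n k \<le> (1/2)^k * ?n 0 \<and> ?n k < d" for k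
    proof (induction k)
      case (Suc k)
      have le: "?n (Suc k) \<le> (1/2) * ?n k" using d(2)[OF st] Suc by blast
      have "?n (Suc k) < d" using le Suc l2_norm_nonneg[of \<Gamma> "\<lambda>x. uk k x - us x"] by linarith
      moreover have "?n (Suc k) \<le> (1/2)^Suc k * ?n 0" using le Suc by simp
      ultimately show ?case by blast
    qed (use start in simp)
    have conv: "?n \<longlonglongrightarrow> 0"
    proof (rule tendsto_sandwich[of "\<lambda>_. 0"])
      show "\<forall>\<^sub>F k in sequentially. ?n k \<le> (1/2)^k * ?n 0" using bd by simp
      show "(\<lambda>k. (1/2)^k * ?n 0) \<longlonglongrightarrow> 0" by (intro tendsto_mult_left_zero LIMSEQ_realpow_zero) auto
    qed auto
    have "(\<lambda>k. ?n (Suc k)) \<in> o(?n)"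
    proof (rule landau_o.smallI)
      fix c :: real assume c: "0 < c"
      obtain d' where d': "0 < d'" "\<And>u u'. step_rel u u' \<Longrightarrow> l2_norm \<Gamma> (\<lambda>x. u x - us x) < d' \<Longrightarrow>
        l2_norm \<Gamma> (\<lambda>x. u' x - us x) \<le> c * l2_norm \<Gamma> (\<lambda>x. u x - us x)"
        using newton_error[OF us c] by auto
      have "\<forall>\<^sub>F k in sequentially. ?n k < d'" using conv d'(1) by (rule order_tendstoD)
      then show "\<forall>\<^sub>F k in sequentially. norm (?n (Suc k)) \<le> c * norm (?n k)"
        by eventually_elim (use d'(2)[OF st] in simp)
    qed
    with conv show "q_superlinear \<Gamma> uk us" by (simp add: q_superlinear_def)
  qed
qed

lemma newton_iterates_exist:
  assumes "u0 \<in> l2 \<Gamma>"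
  shows "\<exists>uk. uk 0 = u0 \<and> (\<forall>k. step_rel (uk k) (uk (Suc k)))"
proof -
  \<comment> \<open>The start value is part of the invariant, because dependent choice only promises
    some first element that satisfies it.\<close>
  have "\<exists>uk. \<forall>k. (uk k \<in> l2 \<Gamma> \<and> (k = 0 \<longrightarrow> uk k = u0)) \<and> step_rel (uk k) (uk (Suc k))"
  proof (rule dependent_nat_choice)
    fix u and k :: nat assume "u \<in> l2 \<Gamma> \<and> (k = 0 \<longrightarrow> u = u0)"
    then show "\<exists>u'. (u' \<in> l2 \<Gamma> \<and> (Suc k = 0 \<longrightarrow> u' = u0)) \<and> step_rel u u'"
      using newton_step_exists[of u] by (auto simp: newton_step_def)
  qed (use assms in auto)
  then show ?thesis by blast
qed

end

theorem theorem5p1: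
  fixes \<Omega> \<omega> :: "(real^2) set" and \<nu> \<gamma> q :: real
    and y\<Omega> b \<mu> u\<gamma> y\<gamma> \<phi>\<gamma> :: "real^2 \<Rightarrow> real"
  assumes "open \<Omega>" "\<Omega> \<noteq> {}" "bounded \<Omega>" "convex \<Omega>" "polytope (closure \<Omega>)"
    and "open \<omega>" "\<omega> \<noteq> {}" "connected \<omega>" "closure \<omega> \<subseteq> \<Omega>"
    and "\<nu> > 0" "\<gamma> > 0"
    and "y\<Omega> \<in> l2 (lebesgue_on \<Omega>)"
    and "continuous_on (closure \<omega>) b"
    and "q > 2" "\<mu> \<in> lp q (lebesgue_on (closure \<omega>))"
    and "optimality_system \<Omega> \<omega> \<nu> \<gamma> y\<Omega> b \<mu> u\<gamma> y\<gamma> \<phi>\<gamma>"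
  shows "(\<forall>u\<in>l2 (bdry \<Omega>).
            (\<exists>y \<phi>. optimality_system \<Omega> \<omega> \<nu> \<gamma> y\<Omega> b \<mu> u y \<phi>)
              \<longleftrightarrow> (AE x in bdry \<Omega>. G_op \<Omega> \<omega> \<nu> \<gamma> y\<Omega> b \<mu> u x = 0)) \<and>
         (\<exists>\<delta>>0. \<forall>u0\<in>l2 (bdry \<Omega>). l2_norm (bdry \<Omega>) (\<lambda>x. u0 x - u\<gamma> x) < \<delta> \<longrightarrow>
            (\<exists>us. us 0 = u0 \<and> (\<forall>k. newton_step \<Omega> \<omega> \<nu> \<gamma> y\<Omega> b \<mu> (us k) (us (Suc k)))) \<and>
            (\<forall>us. us 0 = u0 \<and> (\<forall>k. newton_step \<Omega> \<omega> \<nu> \<gamma> y\<Omega> b \<mu> (us k) (us (Suc k))) \<longrightarrow>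
               (\<forall>k u'. newton_step \<Omega> \<omega> \<nu> \<gamma> y\<Omega> b \<mu> (us k) u' \<longrightarrow> (AE x in bdry \<Omega>. u' x = us (Suc k) x)) \<and>
               q_superlinear (bdry \<Omega>) us u\<gamma>))"
proof -
  interpret newton \<Omega> \<omega> \<nu> \<gamma> q y\<Omega> b \<mu>
    by unfold_locales (use assms in auto)
  have u: "u\<gamma> \<in> l2 \<Gamma>" using assms(16) by (simp add: optimality_system_def)
  have G0: "AE x in \<Gamma>. G u\<gamma> x = 0" using optimality_iff[OF u] assms(16) by blast
  obtain d where d: "0 < d" "\<And>uk. l2_norm \<Gamma> (\<lambda>x. uk 0 x - u\<gamma> x) < d \<Longrightarrow> (\<And>k. step_rel (uk k) (uk (Suc k))) \<Longrightarrow>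
    q_superlinear \<Gamma> uk u\<gamma>" using newton_convergence[OF u G0] by blast
  have unique: "AE x in \<Gamma>. u' x = us (Suc k) x"
    if "\<forall>k. step_rel (us k) (us (Suc k))" "step_rel (us k) u'" for us :: "nat \<Rightarrow> _" and k u'
    using newton_step_unique that by blast
  show ?thesis
    by (intro conjI ballI optimality_iff exI[of _ d] impI allI d(1))
      (use d(2) newton_iterates_exist unique in auto)
qed

end
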